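(* Let $\Omega\subset\mathbb{R}^N$ ($N\ge 2$) be a connected bounded domain with $C^3$ boundary. Then there exist constants $\beta<1$ and $C\ge 0$ such that for all vector fields $\vec u\in H^2(\Omega,\mathbb{R}^N)\cap H^1_0(\Omega,\mathbb{R}^N)$, the Stokes pressure $p_S$ associated with $\vec u$, determined (up to a constant) by $$\mathcal{P}(-\Delta\vec u)=-\Delta\vec u+\nabla(\nabla\cdot\vec u)+\nabla p_S ,$$ satisfies $$\int_\Omega|\nabla p_S|^2\le \beta\int_\Omega|\Delta\vec u|^2+C\int_\Omega|\nabla\vec u|^2 .$$
   Context: $\mathcal{P}$ denotes the Helmholtz projection on $L^2(\Omega,\mathbb{R}^N)$: the $L^2$-orthogonal projection onto the orthogonal complement of $\{\nabla\phi:\phi\in H^1(\Omega)\}$ (equivalently, onto the divergence-free fields $\vec a\in L^2$ with $\vec n\cdot\vec a=0$ on $\partial\Omega$). Thus $\nabla p_S=(I-\mathcal{P})\Delta\vec u-\nabla(\nabla\cdot\vec u)$. No divergence constraint is imposed on $\vec u$. *)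

theory Defs
  imports "HOL-Analysis.Analysis"
begin

section \<open>Smooth functions, test functions and \<open>C\<^sup>k\<close> boundaries\<close>

definition pderiv_at :: "'n::finite \<Rightarrow> (real^'n \<Rightarrow> real) \<Rightarrow> real^'n \<Rightarrow> real" where
  "pderiv_at i f x = frechet_derivative f (at x) (axis i 1)"

primrec C_k :: "nat \<Rightarrow> (real^'n::finite \<Rightarrow> real) \<Rightarrow> bool" where
  "C_k 0 f \<longleftrightarrow> continuous_on UNIV f"
| "C_k (Suc k) f \<longleftrightarrow> (\<forall>x. f differentiable (at x)) \<and> (\<forall>i. C_k k (pderiv_at i f))"

definition test_functions :: "(real^'n::finite) set \<Rightarrow> (real^'n \<Rightarrow> real) set" where
  "test_functions \<Omega> =
    {\<phi>. (\<forall>k. C_k k \<phi>) \<and> (\<exists>K. compact K \<and> K \<subseteq> \<Omega> \<and> (\<forall>x. x \<notin> K \<longrightarrow> \<phi> x = 0))}"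

text \<open>
  Near each boundary point \<open>\<Omega>\<close> is the region above a \<open>C\<^sup>k\<close> graph, in a coordinate system whose
  last axis is the unit vector \<open>e\<close>. The graph function of \<open>N - 1\<close> variables lives on the
  hyperplane orthogonal to \<open>e\<close>: only the values of \<open>\<gamma>\<close> on that hyperplane are used, and a function
  that is \<open>C\<^sup>k\<close> on the hyperplane extends to the whole space by composition with the projection.
\<close>
definition C_k_boundary :: "nat \<Rightarrow> (real^'n::finite) set \<Rightarrow> bool" where
  "C_k_boundary k \<Omega> \<longleftrightarrow>
    (\<forall>x0 \<in> frontier \<Omega>. \<exists>r > 0. \<exists>e \<gamma>. norm e = 1 \<and> C_k k \<gamma> \<and>
      \<Omega> \<inter> ball x0 r = {x \<in> ball x0 r. x \<bullet> e > \<gamma> (x - (x \<bullet> e) *\<^sub>R e)})"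


section \<open>\<open>L\<^sup>2\<close> and Sobolev spaces\<close>

text \<open>
  Elements of these spaces are represented by functions on the whole space whose values outside
  \<open>\<Omega>\<close> are irrelevant; functions that agree almost everywhere on \<open>\<Omega>\<close> are not identified.
\<close>
definition L2 :: "(real^'n::finite) set \<Rightarrow> (real^'n \<Rightarrow> 'b::euclidean_space) set" where
  "L2 \<Omega> = {f. f \<in> borel_measurable (lebesgue_on \<Omega>) \<and>
              integrable (lebesgue_on \<Omega>) (\<lambda>x. (norm (f x))\<^sup>2)}"

definition L2_inner ::
    "(real^'n::finite) set \<Rightarrow> (real^'n \<Rightarrow> 'b::euclidean_space) \<Rightarrow> (real^'n \<Rightarrow> 'b) \<Rightarrow> real" where
  "L2_inner \<Omega> f g = (\<integral>x. f x \<bullet> g x \<partial>(lebesgue_on \<Omega>))"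

definition locally_integrable :: "(real^'n::finite) set \<Rightarrow> (real^'n \<Rightarrow> real) \<Rightarrow> bool" where
  "locally_integrable \<Omega> f \<longleftrightarrow> (\<forall>K. compact K \<and> K \<subseteq> \<Omega> \<longrightarrow> set_integrable lebesgue K f)"

definition has_weak_pderiv ::
    "(real^'n::finite) set \<Rightarrow> 'n \<Rightarrow> (real^'n \<Rightarrow> real) \<Rightarrow> (real^'n \<Rightarrow> real) \<Rightarrow> bool" where
  "has_weak_pderiv \<Omega> i f g \<longleftrightarrow>
    locally_integrable \<Omega> f \<and> locally_integrable \<Omega> g \<and>
    (\<forall>\<phi> \<in> test_functions \<Omega>.
      (\<integral>x. f x * pderiv_at i \<phi> x \<partial>(lebesgue_on \<Omega>)) = - (\<integral>x. g x * \<phi> x \<partial>(lebesgue_on \<Omega>)))"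

text \<open>
  A representative of the weak partial derivative, which is unique up to null sets. It is
  meaningful only when a weak derivative exists.
\<close>
definition weak_pderiv ::
    "(real^'n::finite) set \<Rightarrow> 'n \<Rightarrow> (real^'n \<Rightarrow> real) \<Rightarrow> real^'n \<Rightarrow> real" where
  "weak_pderiv \<Omega> i f = (SOME g. has_weak_pderiv \<Omega> i f g)"

primrec sobolev :: "nat \<Rightarrow> (real^'n::finite) set \<Rightarrow> (real^'n \<Rightarrow> real) set" where
  "sobolev 0 \<Omega> = L2 \<Omega>"
| "sobolev (Suc k) \<Omega> = {f \<in> L2 \<Omega>. \<forall>i. \<exists>g \<in> sobolev k \<Omega>. has_weak_pderiv \<Omega> i f g}"

definition H1_norm :: "(real^'n::finite) set \<Rightarrow> (real^'n \<Rightarrow> real) \<Rightarrow> real" where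
  "H1_norm \<Omega> f = sqrt (L2_inner \<Omega> f f +
      (\<Sum>i\<in>UNIV. L2_inner \<Omega> (weak_pderiv \<Omega> i f) (weak_pderiv \<Omega> i f)))"

text \<open>\<open>H\<^sup>1\<^sub>0\<close> is the closure of the test functions in \<open>H\<^sup>1\<close>.\<close>
definition sobolev_H10 :: "(real^'n::finite) set \<Rightarrow> (real^'n \<Rightarrow> real) set" where
  "sobolev_H10 \<Omega> = {f \<in> sobolev 1 \<Omega>.
      \<forall>\<epsilon> > 0. \<exists>\<phi> \<in> test_functions \<Omega>. H1_norm \<Omega> (\<lambda>x. f x - \<phi> x) < \<epsilon>}"

definition vector_fields_in ::
    "(real^'n::finite \<Rightarrow> real) set \<Rightarrow> (real^'n \<Rightarrow> real^'n) set" where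
  "vector_fields_in S = {u. \<forall>j. (\<lambda>x. u x $ j) \<in> S}"


section \<open>Weak differential operators\<close>

definition weak_grad ::
    "(real^'n::finite) set \<Rightarrow> (real^'n \<Rightarrow> real) \<Rightarrow> real^'n \<Rightarrow> real^'n" where
  "weak_grad \<Omega> f x = (\<chi> i. weak_pderiv \<Omega> i f x)"

definition weak_div ::
    "(real^'n::finite) set \<Rightarrow> (real^'n \<Rightarrow> real^'n) \<Rightarrow> real^'n \<Rightarrow> real" where
  "weak_div \<Omega> u x = (\<Sum>i\<in>UNIV. weak_pderiv \<Omega> i (\<lambda>y. u y $ i) x)"

definition weak_laplacian ::
    "(real^'n::finite) set \<Rightarrow> (real^'n \<Rightarrow> real^'n) \<Rightarrow> real^'n \<Rightarrow> real^'n" where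
  "weak_laplacian \<Omega> u x =
    (\<chi> j. \<Sum>i\<in>UNIV. weak_pderiv \<Omega> i (weak_pderiv \<Omega> i (\<lambda>y. u y $ j)) x)"

text \<open>The \<open>j\<close>-th row is the gradient of the \<open>j\<close>-th component.\<close>
definition weak_jacobian ::
    "(real^'n::finite) set \<Rightarrow> (real^'n \<Rightarrow> real^'n) \<Rightarrow> real^'n \<Rightarrow> real^'n^'n" where
  "weak_jacobian \<Omega> u x = (\<chi> j. weak_grad \<Omega> (\<lambda>y. u y $ j) x)"


section \<open>Helmholtz projection and Stokes pressure\<close>

definition L2_orth_compl ::
    "(real^'n::finite) set \<Rightarrow> (real^'n \<Rightarrow> real^'n) set \<Rightarrow> (real^'n \<Rightarrow> real^'n) set" where
  "L2_orth_compl \<Omega> S = {v \<in> L2 \<Omega>. \<forall>w \<in> S. L2_inner \<Omega> v w = 0}"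

definition helmholtz_space :: "(real^'n::finite) set \<Rightarrow> (real^'n \<Rightarrow> real^'n) set" where
  "helmholtz_space \<Omega> = L2_orth_compl \<Omega> (weak_grad \<Omega> ` sobolev 1 \<Omega>)"

text \<open>
  \<open>w = \<P>f\<close> for the \<open>L\<^sup>2\<close>-orthogonal projection onto the Helmholtz space, as a relation because
  \<open>w\<close> is determined only up to null sets.
\<close>
definition is_helmholtz_projection ::
    "(real^'n::finite) set \<Rightarrow> (real^'n \<Rightarrow> real^'n) \<Rightarrow> (real^'n \<Rightarrow> real^'n) \<Rightarrow> bool" where
  "is_helmholtz_projection \<Omega> f w \<longleftrightarrow>
    f \<in> L2 \<Omega> \<and> w \<in> helmholtz_space \<Omega> \<and>
    (\<lambda>x. f x - w x) \<in> L2_orth_compl \<Omega> (helmholtz_space \<Omega>)"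

definition is_stokes_pressure ::
    "(real^'n::finite) set \<Rightarrow> (real^'n \<Rightarrow> real^'n) \<Rightarrow> (real^'n \<Rightarrow> real) \<Rightarrow> bool" where
  "is_stokes_pressure \<Omega> u p \<longleftrightarrow>
    p \<in> sobolev 1 \<Omega> \<and>
    is_helmholtz_projection \<Omega> (\<lambda>x. - weak_laplacian \<Omega> u x)
      (\<lambda>x. - weak_laplacian \<Omega> u x + weak_grad \<Omega> (weak_div \<Omega> u) x + weak_grad \<Omega> p x)"

end

theory Submission
  imports Defs
begin

text \<open>
  Let \<open>d\<close> be a \<open>C\<^sup>3\<close> defining function of \<open>\<Omega>\<close>, \<open>N = \<nabla>d\<close>, \<open>Q = \<bar>N\<bar>\<^sup>2 + d\<^sup>2\<close>, and split \<open>u = v + w\<close> with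
  \<open>v = M u\<close>, \<open>M = (I - N N\<^sup>T / Q) / (1 + d\<^sup>2)\<close>. On the boundary \<open>v\<close> is the tangential part of \<open>u\<close>, and since
  tangential derivatives of \<open>u\<close> vanish there, \<open>div v\<close> and \<open>curl w\<close> have zero boundary values. The
  pressure \<open>p\<close> is harmonic, so \<open>\<nabla>p\<close> is orthogonal to \<open>\<nabla> div v\<close> and to \<open>\<Delta>w - \<nabla> div w\<close>, which leaves
  \<open>\<parallel>\<nabla>p\<parallel>\<^sup>2 = \<langle>\<Delta>v, \<nabla>p\<rangle> = \<langle>\<Delta>u, M \<nabla>p\<rangle>\<close> up to terms of lower order in \<open>u\<close>. The Rellich identity for the field
  \<open>d N / Q\<close> bounds \<open>\<nabla>p\<close> by the part of it that \<open>M\<close> removes, hence \<open>\<parallel>M \<nabla>p\<parallel>\<^sup>2 \<le> \<theta> \<parallel>\<nabla>p\<parallel>\<^sup>2\<close> with \<open>\<theta> < 1\<close>, and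
  \<open>\<beta>\<close> can be taken between \<open>\<theta>\<close> and \<open>1\<close>. No trace operator is needed: boundary layers are removed by cut-off
  functions of \<open>k d\<close>, \<open>k \<rightarrow> \<infinity>\<close>, and a Hardy inequality.

  The pressure exists because a sequence minimising \<open>\<parallel>\<nabla>q - \<Delta>u\<parallel>\<close> has gradients converging in \<open>L\<^sup>2\<close>, and
  control of \<open>q\<close> by \<open>\<nabla>q\<close> propagates from one ball to the whole of the connected set \<open>\<Omega>\<close>.
\<close>

section \<open>Functions of class \<open>C\<^sup>k\<close>\<close>

text \<open>The difficulty is \<beta> < 1. On the domain \<open>M\<close> has norm at most one, so
  Cauchy-Schwarz in the identity for the energy of \<nabla>p only yields the coefficient one. The
  gain is an equipartition: for a decaying harmonic function on a half space the tangential and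
  normal parts of the gradient carry equal energy, and the Rellich identity keeps this up to terms
  containing \<open>d\<close>. The defining function is glued from local graphs and has critical
  points inside, so N / |N| is not a global smooth field. Adding \<open>d^2\<close> to |N|^2 keeps
  \<open>N / Q\<close> smooth everywhere. At a critical point \<open>M\<close> removes no direction,
  and there the factor \<open>1 / (1 + d^2)\<close> supplies the contraction. One set of global
  formulas thus serves boundary and interior alike, with no collar. C^3 enters because the Laplacian
  of \<open>M u\<close> contains second derivatives of \<open>M\<close>, hence third derivatives of
  \<open>d\<close>. They multiply \<open>u\<close> itself, and a Poincare inequality turns them into
  the gradient of \<open>u\<close>.\<close>

lemma pderiv_at_eqI:
  "(f has_derivative f') (at x) \<Longrightarrow> pderiv_at i f x = f' (axis i 1)"
  unfolding pderiv_at_def by (metis frechet_derivative_at)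

lemma has_derivative_pderiv_at:
  fixes f :: "real^'n::finite \<Rightarrow> real"
  assumes "f differentiable (at x)"
  shows "(f has_derivative (\<lambda>h. \<Sum>i\<in>UNIV. h $ i * pderiv_at i f x)) (at x)"
proof -
  have d: "(f has_derivative frechet_derivative f (at x)) (at x)"
    using assms frechet_derivative_works by blast
  interpret linear "frechet_derivative f (at x)"
    using d by (simp add: has_derivative_bounded_linear bounded_linear.linear)
  have "frechet_derivative f (at x) h = (\<Sum>i\<in>UNIV. h $ i * pderiv_at i f x)" for h
  proof -
    have "h = (\<Sum>i\<in>UNIV. h $ i *\<^sub>R axis i 1)"
      using basis_expansion[of h] by (simp add: scalar_mult_eq_scaleR)
    then have "frechet_derivative f (at x) h = frechet_derivative f (at x) (\<Sum>i\<in>UNIV. h $ i *\<^sub>R axis i 1)"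
      by simp
    also have "\<dots> = (\<Sum>i\<in>UNIV. h $ i * pderiv_at i f x)"
      by (simp add: sum scaleR pderiv_at_def)
    finally show ?thesis .
  qed
  then show ?thesis using d by (metis (no_types, lifting) ext)
qed

lemma pderiv_at_const [simp]: "pderiv_at i (\<lambda>x. c) x = 0"
  by (rule pderiv_at_eqI[where f'="\<lambda>_. 0", simplified]) simp

lemma pderiv_at_add:
  assumes "f differentiable (at x)" "g differentiable (at x)"
  shows "pderiv_at i (\<lambda>x. f x + g x) x = pderiv_at i f x + pderiv_at i g x"
  unfolding pderiv_at_def
  by (rule pderiv_at_eqI[unfolded pderiv_at_def, where f'="\<lambda>h. frechet_derivative f (at x) h + frechet_derivative g (at x) h"])
     (intro has_derivative_add assms[unfolded frechet_derivative_works])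

lemma pderiv_at_mult:
  fixes f g :: "real^'n::finite \<Rightarrow> real"
  assumes "f differentiable (at x)" "g differentiable (at x)"
  shows "pderiv_at i (\<lambda>x. f x * g x) x = f x * pderiv_at i g x + pderiv_at i f x * g x"
  unfolding pderiv_at_def
  by (rule pderiv_at_eqI[unfolded pderiv_at_def, where f'="\<lambda>h. f x * frechet_derivative g (at x) h + frechet_derivative f (at x) h * g x"])
     (intro has_derivative_mult assms[unfolded frechet_derivative_works])

lemma pderiv_at_compose_real:
  fixes f :: "real^'n::finite \<Rightarrow> real"
  assumes "(h has_real_derivative h') (at (f x))" "f differentiable (at x)"
  shows "pderiv_at i (\<lambda>x. h (f x)) x = h' * pderiv_at i f x"
    and "(\<lambda>x. h (f x)) differentiable (at x)"
proof -
  have "(f has_derivative frechet_derivative f (at x)) (at x)"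
    using assms frechet_derivative_works by blast
  then have *: "((\<lambda>x. h (f x)) has_derivative (\<lambda>z. h' * frechet_derivative f (at x) z)) (at x)"
    using assms(1) by (metis has_derivative_compose has_field_derivative_def)
  show "pderiv_at i (\<lambda>x. h (f x)) x = h' * pderiv_at i f x"
    using pderiv_at_eqI[OF *] by (simp add: pderiv_at_def)
  show "(\<lambda>x. h (f x)) differentiable (at x)"
    using * differentiable_def by blast
qed

lemma C_k_Suc_imp: "C_k (Suc k) f \<Longrightarrow> C_k k f"
proof (induction k arbitrary: f)
  case 0
  then show ?case
    by (auto simp: continuous_on_eq_continuous_within intro!: differentiable_imp_continuous_within)
next
  case (Suc k)
  then show ?case by (metis C_k.simps(2))
qed

lemma C_k_mono: "C_k k f \<Longrightarrow> j \<le> k \<Longrightarrow> C_k j f"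
  by (induction k) (auto simp: le_Suc_eq simp del: C_k.simps(2) dest: C_k_Suc_imp)

lemma C_k_continuous: "C_k k f \<Longrightarrow> continuous_on A f"
  using C_k_mono[of k f 0] continuous_on_subset by auto

lemma C_k_differentiable: "C_k (Suc k) f \<Longrightarrow> f differentiable (at x)"
  by simp

lemma C_k_pderiv: "C_k (Suc k) f \<Longrightarrow> C_k k (pderiv_at i f)"
  by simp

lemma C_k_const [simp]: "C_k k (\<lambda>x. c)"
proof (induction k arbitrary: c)
  case (Suc k)
  have "pderiv_at i (\<lambda>x. c) = (\<lambda>x. 0)" for i :: 'a by (rule ext) simp
  then show ?case using Suc by simp
qed simp

lemma C_k_add: "C_k k f \<Longrightarrow> C_k k g \<Longrightarrow> C_k k (\<lambda>x. f x + g x)"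
proof (induction k arbitrary: f g)
  case 0 then show ?case by (simp add: continuous_on_add)
next
  case (Suc k)
  then have "pderiv_at i (\<lambda>x. f x + g x) = (\<lambda>x. pderiv_at i f x + pderiv_at i g x)" for i
    by (intro ext pderiv_at_add) auto
  then show ?case using Suc by (auto intro: differentiable_add)
qed

lemma C_k_mult: "C_k k f \<Longrightarrow> C_k k g \<Longrightarrow> C_k k (\<lambda>x. f x * g x)"
proof (induction k arbitrary: f g)
  case 0 then show ?case by (simp add: continuous_on_mult)
next
  case (Suc k)
  then have "pderiv_at i (\<lambda>x. f x * g x) = (\<lambda>x. f x * pderiv_at i g x + pderiv_at i f x * g x)" for i
    by (intro ext pderiv_at_mult) auto
  moreover have "C_k k (\<lambda>x. f x * pderiv_at i g x + pderiv_at i f x * g x)" for i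
    using Suc.prems C_k_Suc_imp by (intro C_k_add Suc.IH) (blast | simp)+
  ultimately show ?case using Suc by (auto intro: differentiable_mult)
qed

lemma C_k_cmult: "C_k k f \<Longrightarrow> C_k k (\<lambda>x. c * f x)"
  by (intro C_k_mult C_k_const)

lemma C_k_uminus: "C_k k f \<Longrightarrow> C_k k (\<lambda>x. - f x)"
  using C_k_cmult[of k f "-1"] by simp

lemma C_k_diff: "C_k k f \<Longrightarrow> C_k k g \<Longrightarrow> C_k k (\<lambda>x. f x - g x)"
  using C_k_add[of k f "\<lambda>x. - g x"] C_k_uminus[of k g] by simp

lemma C_k_sum: "(\<And>a. a \<in> A \<Longrightarrow> C_k k (f a)) \<Longrightarrow> C_k k (\<lambda>x. \<Sum>a\<in>A. f a x)"
  by (induction A rule: infinite_finite_induct) (auto intro: C_k_add)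

lemma C_k_power: "C_k k f \<Longrightarrow> C_k k (\<lambda>x. f x ^ n)"
  by (induction n) (auto intro: C_k_mult)

lemma C_k_nth [simp]: "C_k k (\<lambda>x::real^'n::finite. x $ i)"
proof (cases k)
  case (Suc j)
  have d: "((\<lambda>x::real^'n. x $ i) has_derivative (\<lambda>h. h $ i)) (at x)" for x
    by (simp add: bounded_linear_imp_has_derivative bounded_linear_vec_nth)
  have "pderiv_at l (\<lambda>x::real^'n. x $ i) = (\<lambda>x. axis l 1 $ i)" for l
    by (rule ext, rule pderiv_at_eqI[OF d])
  then show ?thesis using d unfolding Suc by (auto simp: differentiable_def)
qed (simp add: continuous_on_component)

lemma pderiv_at_nth: "pderiv_at l (\<lambda>x::real^'n::finite. x $ i) x = (if l = i then 1 else 0)"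
proof -
  have d: "((\<lambda>x::real^'n. x $ i) has_derivative (\<lambda>h. h $ i)) (at x)" for x
    by (simp add: bounded_linear_imp_has_derivative bounded_linear_vec_nth)
  show ?thesis using pderiv_at_eqI[OF d, of l] by (simp add: axis_def)
qed

lemma pderiv_at_sum:
  assumes "\<And>a. a \<in> A \<Longrightarrow> f a differentiable (at x)"
  shows "pderiv_at i (\<lambda>x. \<Sum>a\<in>A. f a x) x = (\<Sum>a\<in>A. pderiv_at i (f a) x)"
  using assms
proof (induction A rule: infinite_finite_induct)
  case (insert a A)
  then have "(\<lambda>x. \<Sum>a\<in>A. f a x) differentiable (at x)" by (intro differentiable_sum) auto
  with insert show ?case by (simp add: pderiv_at_add)
qed auto

lemma pderiv_at_cmult:
  fixes f :: "real^'n::finite \<Rightarrow> real"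
  shows "f differentiable (at x) \<Longrightarrow> pderiv_at i (\<lambda>x. c * f x) x = c * pderiv_at i f x"
  by (subst pderiv_at_mult) auto

lemma pderiv_at_uminus:
  fixes f :: "real^'n::finite \<Rightarrow> real"
  shows "f differentiable (at x) \<Longrightarrow> pderiv_at i (\<lambda>x. - f x) x = - pderiv_at i f x"
  using pderiv_at_cmult[of f x i "-1"] by simp

lemma pderiv_at_diff:
  fixes f :: "real^'n::finite \<Rightarrow> real"
  shows "f differentiable (at x) \<Longrightarrow> g differentiable (at x) \<Longrightarrow>
    pderiv_at i (\<lambda>x. f x - g x) x = pderiv_at i f x - pderiv_at i g x"
  using pderiv_at_add[of f x "\<lambda>x. - g x" i] pderiv_at_uminus[of g x i] by (simp add: differentiable_minus)

lemma pderiv_at_power: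
  fixes f :: "real^'n::finite \<Rightarrow> real"
  assumes "f differentiable (at x)"
  shows "pderiv_at i (\<lambda>x. f x ^ n) x = real n * f x ^ (n - 1) * pderiv_at i f x"
  by (rule pderiv_at_compose_real[OF _ assms, of "\<lambda>t. t ^ n"]) (auto intro!: derivative_eq_intros)

lemma C_k_inverse: "C_k k f \<Longrightarrow> (\<And>x. f x \<noteq> 0) \<Longrightarrow> C_k k (\<lambda>x. inverse (f x))"
proof (induction k arbitrary: f)
  case 0 then show ?case by (auto intro: continuous_on_inverse)
next
  case (Suc k)
  have df: "f differentiable (at x)" for x using Suc.prems by simp
  have "(inverse has_real_derivative - (inverse (f x))\<^sup>2) (at (f x))" for x
    using DERIV_inverse[OF Suc.prems(2)[of x]] by (simp add: power2_eq_square)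
  note D = pderiv_at_compose_real[OF this df]
  have "pderiv_at i (\<lambda>x. inverse (f x)) = (\<lambda>x. - (inverse (f x))\<^sup>2 * pderiv_at i f x)" for i
    by (intro ext D)
  moreover have "C_k k (\<lambda>x. - (inverse (f x))\<^sup>2 * pderiv_at i f x)" for i
    by (intro C_k_mult C_k_uminus C_k_power Suc.IH C_k_Suc_imp[OF Suc.prems(1)] C_k_pderiv[OF Suc.prems(1)] Suc.prems(2))
  ultimately show ?case using D(2) by auto
qed

lemma C_k_divide: "C_k k f \<Longrightarrow> C_k k g \<Longrightarrow> (\<And>x. g x \<noteq> 0) \<Longrightarrow> C_k k (\<lambda>x. f x / g x)"
  unfolding divide_inverse by (intro C_k_mult C_k_inverse)

text \<open>Meant for boundary graphs, where a C^k function is composed with the projection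
  \<open>x - (x \<bullet> e) *\<^sub>R e\<close>.\<close>

lemma C_k_compose_linear:
  fixes L :: "real^'n::finite \<Rightarrow> real^'n" and f :: "real^'n \<Rightarrow> real"
  assumes "linear L" "C_k k f"
  shows "C_k k (\<lambda>x. f (L x))"
  using assms(2)
proof (induction k arbitrary: f)
  case 0
  then show ?case using linear_continuous_on[OF linear_conv_bounded_linear[THEN iffD1, OF assms(1)], of UNIV]
    by (auto intro: continuous_on_compose2)
next
  case (Suc k)
  have dL: "(L has_derivative L) (at x)" for x
    using assms(1) by (simp add: bounded_linear_imp_has_derivative linear_conv_bounded_linear)
  have D: "((\<lambda>x. f (L x)) has_derivative (\<lambda>h. \<Sum>l\<in>UNIV. L h $ l * pderiv_at l f (L x))) (at x)" for x
    using has_derivative_compose[OF dL has_derivative_pderiv_at] Suc.prems by simp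
  have "pderiv_at i (\<lambda>x. f (L x)) = (\<lambda>x. \<Sum>l\<in>UNIV. L (axis i 1) $ l * pderiv_at l f (L x))" for i
    by (intro ext pderiv_at_eqI[OF D])
  moreover have "C_k k (\<lambda>x. \<Sum>l\<in>UNIV. L (axis i 1) $ l * pderiv_at l f (L x))" for i
    using Suc by (intro C_k_sum C_k_cmult) auto
  ultimately show ?case using D by (auto simp: differentiable_def)
qed

section \<open>Truncated powers and the flat exponential\<close>

text \<open>The exponent is at least two, so the difference quotient at zero still carries a
  positive power of the positive part and tends to zero.\<close>

lemma pos_part_power_deriv:
  "((\<lambda>t::real. (max 0 t) ^ Suc (Suc n)) has_real_derivative real (Suc (Suc n)) * (max 0 t) ^ Suc n) (at t)"
proof (cases t "0::real" rule: linorder_cases)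
  case less
  have "((\<lambda>t::real. 0) has_real_derivative 0) (at t)" by simp
  then show ?thesis
    by (rule has_field_derivative_transform_within_open[where S="{..<0}", THEN DERIV_cong]) (use less in auto)
next
  case greater
  have "((\<lambda>t::real. t ^ Suc (Suc n)) has_real_derivative real (Suc (Suc n)) * t ^ Suc n) (at t)"
    using DERIV_pow[of "Suc (Suc n)" t UNIV] by simp
  then show ?thesis
    by (rule has_field_derivative_transform_within_open[where S="{0<..}", THEN DERIV_cong]) (use greater in auto)
next
  case equal
  have "((\<lambda>h::real. (max 0 h) ^ Suc n * (if h < 0 then 0 else 1)) \<longlongrightarrow> 0) (at 0)"
  proof (rule Lim_null_comparison)
    show "\<forall>\<^sub>F h in at 0. norm ((max 0 h) ^ Suc n * (if h < 0 then 0 else 1)) \<le> (max 0 h) ^ Suc n"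
      by (auto simp: )
    have "((\<lambda>h::real. (max 0 h) ^ Suc n) \<longlongrightarrow> (max 0 0) ^ Suc n) (at 0)"
      by (intro tendsto_intros)
    then show "((\<lambda>h::real. (max 0 h) ^ Suc n) \<longlongrightarrow> 0) (at 0)" by simp
  qed
  moreover have "(max 0 h) ^ Suc n * (if h < 0 then 0 else 1) = ((max 0 h) ^ Suc (Suc n)) / h" if "h \<noteq> 0" for h :: real
    using that by (auto simp: max_def)
  ultimately have "((\<lambda>h::real. ((max 0 h) ^ Suc (Suc n)) / h) \<longlongrightarrow> 0) (at 0)"
    by (elim Lim_transform_eventually) (simp add: eventually_at_filter del: power_Suc)
  then show ?thesis using equal by (simp add: DERIV_def)
qed

text \<open>Each differentiation lowers the power by one, and \<open>k \<le> n\<close> keeps the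
  last derivative a positive power of the positive part, hence continuous. These are the building
  blocks of cut-offs with explicit derivatives.\<close>

lemma C_k_pos_part_power: "C_k k f \<Longrightarrow> k \<le> n \<Longrightarrow> C_k k (\<lambda>x. (max 0 (f x)) ^ Suc n)"
proof (induction k arbitrary: n)
  case 0
  then show ?case by (simp only: C_k.simps) (intro continuous_intros)
next
  case (Suc k)
  then obtain m where n: "n = Suc m" "k \<le> m" by (cases n) auto
  have df: "f differentiable (at x)" for x using Suc.prems by simp
  note D = pderiv_at_compose_real[where h="\<lambda>t. (max 0 t) ^ Suc (Suc m)", OF pos_part_power_deriv df]
  have "pderiv_at i (\<lambda>x. (max 0 (f x)) ^ Suc (Suc m)) = (\<lambda>x. real (Suc (Suc m)) * (max 0 (f x)) ^ Suc m * pderiv_at i f x)" for i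
    by (intro ext D)
  moreover have "C_k k (\<lambda>x. real (Suc (Suc m)) * (max 0 (f x)) ^ Suc m * pderiv_at i f x)" for i
    using Suc.prems C_k_Suc_imp n by (intro C_k_mult C_k_const Suc.IH) (blast | simp)+
  ultimately show ?case using D(2) n by (simp del: power_Suc)
qed

text \<open>For \<open>n = 0\<close> this is the classical smooth function
  \<open>exp (- 1 / t)\<close> extended by zero. The powers of \<open>1 / t\<close> close the family
  under differentiation, so one induction over all \<open>n\<close> gives smoothness.\<close>

definition flat_exp :: "nat \<Rightarrow> real \<Rightarrow> real" where
  "flat_exp n t = (if t > 0 then inverse t ^ n * exp (- inverse t) else 0)"

lemma flat_exp_tendsto_0: "(flat_exp n \<longlongrightarrow> 0) (at 0)"
proof -
  have "((\<lambda>x::real. x ^ n * exp (- x)) \<longlongrightarrow> 0) at_top"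
    using tendsto_power_div_exp_0[of n] by (simp add: exp_minus field_simps)
  then have "((\<lambda>x::real. inverse x ^ n * exp (- inverse x)) \<longlongrightarrow> 0) (at_right 0)"
    using filterlim_inverse_at_top_right filterlim_compose by blast
  then have r: "(flat_exp n \<longlongrightarrow> 0) (at_right 0)"
    by (rule Lim_transform_eventually) (auto simp: flat_exp_def eventually_at_right_less intro!: eventually_mono[OF eventually_at_right_less])
  have l: "(flat_exp n \<longlongrightarrow> 0) (at_left 0)"
    by (rule tendsto_eventually) (auto simp: flat_exp_def eventually_at_left_field intro!: exI[of _ "-1"])
  show ?thesis using l r by (simp add: filterlim_split_at)
qed

lemma flat_exp_deriv:
  "(flat_exp n has_real_derivative - real n * flat_exp (Suc n) t + flat_exp (Suc (Suc n)) t) (at t)"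
proof (cases t "0::real" rule: linorder_cases)
  case less
  have "((\<lambda>t::real. 0) has_real_derivative 0) (at t)" by simp
  then show ?thesis
    by (rule has_field_derivative_transform_within_open[where S="{..<0}", THEN DERIV_cong]) (use less in \<open>auto simp: flat_exp_def\<close>)
next
  case greater
  have *: "((\<lambda>t. inverse t ^ n * exp (- inverse t)) has_real_derivative
      - real n * (inverse t ^ Suc n * exp (- inverse t)) + inverse t ^ Suc (Suc n) * exp (- inverse t)) (at t)"
  proof -
    have i: "(inverse has_real_derivative - (inverse t)\<^sup>2) (at t)"
      using DERIV_inverse[of t UNIV] greater by (simp add: power2_eq_square)
    have p: "((\<lambda>t. inverse t ^ n) has_real_derivative - real n * inverse t ^ Suc n) (at t)"
      by (rule DERIV_cong[OF DERIV_power[OF i]]) (cases n; simp add: power2_eq_square algebra_simps)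
    have e: "((\<lambda>t. exp (- inverse t)) has_real_derivative exp (- inverse t) * (inverse t)\<^sup>2) (at t)"
      by (rule DERIV_cong[OF DERIV_chain2[OF DERIV_exp DERIV_minus[OF i]]]) simp
    show ?thesis
      by (rule DERIV_cong[OF DERIV_mult[OF p e]]) (simp add: power2_eq_square)
  qed
  then show ?thesis
    by (rule has_field_derivative_transform_within_open[where S="{0<..}", THEN DERIV_cong]) (use greater in \<open>auto simp: flat_exp_def\<close>)
next
  case equal
  \<comment> \<open>Dividing by \<open>h\<close> only raises the index, so the difference quotient
    at zero is again a function with limit zero there.\<close>
  have "flat_exp (Suc n) h = flat_exp n h / h" if "h \<noteq> 0" for h
    using that by (auto simp: flat_exp_def field_simps)
  then have "((\<lambda>h::real. flat_exp n h / h) \<longlongrightarrow> 0) (at 0)"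
    by (intro Lim_transform_eventually[OF flat_exp_tendsto_0[of "Suc n"]]) (simp add: eventually_at_filter)
  then show ?thesis using equal by (simp add: DERIV_def flat_exp_def)
qed

lemma C_k_flat_exp: "C_k k f \<Longrightarrow> C_k k (\<lambda>x. flat_exp n (f x))"
proof (induction k arbitrary: n)
  case 0
  have "continuous_on UNIV (flat_exp n)"
    by (meson DERIV_isCont continuous_at_imp_continuous_on flat_exp_deriv)
  then show ?case using 0 continuous_on_compose2[of UNIV "flat_exp n" UNIV f] by simp
next
  case (Suc k)
  have df: "f differentiable (at x)" for x using Suc.prems by simp
  note D = pderiv_at_compose_real[where h="flat_exp n", OF flat_exp_deriv df]
  have "pderiv_at i (\<lambda>x. flat_exp n (f x)) = (\<lambda>x. (- real n * flat_exp (Suc n) (f x) + flat_exp (Suc (Suc n)) (f x)) * pderiv_at i f x)" for i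
    by (intro ext D)
  moreover have "C_k k (\<lambda>x. (- real n * flat_exp (Suc n) (f x) + flat_exp (Suc (Suc n)) (f x)) * pderiv_at i f x)" for i
    by (intro C_k_mult C_k_add C_k_const Suc.IH C_k_Suc_imp[OF Suc.prems] C_k_pderiv[OF Suc.prems])
  ultimately show ?case using D(2) by simp
qed


section \<open>Symmetry of second derivatives\<close>

lemma C_k_line_DERIV:
  fixes f :: "real^'n::finite \<Rightarrow> real"
  assumes "f differentiable (at (x + t *\<^sub>R axis i 1))"
  shows "((\<lambda>t. f (x + t *\<^sub>R axis i 1)) has_real_derivative pderiv_at i f (x + t *\<^sub>R axis i 1)) (at t)"
proof -
  have g: "((\<lambda>t. x + t *\<^sub>R axis i 1) has_derivative (\<lambda>s. s *\<^sub>R axis i 1)) (at t)"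
    by (auto intro!: derivative_eq_intros)
  have "((\<lambda>t. f (x + t *\<^sub>R axis i 1)) has_derivative (\<lambda>s. \<Sum>l\<in>UNIV. (s *\<^sub>R axis i 1) $ l * pderiv_at l f (x + t *\<^sub>R axis i 1))) (at t)"
    by (rule has_derivative_compose[OF g has_derivative_pderiv_at[OF assms]])
  moreover have "(\<Sum>l\<in>UNIV. (s *\<^sub>R axis i 1) $ l * pderiv_at l f y) = pderiv_at i f y * s" for s y
  proof -
    have "(\<Sum>l\<in>UNIV. (s *\<^sub>R axis i 1) $ l * pderiv_at l f y) = (\<Sum>l\<in>UNIV. if l = i then pderiv_at l f y * s else 0)"
      by (intro sum.cong) (auto simp: axis_def)
    then show ?thesis by simp
  qed
  ultimately show ?thesis by (simp add: has_field_derivative_def)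
qed

text \<open>Two nested applications of the mean value theorem, first in direction \<open>i\<close>,
  then in direction \<open>j\<close>. The second difference on the left does not depend on the order
  of the two directions.\<close>

lemma second_difference_mean_value:
  fixes f :: "real^'n::finite \<Rightarrow> real"
  assumes "C_k 2 f" "t > 0"
  obtains r s where "0 < r" "r < t" "0 < s" "s < t"
    "f (x + t *\<^sub>R axis i 1 + t *\<^sub>R axis j 1) - f (x + t *\<^sub>R axis i 1) - f (x + t *\<^sub>R axis j 1) + f x
      = t\<^sup>2 * pderiv_at j (pderiv_at i f) (x + r *\<^sub>R axis i 1 + s *\<^sub>R axis j 1)"
proof -
  have C: "C_k (Suc (Suc 0)) f" using assms by (simp add: numeral_2_eq_2)
  have df: "f differentiable (at y)" for y using C by simp
  have d2: "pderiv_at i f differentiable (at y)" for y using C by simp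
  define g where "g r = f (x + t *\<^sub>R axis j 1 + r *\<^sub>R axis i 1) - f (x + r *\<^sub>R axis i 1)" for r
  have "(g has_real_derivative pderiv_at i f (x + t *\<^sub>R axis j 1 + r *\<^sub>R axis i 1) - pderiv_at i f (x + r *\<^sub>R axis i 1)) (at r)" for r
    unfolding g_def by (intro DERIV_diff C_k_line_DERIV df)
  then obtain r where r: "0 < r" "r < t" "g t - g 0 = (t - 0) * (pderiv_at i f (x + t *\<^sub>R axis j 1 + r *\<^sub>R axis i 1) - pderiv_at i f (x + r *\<^sub>R axis i 1))"
    using MVT2[OF assms(2), of g "\<lambda>r. pderiv_at i f (x + t *\<^sub>R axis j 1 + r *\<^sub>R axis i 1) - pderiv_at i f (x + r *\<^sub>R axis i 1)"] by blast
  define h where "h s = pderiv_at i f (x + r *\<^sub>R axis i 1 + s *\<^sub>R axis j 1)" for s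
  have "(h has_real_derivative pderiv_at j (pderiv_at i f) (x + r *\<^sub>R axis i 1 + s *\<^sub>R axis j 1)) (at s)" for s
    unfolding h_def by (intro C_k_line_DERIV d2)
  then obtain s where s: "0 < s" "s < t" "h t - h 0 = (t - 0) * pderiv_at j (pderiv_at i f) (x + r *\<^sub>R axis i 1 + s *\<^sub>R axis j 1)"
    using MVT2[OF assms(2), of h "\<lambda>s. pderiv_at j (pderiv_at i f) (x + r *\<^sub>R axis i 1 + s *\<^sub>R axis j 1)"] by blast
  have "h t - h 0 = pderiv_at i f (x + t *\<^sub>R axis j 1 + r *\<^sub>R axis i 1) - pderiv_at i f (x + r *\<^sub>R axis i 1)"
    by (simp add: h_def add.commute add.left_commute)
  then have "g t - g 0 = t\<^sup>2 * pderiv_at j (pderiv_at i f) (x + r *\<^sub>R axis i 1 + s *\<^sub>R axis j 1)"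
    using r(3) s(3) by (simp add: power2_eq_square)
  moreover have "g t - g 0 = f (x + t *\<^sub>R axis i 1 + t *\<^sub>R axis j 1) - f (x + t *\<^sub>R axis i 1) - f (x + t *\<^sub>R axis j 1) + f x"
    by (simp add: g_def add.commute add.left_commute)
  ultimately show ?thesis using that r s by metis
qed

text \<open>Schwarz's theorem: the same second difference \<open>D n\<close>, divided by the square
  of the step, converges to both mixed derivatives, because the intermediate points of the mean
  value theorem shrink to \<open>x\<close>.\<close>

lemma pderiv_at_commute:
  fixes f :: "real^'n::finite \<Rightarrow> real"
  assumes "C_k 2 f"
  shows "pderiv_at i (pderiv_at j f) x = pderiv_at j (pderiv_at i f) x"
proof -
  define t where "t n = inverse (real (Suc n))" for n
  have t0: "t n > 0" for n by (simp add: t_def)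
  have tl: "t \<longlonglongrightarrow> 0" unfolding t_def by (rule LIMSEQ_inverse_real_of_nat)
  have C: "C_k (Suc (Suc 0)) f" using assms by (simp add: numeral_2_eq_2)
  define D where "D n = f (x + t n *\<^sub>R axis i 1 + t n *\<^sub>R axis j 1) - f (x + t n *\<^sub>R axis i 1) - f (x + t n *\<^sub>R axis j 1) + f x" for n
  have lim: "(\<lambda>n. D n / (t n)\<^sup>2) \<longlonglongrightarrow> pderiv_at b (pderiv_at a f) x"
    if ab: "(a = i \<and> b = j) \<or> (a = j \<and> b = i)" for a b
  proof -
    have "\<exists>r s. 0 < r \<and> r < t n \<and> 0 < s \<and> s < t n \<and> D n = (t n)\<^sup>2 * pderiv_at b (pderiv_at a f) (x + r *\<^sub>R axis a 1 + s *\<^sub>R axis b 1)" for n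
    proof -
      obtain r s where rs: "0 < r" "r < t n" "0 < s" "s < t n"
        "f (x + t n *\<^sub>R axis a 1 + t n *\<^sub>R axis b 1) - f (x + t n *\<^sub>R axis a 1) - f (x + t n *\<^sub>R axis b 1) + f x
          = (t n)\<^sup>2 * pderiv_at b (pderiv_at a f) (x + r *\<^sub>R axis a 1 + s *\<^sub>R axis b 1)"
        using second_difference_mean_value[OF assms t0] by blast
      moreover have "D n = f (x + t n *\<^sub>R axis a 1 + t n *\<^sub>R axis b 1) - f (x + t n *\<^sub>R axis a 1) - f (x + t n *\<^sub>R axis b 1) + f x"
        using ab by (auto simp: D_def add_ac)
      ultimately show ?thesis by metis
    qed
    then obtain r s where rs: "\<And>n. 0 < r n \<and> r n < t n \<and> 0 < s n \<and> s n < t n \<and> D n = (t n)\<^sup>2 * pderiv_at b (pderiv_at a f) (x + r n *\<^sub>R axis a 1 + s n *\<^sub>R axis b 1)"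
      by metis
    have r0: "r \<longlonglongrightarrow> 0" and s0: "s \<longlonglongrightarrow> 0"
      using rs by (auto intro!: tendsto_sandwich[OF _ _ tendsto_const tl] always_eventually simp: less_imp_le)
    have "(\<lambda>n. x + r n *\<^sub>R axis a 1 + s n *\<^sub>R axis b 1) \<longlonglongrightarrow> x + 0 *\<^sub>R axis a 1 + 0 *\<^sub>R axis b 1"
      by (intro tendsto_intros r0 s0)
    moreover have "isCont (pderiv_at b (pderiv_at a f)) x"
      using C by (auto simp: continuous_on_eq_continuous_at)
    ultimately have "(\<lambda>n. pderiv_at b (pderiv_at a f) (x + r n *\<^sub>R axis a 1 + s n *\<^sub>R axis b 1)) \<longlonglongrightarrow> pderiv_at b (pderiv_at a f) x"
      using isCont_tendsto_compose by fastforce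
    moreover have "D n / (t n)\<^sup>2 = pderiv_at b (pderiv_at a f) (x + r n *\<^sub>R axis a 1 + s n *\<^sub>R axis b 1)" for n
      using rs[of n] t0[of n] by auto
    ultimately show ?thesis by simp
  qed
  show ?thesis using LIMSEQ_unique[OF lim lim] by blast
qed

section \<open>Square integrable functions\<close>

lemma tendsto_0_le_real:
  fixes f g :: "nat \<Rightarrow> real"
  assumes "\<And>n. \<bar>f n\<bar> \<le> g n" "g \<longlonglongrightarrow> 0"
  shows "f \<longlonglongrightarrow> 0"
  by (rule Lim_null_comparison[OF _ assms(2)]) (simp add: assms(1))

text \<open>The measure is arbitrary because both the restricted Lebesgue measure of the domain and
  \<open>lborel\<close> on the line occur.\<close>

definition sq_integrable :: "'a measure \<Rightarrow> ('a \<Rightarrow> real) \<Rightarrow> bool" where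
  "sq_integrable M f \<longleftrightarrow> f \<in> borel_measurable M \<and> integrable M (\<lambda>x. (f x)\<^sup>2)"

definition nrm2 :: "'a measure \<Rightarrow> ('a \<Rightarrow> real) \<Rightarrow> real" where
  "nrm2 M f = sqrt (\<integral>x. (f x)\<^sup>2 \<partial>M)"

lemma sq_integrable_measurable: "sq_integrable M f \<Longrightarrow> f \<in> borel_measurable M"
  by (simp add: sq_integrable_def)

lemma sq_integrable_square: "sq_integrable M f \<Longrightarrow> integrable M (\<lambda>x. (f x)\<^sup>2)"
  by (simp add: sq_integrable_def)

lemma nrm2_nonneg [simp]: "0 \<le> nrm2 M f"
  by (simp add: nrm2_def)

lemma nrm2_square: "(nrm2 M f)\<^sup>2 = (\<integral>x. (f x)\<^sup>2 \<partial>M)"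
  by (simp add: nrm2_def)

lemma sq_integrable_mult:
  assumes "sq_integrable M f" "sq_integrable M g"
  shows "integrable M (\<lambda>x. f x * g x)"
proof (rule Bochner_Integration.integrable_bound)
  show "integrable M (\<lambda>x. (f x)\<^sup>2 + (g x)\<^sup>2)"
    using assms by (simp add: sq_integrable_def)
  show "(\<lambda>x. f x * g x) \<in> borel_measurable M"
    using assms by (auto simp: sq_integrable_def)
  have "\<bar>a * b\<bar> \<le> a\<^sup>2 + b\<^sup>2" for a b :: real
  proof -
    have "0 \<le> \<bar>a\<bar> * \<bar>b\<bar>" "2 * \<bar>a\<bar> * \<bar>b\<bar> \<le> a\<^sup>2 + b\<^sup>2"
      using sum_squares_bound[of "\<bar>a\<bar>" "\<bar>b\<bar>"] by simp_all
    then show ?thesis unfolding abs_mult by linarith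
  qed
  then show "AE x in M. norm (f x * g x) \<le> norm ((f x)\<^sup>2 + (g x)\<^sup>2)"
    by simp
qed

lemma sq_integrable_add:
  assumes "sq_integrable M f" "sq_integrable M g"
  shows "sq_integrable M (\<lambda>x. f x + g x)"
  using assms sq_integrable_mult[OF assms] by (auto simp: sq_integrable_def power2_sum mult.assoc)

lemma sq_integrable_bdd_mult:
  assumes "sq_integrable M f" "a \<in> borel_measurable M" "\<And>x. x \<in> space M \<Longrightarrow> \<bar>a x\<bar> \<le> B"
  shows "sq_integrable M (\<lambda>x. a x * f x)"
  unfolding sq_integrable_def
proof
  show m: "(\<lambda>x. a x * f x) \<in> borel_measurable M" using assms by (auto simp: sq_integrable_def)
  show "integrable M (\<lambda>x. (a x * f x)\<^sup>2)"
  proof (rule Bochner_Integration.integrable_bound)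
    show "integrable M (\<lambda>x. B\<^sup>2 * (f x)\<^sup>2)" using assms by (simp add: sq_integrable_def)
    show "(\<lambda>x. (a x * f x)\<^sup>2) \<in> borel_measurable M" using m by measurable
    have "(a x * f x)\<^sup>2 \<le> B\<^sup>2 * (f x)\<^sup>2" if "x \<in> space M" for x
      using power_mono[OF assms(3)[OF that], of 2] by (simp add: power_mult_distrib mult_right_mono)
    then show "AE x in M. norm ((a x * f x)\<^sup>2) \<le> norm (B\<^sup>2 * (f x)\<^sup>2)" by simp
  qed
qed

lemma sq_integrable_cmult: "sq_integrable M f \<Longrightarrow> sq_integrable M (\<lambda>x. c * f x)"
  by (rule sq_integrable_bdd_mult[where B="\<bar>c\<bar>"]) auto

lemma sq_integrable_uminus: "sq_integrable M f \<Longrightarrow> sq_integrable M (\<lambda>x. - f x)"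
  using sq_integrable_cmult[of M f "-1"] by simp

lemma sq_integrable_diff: "sq_integrable M f \<Longrightarrow> sq_integrable M g \<Longrightarrow> sq_integrable M (\<lambda>x. f x - g x)"
  using sq_integrable_add[of M f "\<lambda>x. - g x"] sq_integrable_uminus[of M g] by simp

lemma sq_integrable_0 [simp]: "sq_integrable M (\<lambda>x. 0)"
  by (simp add: sq_integrable_def)

lemma sq_integrable_sum: "(\<And>a. a \<in> A \<Longrightarrow> sq_integrable M (f a)) \<Longrightarrow> sq_integrable M (\<lambda>x. \<Sum>a\<in>A. f a x)"
  by (induction A rule: infinite_finite_induct) (auto intro: sq_integrable_add)

lemma sq_integrable_AE_cong:
  assumes "sq_integrable M f" "g \<in> borel_measurable M" "AE x in M. f x = g x"
  shows "sq_integrable M g"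
proof -
  have "integrable M (\<lambda>x. (g x)\<^sup>2) \<longleftrightarrow> integrable M (\<lambda>x. (f x)\<^sup>2)"
    using assms by (intro integrable_cong_AE) (auto simp: sq_integrable_def)
  then show ?thesis using assms by (simp add: sq_integrable_def)
qed

lemma (in finite_measure) sq_integrable_bounded:
  assumes "a \<in> borel_measurable M" "\<And>x. x \<in> space M \<Longrightarrow> \<bar>a x\<bar> \<le> (B::real)"
  shows "sq_integrable M a"
  using sq_integrable_bdd_mult[of M "\<lambda>_. 1" a B] assms by (simp add: sq_integrable_def)

lemma (in finite_measure) sq_integrable_integrable: "sq_integrable M f \<Longrightarrow> integrable M f"
  using sq_integrable_mult[of M f "\<lambda>_. 1"] by (simp add: sq_integrable_def)

lemma nrm2_cmult: "nrm2 M (\<lambda>x. c * f x) = \<bar>c\<bar> * nrm2 M f"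
  by (simp add: nrm2_def power_mult_distrib real_sqrt_mult)

lemma nrm2_minus_commute: "nrm2 M (\<lambda>x. f x - g x) = nrm2 M (\<lambda>x. g x - f x)"
  by (simp add: nrm2_def power2_commute)

lemma nrm2_cong_AE:
  assumes "f \<in> borel_measurable M" "g \<in> borel_measurable M" "AE x in M. f x = g x"
  shows "nrm2 M f = nrm2 M g"
proof -
  have "(\<integral>x. (f x)\<^sup>2 \<partial>M) = (\<integral>x. (g x)\<^sup>2 \<partial>M)"
    using assms by (intro integral_cong_AE) auto
  then show ?thesis by (simp add: nrm2_def)
qed

lemma nrm2_le_AE:
  assumes "sq_integrable M f" "sq_integrable M g" "AE x in M. \<bar>f x\<bar> \<le> \<bar>g x\<bar>"
  shows "nrm2 M f \<le> nrm2 M g"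
proof -
  have "(\<integral>x. (f x)\<^sup>2 \<partial>M) \<le> (\<integral>x. (g x)\<^sup>2 \<partial>M)"
    using assms by (intro integral_mono_AE) (auto simp: sq_integrable_def abs_le_square_iff)
  then show ?thesis by (simp add: nrm2_def)
qed

lemma Cauchy_Schwarz_integral:
  assumes "sq_integrable M f" "sq_integrable M g"
  shows "\<bar>\<integral>x. f x * g x \<partial>M\<bar> \<le> nrm2 M f * nrm2 M g"
proof -
  have z: "(\<integral>x. f x * g x \<partial>M) = 0" if "nrm2 M f = 0" "sq_integrable M f" "sq_integrable M g" for f g
  proof -
    have "(\<integral>x. (f x)\<^sup>2 \<partial>M) = 0" using that by (simp add: nrm2_def)
    then have "AE x in M. (f x)\<^sup>2 = 0"
      using that integral_nonneg_eq_0_iff_AE[of M "\<lambda>x. (f x)\<^sup>2"] by (simp add: sq_integrable_def)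
    then have "AE x in M. f x * g x = 0" by auto
    then have "(\<integral>x. f x * g x \<partial>M) = (\<integral>x. 0 \<partial>M)"
      using that by (intro integral_cong_AE borel_measurable_times borel_measurable_const) (auto simp: sq_integrable_def)
    then show ?thesis by simp
  qed
  show ?thesis
  proof (cases "nrm2 M f = 0 \<or> nrm2 M g = 0")
    case True
    then show ?thesis using z[of f g] z[of g f] assms by (auto simp: mult.commute)
  next
    case False
    define a b where "a = nrm2 M f" and "b = nrm2 M g"
    have ab: "a > 0" "b > 0" using False nrm2_nonneg[of M f] nrm2_nonneg[of M g] by (auto simp: a_def b_def less_le)
    \<comment> \<open>This weight makes the two terms of the weighted Young inequality
      equal.\<close>
    define s where "s = b / a"
    have s: "s > 0" using ab by (simp add: s_def)
    have bd: "2 * \<bar>x * y\<bar> \<le> s * x\<^sup>2 + y\<^sup>2 / s" for x y :: real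
    proof -
      have "0 \<le> (s * \<bar>x\<bar> - \<bar>y\<bar>)\<^sup>2 / s" using s by simp
      also have "(s * \<bar>x\<bar> - \<bar>y\<bar>)\<^sup>2 / s = s * x\<^sup>2 + y\<^sup>2 / s - 2 * \<bar>x * y\<bar>"
        using s by (simp add: power2_diff field_simps abs_mult power2_eq_square)
      finally show ?thesis by simp
    qed
    have i: "integrable M (\<lambda>x. f x * g x)" using assms by (rule sq_integrable_mult)
    have "2 * \<bar>\<integral>x. f x * g x \<partial>M\<bar> \<le> (\<integral>x. 2 * \<bar>f x * g x\<bar> \<partial>M)"
      using integral_abs_bound[of M "\<lambda>x. f x * g x"] by simp
    also have "\<dots> \<le> (\<integral>x. s * (f x)\<^sup>2 + (g x)\<^sup>2 / s \<partial>M)"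
      using assms i bd by (intro integral_mono) (auto simp: sq_integrable_def)
    also have "\<dots> = s * a\<^sup>2 + b\<^sup>2 / s"
      using assms by (simp add: sq_integrable_def a_def b_def nrm2_square)
    also have "\<dots> = 2 * (a * b)" using ab by (simp add: s_def power2_eq_square)
    finally show ?thesis by (simp add: a_def b_def)
  qed
qed

lemma nrm2_triangle:
  assumes "sq_integrable M f" "sq_integrable M g"
  shows "nrm2 M (\<lambda>x. f x + g x) \<le> nrm2 M f + nrm2 M g"
proof (rule power2_le_imp_le)
  have "(nrm2 M (\<lambda>x. f x + g x))\<^sup>2 = (\<integral>x. (f x)\<^sup>2 + (g x)\<^sup>2 + 2 * (f x * g x) \<partial>M)"
    by (simp add: nrm2_square power2_sum mult.assoc)
  also have "\<dots> = (nrm2 M f)\<^sup>2 + (nrm2 M g)\<^sup>2 + 2 * (\<integral>x. f x * g x \<partial>M)"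
    using assms sq_integrable_mult[OF assms] by (simp add: sq_integrable_def nrm2_square)
  also have "\<dots> \<le> (nrm2 M f + nrm2 M g)\<^sup>2"
    using Cauchy_Schwarz_integral[OF assms] by (simp add: power2_sum)
  finally show "(nrm2 M (\<lambda>x. f x + g x))\<^sup>2 \<le> (nrm2 M f + nrm2 M g)\<^sup>2" .
qed simp

lemma nrm2_triangle_diff:
  assumes "sq_integrable M f" "sq_integrable M g" "sq_integrable M h"
  shows "nrm2 M (\<lambda>x. f x - h x) \<le> nrm2 M (\<lambda>x. f x - g x) + nrm2 M (\<lambda>x. g x - h x)"
  using nrm2_triangle[OF sq_integrable_diff[OF assms(1,2)] sq_integrable_diff[OF assms(2,3)]] by simp

lemma nrm2_bdd_mult_le:
  assumes "sq_integrable M f" "a \<in> borel_measurable M" "\<And>x. x \<in> space M \<Longrightarrow> \<bar>a x\<bar> \<le> B" "0 \<le> B"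
  shows "nrm2 M (\<lambda>x. a x * f x) \<le> B * nrm2 M f"
proof -
  have "nrm2 M (\<lambda>x. a x * f x) \<le> nrm2 M (\<lambda>x. B * f x)"
    using assms by (intro nrm2_le_AE sq_integrable_bdd_mult[OF assms(1-3)] sq_integrable_cmult)
      (auto simp: abs_mult intro!: mult_right_mono)
  then show ?thesis using assms(4) by (simp add: nrm2_cmult)
qed

section \<open>Convergence and completeness in L^2\<close>

text \<open>Square integrability of every term and of the limit is built in: the Bochner integral of
  a non-integrable function is zero, so smallness of \<open>nrm2\<close> alone would carry no
  information.\<close>

definition L2_lim :: "'a measure \<Rightarrow> (nat \<Rightarrow> 'a \<Rightarrow> real) \<Rightarrow> ('a \<Rightarrow> real) \<Rightarrow> bool" where
  "L2_lim M f g \<longleftrightarrow> (\<forall>n. sq_integrable M (f n)) \<and> sq_integrable M g \<and> (\<lambda>n. nrm2 M (\<lambda>x. f n x - g x)) \<longlonglongrightarrow> 0"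

lemma L2_lim_const: "sq_integrable M f \<Longrightarrow> L2_lim M (\<lambda>n. f) f"
  by (simp add: L2_lim_def nrm2_def)

lemma L2_lim_product:
  assumes "L2_lim M f F" "L2_lim M g G"
  shows "(\<lambda>n. \<integral>x. f n x * g n x \<partial>M) \<longlonglongrightarrow> (\<integral>x. F x * G x \<partial>M)"
proof -
  have s: "sq_integrable M (f n)" "sq_integrable M F" "sq_integrable M (g n)" "sq_integrable M G" for n
    using assms by (auto simp: L2_lim_def)
  define e d where "e n = nrm2 M (\<lambda>x. f n x - F x)" and "d n = nrm2 M (\<lambda>x. g n x - G x)" for n
  have ed: "e \<longlonglongrightarrow> 0" "d \<longlonglongrightarrow> 0" using assms by (auto simp: L2_lim_def e_def[abs_def] d_def[abs_def])
  have "\<bar>(\<integral>x. f n x * g n x \<partial>M) - (\<integral>x. F x * G x \<partial>M)\<bar> \<le> e n * (d n + nrm2 M G) + nrm2 M F * d n" for n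
  proof -
    have "(\<integral>x. f n x * g n x \<partial>M) - (\<integral>x. F x * G x \<partial>M) = (\<integral>x. f n x * g n x - F x * G x \<partial>M)"
      using s by (subst Bochner_Integration.integral_diff) (auto intro: sq_integrable_mult)
    also have "\<dots> = (\<integral>x. (f n x - F x) * g n x + F x * (g n x - G x) \<partial>M)"
      by (simp add: algebra_simps)
    also have "\<dots> = (\<integral>x. (f n x - F x) * g n x \<partial>M) + (\<integral>x. F x * (g n x - G x) \<partial>M)"
      using s by (intro Bochner_Integration.integral_add sq_integrable_mult sq_integrable_diff)
    finally have "\<bar>(\<integral>x. f n x * g n x \<partial>M) - (\<integral>x. F x * G x \<partial>M)\<bar> \<le> e n * nrm2 M (g n) + nrm2 M F * d n"
      using Cauchy_Schwarz_integral[of M "\<lambda>x. f n x - F x" "g n"]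
        Cauchy_Schwarz_integral[of M F "\<lambda>x. g n x - G x"] s by (simp add: sq_integrable_diff e_def d_def)
    moreover have "nrm2 M (g n) \<le> d n + nrm2 M G"
      using nrm2_triangle[OF sq_integrable_diff[OF s(3)[of n] s(4)] s(4)] by (simp add: d_def)
    moreover have "0 \<le> e n" by (simp add: e_def)
    ultimately show ?thesis by (smt (verit) mult_left_mono)
  qed
  note bd = this
  have "(\<lambda>n. e n * (d n + nrm2 M G) + nrm2 M F * d n) \<longlonglongrightarrow> 0 * (0 + nrm2 M G) + nrm2 M F * 0"
    by (intro tendsto_intros ed)
  then have "(\<lambda>n. (\<integral>x. f n x * g n x \<partial>M) - (\<integral>x. F x * G x \<partial>M)) \<longlonglongrightarrow> 0"
    by (intro tendsto_0_le_real[OF bd]) simp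
  then show ?thesis by (simp add: LIM_zero_iff)
qed

lemma L2_lim_product_const:
  assumes "L2_lim M f F" "sq_integrable M g"
  shows "(\<lambda>n. \<integral>x. f n x * g x \<partial>M) \<longlonglongrightarrow> (\<integral>x. F x * g x \<partial>M)"
  using L2_lim_product[OF assms(1) L2_lim_const[OF assms(2)]] .

lemma L2_lim_bdd_mult:
  assumes "L2_lim M f F" "a \<in> borel_measurable M" "\<And>x. x \<in> space M \<Longrightarrow> \<bar>a x\<bar> \<le> B"
  shows "L2_lim M (\<lambda>n x. a x * f n x) (\<lambda>x. a x * F x)"
  unfolding L2_lim_def
proof (intro conjI allI)
  show "sq_integrable M (\<lambda>x. a x * f n x)" "sq_integrable M (\<lambda>x. a x * F x)" for n
    using assms by (auto simp: L2_lim_def intro: sq_integrable_bdd_mult)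
  have B: "\<And>x. x \<in> space M \<Longrightarrow> \<bar>a x\<bar> \<le> \<bar>B\<bar>" using assms(3) by fastforce
  have bd: "\<bar>nrm2 M (\<lambda>x. a x * f n x - a x * F x)\<bar> \<le> \<bar>B\<bar> * nrm2 M (\<lambda>x. f n x - F x)" for n
    using nrm2_bdd_mult_le[of M "\<lambda>x. f n x - F x" a "\<bar>B\<bar>"] assms B
    by (simp add: L2_lim_def sq_integrable_diff right_diff_distrib)
  have "(\<lambda>n. \<bar>B\<bar> * nrm2 M (\<lambda>x. f n x - F x)) \<longlonglongrightarrow> \<bar>B\<bar> * 0"
    using assms by (intro tendsto_intros) (simp add: L2_lim_def)
  then show "(\<lambda>n. nrm2 M (\<lambda>x. a x * f n x - a x * F x)) \<longlonglongrightarrow> 0"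
    by (intro tendsto_0_le_real[OF bd]) simp
qed

lemma L2_lim_add:
  assumes "L2_lim M f F" "L2_lim M g G"
  shows "L2_lim M (\<lambda>n x. f n x + g n x) (\<lambda>x. F x + G x)"
  unfolding L2_lim_def
proof (intro conjI allI)
  show "sq_integrable M (\<lambda>x. f n x + g n x)" "sq_integrable M (\<lambda>x. F x + G x)" for n
    using assms by (auto simp: L2_lim_def intro: sq_integrable_add)
  have bd: "\<bar>nrm2 M (\<lambda>x. f n x + g n x - (F x + G x))\<bar> \<le> nrm2 M (\<lambda>x. f n x - F x) + nrm2 M (\<lambda>x. g n x - G x)" for n
    using nrm2_triangle[of M "\<lambda>x. f n x - F x" "\<lambda>x. g n x - G x"] assms
    by (simp add: L2_lim_def sq_integrable_diff algebra_simps)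
  have "(\<lambda>n. nrm2 M (\<lambda>x. f n x - F x) + nrm2 M (\<lambda>x. g n x - G x)) \<longlonglongrightarrow> 0 + 0"
    using assms by (intro tendsto_intros) (auto simp: L2_lim_def)
  then show "(\<lambda>n. nrm2 M (\<lambda>x. f n x + g n x - (F x + G x))) \<longlonglongrightarrow> 0"
    by (intro tendsto_0_le_real[OF bd]) simp
qed

lemma L2_lim_diff:
  assumes "L2_lim M f F" "L2_lim M g G"
  shows "L2_lim M (\<lambda>n x. f n x - g n x) (\<lambda>x. F x - G x)"
  using L2_lim_add[OF assms(1) L2_lim_bdd_mult[OF assms(2), of "\<lambda>_. -1" 1]] by simp

text \<open>Riesz-Fischer. A subsequence with geometrically small increments has increments summable
  in L^1, by finiteness of the measure, hence converges almost everywhere; Fatou's lemma turns the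
  pointwise limit into a limit in norm.\<close>

lemma (in finite_measure) L2_complete:
  fixes f :: "nat \<Rightarrow> 'a \<Rightarrow> real"
  assumes sq: "\<And>n. sq_integrable M (f n)"
    and cau: "\<And>e. e > 0 \<Longrightarrow> \<exists>N. \<forall>m\<ge>N. \<forall>n\<ge>N. nrm2 M (\<lambda>x. f m x - f n x) < e"
  shows "\<exists>g. L2_lim M f g"
proof -
  note [measurable] = sq_integrable_measurable[OF sq]
  have "\<forall>k. \<exists>N. \<forall>m\<ge>N. \<forall>n\<ge>N. nrm2 M (\<lambda>x. f m x - f n x) < (1/2) ^ k" using cau by simp
  then obtain N where N: "\<And>k m n. m \<ge> N k \<Longrightarrow> n \<ge> N k \<Longrightarrow> nrm2 M (\<lambda>x. f m x - f n x) < (1/2) ^ k" by metis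
  \<comment> \<open>Summing the thresholds makes \<open>r k\<close> and \<open>r (Suc k)\<close>
    both at least \<open>N k\<close>, so consecutive members of the subsequence differ in norm by
    less than \<open>(1/2) ^ k\<close>.\<close>
  define r where "r k = (\<Sum>j\<le>k. N j) + k" for k
  have "N k \<le> (\<Sum>j\<le>k. N j)" for k by (rule member_le_sum) auto
  then have rN: "r k \<ge> N k" "r (Suc k) \<ge> N k" for k unfolding r_def by (simp_all add: trans_le_add1 le_SucI)
  define D where "D k x = \<bar>f (r (Suc k)) x - f (r k) x\<bar>" for k x
  have [measurable]: "D k \<in> borel_measurable M" for k unfolding D_def by measurable
  define c where "c = sqrt (measure M (space M))"
  have Dint: "integrable M (D k)" for k unfolding D_def
    by (intro integrable_abs sq_integrable_integrable sq_integrable_diff sq)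
  have Dbd: "(\<integral>x. D k x \<partial>M) \<le> c * (1/2) ^ k" for k
  proof -
    have sD: "sq_integrable M (D k)"
      using sq_integrable_diff[OF sq sq, of "r (Suc k)" "r k"] by (simp add: sq_integrable_def D_def)
    have "\<bar>\<integral>x. 1 * D k x \<partial>M\<bar> \<le> nrm2 M (\<lambda>_. 1) * nrm2 M (D k)"
      using sD by (intro Cauchy_Schwarz_integral) (auto simp: sq_integrable_def)
    moreover have "nrm2 M (D k) \<le> (1/2) ^ k"
      using N[OF rN(2) rN(1), of k] by (simp add: D_def nrm2_def)
    moreover have "nrm2 M (\<lambda>_. 1) = c" by (simp add: nrm2_def c_def)
    moreover have "0 \<le> c" by (simp add: c_def)
    ultimately show ?thesis by (smt (verit) mult_left_mono mult_1 Bochner_Integration.integral_cong)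
  qed
  have "(\<integral>\<^sup>+x. (\<Sum>k. ennreal (D k x)) \<partial>M) = (\<Sum>k. \<integral>\<^sup>+x. ennreal (D k x) \<partial>M)"
    by (rule nn_integral_suminf) measurable
  also have "\<dots> = (\<Sum>k. ennreal (\<integral>x. D k x \<partial>M))"
    by (intro suminf_cong nn_integral_eq_integral Dint) (auto simp: D_def)
  also have "\<dots> \<noteq> \<infinity>"
  proof -
    have "summable (\<lambda>k. \<integral>x. D k x \<partial>M)"
    proof (rule summable_comparison_test')
      show "summable (\<lambda>k. c * (1/2) ^ k)" by (intro summable_mult summable_geometric) simp
      show "norm (\<integral>x. D k x \<partial>M) \<le> c * (1/2) ^ k" for k
        using Dbd[of k] by (simp add: D_def)
    qed
    then have "(\<Sum>k. ennreal (\<integral>x. D k x \<partial>M)) = ennreal (\<Sum>k. \<integral>x. D k x \<partial>M)"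
      by (intro suminf_ennreal2) (auto simp: D_def)
    then show ?thesis by simp
  qed
  finally have "AE x in M. (\<Sum>k. ennreal (D k x)) \<noteq> \<infinity>"
    by (intro nn_integral_PInf_AE) auto
  then have conv: "AE x in M. (\<lambda>k. f (r k) x) \<longlonglongrightarrow> lim (\<lambda>k. f (r k) x)"
  proof eventually_elim
    case (elim x)
    then have "summable (\<lambda>k. D k x)"
      by (intro summable_suminf_not_top) (auto simp: D_def top_ennreal_def infinity_ennreal_def)
    then have "summable (\<lambda>k. f (r (Suc k)) x - f (r k) x)"
      unfolding D_def by (rule summable_rabs_cancel)
    then have "convergent (\<lambda>n. \<Sum>k<n. f (r (Suc k)) x - f (r k) x)"
      by (simp add: summable_iff_convergent)
    then have "convergent (\<lambda>n. f (r n) x - f (r 0) x)"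
      by (simp add: sum_lessThan_telescope[of "\<lambda>k. f (r k) x"])
    then have "convergent (\<lambda>n. f (r n) x - f (r 0) x + f (r 0) x)"
      by (intro convergent_add convergent_const)
    then show ?case by (simp add: convergent_LIMSEQ_iff)
  qed
  define g where "g x = lim (\<lambda>k. f (r k) x)" for x
  have [measurable]: "g \<in> borel_measurable M" unfolding g_def by measurable
  have rk: "r k \<ge> k" for k by (simp add: r_def)
  \<comment> \<open>Fatou along the subsequence: letting the second index of the Cauchy estimate
    tend to infinity bounds the distance from \<open>f n\<close> to \<open>g\<close>, and in the end
    shows that \<open>g\<close> is square integrable.\<close>
  have fatou: "(\<integral>\<^sup>+x. ennreal ((f n x - g x)\<^sup>2) \<partial>M) \<le> ennreal (e\<^sup>2)"
    if e: "e > 0" "\<And>m. m \<ge> n \<Longrightarrow> nrm2 M (\<lambda>x. f n x - f m x) \<le> e" for n e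
  proof -
    have "(\<integral>\<^sup>+x. ennreal ((f n x - g x)\<^sup>2) \<partial>M) = (\<integral>\<^sup>+x. liminf (\<lambda>k. ennreal ((f n x - f (r k) x)\<^sup>2)) \<partial>M)"
    proof (rule nn_integral_cong_AE)
      show "AE x in M. ennreal ((f n x - g x)\<^sup>2) = liminf (\<lambda>k. ennreal ((f n x - f (r k) x)\<^sup>2))"
        using conv
      proof eventually_elim
        case (elim x)
        then have "(\<lambda>k. ennreal ((f n x - f (r k) x)\<^sup>2)) \<longlonglongrightarrow> ennreal ((f n x - g x)\<^sup>2)"
          unfolding g_def by (intro tendsto_ennrealI tendsto_intros)
        then show ?case by (metis lim_imp_Liminf trivial_limit_sequentially)
      qed
    qed
    also have "\<dots> \<le> liminf (\<lambda>k. \<integral>\<^sup>+x. ennreal ((f n x - f (r k) x)\<^sup>2) \<partial>M)"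
      by (rule nn_integral_liminf) measurable
    also have "\<dots> \<le> ennreal (e\<^sup>2)"
    proof (rule Liminf_le)
      show "\<forall>\<^sub>F k in sequentially. (\<integral>\<^sup>+x. ennreal ((f n x - f (r k) x)\<^sup>2) \<partial>M) \<le> ennreal (e\<^sup>2)"
        using eventually_ge_at_top[of n]
      proof eventually_elim
        case (elim k)
        have "(\<integral>\<^sup>+x. ennreal ((f n x - f (r k) x)\<^sup>2) \<partial>M) = ennreal (\<integral>x. (f n x - f (r k) x)\<^sup>2 \<partial>M)"
          by (intro nn_integral_eq_integral sq_integrable_square sq_integrable_diff sq) auto
        also have "\<dots> \<le> ennreal (e\<^sup>2)"
          using e(2)[of "r k"] rk[of k] elim by (intro ennreal_leI) (auto simp: nrm2_square[symmetric] intro!: power_mono)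
        finally show ?case .
      qed
    qed simp
    finally show ?thesis .
  qed
  have sqd: "sq_integrable M (\<lambda>x. f n x - g x) \<and> nrm2 M (\<lambda>x. f n x - g x) \<le> e"
    if e: "e > 0" "\<And>m. m \<ge> n \<Longrightarrow> nrm2 M (\<lambda>x. f n x - f m x) \<le> e" for n e
  proof -
    have "integrable M (\<lambda>x. (f n x - g x)\<^sup>2)"
      using fatou[OF e] by (intro integrableI_bounded) (auto simp: top_unique less_top[symmetric])
    then have s: "sq_integrable M (\<lambda>x. f n x - g x)" by (simp add: sq_integrable_def)
    have "ennreal (\<integral>x. (f n x - g x)\<^sup>2 \<partial>M) \<le> ennreal (e\<^sup>2)"
      using fatou[OF e] s by (subst nn_integral_eq_integral[symmetric]) (auto simp: sq_integrable_def)
    then have "(\<integral>x. (f n x - g x)\<^sup>2 \<partial>M) \<le> e\<^sup>2" by (simp add: ennreal_le_iff)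
    then have "nrm2 M (\<lambda>x. f n x - g x) \<le> e"
      using e(1) by (simp add: nrm2_def real_le_lsqrt)
    with s show ?thesis by simp
  qed
  have small: "\<exists>n0. \<forall>n\<ge>n0. sq_integrable M (\<lambda>x. f n x - g x) \<and> nrm2 M (\<lambda>x. f n x - g x) \<le> e" if e0: "e > 0" for e
  proof -
    obtain N where "\<forall>m\<ge>N. \<forall>n\<ge>N. nrm2 M (\<lambda>x. f m x - f n x) < e" using cau[OF e0] by blast
    then show ?thesis using sqd[OF e0] by (meson less_imp_le order_trans)
  qed
  then obtain n0 where "sq_integrable M (\<lambda>x. f n0 x - g x)" by (metis zero_less_one order_refl)
  from sq_integrable_diff[OF sq[of n0] this] have g: "sq_integrable M g" by simp
  have "(\<lambda>n. nrm2 M (\<lambda>x. f n x - g x)) \<longlonglongrightarrow> 0"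
  proof (rule LIMSEQ_I)
    fix e :: real assume "e > 0"
    then obtain n0 where "\<forall>n\<ge>n0. nrm2 M (\<lambda>x. f n x - g x) \<le> e / 2" using small[of "e/2"] by auto
    with \<open>e > 0\<close> show "\<exists>no. \<forall>n\<ge>no. norm (nrm2 M (\<lambda>x. f n x - g x) - 0) < e"
      by (intro exI[of _ n0]) (auto intro: le_less_trans)
  qed
  then show ?thesis using g sq by (auto simp: L2_lim_def)
qed

section \<open>Functions of compact support and integrals of derivatives\<close>

lemma continuous_compact_support_bounded:
  fixes f :: "'a::euclidean_space \<Rightarrow> real"
  assumes "continuous_on UNIV f" "compact K" "\<And>x. x \<notin> K \<Longrightarrow> f x = 0"
  obtains B where "B > 0" "\<And>x. \<bar>f x\<bar> \<le> B"
proof -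
  have "compact (f ` K)" using assms by (intro compact_continuous_image continuous_on_subset[OF assms(1)]) auto
  then have "bounded (f ` K)" by (rule compact_imp_bounded)
  then obtain b where b: "b > 0" "\<And>y. y \<in> f ` K \<Longrightarrow> norm y \<le> b" using bounded_pos by metis
  have "\<bar>f x\<bar> \<le> b" for x using assms(3)[of x] b by (cases "x \<in> K") auto
  then show ?thesis using that b(1) by blast
qed

lemma continuous_compact_support_integrable:
  fixes f :: "'a::euclidean_space \<Rightarrow> real"
  assumes "continuous_on UNIV f" "compact K" "\<And>x. x \<notin> K \<Longrightarrow> f x = 0"
  shows "integrable lborel f" "integrable lebesgue f" "integral\<^sup>L lebesgue f = integral\<^sup>L lborel f"
proof -
  have "integrable lborel (\<lambda>x. indicator K x *\<^sub>R f x)"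
    using assms by (intro borel_integrable_compact continuous_on_subset[OF assms(1)]) auto
  moreover have "(\<lambda>x. indicator K x *\<^sub>R f x) = f"
    using assms(3) by (intro ext) (auto simp: indicator_def)
  ultimately show *: "integrable lborel f" by simp
  have m: "f \<in> borel_measurable lborel" using * by auto
  show "integrable lebesgue f" using * integrable_completion[OF m] by simp
  show "integral\<^sup>L lebesgue f = integral\<^sup>L lborel f" using integral_completion[OF m] by simp
qed

lemma lborel_integral_translation:
  fixes f :: "'a::euclidean_space \<Rightarrow> real"
  assumes "f \<in> borel_measurable borel"
  shows "(\<integral>x. f (c + x) \<partial>lborel) = (\<integral>x. f x \<partial>lborel)"
proof -
  have "(\<integral>x. f x \<partial>lborel) = (\<integral>x. f x \<partial>distr lborel borel ((+) c))" by (simp add: lborel_distr_plus)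
  also have "\<dots> = (\<integral>x. f (c + x) \<partial>lborel)" using assms by (intro integral_distr) auto
  finally show ?thesis by simp
qed

lemma pderiv_eq_0_outside:
  fixes f :: "real^'n::finite \<Rightarrow> real"
  assumes "compact K" "\<And>x. x \<notin> K \<Longrightarrow> f x = 0" "x \<notin> K"
  shows "pderiv_at i f x = 0"
proof (rule pderiv_at_eqI)
  show "(f has_derivative (\<lambda>_. 0)) (at x)"
    by (rule has_derivative_transform_within_open[where s="-K" and f="\<lambda>_. 0"])
      (use assms compact_imp_closed in \<open>auto simp: open_Compl\<close>)
qed

lemma C_k_1_Lipschitz:
  fixes f :: "real^'n::finite \<Rightarrow> real"
  assumes "C_k (Suc 0) f" "\<And>i x. \<bar>pderiv_at i f x\<bar> \<le> B"
  shows "\<bar>f x - f y\<bar> \<le> (real CARD('n) * B) * norm (x - y)"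
proof -
  have "norm (f x - f y) \<le> (real CARD('n) * B) * norm (x - y)"
  proof (rule differentiable_bound[of UNIV f "\<lambda>x h. \<Sum>i\<in>UNIV. h $ i * pderiv_at i f x"])
    show "(f has_derivative (\<lambda>h. \<Sum>i\<in>UNIV. h $ i * pderiv_at i f x)) (at x)" for x
      using assms by (intro has_derivative_pderiv_at) simp
    show "onorm (\<lambda>h. \<Sum>i\<in>UNIV. h $ i * pderiv_at i f x) \<le> real CARD('n) * B" for x
    proof (rule onorm_le)
      fix h :: "real^'n"
      have "\<bar>h $ i * pderiv_at i f x\<bar> \<le> norm h * B" for i
        unfolding abs_mult by (intro mult_mono assms component_le_norm_cart) auto
      then have "\<bar>\<Sum>i\<in>UNIV. h $ i * pderiv_at i f x\<bar> \<le> (\<Sum>i\<in>(UNIV::'n set). norm h * B)"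
        by (intro order_trans[OF sum_abs] sum_mono) auto
      then show "norm (\<Sum>i\<in>UNIV. h $ i * pderiv_at i f x) \<le> real CARD('n) * B * norm h" by (simp add: mult_ac)
    qed
  qed auto
  then show ?thesis by simp
qed

lemma pderiv_compact_support_bounded:
  fixes f :: "real^'n::finite \<Rightarrow> real"
  assumes f: "C_k (Suc 0) f" and K: "compact K" "\<And>x. x \<notin> K \<Longrightarrow> f x = 0"
  obtains B where "\<And>j x. \<bar>pderiv_at j f x\<bar> \<le> B"
proof -
  have cp: "continuous_on UNIV (pderiv_at j f)" for j using f by simp
  have "\<exists>B. B > 0 \<and> (\<forall>x. \<bar>pderiv_at j f x\<bar> \<le> B)" for j
    using continuous_compact_support_bounded[OF cp K(1) pderiv_eq_0_outside[OF K]] by metis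
  then obtain b where b: "\<And>j. b j > 0" "\<And>j x. \<bar>pderiv_at j f x\<bar> \<le> b j" by metis
  have "b j \<le> (\<Sum>j\<in>UNIV. b j)" for j using b(1) by (intro member_le_sum) (auto simp: less_imp_le)
  then show ?thesis using that b(2) order_trans by blast
qed

text \<open>By translation invariance every difference quotient has integral zero. The Lipschitz
  bound together with a common bounded support lets the quotients pass to the derivative by
  dominated convergence.\<close>

lemma integral_pderiv_compact_support:
  fixes f :: "real^'n::finite \<Rightarrow> real"
  assumes f: "C_k (Suc 0) f" and K: "compact K" "\<And>x. x \<notin> K \<Longrightarrow> f x = 0"
  shows "(\<integral>x. pderiv_at i f x \<partial>lborel) = 0"
proof -
  have cf: "continuous_on UNIV f" and cp: "continuous_on UNIV (pderiv_at j f)" for j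
    using f C_k_continuous[OF f] by auto
  obtain B where Bb: "\<And>j x. \<bar>pderiv_at j f x\<bar> \<le> B"
    by (rule pderiv_compact_support_bounded[OF f K(1)], erule K(2)) (rule that; assumption)
  define L where "L = real CARD('n) * B"
  have L: "\<bar>f x - f y\<bar> \<le> L * norm (x - y)" for x y
    unfolding L_def by (rule C_k_1_Lipschitz[OF f Bb])
  define t where "t n = inverse (real (Suc n))" for n
  have t0: "t n > 0" "t n \<le> 1" for n by (auto simp: t_def field_simps)
  have tl: "t \<longlonglongrightarrow> 0" unfolding t_def by (rule LIMSEQ_inverse_real_of_nat)
  define D where "D n x = (f (t n *\<^sub>R axis i 1 + x) - f x) / t n" for n x
  obtain R where "\<forall>x\<in>K. norm x \<le> R" using compact_imp_bounded[OF K(1)] by (auto simp: bounded_iff)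
  then have R: "K \<subseteq> cball 0 R" by auto
  have fint: "integrable lborel f" using continuous_compact_support_integrable[OF cf K] by simp
  have mf[measurable]: "f \<in> borel_measurable borel" using cf by (rule borel_measurable_continuous_onI)
  have mp[measurable]: "pderiv_at i f \<in> borel_measurable borel" using cp by (rule borel_measurable_continuous_onI)
  have fint2: "integrable lborel (\<lambda>x. f (c + x))" for c
  proof (rule continuous_compact_support_integrable(1))
    show "continuous_on UNIV (\<lambda>x. f (c + x))" by (intro continuous_on_compose2[OF cf] continuous_intros) auto
    show "compact ((\<lambda>x. x - c) ` K)" using K(1) by (intro compact_continuous_image continuous_intros)
    show "f (c + x) = 0" if "x \<notin> (\<lambda>x. x - c) ` K" for x
      using that K(2)[of "c + x"] by (metis (no_types, lifting) add_diff_cancel_left' image_eqI)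
  qed
  have "(\<lambda>n. \<integral>x. D n x \<partial>lborel) \<longlonglongrightarrow> (\<integral>x. pderiv_at i f x \<partial>lborel)"
  \<comment> \<open>The steps \<open>t n\<close> are at most one, so all quotients vanish outside
    the ball of radius \<open>R + 1\<close>.\<close>
  proof (rule integral_dominated_convergence[where w="\<lambda>x. L * indicator (cball (0::real^'n) (R + 1)) x"])
    show "integrable lborel (\<lambda>x. L * indicator (cball (0::real^'n) (R + 1)) x)"
      using emeasure_lborel_cball_finite[of "0::real^'n" "R+1"] by (auto intro!: integrable_mult_right integrable_real_indicator)
    show "AE x in lborel. (\<lambda>n. D n x) \<longlonglongrightarrow> pderiv_at i f x"
    proof (rule AE_I2)
      fix x :: "real^'n"
      have "((\<lambda>s. f (x + s *\<^sub>R axis i 1)) has_real_derivative pderiv_at i f (x + 0 *\<^sub>R axis i 1)) (at 0)"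
        using f by (intro C_k_line_DERIV) simp
      then have "((\<lambda>h. (f (x + h *\<^sub>R axis i 1) - f x) / h) \<longlongrightarrow> pderiv_at i f x) (at 0)"
        by (simp add: DERIV_def)
      moreover have "filterlim t (at 0) sequentially"
        using tl t0(1) by (auto simp: filterlim_at less_imp_neq[symmetric] intro!: always_eventually)
      ultimately show "(\<lambda>n. D n x) \<longlonglongrightarrow> pderiv_at i f x"
        unfolding D_def by (rule filterlim_compose[of "\<lambda>h. (f (x + h *\<^sub>R axis i 1) - f x) / h", THEN tendsto_cong[THEN iffD1, rotated]]) (simp add: add.commute)
    qed
    show "AE x in lborel. norm (D n x) \<le> L * indicator (cball (0::real^'n) (R + 1)) x" for n
    proof (rule AE_I2)
      fix x :: "real^'n"
      show "norm (D n x) \<le> L * indicator (cball (0::real^'n) (R + 1)) x"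
      proof (cases "x \<in> cball 0 (R + 1)")
        case True
        have "\<bar>f (t n *\<^sub>R axis i 1 + x) - f x\<bar> \<le> L * t n"
          using L[of "t n *\<^sub>R axis i 1 + x" x] t0(1)[of n] by simp
        then show ?thesis using True t0(1)[of n] by (simp add: D_def field_simps)
      next
        case False
        have "norm x \<le> norm (t n *\<^sub>R axis i 1 + x) + t n"
          using norm_triangle_ineq4[of "t n *\<^sub>R axis i 1 + x" "t n *\<^sub>R axis i (1::real)"] t0(1)[of n] by simp
        then have "t n *\<^sub>R axis i 1 + x \<notin> cball 0 R" "x \<notin> cball 0 R" using False t0(2)[of n] by auto
        then have "f (t n *\<^sub>R axis i 1 + x) = 0" "f x = 0" using K(2) R by blast+
        then show ?thesis using False by (simp add: D_def)
      qed
    qed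
    show "D n \<in> borel_measurable lborel" for n unfolding D_def by measurable
    show "pderiv_at i f \<in> borel_measurable lborel" by simp
  qed
  moreover have "(\<integral>x. D n x \<partial>lborel) = 0" for n
    unfolding D_def using fint fint2 lborel_integral_translation[OF mf] by simp
  ultimately show ?thesis by (simp add: LIMSEQ_const_iff)
qed

section \<open>Mollification\<close>

text \<open>The standard kernel, rotationally symmetric and positive exactly on the open ball of
  radius \<open>1 / Suc n\<close>; the successor gives a radius for \<open>n = 0\<close> as
  well.\<close>

definition bump :: "nat \<Rightarrow> real^'n::finite \<Rightarrow> real" where
  "bump n x = flat_exp 0 (1 - (real (Suc n))\<^sup>2 * (\<Sum>i\<in>UNIV. (x $ i)\<^sup>2))"

definition mollifier :: "nat \<Rightarrow> real^'n::finite \<Rightarrow> real" where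
  "mollifier n x = bump n x / (\<integral>y. bump n y \<partial>(lborel :: (real^'n) measure))"

lemma sum_square_norm: "(\<Sum>i\<in>UNIV. (x $ i)\<^sup>2) = (norm (x :: real^'n::finite))\<^sup>2"
  by (simp add: norm_vec_def L2_set_def sum_nonneg)

lemma C_k_bump: "C_k k (bump n)"
  unfolding bump_def[abs_def] by (intro C_k_flat_exp C_k_diff C_k_cmult C_k_sum C_k_power C_k_const C_k_nth)

lemma bump_nonneg: "0 \<le> bump n x"
  by (simp add: bump_def flat_exp_def)

lemma bump_eq_0_iff: "bump n x = 0 \<longleftrightarrow> norm x \<ge> 1 / real (Suc n)"
proof -
  have "bump n x = 0 \<longleftrightarrow> 1 \<le> (real (Suc n) * norm x)\<^sup>2"
    by (auto simp: bump_def flat_exp_def sum_square_norm power_mult_distrib not_less simp del: of_nat_Suc)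
  also have "\<dots> \<longleftrightarrow> 1 \<le> real (Suc n) * norm x"
    by (metis abs_le_square_iff abs_of_nonneg mult_nonneg_nonneg norm_ge_zero of_nat_0_le_iff one_power2 abs_one)
  finally show ?thesis by (simp add: field_simps)
qed

lemma bump_outside: "x \<notin> cball 0 (1 / real (Suc n)) \<Longrightarrow> bump n x = 0"
  by (simp add: bump_eq_0_iff)

lemma bump_integrable: "integrable lborel (bump n)"
  by (rule continuous_compact_support_integrable(1)[OF C_k_continuous[OF C_k_bump] compact_cball bump_outside])

lemma bump_integral_pos: "(\<integral>y. bump n y \<partial>(lborel :: (real^'n::finite) measure)) > 0"
proof -
  have "\<not> (AE y in (lborel :: (real^'n) measure). bump n y = 0)"
  proof
    assume "AE y in (lborel :: (real^'n) measure). bump n y = 0"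
    then have "AE y in (lborel :: (real^'n) measure). y \<notin> ball 0 (1 / real (Suc n))"
      by (auto simp: bump_eq_0_iff)
    then have "ball (0::real^'n) (1 / real (Suc n)) \<in> null_sets lborel"
      by (intro AE_iff_null_sets[THEN iffD2]) auto
    then have "negligible (ball (0::real^'n) (1 / real (Suc n)))"
      by (auto simp: negligible_iff_null_sets null_sets_completion_iff)
    moreover have "\<not> negligible (ball (0::real^'n) (1 / real (Suc n)))"
      by (rule open_not_negligible) auto
    ultimately show False by simp
  qed
  moreover have "(\<integral>y. bump n y \<partial>(lborel :: (real^'n) measure)) \<ge> 0"
    by (intro integral_nonneg_AE AE_I2 bump_nonneg)
  ultimately show ?thesis
    using integral_nonneg_eq_0_iff_AE[OF bump_integrable, of n] bump_nonneg by (smt (verit) AE_I2)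
qed

lemma C_k_mollifier: "C_k k (mollifier n :: real^'n::finite \<Rightarrow> real)"
  unfolding mollifier_def[abs_def]
  by (intro C_k_divide C_k_bump C_k_const) (use bump_integral_pos[where 'n='n, of n] in linarith)

lemma mollifier_nonneg: "0 \<le> mollifier n x"
  unfolding mollifier_def by (intro divide_nonneg_nonneg bump_nonneg less_imp_le[OF bump_integral_pos])

lemma mollifier_outside: "1 / real (Suc n) \<le> norm x \<Longrightarrow> mollifier n x = 0"
  unfolding mollifier_def using bump_eq_0_iff[of n x] by simp

lemma mollifier_integrable: "integrable lborel (mollifier n)"
  unfolding mollifier_def[abs_def] by (intro integrable_divide bump_integrable)

lemma mollifier_integral: "(\<integral>y. mollifier n y \<partial>(lborel :: (real^'n::finite) measure)) = 1"
  unfolding mollifier_def[abs_def] using bump_integral_pos[where 'n='n, of n] by simp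

section \<open>Integration over a bounded open set\<close>

locale bounded_open =
  fixes \<Omega> :: "(real^'n::finite) set"
  assumes open_domain: "open \<Omega>" and bounded_domain: "bounded \<Omega>"
begin

abbreviation M where "M \<equiv> lebesgue_on \<Omega>"

lemma domain_sets [simp]: "\<Omega> \<in> sets lebesgue"
  using open_domain by (simp add: lmeasurable_open bounded_domain fmeasurableD)

lemma domain_lmeasurable: "\<Omega> \<in> lmeasurable"
  using open_domain bounded_domain by (simp add: lmeasurable_open)

sublocale fm: finite_measure M
  using domain_lmeasurable by (rule finite_measure_lebesgue_on)

lemma continuous_measurable: "continuous_on UNIV f \<Longrightarrow> f \<in> borel_measurable M"
  for f :: "real^'n \<Rightarrow> real"
  by (intro continuous_imp_measurable_on_sets_lebesgue domain_sets) (auto intro: continuous_on_subset)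

lemma continuous_bounded:
  fixes f :: "real^'n \<Rightarrow> real"
  assumes "continuous_on UNIV f"
  obtains B where "B > 0" "\<And>x. x \<in> closure \<Omega> \<Longrightarrow> \<bar>f x\<bar> \<le> B"
proof -
  have "compact (f ` closure \<Omega>)"
    using bounded_domain by (intro compact_continuous_image continuous_on_subset[OF assms]) auto
  then obtain b where "b > 0" "\<And>y. y \<in> f ` closure \<Omega> \<Longrightarrow> norm y \<le> b"
    using compact_imp_bounded bounded_pos by metis
  then show ?thesis using that by auto
qed

lemma continuous_sq_integrable:
  fixes f :: "real^'n \<Rightarrow> real"
  assumes "continuous_on UNIV f" shows "sq_integrable M f"
proof -
  obtain B where "\<And>x. x \<in> closure \<Omega> \<Longrightarrow> \<bar>f x\<bar> \<le> B" using continuous_bounded[OF assms] by blast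
  then show ?thesis
    by (intro fm.sq_integrable_bounded[where B=B] continuous_measurable assms) (auto simp: closure_subset[THEN subsetD])
qed

lemma continuous_mult_sq_integrable:
  fixes f :: "real^'n \<Rightarrow> real"
  assumes "continuous_on UNIV a" "sq_integrable M f" shows "sq_integrable M (\<lambda>x. a x * f x)"
proof -
  obtain B where "\<And>x. x \<in> closure \<Omega> \<Longrightarrow> \<bar>a x\<bar> \<le> B" using continuous_bounded[OF assms(1)] by blast
  then show ?thesis
    by (intro sq_integrable_bdd_mult[where B=B] continuous_measurable assms) (auto simp: closure_subset[THEN subsetD])
qed

lemma continuous_mult_integrable:
  fixes h :: "real^'n \<Rightarrow> real"
  assumes "continuous_on UNIV a" "integrable M h" shows "integrable M (\<lambda>x. a x * h x)"
proof -
  obtain B where B: "\<And>x. x \<in> closure \<Omega> \<Longrightarrow> \<bar>a x\<bar> \<le> B" using continuous_bounded[OF assms(1)] by blast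
  have B: "\<bar>a x\<bar> \<le> B" if "x \<in> \<Omega>" for x using B that closure_subset by blast
  show ?thesis
  proof (rule Bochner_Integration.integrable_bound)
    show "integrable M (\<lambda>x. B * h x)" using assms by simp
    show "(\<lambda>x. a x * h x) \<in> borel_measurable M"
      using assms continuous_measurable by (intro borel_measurable_times) auto
    show "AE x in M. norm (a x * h x) \<le> norm (B * h x)"
    proof (rule AE_I2)
      fix x assume "x \<in> space M"
      then have "\<bar>a x\<bar> \<le> \<bar>B\<bar>" using B[of x] by simp
      then show "norm (a x * h x) \<le> norm (B * h x)" by (simp add: abs_mult mult_right_mono)
    qed
  qed
qed

lemma continuous_mult_L2_lim:
  assumes "continuous_on UNIV a" "L2_lim M f F" shows "L2_lim M (\<lambda>n x. a x * f n x) (\<lambda>x. a x * F x)"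
proof -
  obtain B where "\<And>x. x \<in> closure \<Omega> \<Longrightarrow> \<bar>a x\<bar> \<le> B" using continuous_bounded[OF assms(1)] by blast
  then show ?thesis
    by (intro L2_lim_bdd_mult[where B=B] continuous_measurable assms) (auto simp: closure_subset[THEN subsetD])
qed

text \<open>A bridge to \<open>lborel\<close>, where translation invariance and the vanishing of
  integrals of derivatives are stated.\<close>

lemma integral_eq_lborel:
  fixes f :: "real^'n \<Rightarrow> real"
  assumes "continuous_on UNIV f" "\<And>x. x \<notin> \<Omega> \<Longrightarrow> f x = 0"
  shows "(\<integral>x. f x \<partial>M) = (\<integral>x. f x \<partial>lborel)"
proof -
  have "(\<integral>x. f x \<partial>M) = (\<integral>x. indicator \<Omega> x *\<^sub>R f x \<partial>lebesgue)"
    by (rule integral_restrict_space) simp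
  also have "(\<lambda>x. indicator \<Omega> x *\<^sub>R f x) = f" using assms(2) by (intro ext) (auto simp: indicator_def)
  also have "(\<integral>x. f x \<partial>lebesgue) = (\<integral>x. f x \<partial>lborel)"
  proof (rule continuous_compact_support_integrable(3)[where K="closure \<Omega>"])
    show "f x = 0" if "x \<notin> closure \<Omega>" for x using that closure_subset assms(2) by blast
  qed (use bounded_domain assms in auto)
  finally show ?thesis by simp
qed

section \<open>Convolution and mollification on the domain\<close>

text \<open>The integral runs over the domain only, so \<open>f\<close> is in effect extended by
  zero. Derivatives can be put on \<open>g\<close> everywhere, but moved to \<open>f\<close> only
  where the support of the kernel stays inside the domain.\<close>

definition conv :: "(real^'n \<Rightarrow> real) \<Rightarrow> (real^'n \<Rightarrow> real) \<Rightarrow> real^'n \<Rightarrow> real" where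
  "conv f g x = (\<integral>y. f y * g (x - y) \<partial>M)"

lemma continuous_reflect: "continuous_on UNIV g \<Longrightarrow> continuous_on UNIV (\<lambda>y. g (x - y))"
  for g :: "real^'n \<Rightarrow> real"
  by (rule continuous_on_compose2[of UNIV g]) (auto intro!: continuous_intros)

lemma conv_integrable:
  fixes f g :: "real^'n \<Rightarrow> real"
  assumes "integrable M f" "continuous_on UNIV g"
  shows "integrable M (\<lambda>y. f y * g (x - y))"
  using continuous_mult_integrable[OF continuous_reflect[OF assms(2)] assms(1)] by (simp add: mult.commute)

lemma conv_continuous:
  assumes f: "integrable M f" and g: "continuous_on UNIV g" and K: "compact K" "\<And>x. x \<notin> K \<Longrightarrow> g x = 0"
  shows "continuous_on UNIV (conv f g)"
  unfolding continuous_on_sequentially comp_def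
proof (intro allI ballI impI)
  fix X :: "nat \<Rightarrow> real^'n" and x assume X: "(\<forall>n. X n \<in> UNIV) \<and> X \<longlonglongrightarrow> x"
  obtain B where B: "\<And>x. \<bar>g x\<bar> \<le> B" using continuous_compact_support_bounded[OF g K] by metis
  have [measurable]: "f \<in> borel_measurable M" using f by auto
  have gm [measurable]: "(\<lambda>y. g (x - y)) \<in> borel_measurable M" for x
    by (intro continuous_measurable continuous_reflect g)
  show "(\<lambda>n. conv f g (X n)) \<longlonglongrightarrow> conv f g x"
    unfolding conv_def
  proof (rule integral_dominated_convergence[where w="\<lambda>y. B * \<bar>f y\<bar>"])
    show "integrable M (\<lambda>y. B * \<bar>f y\<bar>)" using f by auto
    show "AE y in M. (\<lambda>n. f y * g (X n - y)) \<longlonglongrightarrow> f y * g (x - y)"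
    proof (rule AE_I2)
      fix y
      have "isCont g (x - y)" using g by (simp add: continuous_on_eq_continuous_at)
      then have "(\<lambda>n. g (X n - y)) \<longlonglongrightarrow> g (x - y)"
        using X by (intro isCont_tendsto_compose[where g=g]) (auto intro!: tendsto_intros)
      then show "(\<lambda>n. f y * g (X n - y)) \<longlonglongrightarrow> f y * g (x - y)" by (intro tendsto_intros)
    qed
    show "AE y in M. norm (f y * g (X n - y)) \<le> B * \<bar>f y\<bar>" for n
      using B by (intro AE_I2) (simp add: abs_mult mult.commute[of "\<bar>f _\<bar>"] mult_right_mono)
  qed measurable
qed

text \<open>Differentiation under the integral, carried out for the total derivative because
  \<open>C_k\<close> asks for total differentiability. The remainder quotient \<open>R\<close> is
  bounded by \<open>2 * L\<close>, which provides the dominating function.\<close>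

lemma conv_has_derivative:
  assumes f: "integrable M f" and g: "C_k (Suc 0) g" and K: "compact K" "\<And>x. x \<notin> K \<Longrightarrow> g x = 0"
  shows "(conv f g has_derivative (\<lambda>h. \<Sum>i\<in>UNIV. h $ i * conv f (pderiv_at i g) x)) (at x)"
proof -
  have cp: "continuous_on UNIV (pderiv_at j g)" for j using g by auto
  have cg: "continuous_on UNIV g" using g by (rule C_k_continuous)
  obtain B where Bb: "\<And>j x. \<bar>pderiv_at j g x\<bar> \<le> B"
    by (rule pderiv_compact_support_bounded[OF g K(1)], erule K(2)) (rule that; assumption)
  define L where "L = real CARD('n) * B"
  have L: "\<bar>g x - g y\<bar> \<le> L * norm (x - y)" for x y
    unfolding L_def by (rule C_k_1_Lipschitz[OF g Bb])
  define Dg where "Dg h z = (\<Sum>i\<in>UNIV. h $ i * pderiv_at i g z)" for h z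
  have Dg: "\<bar>Dg h z\<bar> \<le> L * norm h" for h z
  proof -
    have "\<bar>h $ i * pderiv_at i g z\<bar> \<le> norm h * B" for i
      unfolding abs_mult by (intro mult_mono Bb component_le_norm_cart) auto
    then have "\<bar>Dg h z\<bar> \<le> (\<Sum>i\<in>(UNIV::'n set). norm h * B)"
      unfolding Dg_def by (intro order_trans[OF sum_abs] sum_mono) auto
    then show ?thesis by (simp add: L_def mult_ac)
  qed
  have [measurable]: "f \<in> borel_measurable M" using f by auto
  have [measurable]: "(\<lambda>y. g (z - y)) \<in> borel_measurable M" "(\<lambda>y. pderiv_at i g (z - y)) \<in> borel_measurable M" for z i
    by (intro continuous_measurable continuous_reflect cg cp)+
  define R where "R X y = (g (X - y) - g (x - y) - Dg (X - x) (x - y)) / norm (X - x)" for X y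
  have [measurable]: "R X \<in> borel_measurable M" for X unfolding R_def Dg_def by measurable
  have eq: "(conv f g X - conv f g x - (\<Sum>i\<in>UNIV. (X - x) $ i * conv f (pderiv_at i g) x)) / norm (X - x)
      = (\<integral>y. f y * R X y \<partial>M)" for X
  proof -
    have i1: "integrable M (\<lambda>y. f y * g (z - y))" for z by (rule conv_integrable[OF f cg])
    have i2: "integrable M (\<lambda>y. f y * pderiv_at i g (x - y))" for i by (rule conv_integrable[OF f cp])
    have i3: "integrable M (\<lambda>y. \<Sum>i\<in>UNIV. (X - x) $ i * (f y * pderiv_at i g (x - y)))"
      by (intro Bochner_Integration.integrable_sum integrable_mult_right i2)
    have "(\<integral>y. f y * R X y \<partial>M) = (\<integral>y. (f y * g (X - y) - f y * g (x - y) - (\<Sum>i\<in>UNIV. (X - x) $ i * (f y * pderiv_at i g (x - y)))) / norm (X - x) \<partial>M)"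
      by (intro Bochner_Integration.integral_cong) (auto simp: R_def Dg_def algebra_simps sum_distrib_left diff_divide_distrib)
    also have "\<dots> = (conv f g X - conv f g x - (\<integral>y. (\<Sum>i\<in>UNIV. (X - x) $ i * (f y * pderiv_at i g (x - y))) \<partial>M)) / norm (X - x)"
      using i1 i3 unfolding conv_def by simp
    also have "(\<integral>y. (\<Sum>i\<in>UNIV. (X - x) $ i * (f y * pderiv_at i g (x - y))) \<partial>M) = (\<Sum>i\<in>UNIV. (X - x) $ i * conv f (pderiv_at i g) x)"
      using i2 unfolding conv_def by (subst Bochner_Integration.integral_sum) auto
    finally show ?thesis by simp
  qed
  have "((\<lambda>X. (conv f g X - conv f g x - (\<Sum>i\<in>UNIV. (X - x) $ i * conv f (pderiv_at i g) x)) / norm (X - x)) \<longlongrightarrow> 0) (at x)"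
    unfolding tendsto_at_iff_sequentially comp_def eq
  proof (intro allI impI)
    fix X :: "nat \<Rightarrow> real^'n" assume X: "\<forall>i. X i \<in> UNIV - {x}" "X \<longlonglongrightarrow> x"
    have "(\<lambda>n. \<integral>y. f y * R (X n) y \<partial>M) \<longlonglongrightarrow> (\<integral>y. 0 \<partial>M)"
    proof (rule integral_dominated_convergence[where w="\<lambda>y. \<bar>f y\<bar> * (2 * L)"])
      show "integrable M (\<lambda>y. \<bar>f y\<bar> * (2 * L))" using f by auto
      show "AE y in M. (\<lambda>n. f y * R (X n) y) \<longlonglongrightarrow> 0"
      proof (rule AE_I2)
        fix y
        have "(g has_derivative (\<lambda>h. Dg h (x - y))) (at (x - y))"
          unfolding Dg_def using g by (intro has_derivative_pderiv_at) simp
        then have "((\<lambda>z. (g z - g (x - y) - Dg (z - (x - y)) (x - y)) / norm (z - (x - y))) \<longlongrightarrow> 0) (at (x - y))"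
          unfolding has_derivative_iff_norm by (subst tendsto_norm_zero_iff[symmetric]) simp
        moreover have "(\<lambda>n. X n - y) \<longlonglongrightarrow> x - y" using X by (intro tendsto_intros)
        ultimately have "(\<lambda>n. (g (X n - y) - g (x - y) - Dg (X n - y - (x - y)) (x - y)) / norm (X n - y - (x - y))) \<longlonglongrightarrow> 0"
          unfolding tendsto_at_iff_sequentially comp_def using X(1) by (auto dest!: spec[of _ "\<lambda>n. X n - y"])
        then have "(\<lambda>n. R (X n) y) \<longlonglongrightarrow> 0" unfolding R_def by simp
        then have "(\<lambda>n. f y * R (X n) y) \<longlonglongrightarrow> f y * 0" by (intro tendsto_intros)
        then show "(\<lambda>n. f y * R (X n) y) \<longlonglongrightarrow> 0" by simp
      qed
      show "AE y in M. norm (f y * R (X n) y) \<le> \<bar>f y\<bar> * (2 * L)" for n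
      proof (rule AE_I2)
        fix y
        have n0: "norm (X n - x) > 0" using X(1) by auto
        have "\<bar>g (X n - y) - g (x - y) - Dg (X n - x) (x - y)\<bar> \<le> 2 * L * norm (X n - x)"
          using L[of "X n - y" "x - y"] Dg[of "X n - x" "x - y"] by simp
        then have "\<bar>R (X n) y\<bar> \<le> 2 * L" using n0 by (simp add: R_def field_simps)
        then show "norm (f y * R (X n) y) \<le> \<bar>f y\<bar> * (2 * L)" by (simp add: abs_mult mult_left_mono)
      qed
    qed measurable
    then show "(\<lambda>n. \<integral>y. f y * R (X n) y \<partial>M) \<longlonglongrightarrow> 0" by simp
  qed
  moreover have "bounded_linear (\<lambda>h. \<Sum>i\<in>UNIV. h $ i * conv f (pderiv_at i g) x)"
    by (intro bounded_linear_sum bounded_linear_mult_const bounded_linear_vec_nth)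
  ultimately show ?thesis
    unfolding has_derivative_iff_norm by (subst (asm) tendsto_norm_zero_iff[symmetric]) simp
qed

lemma pderiv_at_conv:
  assumes "integrable M f" "C_k (Suc 0) g" "compact K" "\<And>x. x \<notin> K \<Longrightarrow> g x = 0"
  shows "pderiv_at i (conv f g) x = conv f (pderiv_at i g) x"
proof -
  have "pderiv_at i (conv f g) x = (\<Sum>l\<in>UNIV. axis i 1 $ l * conv f (pderiv_at l g) x)"
    by (rule pderiv_at_eqI[OF conv_has_derivative[OF assms]])
  also have "\<dots> = (\<Sum>l\<in>UNIV. if l = i then conv f (pderiv_at l g) x else 0)"
    by (intro sum.cong) (auto simp: axis_def)
  finally show ?thesis by simp
qed

lemma C_k_conv:
  assumes "integrable M f" "C_k k g" "compact K" "\<And>x. x \<notin> K \<Longrightarrow> g x = 0"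
  shows "C_k k (conv f g)"
  using assms(2,4)
proof (induction k arbitrary: g)
  case 0
  then show ?case using conv_continuous[OF assms(1) _ assms(3)] by simp
next
  case (Suc k)
  have g1: "C_k (Suc 0) g" using Suc.prems(1) by (rule C_k_mono) simp
  have "pderiv_at i (conv f g) = conv f (pderiv_at i g)" for i
    using pderiv_at_conv[OF assms(1) g1 assms(3)] Suc.prems by blast
  moreover have "C_k k (conv f (pderiv_at i g))" for i
    using Suc.prems pderiv_eq_0_outside[OF assms(3), of g] by (intro Suc.IH) auto
  moreover have "conv f g differentiable (at x)" for x
    using conv_has_derivative[OF assms(1) g1 assms(3)] Suc.prems by (auto simp: differentiable_def)
  ultimately show ?case by simp
qed

definition mollify :: "nat \<Rightarrow> (real^'n \<Rightarrow> real) \<Rightarrow> real^'n \<Rightarrow> real" where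
  "mollify n f = conv f (mollifier n)"

lemma mollifier_outside_cball: "x \<notin> cball 0 (1 / real (Suc n)) \<Longrightarrow> mollifier n x = 0"
  by (rule mollifier_outside) simp

lemma C_k_mollify: "sq_integrable M f \<Longrightarrow> C_k k (mollify n f)"
  unfolding mollify_def
  by (rule C_k_conv[OF fm.sq_integrable_integrable C_k_mollifier compact_cball mollifier_outside_cball])

lemma pderiv_at_mollify: "sq_integrable M f \<Longrightarrow> pderiv_at i (mollify n f) x = conv f (pderiv_at i (mollifier n)) x"
  unfolding mollify_def
  by (rule pderiv_at_conv[OF fm.sq_integrable_integrable C_k_mollifier compact_cball mollifier_outside_cball])

lemma mollify_continuous: "sq_integrable M f \<Longrightarrow> continuous_on A (mollify n f)"
  using C_k_continuous[OF C_k_mollify] .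

lemma mollify_sq_integrable: "sq_integrable M f \<Longrightarrow> sq_integrable M (mollify n f)"
  by (rule continuous_sq_integrable) (rule mollify_continuous)

lemma mollify_diff:
  assumes "sq_integrable M f" "sq_integrable M g"
  shows "mollify n (\<lambda>x. f x - g x) x = mollify n f x - mollify n g x"
  unfolding mollify_def conv_def left_diff_distrib
  by (intro Bochner_Integration.integral_diff conv_integrable fm.sq_integrable_integrable assms C_k_continuous[OF C_k_mollifier])

lemma mollifier_reflect_integral:
  "integrable lborel (\<lambda>y. mollifier n (x - y :: real^'n))" "(\<integral>y. mollifier n (x - y :: real^'n) \<partial>lborel) = 1"
proof -
  have "integrable lborel (mollifier n :: real^'n \<Rightarrow> real)" by (rule mollifier_integrable)
  have e: "mollifier n (- y) = mollifier n y" for y :: "real^'n" by (simp add: mollifier_def bump_def)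
  have eq: "mollifier n (x - y) = mollifier n (- x + y)" for y :: "real^'n" using e[of "x - y"] by simp
  show "integrable lborel (\<lambda>y. mollifier n (x - y :: real^'n))"
  proof (rule continuous_compact_support_integrable(1))
    show "continuous_on UNIV (\<lambda>y. mollifier n (x - y))" by (intro continuous_reflect C_k_continuous[OF C_k_mollifier])
    show "compact (cball x (1 / real (Suc n)))" by simp
    show "mollifier n (x - y) = 0" if "y \<notin> cball x (1 / real (Suc n))" for y
      using that by (intro mollifier_outside) (simp add: dist_norm)
  qed
  have "(\<integral>y. mollifier n (x - y :: real^'n) \<partial>lborel) = (\<integral>y. mollifier n (- x + y) \<partial>lborel)"
    unfolding eq ..
  also have "\<dots> = 1"
    by (subst lborel_integral_translation) (auto intro!: borel_measurable_continuous_onI C_k_continuous[OF C_k_mollifier] simp: mollifier_integral)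
  finally show "(\<integral>y. mollifier n (x - y :: real^'n) \<partial>lborel) = 1" .
qed

lemma mollifier_M_integral_le:
  "(\<integral>y. mollifier n (x - y) \<partial>M) \<le> 1" "(\<integral>y. mollifier n (y - x) \<partial>M) \<le> 1"
proof -
  have m: "(\<lambda>y. mollifier n (x - y)) \<in> borel_measurable lborel"
    using mollifier_reflect_integral(1) by auto
  have "(\<integral>y. mollifier n (x - y) \<partial>M) = (\<integral>y. indicator \<Omega> y *\<^sub>R mollifier n (x - y) \<partial>lebesgue)"
    by (rule integral_restrict_space) simp
  also have "\<dots> \<le> (\<integral>y. mollifier n (x - y) \<partial>lebesgue)"
  proof (rule integral_mono_AE')
    show "integrable lebesgue (\<lambda>y. mollifier n (x - y))"
      using mollifier_reflect_integral(1) integrable_completion[OF m] by simp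
  qed (auto simp: mollifier_nonneg indicator_def)
  also have "\<dots> = 1" using integral_completion[OF m] mollifier_reflect_integral(2) by simp
  finally show *: "(\<integral>y. mollifier n (x - y) \<partial>M) \<le> 1" .
  have "mollifier n (y - x) = mollifier n (x - y)" for y :: "real^'n"
    by (simp add: mollifier_def bump_def power2_commute)
  then show "(\<integral>y. mollifier n (y - x) \<partial>M) \<le> 1" using * by simp
qed

text \<open>Jensen's inequality for a kernel of mass at most one: the kernel is split as the square
  of its root \<open>s\<close>, and Cauchy-Schwarz is applied to \<open>s * f\<close> and
  \<open>s\<close>.\<close>

lemma mollify_square_le:
  assumes f: "sq_integrable M f"
  shows "(mollify n f x)\<^sup>2 \<le> (\<integral>y. (f y)\<^sup>2 * mollifier n (x - y) \<partial>M)"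
proof -
  define s where "s y = sqrt (mollifier n (x - y))" for y
  have s0: "s y \<ge> 0" "(s y)\<^sup>2 = mollifier n (x - y)" for y by (auto simp: s_def mollifier_nonneg)
  have cs: "continuous_on UNIV s" unfolding s_def
    by (intro continuous_on_real_sqrt continuous_reflect C_k_continuous[OF C_k_mollifier])
  have sq: "sq_integrable M s" "sq_integrable M (\<lambda>y. s y * f y)"
    using cs f by (auto intro: continuous_sq_integrable continuous_mult_sq_integrable)
  have "mollify n f x = (\<integral>y. (s y * f y) * s y \<partial>M)"
    unfolding mollify_def conv_def s0(2)[symmetric] by (simp add: power2_eq_square mult_ac)
  then have "\<bar>mollify n f x\<bar> \<le> nrm2 M (\<lambda>y. s y * f y) * nrm2 M s"
    using Cauchy_Schwarz_integral[OF sq(2,1)] by simp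
  also have "\<dots> \<le> nrm2 M (\<lambda>y. s y * f y) * 1"
    using mollifier_M_integral_le(1)[of n x] by (intro mult_left_mono) (auto simp: nrm2_def s0)
  finally have "(mollify n f x)\<^sup>2 \<le> (nrm2 M (\<lambda>y. s y * f y))\<^sup>2"
    using abs_le_square_iff by fastforce
  also have "\<dots> = (\<integral>y. (f y)\<^sup>2 * mollifier n (x - y) \<partial>M)"
    by (simp add: nrm2_square power_mult_distrib s0 mult.commute)
  finally show ?thesis .
qed

text \<open>The pointwise Jensen bound is integrated in \<open>x\<close> and the order of
  integration exchanged; the kernel has mass at most one in either variable. Nonnegative integrals
  are used so that Tonelli applies directly.\<close>

lemma nrm2_mollify_le:
  assumes f: "sq_integrable M f"
  shows "nrm2 M (mollify n f) \<le> nrm2 M f"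
proof -
  interpret pair_sigma_finite M M ..
  have [measurable]: "f \<in> borel_measurable M" using f by (simp add: sq_integrable_def)
  have idm: "(\<lambda>x. x) \<in> M \<rightarrow>\<^sub>M (borel :: (real^'n) measure)"
    by (intro continuous_imp_measurable_on_sets_lebesgue domain_sets continuous_intros)
  have [measurable]: "mollifier n \<in> borel_measurable (borel :: (real^'n) measure)"
    by (intro borel_measurable_continuous_onI C_k_continuous[OF C_k_mollifier])
  have dm: "(\<lambda>z. fst z - snd z :: real^'n) \<in> borel_measurable (M \<Otimes>\<^sub>M M)"
    using measurable_compose[OF measurable_fst idm] measurable_compose[OF measurable_snd idm]
    by (intro borel_measurable_diff) auto
  have "(\<lambda>z. mollifier n (fst z - snd z)) \<in> borel_measurable (M \<Otimes>\<^sub>M M)"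
    using measurable_compose[OF dm, of "mollifier n" borel] by simp
  then have m: "(\<lambda>(x, y). ennreal ((f y)\<^sup>2 * mollifier n (x - y))) \<in> borel_measurable (M \<Otimes>\<^sub>M M)"
    by (simp add: case_prod_beta')
  have "(\<integral>\<^sup>+x. ennreal ((mollify n f x)\<^sup>2) \<partial>M) \<le> (\<integral>\<^sup>+x. \<integral>\<^sup>+y. ennreal ((f y)\<^sup>2 * mollifier n (x - y)) \<partial>M \<partial>M)"
  proof (rule nn_integral_mono)
    fix x
    have "ennreal ((mollify n f x)\<^sup>2) \<le> ennreal (\<integral>y. (f y)\<^sup>2 * mollifier n (x - y) \<partial>M)"
      by (intro ennreal_leI mollify_square_le f)
    also have "\<dots> = (\<integral>\<^sup>+y. ennreal ((f y)\<^sup>2 * mollifier n (x - y)) \<partial>M)"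
      using f by (intro nn_integral_eq_integral[symmetric] conv_integrable C_k_continuous[OF C_k_mollifier] AE_I2)
        (auto simp: sq_integrable_def mollifier_nonneg)
    finally show "ennreal ((mollify n f x)\<^sup>2) \<le> (\<integral>\<^sup>+y. ennreal ((f y)\<^sup>2 * mollifier n (x - y)) \<partial>M)" .
  qed
  also have "\<dots> = (\<integral>\<^sup>+y. \<integral>\<^sup>+x. ennreal ((f y)\<^sup>2 * mollifier n (x - y)) \<partial>M \<partial>M)"
    using Fubini'[OF m] by simp
  also have "\<dots> \<le> (\<integral>\<^sup>+y. ennreal ((f y)\<^sup>2) \<partial>M)"
  proof (rule nn_integral_mono)
    fix y :: "real^'n"
    have cm: "continuous_on UNIV (\<lambda>x::real^'n. mollifier n (x - y))"
      by (rule continuous_on_compose2[OF C_k_continuous[OF C_k_mollifier]]) (auto intro!: continuous_intros)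
    have i: "integrable M (\<lambda>x. mollifier n (x - y))"
      by (intro fm.sq_integrable_integrable continuous_sq_integrable cm)
    have "(\<integral>\<^sup>+x. ennreal ((f y)\<^sup>2 * mollifier n (x - y)) \<partial>M) = ennreal (\<integral>x. (f y)\<^sup>2 * mollifier n (x - y) \<partial>M)"
      using i by (intro nn_integral_eq_integral integrable_mult_right AE_I2) (auto simp: mollifier_nonneg)
    also have "\<dots> = ennreal ((f y)\<^sup>2 * (\<integral>x. mollifier n (x - y) \<partial>M))" by simp
    also have "\<dots> \<le> ennreal ((f y)\<^sup>2 * 1)"
      by (intro ennreal_leI mult_left_mono mollifier_M_integral_le) simp
    finally show "(\<integral>\<^sup>+x. ennreal ((f y)\<^sup>2 * mollifier n (x - y)) \<partial>M) \<le> ennreal ((f y)\<^sup>2)" by simp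
  qed
  finally have *: "(\<integral>\<^sup>+x. ennreal ((mollify n f x)\<^sup>2) \<partial>M) \<le> (\<integral>\<^sup>+y. ennreal ((f y)\<^sup>2) \<partial>M)" .
  have "(\<integral>\<^sup>+x. ennreal ((g x)\<^sup>2) \<partial>M) = ennreal ((nrm2 M g)\<^sup>2)" if "sq_integrable M g" for g
    using that by (subst nn_integral_eq_integral) (auto simp: sq_integrable_def nrm2_square)
  then have "ennreal ((nrm2 M (mollify n f))\<^sup>2) \<le> ennreal ((nrm2 M f)\<^sup>2)"
    using * f mollify_sq_integrable[OF f] by simp
  then show ?thesis by (simp add: ennreal_le_iff abs_le_square_iff[symmetric])
qed

end

lemma L2_lim_dominated:
  assumes F: "sq_integrable M F" and w: "sq_integrable M w" and f: "\<And>n. f n \<in> borel_measurable M"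
    and lim: "AE x in M. (\<lambda>n. f n x) \<longlonglongrightarrow> F x" and bd: "\<And>n. AE x in M. \<bar>f n x\<bar> \<le> w x"
  shows "L2_lim M f F"
proof -
  have m[measurable]: "F \<in> borel_measurable M" "w \<in> borel_measurable M" "\<And>n. f n \<in> borel_measurable M"
    using F w f by (auto simp: sq_integrable_def)
  have sf: "sq_integrable M (f n)" for n
    unfolding sq_integrable_def
  proof
    show "integrable M (\<lambda>x. (f n x)\<^sup>2)"
    proof (rule Bochner_Integration.integrable_bound[OF sq_integrable_square[OF w]])
      show "AE x in M. norm ((f n x)\<^sup>2) \<le> norm ((w x)\<^sup>2)"
        using bd[of n] by eventually_elim (auto intro: power2_le_iff_abs_le[THEN iffD2] order_trans simp: abs_le_square_iff[symmetric])
    qed simp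
  qed simp
  have "(\<lambda>n. \<integral>x. (f n x - F x)\<^sup>2 \<partial>M) \<longlonglongrightarrow> (\<integral>x. 0 \<partial>M)"
  proof (rule integral_dominated_convergence[where w="\<lambda>x. (\<bar>w x\<bar> + \<bar>F x\<bar>)\<^sup>2"])
    have "sq_integrable M (\<lambda>x. \<bar>w x\<bar> + \<bar>F x\<bar>)"
      using F w by (intro sq_integrable_add) (auto simp: sq_integrable_def)
    then show "integrable M (\<lambda>x. (\<bar>w x\<bar> + \<bar>F x\<bar>)\<^sup>2)" by (rule sq_integrable_square)
    show "AE x in M. (\<lambda>n. (f n x - F x)\<^sup>2) \<longlonglongrightarrow> 0"
      using lim
    proof eventually_elim
      case (elim x)
      then have "(\<lambda>n. (f n x - F x)\<^sup>2) \<longlonglongrightarrow> (F x - F x)\<^sup>2" by (intro tendsto_intros)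
      then show ?case by simp
    qed
    show "AE x in M. norm ((f n x - F x)\<^sup>2) \<le> (\<bar>w x\<bar> + \<bar>F x\<bar>)\<^sup>2" for n
      using bd[of n]
    proof eventually_elim
      case (elim x)
      then have "\<bar>f n x - F x\<bar> \<le> \<bar>\<bar>w x\<bar> + \<bar>F x\<bar>\<bar>" by linarith
      then have "(f n x - F x)\<^sup>2 \<le> (\<bar>w x\<bar> + \<bar>F x\<bar>)\<^sup>2" by (simp only: abs_le_square_iff)
      then show ?case by simp
    qed
  qed measurable
  then have "(\<lambda>n. sqrt (\<integral>x. (f n x - F x)\<^sup>2 \<partial>M)) \<longlonglongrightarrow> sqrt 0"
    by (intro tendsto_real_sqrt) simp
  then show ?thesis using sf F by (simp add: L2_lim_def nrm2_def)
qed

lemma L2_lim_AE_subseq: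
  assumes "L2_lim M f F"
  obtains r :: "nat \<Rightarrow> nat" where "strict_mono r" "AE x in M. (\<lambda>n. f (r n) x) \<longlonglongrightarrow> F x"
proof -
  have s: "sq_integrable M (\<lambda>x. f n x - F x)" for n
    using assms by (auto simp: L2_lim_def intro: sq_integrable_diff)
  have "(\<lambda>n. (nrm2 M (\<lambda>x. f n x - F x))\<^sup>2) \<longlonglongrightarrow> 0\<^sup>2"
    using assms by (intro tendsto_intros) (simp add: L2_lim_def)
  then have "(\<lambda>n. \<integral>x. norm ((f n x - F x)\<^sup>2) \<partial>M) \<longlonglongrightarrow> 0" by (simp add: nrm2_square)
  from tendsto_L1_AE_subseq[OF sq_integrable_square[OF s] this]
  obtain r where r: "strict_mono r" "AE x in M. (\<lambda>n. (f (r n) x - F x)\<^sup>2) \<longlonglongrightarrow> 0" by blast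
  have "AE x in M. (\<lambda>n. f (r n) x) \<longlonglongrightarrow> F x"
    using r(2)
  proof eventually_elim
    case (elim x)
    then have "(\<lambda>n. sqrt ((f (r n) x - F x)\<^sup>2)) \<longlonglongrightarrow> sqrt 0" by (rule tendsto_real_sqrt)
    then have "(\<lambda>n. f (r n) x - F x) \<longlonglongrightarrow> 0" by (simp add: tendsto_rabs_zero_iff)
    then show ?case by (simp add: LIM_zero_iff)
  qed
  with r(1) show ?thesis using that by blast
qed

section \<open>Density of continuous functions and convergence of mollifications\<close>

context bounded_open
begin

text \<open>The complement has to be non-empty because \<open>infdist\<close> from the empty set is
  zero by definition, and the cut-offs below are built from the distance to the complement.\<close>

lemma compl_domain: "closed (- \<Omega>)" "- \<Omega> \<noteq> {}"
proof -
  show "closed (- \<Omega>)" using open_domain by (simp add: closed_Compl)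
  have "\<Omega> \<noteq> UNIV" using bounded_domain not_bounded_UNIV by blast
  then show "- \<Omega> \<noteq> {}" by auto
qed

text \<open>The values are clipped to the interval from \<open>-n\<close> to \<open>n\<close> and
  cut off near the complement; both changes are small in L^2 by dominated convergence. The resulting
  bounded function is then approximated by continuous ones.\<close>

lemma L2_density:
  assumes f: "sq_integrable M f" and e: "e > 0"
  shows "\<exists>h. continuous_on UNIV h \<and> (\<forall>x. x \<notin> \<Omega> \<longrightarrow> h x = 0) \<and> nrm2 M (\<lambda>x. f x - h x) < e"
proof -
  define cut where "cut n x = min 1 (real n * infdist x (- \<Omega>))" for n x
  define cl where "cl n v = max (- real n) (min (real n) v)" for n and v :: real
  have cut: "continuous_on UNIV (cut n)" for n unfolding cut_def by (intro continuous_intros)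
  have cut01: "0 \<le> cut n x" "cut n x \<le> 1" for n x by (auto simp: cut_def infdist_nonneg)
  have cut0: "cut n x = 0" if "x \<notin> \<Omega>" for n x using that by (simp add: cut_def)
  have clc: "continuous_on UNIV (cl n)" for n unfolding cl_def by (intro continuous_intros)
  have clm[measurable]: "cl n \<in> borel_measurable borel" for n using clc by (rule borel_measurable_continuous_onI)
  have clb: "\<bar>cl n v\<bar> \<le> \<bar>v\<bar>" "\<bar>cl n v\<bar> \<le> real n" for n v by (auto simp: cl_def)
  have fm[measurable]: "f \<in> borel_measurable M" using f by (simp add: sq_integrable_def)
  have cutm[measurable]: "cut n \<in> borel_measurable M" for n using cut by (rule continuous_measurable)
  have cutlim: "(\<lambda>n. cut n x) \<longlonglongrightarrow> 1" if "x \<in> \<Omega>" for x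
  proof -
    have p: "infdist x (- \<Omega>) > 0" using infdist_pos_not_in_closed[OF compl_domain] that by simp
    obtain N where N: "1 \<le> real N * infdist x (- \<Omega>)"
      using reals_Archimedean3[OF p] less_imp_le by metis
    have "cut n x = 1" if "n \<ge> N" for n
    proof -
      have "1 \<le> real n * infdist x (- \<Omega>)"
        using N that p by (meson mult_right_mono of_nat_le_iff order_trans less_imp_le)
      then show ?thesis by (simp add: cut_def)
    qed
    then show ?thesis by (intro tendsto_eventually eventually_sequentiallyI[of N]) auto
  qed
  have cllim: "(\<lambda>n. cl n v) \<longlonglongrightarrow> v" for v
  proof -
    obtain N where N: "\<bar>v\<bar> \<le> real N" using real_arch_simple by blast
    have "cl n v = v" if "n \<ge> N" for n
    proof -
      have "\<bar>v\<bar> \<le> real n" using N that by linarith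
      then show ?thesis by (auto simp: cl_def)
    qed
    then show ?thesis by (intro tendsto_eventually eventually_sequentiallyI[of N]) auto
  qed
  have "L2_lim M (\<lambda>n x. cut n x * cl n (f x)) f"
  proof (rule L2_lim_dominated[where w="\<lambda>x. \<bar>f x\<bar>"])
    show "sq_integrable M (\<lambda>x. \<bar>f x\<bar>)" using f by (simp add: sq_integrable_def)
    show "AE x in M. (\<lambda>n. cut n x * cl n (f x)) \<longlonglongrightarrow> f x"
    proof (rule AE_I2)
      fix x assume "x \<in> space M"
      then have "(\<lambda>n. cut n x * cl n (f x)) \<longlonglongrightarrow> 1 * f x"
        by (intro tendsto_mult cutlim cllim) simp
      then show "(\<lambda>n. cut n x * cl n (f x)) \<longlonglongrightarrow> f x" by simp
    qed
    show "AE x in M. \<bar>cut n x * cl n (f x)\<bar> \<le> \<bar>f x\<bar>" for n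
    proof (rule AE_I2)
      fix x
      have "\<bar>cut n x\<bar> * \<bar>cl n (f x)\<bar> \<le> 1 * \<bar>f x\<bar>" using cut01 clb by (intro mult_mono) auto
      then show "\<bar>cut n x * cl n (f x)\<bar> \<le> \<bar>f x\<bar>" by (simp add: abs_mult)
    qed
  qed (use f in \<open>measurable\<close>)
  then have "(\<lambda>n. nrm2 M (\<lambda>x. cut n x * cl n (f x) - f x)) \<longlonglongrightarrow> 0" by (simp add: L2_lim_def)
  then obtain n where n: "nrm2 M (\<lambda>x. cut n x * cl n (f x) - f x) < e / 2"
    using e LIMSEQ_D[of _ 0 "e/2"] by fastforce
  \<comment> \<open>Measurability in this sense supplies continuous functions that converge off a
    negligible set; clipping and cutting them in the same way makes that convergence
    dominated.\<close>
  have "f measurable_on \<Omega>" using measurable_on_iff_borel_measurable[OF domain_sets] fm by blast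
  then obtain N g where N: "negligible N" and g: "\<And>k. continuous_on UNIV (g k)"
    and gl: "\<And>x. x \<notin> N \<Longrightarrow> (\<lambda>k. g k x) \<longlonglongrightarrow> (if x \<in> \<Omega> then f x else 0)"
    unfolding measurable_on_def by metis
  have AEN: "AE x in M. x \<notin> N"
  proof -
    have "AE x in lebesgue. x \<notin> N" using N by (auto simp: negligible_iff_null_sets intro: AE_not_in)
    then show ?thesis by (subst AE_restrict_space_iff) auto
  qed
  define h where "h k x = cut n x * cl n (g k x)" for k x
  have h: "continuous_on UNIV (h k)" for k
    unfolding h_def by (intro continuous_on_mult cut continuous_on_compose2[OF clc g]) auto
  have "L2_lim M h (\<lambda>x. cut n x * cl n (f x))"
  proof (rule L2_lim_dominated[where w="\<lambda>x. real n"])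
    have cb: "\<bar>cut n x * cl n v\<bar> \<le> real n" for x v
    proof -
      have "\<bar>cut n x\<bar> * \<bar>cl n v\<bar> \<le> 1 * real n" using cut01 clb by (intro mult_mono) auto
      then show ?thesis by (simp add: abs_mult)
    qed
    show "sq_integrable M (\<lambda>x. cut n x * cl n (f x))"
      using cb by (intro fm.sq_integrable_bounded[where B="real n"]) auto
    show "sq_integrable M (\<lambda>x. real n)" by (rule fm.sq_integrable_bounded) auto
    show "h k \<in> borel_measurable M" for k using h by (rule continuous_measurable)
    show "AE x in M. \<bar>h k x\<bar> \<le> real n" for k using cb by (simp add: h_def)
    show "AE x in M. (\<lambda>k. h k x) \<longlonglongrightarrow> cut n x * cl n (f x)"
      using AEN AE_space
    proof eventually_elim
      case (elim x)
      have "(\<lambda>k. g k x) \<longlonglongrightarrow> f x" using gl[OF elim(1)] elim(2) by simp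
      moreover have "isCont (cl n) (f x)" using clc by (simp add: continuous_on_eq_continuous_at)
      ultimately have "(\<lambda>k. cl n (g k x)) \<longlonglongrightarrow> cl n (f x)" by (rule isCont_tendsto_compose[rotated])
      then show ?case unfolding h_def by (intro tendsto_intros)
    qed
  qed
  then have hs: "(\<lambda>k. nrm2 M (\<lambda>x. h k x - cut n x * cl n (f x))) \<longlonglongrightarrow> 0"
    and sq: "sq_integrable M (\<lambda>x. cut n x * cl n (f x))" by (simp_all add: L2_lim_def)
  then obtain k where k: "nrm2 M (\<lambda>x. h k x - cut n x * cl n (f x)) < e / 2"
    using e LIMSEQ_D[OF hs, of "e/2"] by fastforce
  have "nrm2 M (\<lambda>x. f x - h k x) \<le> nrm2 M (\<lambda>x. f x - cut n x * cl n (f x)) + nrm2 M (\<lambda>x. cut n x * cl n (f x) - h k x)"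
    by (intro nrm2_triangle_diff f sq continuous_sq_integrable h)
  also have "\<dots> < e" using n k by (subst (1 2) nrm2_minus_commute) simp
  finally have "nrm2 M (\<lambda>x. f x - h k x) < e" .
  moreover have "\<forall>x. x \<notin> \<Omega> \<longrightarrow> h k x = 0" by (simp add: h_def cut0)
  ultimately show ?thesis using h by blast
qed

lemma mollify_bound:
  assumes "s \<in> borel_measurable M" "\<And>x. x \<in> \<Omega> \<Longrightarrow> \<bar>s x\<bar> \<le> B" "0 \<le> B"
  shows "\<bar>mollify n s x\<bar> \<le> B"
proof -
  have i: "integrable M s"
    using assms by (intro fm.sq_integrable_integrable fm.sq_integrable_bounded[where B=B]) auto
  have c: "continuous_on UNIV (mollifier n)" by (rule C_k_continuous[OF C_k_mollifier])
  have im: "integrable M (\<lambda>y. mollifier n (x - y))"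
    by (intro fm.sq_integrable_integrable continuous_sq_integrable continuous_reflect c)
  have "\<bar>mollify n s x\<bar> \<le> (\<integral>y. \<bar>s y * mollifier n (x - y)\<bar> \<partial>M)"
    unfolding mollify_def conv_def by (rule integral_abs_bound)
  also have "\<dots> \<le> (\<integral>y. B * mollifier n (x - y) \<partial>M)"
  proof (rule integral_mono_AE)
    show "integrable M (\<lambda>y. \<bar>s y * mollifier n (x - y)\<bar>)" by (intro integrable_abs conv_integrable i c)
    show "integrable M (\<lambda>y. B * mollifier n (x - y))" using im by simp
    show "AE y in M. \<bar>s y * mollifier n (x - y)\<bar> \<le> B * mollifier n (x - y)"
      using assms(2) by (intro AE_I2) (auto simp: abs_mult mollifier_nonneg intro!: mult_right_mono)
  qed
  also have "\<dots> = B * (\<integral>y. mollifier n (x - y) \<partial>M)" by simp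
  also have "\<dots> \<le> B * 1" by (intro mult_left_mono mollifier_M_integral_le assms)
  finally show ?thesis by simp
qed

text \<open>Since \<open>h\<close> vanishes outside the domain, its mollification is the convolution
  over the whole space, which converges pointwise by continuity; the common bound \<open>B\<close>
  gives convergence in L^2.\<close>

lemma mollify_continuous_L2_lim:
  assumes h: "continuous_on UNIV h" and h0: "\<And>x. x \<notin> \<Omega> \<Longrightarrow> h x = 0"
  shows "L2_lim M (\<lambda>n. mollify n h) h"
proof -
  have sh: "sq_integrable M h" using h by (rule continuous_sq_integrable)
  obtain B where B: "B > 0" "\<And>x. x \<in> closure \<Omega> \<Longrightarrow> \<bar>h x\<bar> \<le> B" using continuous_bounded[OF h] by metis
  have c: "continuous_on UNIV (mollifier n :: real^'n \<Rightarrow> real)" for n by (rule C_k_continuous[OF C_k_mollifier])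
  have lim: "(\<lambda>n. mollify n h x) \<longlonglongrightarrow> h x" for x
  proof (rule LIMSEQ_I)
    fix e :: real assume e: "e > 0"
    have "isCont h x" using h by (simp add: continuous_on_eq_continuous_at)
    then obtain d where d: "d > 0" "\<And>y. dist y x < d \<Longrightarrow> dist (h y) (h x) < e / 2"
      unfolding continuous_at_eps_delta using e by (metis half_gt_zero)
    obtain N where N: "1 / real (Suc N) < d" using nat_approx_posE[OF d(1)] by metis
    have "norm (mollify n h x - h x) < e" if "n \<ge> N" for n
    proof -
      have n: "1 / real (Suc n) < d" using N that by (smt (verit) frac_le of_nat_0_less_iff of_nat_mono Suc_le_mono zero_less_Suc)
      have i1: "integrable lborel (\<lambda>y. h y * mollifier n (x - y))"
        using B(2) h0 h bounded_domain closure_subset[of \<Omega>]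
        by (intro continuous_compact_support_integrable(1)[where K="closure \<Omega>"] continuous_on_mult continuous_reflect c) auto
      note i2 = mollifier_reflect_integral(1)[of n x]
      have mh: "mollify n h x = (\<integral>y. h y * mollifier n (x - y) \<partial>lborel)"
        unfolding mollify_def conv_def
        by (intro integral_eq_lborel continuous_on_mult h continuous_reflect c) (simp add: h0)
      have "mollify n h x - h x = (\<integral>y. h y * mollifier n (x - y) \<partial>lborel) - (\<integral>y. h x * mollifier n (x - y) \<partial>lborel)"
        using mollifier_reflect_integral(2)[of n x] mh by simp
      also have "\<dots> = (\<integral>y. h y * mollifier n (x - y) - h x * mollifier n (x - y) \<partial>lborel)"
        using i1 i2 by (intro Bochner_Integration.integral_diff[symmetric]) auto
      finally have eq: "mollify n h x - h x = (\<integral>y. h y * mollifier n (x - y) - h x * mollifier n (x - y) \<partial>lborel)" .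
      have "\<bar>mollify n h x - h x\<bar> \<le> (\<integral>y. \<bar>h y * mollifier n (x - y) - h x * mollifier n (x - y)\<bar> \<partial>lborel)"
        unfolding eq by (rule integral_abs_bound)
      also have "\<dots> \<le> (\<integral>y. (e / 2) * mollifier n (x - y) \<partial>lborel)"
      proof (rule integral_mono)
        show "integrable lborel (\<lambda>y. \<bar>h y * mollifier n (x - y) - h x * mollifier n (x - y)\<bar>)"
          using i1 i2 by (intro integrable_abs Bochner_Integration.integrable_diff) auto
        show "integrable lborel (\<lambda>y. e / 2 * mollifier n (x - y))" using i2 by simp
        fix y
        show "\<bar>h y * mollifier n (x - y) - h x * mollifier n (x - y)\<bar> \<le> e / 2 * mollifier n (x - y)"
        proof (cases "1 / real (Suc n) \<le> norm (x - y)")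
          case False
          then have "\<bar>h y - h x\<bar> \<le> e / 2"
            using d(2)[of y] n by (auto simp: dist_norm norm_minus_commute)
          then have "\<bar>h y - h x\<bar> * mollifier n (x - y) \<le> e / 2 * mollifier n (x - y)"
            by (intro mult_right_mono mollifier_nonneg)
          then show ?thesis by (simp add: left_diff_distrib[symmetric] abs_mult mollifier_nonneg)
        qed (simp add: mollifier_outside)
      qed
      also have "\<dots> = e / 2" using mollifier_reflect_integral(2)[of n x] by simp
      finally show ?thesis using e by simp
    qed
    then show "\<exists>no. \<forall>n\<ge>no. norm (mollify n h x - h x) < e" by blast
  qed
  show ?thesis
  proof (rule L2_lim_dominated[where w="\<lambda>x. B"])
    show "sq_integrable M (\<lambda>x. B)" by (rule fm.sq_integrable_bounded) auto
    show "AE x in M. \<bar>mollify n h x\<bar> \<le> B" for n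
    proof (rule AE_I2, rule mollify_bound)
      show "\<bar>h x\<bar> \<le> B" if "x \<in> \<Omega>" for x using B(2) that closure_subset by blast
    qed (use B h continuous_measurable in auto)
    show "mollify n h \<in> borel_measurable M" for n
      using mollify_sq_integrable[OF sh] by (simp add: sq_integrable_def)
  qed (use sh lim in auto)
qed

lemma mollify_L2_lim:
  assumes f: "sq_integrable M f"
  shows "L2_lim M (\<lambda>n. mollify n f) f"
proof -
  have "(\<lambda>n. nrm2 M (\<lambda>x. mollify n f x - f x)) \<longlonglongrightarrow> 0"
  proof (rule LIMSEQ_I)
    fix e :: real assume e: "e > 0"
    obtain h where h: "continuous_on UNIV h" "\<And>x. x \<notin> \<Omega> \<Longrightarrow> h x = 0" "nrm2 M (\<lambda>x. f x - h x) < e / 3"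
      using L2_density[OF f, of "e / 3"] e by auto
    have sh: "sq_integrable M h" using h(1) by (rule continuous_sq_integrable)
    have l: "(\<lambda>n. nrm2 M (\<lambda>x. mollify n h x - h x)) \<longlonglongrightarrow> 0"
      using mollify_continuous_L2_lim[OF h(1,2)] by (simp add: L2_lim_def)
    obtain N where N: "\<And>n. n \<ge> N \<Longrightarrow> nrm2 M (\<lambda>x. mollify n h x - h x) < e / 3"
      using LIMSEQ_D[OF l, of "e / 3"] e by auto
    have "norm (nrm2 M (\<lambda>x. mollify n f x - f x) - 0) < e" if "n \<ge> N" for n
    proof -
      have "nrm2 M (\<lambda>x. mollify n f x - f x) \<le> nrm2 M (\<lambda>x. mollify n f x - mollify n h x) + nrm2 M (\<lambda>x. mollify n h x - f x)"
        by (intro nrm2_triangle_diff mollify_sq_integrable f sh)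
      moreover have "nrm2 M (\<lambda>x. mollify n h x - f x) \<le> nrm2 M (\<lambda>x. mollify n h x - h x) + nrm2 M (\<lambda>x. h x - f x)"
        by (intro nrm2_triangle_diff mollify_sq_integrable f sh)
      moreover have "nrm2 M (\<lambda>x. mollify n f x - mollify n h x) \<le> nrm2 M (\<lambda>x. f x - h x)"
        using nrm2_mollify_le[OF sq_integrable_diff[OF f sh], of n] mollify_diff[OF f sh]
        by (simp add: nrm2_def)
      ultimately have "nrm2 M (\<lambda>x. mollify n f x - f x) < e"
        using N[OF that] h(3) nrm2_minus_commute[of M f h] by linarith
      then show ?thesis by simp
    qed
    then show "\<exists>no. \<forall>n\<ge>no. norm (nrm2 M (\<lambda>x. mollify n f x - f x) - 0) < e" by blast
  qed
  then show ?thesis using f mollify_sq_integrable[OF f] by (simp add: L2_lim_def)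
qed

end

lemma C_k_reflect:
  fixes f :: "real^'n::finite \<Rightarrow> real"
  shows "C_k k f \<Longrightarrow> C_k k (\<lambda>y. f (x - y))"
proof (induction k arbitrary: f)
  case 0
  then show ?case by (auto intro!: continuous_on_compose2[of UNIV f] continuous_intros)
next
  case (Suc k)
  have D: "((\<lambda>y. f (x - y)) has_derivative (\<lambda>h. \<Sum>i\<in>UNIV. (- h) $ i * pderiv_at i f (x - y))) (at y)" for y
    using Suc.prems
    by (intro has_derivative_compose[of "\<lambda>y. x - y" "\<lambda>h. - h", OF _ has_derivative_pderiv_at])
      (auto intro!: derivative_eq_intros)
  have "pderiv_at i (\<lambda>y. f (x - y)) = (\<lambda>y. - pderiv_at i f (x - y))" for i
  proof
    fix y
    have "pderiv_at i (\<lambda>y. f (x - y)) y = (\<Sum>l\<in>UNIV. (- axis i 1) $ l * pderiv_at l f (x - y))"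
      by (rule pderiv_at_eqI[OF D])
    also have "\<dots> = (\<Sum>l\<in>UNIV. if l = i then - pderiv_at l f (x - y) else 0)"
      by (intro sum.cong) (auto simp: axis_def)
    finally show "pderiv_at i (\<lambda>y. f (x - y)) y = - pderiv_at i f (x - y)" by simp
  qed
  then show ?case using Suc D by (auto simp: differentiable_def intro: C_k_uminus)
qed

lemma pderiv_at_reflect:
  fixes f :: "real^'n::finite \<Rightarrow> real"
  assumes "f differentiable (at (x - y))"
  shows "pderiv_at i (\<lambda>y. f (x - y)) y = - pderiv_at i f (x - y)"
proof -
  have D: "((\<lambda>y. f (x - y)) has_derivative (\<lambda>h. \<Sum>i\<in>UNIV. (- h) $ i * pderiv_at i f (x - y))) (at y)"
    by (intro has_derivative_compose[of "\<lambda>y. x - y" "\<lambda>h. - h", OF _ has_derivative_pderiv_at] assms)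
      (auto intro!: derivative_eq_intros)
  have "pderiv_at i (\<lambda>y. f (x - y)) y = (\<Sum>l\<in>UNIV. (- axis i 1) $ l * pderiv_at l f (x - y))"
    by (rule pderiv_at_eqI[OF D])
  also have "\<dots> = (\<Sum>l\<in>UNIV. if l = i then - pderiv_at l f (x - y) else 0)"
    by (intro sum.cong) (auto simp: axis_def)
  finally show ?thesis by simp
qed

lemma C_k_pderiv_all: "(\<forall>k. C_k k f) \<Longrightarrow> (\<forall>k. C_k k (pderiv_at i f))"
  by (metis C_k.simps(2))

lemma test_functionsD:
  assumes "\<phi> \<in> test_functions \<Omega>"
  shows "C_k k \<phi>" "\<exists>K. compact K \<and> K \<subseteq> \<Omega> \<and> (\<forall>x. x \<notin> K \<longrightarrow> \<phi> x = 0)"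
  using assms by (auto simp: test_functions_def)

lemma test_functions_pderiv: "\<phi> \<in> test_functions \<Omega> \<Longrightarrow> pderiv_at i \<phi> \<in> test_functions \<Omega>"
  using C_k_pderiv_all[of \<phi> i] pderiv_eq_0_outside[of _ \<phi> _ i] unfolding test_functions_def by blast

context bounded_open
begin

text \<open>Evaluating a mollification at \<open>x\<close> is pairing with this function. Every weak
  identity therefore becomes a pointwise one for mollifications, at points away from the
  boundary.\<close>

lemma test_reflect_mollifier:
  assumes "cball x (1 / real (Suc n)) \<subseteq> \<Omega>"
  shows "(\<lambda>y. mollifier n (x - y)) \<in> test_functions \<Omega>"
  unfolding test_functions_def
proof (intro CollectI conjI allI exI)
  show "C_k k (\<lambda>y. mollifier n (x - y))" for k by (intro C_k_reflect C_k_mollifier)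
  show "cball x (1 / real (Suc n)) \<subseteq> \<Omega>" by fact
  show "y \<notin> cball x (1 / real (Suc n)) \<longrightarrow> mollifier n (x - y) = 0" for y
    by (auto intro!: mollifier_outside simp: dist_norm)
qed simp

subsection \<open>Weak derivatives\<close>

text \<open>The square integrable form of \<open>has_weak_pderiv\<close>. Keeping the derivative as
  an argument leaves the choice made by \<open>weak_pderiv\<close> out of all computations.\<close>

definition wd :: "'n \<Rightarrow> (real^'n \<Rightarrow> real) \<Rightarrow> (real^'n \<Rightarrow> real) \<Rightarrow> bool" where
  "wd i f g \<longleftrightarrow> sq_integrable M f \<and> sq_integrable M g \<and>
     (\<forall>\<phi> \<in> test_functions \<Omega>. (\<integral>x. f x * pderiv_at i \<phi> x \<partial>M) = - (\<integral>x. g x * \<phi> x \<partial>M))"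

lemma wdD:
  assumes "wd i f g"
  shows "sq_integrable M f" "sq_integrable M g"
    "\<phi> \<in> test_functions \<Omega> \<Longrightarrow> (\<integral>x. f x * pderiv_at i \<phi> x \<partial>M) = - (\<integral>x. g x * \<phi> x \<partial>M)"
  using assms by (auto simp: wd_def)

lemma test_continuous: "\<phi> \<in> test_functions \<Omega> \<Longrightarrow> continuous_on UNIV \<phi>"
  using test_functionsD(1)[of \<phi> \<Omega> 0] by simp

lemma test_sq: "\<phi> \<in> test_functions \<Omega> \<Longrightarrow> sq_integrable M \<phi>"
  by (rule continuous_sq_integrable) (rule test_continuous)

text \<open>The reflected kernel is a test function exactly when its support fits into the domain,
  and reflecting it changes the sign of its derivative.\<close>

lemma conv_pderiv_interior:
  assumes w: "wd i f g" and b: "cball x (1 / real (Suc n)) \<subseteq> \<Omega>"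
  shows "conv f (pderiv_at i (mollifier n)) x = mollify n g x"
proof -
  have d: "mollifier n differentiable (at z)" for z :: "real^'n"
    by (rule C_k_differentiable[OF C_k_mollifier[of "Suc 0"]])
  have "(\<integral>y. f y * pderiv_at i (\<lambda>y. mollifier n (x - y)) y \<partial>M) = - (\<integral>y. g y * mollifier n (x - y) \<partial>M)"
    by (rule wdD(3)[OF w test_reflect_mollifier[OF b]])
  then show ?thesis
    unfolding conv_def mollify_def by (simp add: pderiv_at_reflect[OF d])
qed

text \<open>Everything that holds for functions supported in \<open>K\<close> once the kernel is
  narrow enough. The claims are stated with object quantifiers so that one \<open>K'\<close> and one
  \<open>N\<close> serve all functions at once.\<close>

lemma mollify_compact:
  assumes K: "compact K" "K \<subseteq> \<Omega>"
  obtains K' N where "compact K'" "K' \<subseteq> \<Omega>" "K \<subseteq> K'"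
    "\<forall>n f x. N \<le> n \<longrightarrow> (\<forall>y. y \<notin> K \<longrightarrow> f y = 0) \<longrightarrow> x \<notin> K' \<longrightarrow> mollify n f x = 0"
    "\<forall>n f. N \<le> n \<longrightarrow> sq_integrable M f \<longrightarrow> (\<forall>y. y \<notin> K \<longrightarrow> f y = 0) \<longrightarrow> mollify n f \<in> test_functions \<Omega>"
    "\<forall>n f i f' x. N \<le> n \<longrightarrow> wd i f f' \<longrightarrow> (\<forall>y. y \<notin> K \<longrightarrow> f y = 0) \<longrightarrow> (\<forall>y. y \<notin> K \<longrightarrow> f' y = 0) \<longrightarrow>
      pderiv_at i (mollify n f) x = mollify n f' x"
    "\<forall>n x. N \<le> n \<longrightarrow> x \<in> K \<longrightarrow> cball x (1 / real (Suc n)) \<subseteq> \<Omega>"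
proof -
  obtain e where e: "e > 0" "(\<Union>x\<in>K. cball x e) \<subseteq> \<Omega>"
    using compact_subset_open_imp_cball_epsilon_subset[OF K(1) open_domain K(2)] by metis
  \<comment> \<open>Half the available distance: points of the \<open>d\<close>-neighbourhood
    \<open>K'\<close> still have a ball of radius \<open>d\<close> inside the domain.\<close>
  define d where "d = e / 2"
  have d: "d > 0" using e by (simp add: d_def)
  define K' where "K' = {x + y | x y. x \<in> K \<and> y \<in> cball 0 d}"
  have K'c: "compact K'" unfolding K'_def by (intro compact_sums K) simp
  have K'b: "x \<in> K' \<longleftrightarrow> (\<exists>y\<in>K. dist y x \<le> d)" for x
  proof
    assume "x \<in> K'"
    then obtain a y where "x = a + y" "a \<in> K" "norm y \<le> d" by (auto simp: K'_def)
    then show "\<exists>y\<in>K. dist y x \<le> d" by (intro bexI[of _ a]) (auto simp: dist_norm)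
  next
    assume "\<exists>y\<in>K. dist y x \<le> d"
    then obtain y where "y \<in> K" "dist y x \<le> d" by blast
    then show "x \<in> K'" unfolding K'_def by (intro CollectI exI[of _ y] exI[of _ "x - y"]) (auto simp: dist_norm norm_minus_commute)
  qed
  have K'i: "cball x d \<subseteq> \<Omega>" if x: "x \<in> K'" for x
  proof
    fix z assume z: "z \<in> cball x d"
    obtain y where y: "y \<in> K" "dist y x \<le> d" using x K'b by blast
    have "dist y z \<le> dist y x + dist x z" by (rule dist_triangle)
    then have "dist y z \<le> e" using y z by (simp add: d_def)
    then have "z \<in> cball y e" by simp
    then show "z \<in> \<Omega>" using e(2) y(1) by blast
  qed
  have K'O: "K' \<subseteq> \<Omega>" using K'i d by force
  have KK': "K \<subseteq> K'" using K'b d by force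
  obtain N where N: "1 / real (Suc N) < d" using nat_approx_posE[OF d] by metis
  have Nn: "1 / real (Suc n) < d" if "n \<ge> N" for n
    using N that by (smt (verit) frac_le of_nat_0_less_iff of_nat_mono Suc_le_mono zero_less_Suc)
  have far: "1 / real (Suc n) < norm (x - y)" if "n \<ge> N" "x \<notin> K'" "y \<in> K" for n x y
    using Nn[OF that(1)] K'b[of x] that by (auto simp: dist_norm norm_minus_commute not_le)
  have zero: "mollify n f x = 0" if n: "n \<ge> N" and f: "\<And>y. y \<notin> K \<Longrightarrow> f y = 0" and x: "x \<notin> K'" for n f x
  proof -
    have "f y * mollifier n (x - y) = 0" for y
      using f[of y] far[OF n x, of y] by (cases "y \<in> K") (auto intro!: mollifier_outside)
    then show ?thesis unfolding mollify_def conv_def by (simp only:) simp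
  qed
  have test: "mollify n f \<in> test_functions \<Omega>"
    if n: "n \<ge> N" and f: "sq_integrable M f" "\<And>y. y \<notin> K \<Longrightarrow> f y = 0" for n f
    unfolding test_functions_def
  proof (intro CollectI conjI allI exI impI)
    show "C_k k (mollify n f)" for k by (rule C_k_mollify[OF f(1)])
    show "mollify n f x = 0" if "x \<notin> K'" for x by (rule zero[OF n f(2) that])
  qed (rule K'c K'O)+
  have pd: "pderiv_at i (mollify n f) x = mollify n f' x"
    if n: "n \<ge> N" and w: "wd i f f'" and f: "\<And>y. y \<notin> K \<Longrightarrow> f y = 0" "\<And>y. y \<notin> K \<Longrightarrow> f' y = 0" for n f f' i x
  proof (cases "x \<in> K'")
    case True
    then have "cball x (1 / real (Suc n)) \<subseteq> \<Omega>" using K'i[OF True] Nn[OF n] by (auto simp: subset_iff)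
    then show ?thesis using conv_pderiv_interior[OF w] pderiv_at_mollify[OF wdD(1)[OF w]] by simp
  next
    case False
    have "f y * pderiv_at i (mollifier n) (x - y) = 0" for y
    proof (cases "y \<in> K")
      case True
      then have "x - y \<notin> cball 0 (1 / real (Suc n))" using far[OF n False True] by simp
      then have "pderiv_at i (mollifier n) (x - y) = 0"
        by (intro pderiv_eq_0_outside[OF compact_cball mollifier_outside_cball])
      then show ?thesis by simp
    qed (simp add: f)
    then have "conv f (pderiv_at i (mollifier n)) x = 0" unfolding conv_def by (simp only:) simp
    then show ?thesis using zero[OF n f(2) False] pderiv_at_mollify[OF wdD(1)[OF w]] by simp
  qed
  have "cball x (1 / real (Suc n)) \<subseteq> \<Omega>" if "n \<ge> N" "x \<in> K" for n x
    using K'i[of x] KK' Nn[OF that(1)] that(2) by (auto simp: subset_iff)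
  with zero test pd show ?thesis by (intro that[OF K'c K'O KK', of N]) blast+
qed

lemma borel_imp_measurable:
  fixes f :: "real^'n \<Rightarrow> real"
  assumes "f \<in> borel_measurable borel" shows "f \<in> borel_measurable M"
proof -
  have idm: "(\<lambda>x. x) \<in> M \<rightarrow>\<^sub>M (borel :: (real^'n) measure)"
    by (intro continuous_imp_measurable_on_sets_lebesgue domain_sets continuous_intros)
  show ?thesis using measurable_compose[OF idm assms] .
qed

lemma integrable_M_compact:
  assumes "locally_integrable \<Omega> h" "compact K" "K \<subseteq> \<Omega>"
  shows "integrable M (\<lambda>x. indicator K x * h x)"
proof -
  have "set_integrable lebesgue K h" using assms by (simp add: locally_integrable_def)
  then have "integrable lebesgue (\<lambda>x. indicator K x * h x)" by (simp add: set_integrable_def)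
  moreover have "(\<lambda>x. indicator \<Omega> x *\<^sub>R (indicator K x * h x)) = (\<lambda>x. indicator K x * h x)"
    using assms(3) by (intro ext) (auto simp: indicator_def)
  ultimately show ?thesis by (subst integrable_restrict_space) auto
qed

text \<open>Countably many compact sets, given by lower bounds for the distance to the complement,
  exhaust the domain.\<close>

lemma AE_M_compact_exhaustion:
  assumes "\<And>K. compact K \<Longrightarrow> K \<subseteq> \<Omega> \<Longrightarrow> AE x in M. x \<in> K \<longrightarrow> P x"
  shows "AE x in M. P x"
proof -
  define K where "K n = closure \<Omega> \<inter> {x. infdist x (- \<Omega>) \<ge> 1 / real (Suc n)}" for n
  have "compact (K n)" for n
    unfolding K_def using bounded_domain
    by (intro compact_Int_closed closed_Collect_le continuous_intros) auto
  moreover have "K n \<subseteq> \<Omega>" for n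
  proof
    fix x assume "x \<in> K n"
    then have "infdist x (- \<Omega>) > 0" by (auto simp: K_def intro: less_le_trans[of 0 "1 / real (Suc n)"])
    then show "x \<in> \<Omega>" by (metis ComplI infdist_zero less_irrefl)
  qed
  ultimately have "\<forall>n. AE x in M. x \<in> K n \<longrightarrow> P x" using assms by simp
  then have "AE x in M. \<forall>n. x \<in> K n \<longrightarrow> P x" unfolding AE_all_countable .
  then show ?thesis using AE_space
  proof eventually_elim
    case (elim x)
    then have "infdist x (- \<Omega>) > 0" using infdist_pos_not_in_closed[OF compl_domain] by simp
    then obtain n where "1 / real (Suc n) < infdist x (- \<Omega>)" using nat_approx_posE by metis
    then have "x \<in> K n" using elim closure_subset by (auto simp: K_def)
    then show ?case using elim by blast
  qed
qed

text \<open>The function is tested with mollifications of its sign on \<open>K\<close>. They are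
  bounded by one and converge almost everywhere along a subsequence, so the integral of |h| over
  \<open>K\<close> vanishes. As \<open>h\<close> is only locally integrable, it is first restricted
  to a compact \<open>K'\<close> that contains the supports of all these test functions.\<close>

lemma fundamental_lemma:
  assumes h: "locally_integrable \<Omega> h"
    and z: "\<And>\<phi>. \<phi> \<in> test_functions \<Omega> \<Longrightarrow> (\<integral>x. h x * \<phi> x \<partial>M) = 0"
  shows "AE x in M. h x = 0"
proof (rule AE_M_compact_exhaustion)
  fix K assume K: "compact K" "K \<subseteq> \<Omega>"
  obtain K' N where K': "compact K'" "K' \<subseteq> \<Omega>" "K \<subseteq> K'"
    and zero: "\<forall>n f x. N \<le> n \<longrightarrow> (\<forall>y. y \<notin> K \<longrightarrow> f y = 0) \<longrightarrow> x \<notin> K' \<longrightarrow> mollify n f x = 0"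
    and test: "\<forall>n f. N \<le> n \<longrightarrow> sq_integrable M f \<longrightarrow> (\<forall>y. y \<notin> K \<longrightarrow> f y = 0) \<longrightarrow> mollify n f \<in> test_functions \<Omega>"
    by (rule mollify_compact[OF K]) (rule that; assumption)
  define h' where "h' x = indicator K' x * h x" for x
  have h': "integrable M h'" unfolding h'_def by (rule integrable_M_compact[OF h K'(1,2)])
  then have [measurable]: "h' \<in> borel_measurable M" by auto
  have Ks[measurable]: "(indicator K :: real^'n \<Rightarrow> real) \<in> borel_measurable M"
    by (rule borel_imp_measurable, rule borel_measurable_indicator) (rule borel_closed[OF compact_imp_closed[OF K(1)]])
  define s where "s x = indicator K x * sgn (h' x)" for x
  have sm[measurable]: "s \<in> borel_measurable M" unfolding s_def by measurable
  have sb: "\<bar>s x\<bar> \<le> 1" for x by (auto simp: s_def indicator_def sgn_if)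
  have ss: "sq_integrable M s" by (rule fm.sq_integrable_bounded[OF sm sb])
  have s0: "s y = 0" if "y \<notin> K" for y using that by (simp add: s_def)
  obtain r where r: "strict_mono r" "AE x in M. (\<lambda>n. mollify (r n) s x) \<longlonglongrightarrow> s x"
    by (rule L2_lim_AE_subseq[OF mollify_L2_lim[OF ss]]) (rule that)
  have mm[measurable]: "mollify n s \<in> borel_measurable M" for n
    using mollify_sq_integrable[OF ss] by (simp add: sq_integrable_def)
  have "(\<lambda>n. \<integral>x. h' x * mollify (r n) s x \<partial>M) \<longlonglongrightarrow> (\<integral>x. h' x * s x \<partial>M)"
  proof (rule integral_dominated_convergence[where w="\<lambda>x. \<bar>h' x\<bar>"])
    show "AE x in M. (\<lambda>n. h' x * mollify (r n) s x) \<longlonglongrightarrow> h' x * s x"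
      using r(2) by eventually_elim (intro tendsto_intros)
    have "\<bar>mollify n s x\<bar> \<le> 1" for n x by (rule mollify_bound[OF sm]) (use sb in auto)
    then show "AE x in M. norm (h' x * mollify (r n) s x) \<le> \<bar>h' x\<bar>" for n
      by (intro AE_I2) (simp add: abs_mult mult_left_le)
    show "integrable M (\<lambda>x. \<bar>h' x\<bar>)" using h' by simp
  qed measurable
  moreover have "(\<integral>x. h' x * mollify (r n) s x \<partial>M) = 0" if "n \<ge> N" for n
  proof -
    have rn: "r n \<ge> N" using that strict_mono_imp_increasing[OF r(1), of n] by linarith
    have eq: "h' x * mollify (r n) s x = h x * mollify (r n) s x" for x
      using zero rn s0 by (cases "x \<in> K'") (auto simp: h'_def)
    have "mollify (r n) s \<in> test_functions \<Omega>" using test rn ss s0 by blast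
    then show ?thesis unfolding eq by (rule z)
  qed
  then have "(\<lambda>n. \<integral>x. h' x * mollify (r n) s x \<partial>M) \<longlonglongrightarrow> 0"
    by (intro tendsto_eventually eventually_sequentiallyI[of N]) auto
  ultimately have "(\<integral>x. h' x * s x \<partial>M) = 0" using LIMSEQ_unique by blast
  moreover have "h' x * s x \<ge> 0" for x
    by (auto simp: s_def indicator_def sgn_if)
  moreover have "integrable M (\<lambda>x. h' x * s x)"
    by (rule Bochner_Integration.integrable_bound[OF h']) (use sb in \<open>auto simp: abs_mult mult_left_le\<close>)
  ultimately have "AE x in M. h' x * s x = 0"
    using integral_nonneg_eq_0_iff_AE[of M "\<lambda>x. h' x * s x"] by auto
  then show "AE x in M. x \<in> K \<longrightarrow> h x = 0"
    by eventually_elim (use K'(3) in \<open>auto simp: s_def h'_def sgn_if split: if_splits\<close>)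
qed

lemma sq_locally_integrable:
  assumes "sq_integrable M f" shows "locally_integrable \<Omega> f"
  unfolding locally_integrable_def
proof (intro allI impI)
  fix K assume K: "compact K \<and> K \<subseteq> \<Omega>"
  have "integrable M f" using assms by (rule fm.sq_integrable_integrable)
  then have "set_integrable lebesgue \<Omega> f" unfolding set_integrable_def by (subst (asm) integrable_restrict_space) auto
  then show "set_integrable lebesgue K f"
    by (rule set_integrable_subset) (use K in \<open>auto simp: lmeasurable_compact fmeasurableD\<close>)
qed

lemma L2_iff: "f \<in> L2 \<Omega> \<longleftrightarrow> sq_integrable M f" for f :: "real^'n \<Rightarrow> real"
  by (simp add: L2_def sq_integrable_def)

lemma wd_imp_weak: "wd i f g \<Longrightarrow> has_weak_pderiv \<Omega> i f g"
  by (auto simp: wd_def has_weak_pderiv_def sq_locally_integrable)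

lemma weak_imp_wd: "has_weak_pderiv \<Omega> i f g \<Longrightarrow> sq_integrable M f \<Longrightarrow> sq_integrable M g \<Longrightarrow> wd i f g"
  by (auto simp: wd_def has_weak_pderiv_def)

lemma integrable_test_mult:
  assumes "locally_integrable \<Omega> g" "\<phi> \<in> test_functions \<Omega>"
  shows "integrable M (\<lambda>x. g x * \<phi> x)"
proof -
  obtain K where K: "compact K" "K \<subseteq> \<Omega>" "\<And>x. x \<notin> K \<Longrightarrow> \<phi> x = 0" using test_functionsD(2)[OF assms(2)] by blast
  have "integrable M (\<lambda>x. \<phi> x * (indicator K x * g x))"
    by (intro continuous_mult_integrable test_continuous assms integrable_M_compact K)
  moreover have "\<phi> x * (indicator K x * g x) = g x * \<phi> x" for x using K(3) by (cases "x \<in> K") auto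
  ultimately show ?thesis by simp
qed

lemma weak_pderiv_unique:
  assumes "has_weak_pderiv \<Omega> i f g" "has_weak_pderiv \<Omega> i f g'"
  shows "AE x in M. g x = g' x"
proof -
  have l: "locally_integrable \<Omega> g" "locally_integrable \<Omega> g'" using assms by (auto simp: has_weak_pderiv_def)
  have "AE x in M. g x - g' x = 0"
  proof (rule fundamental_lemma)
    show "locally_integrable \<Omega> (\<lambda>x. g x - g' x)"
      using l unfolding locally_integrable_def set_integrable_def right_diff_distrib real_scaleR_def
      by (auto intro!: Bochner_Integration.integrable_diff)
    fix \<phi> assume p: "\<phi> \<in> test_functions \<Omega>"
    have "(\<integral>x. g x * \<phi> x \<partial>M) = (\<integral>x. g' x * \<phi> x \<partial>M)"
      using assms p by (auto simp: has_weak_pderiv_def)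
    then show "(\<integral>x. (g x - g' x) * \<phi> x \<partial>M) = 0"
      using integrable_test_mult[OF l(1) p] integrable_test_mult[OF l(2) p] by (simp add: left_diff_distrib)
  qed
  then show ?thesis by simp
qed

text \<open>Completeness of Lebesgue measure. This makes arbitrary representatives, such as those
  picked by \<open>weak_pderiv\<close>, measurable.\<close>

lemma complete_AE_measurable:
  fixes f g :: "real^'n \<Rightarrow> real"
  assumes "f \<in> borel_measurable M" "AE x in M. f x = g x"
  shows "g \<in> borel_measurable M"
proof -
  define f' where "f' x = (if x \<in> \<Omega> then f x else 0)" for x
  define g' where "g' x = (if x \<in> \<Omega> then g x else 0)" for x
  have "f' \<in> borel_measurable lebesgue" unfolding f'_def using assms(1) by (simp add: borel_measurable_if_I)
  moreover have "AE x in lebesgue. f' x = g' x"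
    using assms(2) by (subst (asm) AE_restrict_space_iff) (auto simp: f'_def g'_def)
  ultimately have "g' \<in> borel_measurable lebesgue"
    by (rule borel_measurable_AE)
  then show ?thesis unfolding g'_def by (rule borel_measurable_if_D)
qed

text \<open>The chosen representative is a priori only locally integrable; uniqueness identifies it
  almost everywhere with the given square integrable derivative.\<close>

lemma weak_pderiv_wd:
  assumes "wd i f g"
  shows "wd i f (weak_pderiv \<Omega> i f)" "AE x in M. weak_pderiv \<Omega> i f x = g x"
proof -
  have w: "has_weak_pderiv \<Omega> i f (weak_pderiv \<Omega> i f)"
    unfolding weak_pderiv_def by (rule someI[where P="has_weak_pderiv \<Omega> i f", OF wd_imp_weak[OF assms]])
  have a: "AE x in M. g x = weak_pderiv \<Omega> i f x"
    by (rule weak_pderiv_unique[OF wd_imp_weak[OF assms] w])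
  have "sq_integrable M (weak_pderiv \<Omega> i f)"
    by (rule sq_integrable_AE_cong[OF wdD(2)[OF assms]
          complete_AE_measurable[OF sq_integrable_measurable[OF wdD(2)[OF assms]] a] a])
  then show "wd i f (weak_pderiv \<Omega> i f)" using weak_imp_wd[OF w] wdD(1)[OF assms] by blast
  show "AE x in M. weak_pderiv \<Omega> i f x = g x" using a by auto
qed

lemma wd_unique: "wd i f g \<Longrightarrow> wd i f g' \<Longrightarrow> AE x in M. g x = g' x"
  by (intro weak_pderiv_unique wd_imp_weak)

lemma wd_add:
  assumes "wd i f f'" "wd i g g'" shows "wd i (\<lambda>x. f x + g x) (\<lambda>x. f' x + g' x)"
  unfolding wd_def
proof (intro conjI ballI)
  show "sq_integrable M (\<lambda>x. f x + g x)" "sq_integrable M (\<lambda>x. f' x + g' x)"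
    using assms by (auto simp: wd_def intro: sq_integrable_add)
  fix \<phi> assume p: "\<phi> \<in> test_functions \<Omega>"
  note s = test_sq[OF p] test_sq[OF test_functions_pderiv[OF p], of i]
  show "(\<integral>x. (f x + g x) * pderiv_at i \<phi> x \<partial>M) = - (\<integral>x. (f' x + g' x) * \<phi> x \<partial>M)"
    using wdD(3)[OF assms(1) p] wdD(3)[OF assms(2) p] wdD(1,2)[OF assms(1)] wdD(1,2)[OF assms(2)] s
    by (simp add: distrib_right sq_integrable_mult)
qed

lemma wd_cmult:
  assumes "wd i f f'" shows "wd i (\<lambda>x. c * f x) (\<lambda>x. c * f' x)"
  using assms by (auto simp: wd_def mult.assoc intro: sq_integrable_cmult)

lemma wd_diff:
  assumes "wd i f f'" "wd i g g'" shows "wd i (\<lambda>x. f x - g x) (\<lambda>x. f' x - g' x)"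
  using wd_add[OF assms(1) wd_cmult[OF assms(2), of "-1"]] by simp

lemma wd_0: "wd i (\<lambda>x. 0) (\<lambda>x. 0)"
  by (simp add: wd_def)

lemma wd_sum:
  assumes "\<And>a. a \<in> A \<Longrightarrow> wd i (f a) (f' a)" shows "wd i (\<lambda>x. \<Sum>a\<in>A. f a x) (\<lambda>x. \<Sum>a\<in>A. f' a x)"
  using assms by (induction A rule: infinite_finite_induct) (auto intro: wd_add wd_0)

lemma wd_classical:
  assumes f: "C_k (Suc 0) f" shows "wd i f (pderiv_at i f)"
  unfolding wd_def
proof (intro conjI ballI)
  have cf: "continuous_on UNIV f" and cp: "continuous_on UNIV (pderiv_at i f)"
    using C_k_continuous[OF f] f by auto
  show "sq_integrable M f" "sq_integrable M (pderiv_at i f)"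
    using cf cp by (auto intro: continuous_sq_integrable)
  fix \<phi> assume p: "\<phi> \<in> test_functions \<Omega>"
  obtain K where K: "compact K" "K \<subseteq> \<Omega>" "\<And>x. x \<notin> K \<Longrightarrow> \<phi> x = 0" using test_functionsD(2)[OF p] by blast
  have p1: "C_k (Suc 0) \<phi>" using p by (rule test_functionsD)
  have cpp: "continuous_on UNIV (pderiv_at i \<phi>)" using p1 by simp
  have p0: "\<phi> x = 0" "pderiv_at i \<phi> x = 0" if "x \<notin> \<Omega>" for x
  proof -
    have "x \<notin> K" using that K(2) by blast
    then show "\<phi> x = 0" "pderiv_at i \<phi> x = 0"
      using K(3) by (simp_all add: pderiv_eq_0_outside[OF K(1,3)])
  qed
  have eq: "pderiv_at i (\<lambda>x. f x * \<phi> x) x = f x * pderiv_at i \<phi> x + pderiv_at i f x * \<phi> x" for x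
    using f p1 by (intro pderiv_at_mult) auto
  have "(\<integral>x. pderiv_at i (\<lambda>x. f x * \<phi> x) x \<partial>lborel) = 0"
    using K by (intro integral_pderiv_compact_support[of _ K] C_k_mult f p1) auto
  then have "(\<integral>x. f x * pderiv_at i \<phi> x + pderiv_at i f x * \<phi> x \<partial>M) = 0"
    unfolding eq using cf cp cpp test_continuous[OF p] p0
    by (subst integral_eq_lborel) (auto intro!: continuous_intros)
  moreover have "integrable M (\<lambda>x. f x * pderiv_at i \<phi> x)" "integrable M (\<lambda>x. pderiv_at i f x * \<phi> x)"
    using cf cp cpp test_continuous[OF p] by (auto intro!: sq_integrable_mult continuous_sq_integrable)
  ultimately show "(\<integral>x. f x * pderiv_at i \<phi> x \<partial>M) = - (\<integral>x. pderiv_at i f x * \<phi> x \<partial>M)" by simp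
qed

text \<open>Mollifying the compactly supported factor gives test functions whose derivatives are the
  mollified weak derivatives, so the defining identity for \<open>g\<close> applies and passes to
  the limit.\<close>

lemma integration_by_parts_compact:
  assumes K: "compact K" "K \<subseteq> \<Omega>" and f: "wd i f f'" "\<And>x. x \<notin> K \<Longrightarrow> f x = 0" "\<And>x. x \<notin> K \<Longrightarrow> f' x = 0"
    and g: "wd i g g'"
  shows "(\<integral>x. g x * f' x \<partial>M) = - (\<integral>x. g' x * f x \<partial>M)"
proof -
  obtain K' N where K': "compact K'" "K' \<subseteq> \<Omega>" "K \<subseteq> K'"
    and test: "\<forall>n f. N \<le> n \<longrightarrow> sq_integrable M f \<longrightarrow> (\<forall>y. y \<notin> K \<longrightarrow> f y = 0) \<longrightarrow> mollify n f \<in> test_functions \<Omega>"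
    and pd: "\<forall>n f i f' x. N \<le> n \<longrightarrow> wd i f f' \<longrightarrow> (\<forall>y. y \<notin> K \<longrightarrow> f y = 0) \<longrightarrow> (\<forall>y. y \<notin> K \<longrightarrow> f' y = 0) \<longrightarrow>
      pderiv_at i (mollify n f) x = mollify n f' x"
    by (rule mollify_compact[OF K]) (rule that; assumption)
  note fs = wdD(1,2)[OF f(1)] and gs = wdD(1,2)[OF g]
  have 1: "(\<lambda>n. \<integral>x. mollify n f' x * g x \<partial>M) \<longlonglongrightarrow> (\<integral>x. f' x * g x \<partial>M)"
    by (rule L2_lim_product_const[OF mollify_L2_lim[OF fs(2)] gs(1)])
  have 2: "(\<lambda>n. - (\<integral>x. mollify n f x * g' x \<partial>M)) \<longlonglongrightarrow> - (\<integral>x. f x * g' x \<partial>M)"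
    by (rule tendsto_minus[OF L2_lim_product_const[OF mollify_L2_lim[OF fs(1)] gs(2)]])
  have "(\<integral>x. mollify n f' x * g x \<partial>M) = - (\<integral>x. mollify n f x * g' x \<partial>M)" if n: "n \<ge> N" for n
  proof -
    have t: "mollify n f \<in> test_functions \<Omega>" using test n fs(1) f(2) by blast
    have "pderiv_at i (mollify n f) x = mollify n f' x" for x using pd n f by blast
    then show ?thesis using wdD(3)[OF g t] by (simp add: mult.commute)
  qed
  then have "(\<lambda>n. \<integral>x. mollify n f' x * g x \<partial>M) \<longlonglongrightarrow> - (\<integral>x. f x * g' x \<partial>M)"
    by (intro Lim_transform_eventually[OF 2] eventually_sequentiallyI[of N]) simp
  then show ?thesis using LIMSEQ_unique[OF 1] by (simp add: mult.commute)
qed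

text \<open>With \<open>a\<close> only of class C^1 the product of \<open>a\<close> and a test
  function is no longer a test function; it is an admissible compactly supported factor in the
  previous integration by parts.\<close>

lemma wd_mult_C1:
  assumes f: "wd i f g" and a: "C_k (Suc 0) a"
  shows "wd i (\<lambda>x. a x * f x) (\<lambda>x. a x * g x + pderiv_at i a x * f x)"
  unfolding wd_def
proof (intro conjI ballI)
  have ca: "continuous_on UNIV a" and cp: "continuous_on UNIV (pderiv_at i a)"
    using C_k_continuous[OF a] a by auto
  show s: "sq_integrable M (\<lambda>x. a x * f x)" "sq_integrable M (\<lambda>x. a x * g x + pderiv_at i a x * f x)"
    using wdD(1,2)[OF f] ca cp by (auto intro!: continuous_mult_sq_integrable sq_integrable_add)
  fix \<phi> assume p: "\<phi> \<in> test_functions \<Omega>"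
  obtain K where K: "compact K" "K \<subseteq> \<Omega>" "\<And>x. x \<notin> K \<Longrightarrow> \<phi> x = 0" using test_functionsD(2)[OF p] by blast
  have p1: "C_k (Suc 0) \<phi>" using p by (rule test_functionsD)
  have eq: "pderiv_at i (\<lambda>x. a x * \<phi> x) x = a x * pderiv_at i \<phi> x + pderiv_at i a x * \<phi> x" for x
    using a p1 by (intro pderiv_at_mult) auto
  have w: "wd i (\<lambda>x. a x * \<phi> x) (\<lambda>x. a x * pderiv_at i \<phi> x + pderiv_at i a x * \<phi> x)"
    using wd_classical[OF C_k_mult[OF a p1], of i] unfolding eq[abs_def] .
  have "(\<integral>x. f x * (a x * pderiv_at i \<phi> x + pderiv_at i a x * \<phi> x) \<partial>M) = - (\<integral>x. g x * (a x * \<phi> x) \<partial>M)"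
    using K pderiv_eq_0_outside[OF K(1,3)] by (intro integration_by_parts_compact[OF K(1,2) w _ _ f]) auto
  moreover have "integrable M (\<lambda>x. a x * (pderiv_at i \<phi> x * f x))" "integrable M (\<lambda>x. pderiv_at i a x * (\<phi> x * f x))"
    "integrable M (\<lambda>x. a x * (\<phi> x * g x))"
    by (intro continuous_mult_integrable sq_integrable_mult ca cp wdD(1,2)[OF f] test_sq[OF p] test_sq[OF test_functions_pderiv[OF p]])+
  ultimately show "(\<integral>x. a x * f x * pderiv_at i \<phi> x \<partial>M) = - (\<integral>x. (a x * g x + pderiv_at i a x * f x) * \<phi> x \<partial>M)"
    by (simp add: algebra_simps)
qed

lemma sq_integrable_cong_AE:
  assumes "sq_integrable M f" "AE x in M. f x = g x" shows "sq_integrable M g"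
  using sq_integrable_AE_cong[OF assms(1) complete_AE_measurable[OF sq_integrable_measurable[OF assms(1)] assms(2)] assms(2)] .

lemma wd_cong_AE:
  assumes "wd i f g" "AE x in M. g x = g' x"
  shows "wd i f g'"
proof -
  have g': "sq_integrable M g'" by (rule sq_integrable_cong_AE[OF wdD(2)[OF assms(1)] assms(2)])
  then have gm: "g' \<in> borel_measurable M" by (rule sq_integrable_measurable)
  have "(\<integral>x. g' x * \<phi> x \<partial>M) = (\<integral>x. g x * \<phi> x \<partial>M)" if "\<phi> \<in> test_functions \<Omega>" for \<phi>
    using assms(2) gm wdD(2)[OF assms(1)] test_sq[OF that]
    by (intro integral_cong_AE) (auto simp: sq_integrable_def)
  then show ?thesis using assms(1) g' by (auto simp: wd_def)
qed

section \<open>Functions with square integrable gradient\<close>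

definition H1 :: "(real^'n \<Rightarrow> real) \<Rightarrow> ('n \<Rightarrow> real^'n \<Rightarrow> real) \<Rightarrow> bool" where
  "H1 f F \<longleftrightarrow> (\<forall>i. wd i f (F i))"

lemma H1_wd: "H1 f F \<Longrightarrow> wd i f (F i)" by (simp add: H1_def)

lemma H1_sq: "H1 f F \<Longrightarrow> sq_integrable M f" "H1 f F \<Longrightarrow> sq_integrable M (F i)"
  by (auto simp: H1_def wd_def)

lemma H1_unique: "H1 f F \<Longrightarrow> H1 f G \<Longrightarrow> AE x in M. F i x = G i x"
  by (rule wd_unique[of i f]) (simp_all add: H1_def)

lemma H1_0: "H1 (\<lambda>x. 0) (\<lambda>i x. 0)" by (simp add: H1_def wd_0)

lemma H1_add: "H1 f F \<Longrightarrow> H1 g G \<Longrightarrow> H1 (\<lambda>x. f x + g x) (\<lambda>i x. F i x + G i x)"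
  by (auto simp: H1_def intro: wd_add)

lemma H1_diff: "H1 f F \<Longrightarrow> H1 g G \<Longrightarrow> H1 (\<lambda>x. f x - g x) (\<lambda>i x. F i x - G i x)"
  by (auto simp: H1_def intro: wd_diff)

lemma H1_cmult: "H1 f F \<Longrightarrow> H1 (\<lambda>x. c * f x) (\<lambda>i x. c * F i x)"
  by (auto simp: H1_def intro: wd_cmult)

lemma H1_sum: "(\<And>a. a \<in> A \<Longrightarrow> H1 (f a) (F a)) \<Longrightarrow> H1 (\<lambda>x. \<Sum>a\<in>A. f a x) (\<lambda>i x. \<Sum>a\<in>A. F a i x)"
  by (auto simp: H1_def intro: wd_sum)

lemma H1_classical: "C_k (Suc 0) f \<Longrightarrow> H1 f (\<lambda>i. pderiv_at i f)"
  by (auto simp: H1_def intro: wd_classical)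

lemma H1_mult: "H1 f F \<Longrightarrow> C_k (Suc 0) a \<Longrightarrow> H1 (\<lambda>x. a x * f x) (\<lambda>i x. a x * F i x + pderiv_at i a x * f x)"
  by (auto simp: H1_def intro: wd_mult_C1)

lemma H1_compact_support_parts:
  assumes K: "compact K" "K \<subseteq> \<Omega>" and f: "H1 f F" and a: "C_k (Suc 0) a" "\<And>x. x \<in> \<Omega> \<Longrightarrow> x \<notin> K \<Longrightarrow> a x = 0"
    "\<And>x. x \<in> \<Omega> \<Longrightarrow> x \<notin> K \<Longrightarrow> pderiv_at i a x = 0" and g: "H1 g G"
  shows "(\<integral>x. g x * (a x * F i x + pderiv_at i a x * f x) \<partial>M) = - (\<integral>x. G i x * (a x * f x) \<partial>M)"
proof -
  \<comment> \<open>Outside the domain the values are arbitrary; setting them to zero gives the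
    global support condition and changes no integral over the domain.\<close>
  define r where "r h x = (if x \<in> \<Omega> then h x else 0)" for h :: "real^'n \<Rightarrow> real" and x
  have w: "wd i (\<lambda>x. a x * f x) (\<lambda>x. a x * F i x + pderiv_at i a x * f x)"
    using f a(1) by (auto simp: H1_def intro: wd_mult_C1)
  have r: "(\<integral>x. r h x * k x \<partial>M) = (\<integral>x. h x * k x \<partial>M)" "(\<integral>x. k x * r h x \<partial>M) = (\<integral>x. k x * h x \<partial>M)" for h k
    by (intro Bochner_Integration.integral_cong; simp add: r_def)+
  have sr: "sq_integrable M (r h)" if "sq_integrable M h" for h
  proof -
    have "r h \<in> borel_measurable M \<longleftrightarrow> h \<in> borel_measurable M" by (rule measurable_cong) (simp add: r_def)
    moreover have "integrable M (\<lambda>x. (r h x)\<^sup>2) \<longleftrightarrow> integrable M (\<lambda>x. (h x)\<^sup>2)"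
      by (rule Bochner_Integration.integrable_cong) (auto simp: r_def)
    ultimately show ?thesis using that by (simp add: sq_integrable_def)
  qed
  have "wd i (r (\<lambda>x. a x * f x)) (r (\<lambda>x. a x * F i x + pderiv_at i a x * f x))"
    using w unfolding wd_def r by (auto intro: sr)
  from integration_by_parts_compact[OF K this _ _ H1_wd[OF g]]
  have "(\<integral>x. g x * r (\<lambda>x. a x * F i x + pderiv_at i a x * f x) x \<partial>M) = - (\<integral>x. G i x * r (\<lambda>x. a x * f x) x \<partial>M)"
    using a K(2) by (auto simp: r_def)
  then show ?thesis unfolding r .
qed

section \<open>Zero boundary values\<close>

text \<open>Vanishing boundary values are expressed by integration by parts without a boundary term.\<close>
definition zero_trace :: "(real^'n \<Rightarrow> real) \<Rightarrow> bool" where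
  "zero_trace f \<longleftrightarrow> (\<exists>F. H1 f F \<and> (\<forall>\<psi> \<Psi> i. H1 \<psi> \<Psi> \<longrightarrow> (\<integral>x. f x * \<Psi> i x \<partial>M) = - (\<integral>x. F i x * \<psi> x \<partial>M)))"

lemma zero_traceI:
  assumes "H1 f F" "\<And>\<psi> \<Psi> i. H1 \<psi> \<Psi> \<Longrightarrow> (\<integral>x. f x * \<Psi> i x \<partial>M) = - (\<integral>x. F i x * \<psi> x \<partial>M)"
  shows "zero_trace f"
  using assms unfolding zero_trace_def by blast

text \<open>Gradients are unique almost everywhere, so the identity can be used with whichever
  gradient is at hand.\<close>

lemma zero_traceD:
  assumes "zero_trace f" "H1 f F" "H1 \<psi> \<Psi>"
  shows "(\<integral>x. f x * \<Psi> i x \<partial>M) = - (\<integral>x. F i x * \<psi> x \<partial>M)"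
proof -
  obtain F' where F': "H1 f F'" "\<And>\<psi> \<Psi> i. H1 \<psi> \<Psi> \<Longrightarrow> (\<integral>x. f x * \<Psi> i x \<partial>M) = - (\<integral>x. F' i x * \<psi> x \<partial>M)"
    using assms(1) unfolding zero_trace_def by blast
  have "(\<integral>x. F' i x * \<psi> x \<partial>M) = (\<integral>x. F i x * \<psi> x \<partial>M)"
    using H1_unique[OF F'(1) assms(2), of i] H1_sq(2)[OF F'(1), of i] H1_sq(2)[OF assms(2), of i] H1_sq(1)[OF assms(3)]
    by (intro integral_cong_AE) (auto simp: sq_integrable_def)
  then show ?thesis using F'(2)[OF assms(3)] by simp
qed

lemma zero_trace_H1: "zero_trace f \<Longrightarrow> \<exists>F. H1 f F"
  unfolding zero_trace_def by blast

lemma zero_trace_add: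
  assumes "zero_trace f" "zero_trace g" shows "zero_trace (\<lambda>x. f x + g x)"
proof -
  obtain F G where FG: "H1 f F" "H1 g G" using assms zero_trace_H1 by blast
  show ?thesis
  proof (rule zero_traceI[OF H1_add[OF FG]])
    fix \<psi> \<Psi> i assume p: "H1 \<psi> \<Psi>"
    show "(\<integral>x. (f x + g x) * \<Psi> i x \<partial>M) = - (\<integral>x. (F i x + G i x) * \<psi> x \<partial>M)"
      using zero_traceD[OF assms(1) FG(1) p, of i] zero_traceD[OF assms(2) FG(2) p, of i] H1_sq[OF FG(1)] H1_sq[OF FG(2)] H1_sq[OF p]
      by (simp add: distrib_right sq_integrable_mult)
  qed
qed

lemma zero_trace_0: "zero_trace (\<lambda>x. 0)"
  by (rule zero_traceI[OF H1_0]) simp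

lemma zero_trace_sum: "(\<And>a. a \<in> A \<Longrightarrow> zero_trace (f a)) \<Longrightarrow> zero_trace (\<lambda>x. \<Sum>a\<in>A. f a x)"
  by (induction A rule: infinite_finite_induct) (auto intro: zero_trace_add zero_trace_0)

text \<open>The factor \<open>a\<close> is moved onto \<psi>, since \<open>a\<close> times \<psi> is
  again an admissible test partner.\<close>

lemma zero_trace_mult:
  assumes "zero_trace f" and a: "C_k (Suc 0) a" shows "zero_trace (\<lambda>x. a x * f x)"
proof -
  obtain F where F: "H1 f F" using assms zero_trace_H1 by blast
  have ca: "continuous_on UNIV a" and cp: "continuous_on UNIV (pderiv_at i a)" for i
    using C_k_continuous[OF a] a by auto
  show ?thesis
  proof (rule zero_traceI[OF H1_mult[OF F a]])
    fix \<psi> \<Psi> i assume p: "H1 \<psi> \<Psi>"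
    have "(\<integral>x. f x * (a x * \<Psi> i x + pderiv_at i a x * \<psi> x) \<partial>M) = - (\<integral>x. F i x * (a x * \<psi> x) \<partial>M)"
      using zero_traceD[OF assms(1) F H1_mult[OF p a], of i] .
    moreover have "integrable M (\<lambda>x. a x * (f x * \<Psi> i x))" "integrable M (\<lambda>x. pderiv_at i a x * (f x * \<psi> x))"
      "integrable M (\<lambda>x. a x * (F i x * \<psi> x))"
      by (intro continuous_mult_integrable sq_integrable_mult ca cp H1_sq[OF F] H1_sq[OF p])+
    ultimately show "(\<integral>x. a x * f x * \<Psi> i x \<partial>M) = - (\<integral>x. (a x * F i x + pderiv_at i a x * f x) * \<psi> x \<partial>M)"
      by (simp add: algebra_simps)
  qed
qed

lemma zero_trace_cmult: "zero_trace f \<Longrightarrow> zero_trace (\<lambda>x. c * f x)"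
  by (intro zero_trace_mult C_k_const)

lemma zero_trace_diff: "zero_trace f \<Longrightarrow> zero_trace g \<Longrightarrow> zero_trace (\<lambda>x. f x - g x)"
  using zero_trace_add[of f "\<lambda>x. -1 * g x"] zero_trace_cmult[of g "-1"] by simp

lemma zero_trace_limit:
  assumes F: "H1 f F" and z: "\<And>n. zero_trace (f' n)" "\<And>n. H1 (f' n) (F' n)"
    and l: "L2_lim M f' f" "\<And>i. L2_lim M (\<lambda>n. F' n i) (F i)"
  shows "zero_trace f"
proof (rule zero_traceI[OF F])
  fix \<psi> \<Psi> i assume p: "H1 \<psi> \<Psi>"
  have "(\<lambda>n. \<integral>x. f' n x * \<Psi> i x \<partial>M) \<longlonglongrightarrow> (\<integral>x. f x * \<Psi> i x \<partial>M)"
    by (intro L2_lim_product_const l H1_sq[OF p])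
  moreover have "(\<lambda>n. - (\<integral>x. F' n i x * \<psi> x \<partial>M)) \<longlonglongrightarrow> - (\<integral>x. F i x * \<psi> x \<partial>M)"
    by (intro tendsto_minus L2_lim_product_const l H1_sq[OF p])
  moreover have "(\<integral>x. f' n x * \<Psi> i x \<partial>M) = - (\<integral>x. F' n i x * \<psi> x \<partial>M)" for n
    by (rule zero_traceD[OF z p])
  ultimately show "(\<integral>x. f x * \<Psi> i x \<partial>M) = - (\<integral>x. F i x * \<psi> x \<partial>M)"
    using LIMSEQ_unique by simp
qed

lemma zero_trace_test:
  assumes "\<phi> \<in> test_functions \<Omega>" shows "zero_trace \<phi>"
proof (rule zero_traceI[OF H1_classical[OF test_functionsD(1)[OF assms]]])
  fix \<psi> \<Psi> i assume p: "H1 \<psi> \<Psi>"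
  show "(\<integral>x. \<phi> x * \<Psi> i x \<partial>M) = - (\<integral>x. pderiv_at i \<phi> x * \<psi> x \<partial>M)"
    using wdD(3)[OF H1_wd[OF p, of i] assms] by (simp add: mult.commute)
qed

lemma sobolev_1_iff: "f \<in> sobolev 1 \<Omega> \<longleftrightarrow> (\<exists>F. H1 f F)"
proof
  assume "f \<in> sobolev 1 \<Omega>"
  then have "sq_integrable M f" "\<forall>i. \<exists>g. sq_integrable M g \<and> has_weak_pderiv \<Omega> i f g"
    by (auto simp: L2_iff Bex_def)
  then have "\<forall>i. \<exists>g. wd i f g" using weak_imp_wd by blast
  then show "\<exists>F. H1 f F" unfolding H1_def by (rule choice)
next
  assume "\<exists>F. H1 f F"
  then obtain F where F: "H1 f F" by blast
  have "\<exists>g\<in>L2 \<Omega>. has_weak_pderiv \<Omega> i f g" for i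
    using H1_sq(2)[OF F] wd_imp_weak[OF H1_wd[OF F]] unfolding L2_iff[symmetric] by blast
  then show "f \<in> sobolev 1 \<Omega>" using H1_sq(1)[OF F] by (auto simp: L2_iff)
qed

lemma H1_weak_pderiv:
  assumes "H1 f F" shows "H1 f (\<lambda>i. weak_pderiv \<Omega> i f)" "AE x in M. weak_pderiv \<Omega> i f x = F i x"
  using weak_pderiv_wd[OF H1_wd[OF assms]] by (auto simp: H1_def)

lemma nrm2_le_H1_norm:
  assumes "H1 f F" shows "nrm2 M f \<le> H1_norm \<Omega> f" "nrm2 M (F i) \<le> H1_norm \<Omega> f"
proof -
  have w: "L2_inner \<Omega> (weak_pderiv \<Omega> j f) (weak_pderiv \<Omega> j f) = (nrm2 M (F j))\<^sup>2" for j
  proof -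
    have "nrm2 M (weak_pderiv \<Omega> j f) = nrm2 M (F j)"
      using H1_weak_pderiv(2)[OF assms] H1_sq(2)[OF H1_weak_pderiv(1)[OF assms]] H1_sq(2)[OF assms]
      by (intro nrm2_cong_AE) (auto simp: sq_integrable_def)
    then have "(nrm2 M (F j))\<^sup>2 = (nrm2 M (weak_pderiv \<Omega> j f))\<^sup>2" by simp
    then show ?thesis unfolding nrm2_square by (simp add: L2_inner_def power2_eq_square)
  qed
  have e: "H1_norm \<Omega> f = sqrt ((nrm2 M f)\<^sup>2 + (\<Sum>j\<in>UNIV. (nrm2 M (F j))\<^sup>2))"
    unfolding H1_norm_def w unfolding nrm2_square by (simp add: L2_inner_def power2_eq_square)
  show "nrm2 M f \<le> H1_norm \<Omega> f"
    unfolding e by (intro real_le_rsqrt) (simp add: sum_nonneg)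
  have "(nrm2 M (F i))\<^sup>2 \<le> (\<Sum>j\<in>UNIV. (nrm2 M (F j))\<^sup>2)"
    by (rule member_le_sum) auto
  then have "(nrm2 M (F i))\<^sup>2 \<le> (nrm2 M f)\<^sup>2 + (\<Sum>j\<in>UNIV. (nrm2 M (F j))\<^sup>2)"
    using zero_le_power2[of "nrm2 M f"] by linarith
  then show "nrm2 M (F i) \<le> H1_norm \<Omega> f" unfolding e by (rule real_le_rsqrt)
qed

text \<open>For a test function the identity is the definition of the weak derivative of \<psi>, and
  both sides are continuous under convergence of functions and gradients in L^2.\<close>

lemma sobolev_H10_zero_trace:
  assumes "f \<in> sobolev_H10 \<Omega>" shows "zero_trace f"
proof -
  have "f \<in> sobolev 1 \<Omega>" using assms unfolding sobolev_H10_def by blast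
  then obtain F where F: "H1 f F" using sobolev_1_iff by blast
  have "\<forall>n. \<exists>\<phi>\<in>test_functions \<Omega>. H1_norm \<Omega> (\<lambda>x. f x - \<phi> x) < inverse (real (Suc n))"
    using assms by (auto simp: sobolev_H10_def)
  then obtain p where p: "\<And>n. p n \<in> test_functions \<Omega>" "\<And>n. H1_norm \<Omega> (\<lambda>x. f x - p n x) < inverse (real (Suc n))"
    by metis
  have h: "H1 (p n) (\<lambda>i. pderiv_at i (p n))" for n by (rule H1_classical[OF test_functionsD(1)[OF p(1)]])
  note n = nrm2_le_H1_norm[OF H1_diff[OF F h]]
  have i0: "(\<lambda>n. inverse (real (Suc n))) \<longlonglongrightarrow> 0" by (rule LIMSEQ_inverse_real_of_nat)
  show ?thesis
  proof (rule zero_trace_limit[OF F zero_trace_test[OF p(1)] h])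
    have "\<bar>nrm2 M (\<lambda>x. p n x - f x)\<bar> \<le> inverse (real (Suc n))" for n
      using n(1)[of n] p(2)[of n] nrm2_minus_commute[of M "p n" f] by simp
    then show "L2_lim M p f"
      using H1_sq(1)[OF h] H1_sq(1)[OF F] by (auto simp: L2_lim_def intro: tendsto_0_le_real[OF _ i0])
    fix i
    have "\<bar>nrm2 M (\<lambda>x. pderiv_at i (p n) x - F i x)\<bar> \<le> inverse (real (Suc n))" for n
      using n(2)[of i n] p(2)[of n] nrm2_minus_commute[of M "pderiv_at i (p n)" "F i"] by simp
    then show "L2_lim M (\<lambda>n. pderiv_at i (p n)) (F i)"
      using H1_sq(2)[OF h] H1_sq(2)[OF F] by (auto simp: L2_lim_def intro: tendsto_0_le_real[OF _ i0])
  qed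
qed

end

section \<open>Cut-off functions near the boundary\<close>

text \<open>A transition from 0 for \<open>t \<le> 1\<close> to 1 for \<open>t \<ge> 2\<close>, made
  of two nested clippings. Cubes are used because the cut-off has to be C^2, so that its gradient
  factor is C^1 and can itself be differentiated.\<close>

definition step :: "real \<Rightarrow> real" where
  "step t = 1 - (max 0 (1 - (max 0 (t - 1)) ^ 3)) ^ 3"

definition step' :: "real \<Rightarrow> real" where
  "step' t = 9 * (max 0 (1 - (max 0 (t - 1)) ^ 3))\<^sup>2 * (max 0 (t - 1))\<^sup>2"

lemma pos_part_cube_deriv: "((\<lambda>t::real. (max 0 t) ^ 3) has_real_derivative 3 * (max 0 t)\<^sup>2) (at t)"
  using pos_part_power_deriv[of 1 t] by (simp add: numeral_2_eq_2 numeral_3_eq_3)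

lemma pos_part_square_deriv: "((\<lambda>t::real. (max 0 t)\<^sup>2) has_real_derivative 2 * max 0 t) (at t)"
  using pos_part_power_deriv[of 0 t] by (simp add: numeral_2_eq_2)

lemma step_deriv: "(step has_real_derivative step' t) (at t)"
proof -
  have 1: "((\<lambda>t. (max 0 (t - 1)) ^ 3) has_real_derivative 3 * (max 0 (t - 1))\<^sup>2) (at t)"
    using DERIV_chain2[OF pos_part_cube_deriv DERIV_diff[OF DERIV_ident DERIV_const[of 1]]] by simp
  have 2: "((\<lambda>t. 1 - (max 0 (t - 1)) ^ 3) has_real_derivative - (3 * (max 0 (t - 1))\<^sup>2)) (at t)"
    using DERIV_diff[OF DERIV_const 1] by simp
  have "((\<lambda>t. 1 - (max 0 (1 - (max 0 (t - 1)) ^ 3)) ^ 3) has_real_derivative step' t) (at t)"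
    by (rule DERIV_cong[OF DERIV_diff[OF DERIV_const DERIV_chain2[OF pos_part_cube_deriv 2]]]) (simp add: step'_def)
  then show ?thesis unfolding step_def[abs_def] .
qed

lemma step'_deriv: "\<exists>e. (step' has_real_derivative e) (at t)"
proof -
  have 0: "((\<lambda>t::real. t - 1) has_real_derivative 1) (at t)" by (auto intro!: derivative_eq_intros)
  note 1 = DERIV_chain2[OF pos_part_cube_deriv 0]
  note 2 = DERIV_diff[OF DERIV_const[of 1] 1]
  note 3 = DERIV_chain2[OF pos_part_square_deriv 2]
  note 4 = DERIV_chain2[OF pos_part_square_deriv 0]
  show ?thesis unfolding step'_def[abs_def] using DERIV_mult[OF DERIV_cmult[OF 3, of 9] 4] by blast
qed

lemma step_eq_0: "t \<le> 1 \<Longrightarrow> step t = 0" by (simp add: step_def)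

lemma step_eq_1: "t \<ge> 2 \<Longrightarrow> step t = 1"
proof -
  assume "t \<ge> 2"
  then have "1 \<le> (t - 1) ^ 3" by (intro one_le_power) simp
  with \<open>t \<ge> 2\<close> show ?thesis by (simp add: step_def)
qed

lemma step_bounds: "0 \<le> step t" "step t \<le> 1"
proof -
  have "max 0 (1 - (max 0 (t - 1)) ^ 3) \<le> 1" by simp
  then have "(max 0 (1 - (max 0 (t - 1)) ^ 3)) ^ 3 \<le> 1" by (intro power_le_one) auto
  then show "0 \<le> step t" by (simp add: step_def)
  show "step t \<le> 1" by (simp add: step_def)
qed

lemma step'_eq_0: "t \<le> 1 \<or> t \<ge> 2 \<Longrightarrow> step' t = 0"
proof -
  assume t: "t \<le> 1 \<or> t \<ge> 2"
  have "1 \<le> (t - 1) ^ 3" if "t \<ge> 2" using that by (intro one_le_power) simp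
  then show ?thesis using t by (auto simp: step'_def)
qed

lemma step'_bounds: "0 \<le> step' t" "step' t \<le> 9"
proof -
  show "0 \<le> step' t" by (simp add: step'_def)
  show "step' t \<le> 9"
  proof (cases "t \<ge> 2")
    case True
    then show ?thesis using step'_eq_0[of t] by simp
  next
    case False
    have a: "(max 0 (1 - (max 0 (t - 1)) ^ 3))\<^sup>2 \<le> 1" by (intro power_le_one) auto
    have b: "(max 0 (t - 1))\<^sup>2 \<le> 1" using False by (intro power_le_one) auto
    have "(max 0 (1 - (max 0 (t - 1)) ^ 3))\<^sup>2 * (max 0 (t - 1))\<^sup>2 \<le> 1 * 1" using a b by (intro mult_mono) auto
    then show ?thesis by (simp add: step'_def)
  qed
qed

lemma C_k_step: "C_k 2 f \<Longrightarrow> C_k 2 (\<lambda>x. step (f x))"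
proof -
  assume f: "C_k 2 f"
  have p3: "C_k 2 (\<lambda>x. (max 0 (g x)) ^ 3)" if "C_k 2 g" for g :: "real^'a \<Rightarrow> real"
    using C_k_pos_part_power[OF that order_refl] by (simp only: numeral_3_eq_3 numeral_2_eq_2)
  show ?thesis unfolding step_def by (intro C_k_diff C_k_const p3 f)
qed

lemma C_k_step': "C_k 1 f \<Longrightarrow> C_k 1 (\<lambda>x. step' (f x))"
proof -
  assume f: "C_k 1 f"
  have p2: "C_k 1 (\<lambda>x. (max 0 (g x))\<^sup>2)" if "C_k 1 g" for g :: "real^'a \<Rightarrow> real"
    using C_k_pos_part_power[OF that, of 1] by (simp only: Suc_1 order_refl)
  have p3: "C_k 1 (\<lambda>x. (max 0 (g x)) ^ 3)" if "C_k 1 g" for g :: "real^'a \<Rightarrow> real"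
    using C_k_pos_part_power[OF that, of 2] by (simp add: numeral_3_eq_3 numeral_2_eq_2 del: C_k.simps)
  show ?thesis unfolding step'_def by (intro C_k_mult C_k_const p2 p3 C_k_diff f)
qed

section \<open>Calculus with a defining function\<close>

text \<open>\<open>Q\<close> is a separate parameter because |\<nabla>d|^2 + d^2 may vanish far from
  the domain, whereas division by \<open>Q\<close> has to produce C^2 functions on the whole space;
  the formula is imposed only on the domain.\<close>

locale defining_function = bounded_open \<Omega> for \<Omega> :: "(real^'n::finite) set" +
  fixes d Q :: "real^'n \<Rightarrow> real"
  assumes d_C3: "C_k 3 d" and Q_C2: "C_k 2 Q" and Q_pos: "\<And>x. Q x > 0"
    and domain_eq: "\<Omega> = {x. d x > 0}"
    and Q_eq: "\<And>x. x \<in> \<Omega> \<Longrightarrow> Q x = (\<Sum>i\<in>UNIV. (pderiv_at i d x)\<^sup>2) + (d x)\<^sup>2"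
begin

abbreviation N where "N i x \<equiv> pderiv_at i d x"

lemma N_C2: "C_k 2 (N i)" using d_C3 by (simp add: numeral_3_eq_3 numeral_2_eq_2)

lemma N_C1: "C_k (Suc 0) (N i)" by (rule C_k_mono[OF N_C2]) simp

lemma d_Ck: "k \<le> 3 \<Longrightarrow> C_k k d" using C_k_mono[OF d_C3] .

lemma d_differentiable: "d differentiable (at x)" using d_Ck[of "Suc 0"] by simp

lemma N_differentiable: "N i differentiable (at x)" using N_C1 by simp

lemma N_sym: "pderiv_at i (N j) x = pderiv_at j (N i) x"
  by (rule pderiv_at_commute[OF d_Ck]) simp

lemma N_cont: "continuous_on UNIV (N i)" by (rule C_k_continuous[OF N_C2])

lemma d_pos: "x \<in> \<Omega> \<Longrightarrow> d x > 0" by (simp add: domain_eq)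

definition cutoff :: "nat \<Rightarrow> real^'n \<Rightarrow> real" where
  "cutoff k x = step (real (Suc k) * d x)"

text \<open>The gradient of the cut-off is \<open>wgt k x * N i x\<close>. The weight lives in the
  layer where \<open>Suc k * d\<close> lies between 1 and 2 and has size of order \<open>k\<close>,
  so integrals against it are approximate boundary integrals.\<close>

definition wgt :: "nat \<Rightarrow> real^'n \<Rightarrow> real" where
  "wgt k x = real (Suc k) * step' (real (Suc k) * d x)"

lemma cutoff_C2: "C_k 2 (cutoff k)"
  unfolding cutoff_def[abs_def] by (intro C_k_step C_k_cmult d_Ck) simp

lemma cutoff_C1: "C_k (Suc 0) (cutoff k)" by (rule C_k_mono[OF cutoff_C2]) simp

lemma cutoff_cont: "continuous_on UNIV (cutoff k)" by (rule C_k_continuous[OF cutoff_C2])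

lemma wgt_C1: "C_k (Suc 0) (wgt k)"
  unfolding wgt_def[abs_def] One_nat_def[symmetric] by (intro C_k_cmult C_k_step' d_Ck) simp

lemma wgt_cont: "continuous_on UNIV (wgt k)" by (rule C_k_continuous[OF wgt_C1])

lemma pderiv_cutoff: "pderiv_at i (cutoff k) x = wgt k x * N i x"
proof -
  have "pderiv_at i (\<lambda>x. step (real (Suc k) * d x)) x = step' (real (Suc k) * d x) * pderiv_at i (\<lambda>x. real (Suc k) * d x) x"
    by (intro pderiv_at_compose_real(1)[OF step_deriv] differentiable_mult differentiable_const d_differentiable)
  then show ?thesis unfolding cutoff_def[abs_def] wgt_def pderiv_at_cmult[OF d_differentiable] by simp
qed

text \<open>The weight is a function of \<open>d\<close>, so its gradient is parallel to
  \<open>N\<close>; in antisymmetrised tangential derivatives it cancels and its size never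
  matters.\<close>

lemma pderiv_wgt: "\<exists>e. \<forall>i. pderiv_at i (wgt k) x = e * N i x"
proof -
  obtain e where e: "(step' has_real_derivative e) (at (real (Suc k) * d x))" using step'_deriv by blast
  have df: "(\<lambda>x. real (Suc k) * d x) differentiable (at x)"
    by (intro differentiable_mult differentiable_const d_differentiable)
  have "pderiv_at i (wgt k) x = real (Suc k) * (e * (real (Suc k) * N i x))" for i
    unfolding wgt_def[abs_def] pderiv_at_cmult[OF pderiv_at_compose_real(2)[OF e df]]
      pderiv_at_compose_real(1)[OF e df] pderiv_at_cmult[OF d_differentiable] ..
  then show ?thesis by (intro exI[of _ "real (Suc k) * e * real (Suc k)"]) simp
qed

lemma cutoff_support:
  obtains K where "compact K" "K \<subseteq> \<Omega>" "\<And>x. x \<notin> K \<Longrightarrow> cutoff k x = 0" "\<And>x. x \<notin> K \<Longrightarrow> wgt k x = 0"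
proof -
  define K where "K = closure \<Omega> \<inter> {x. 1 \<le> real (Suc k) * d x}"
  have "compact K" unfolding K_def using bounded_domain
    by (intro compact_Int_closed closed_Collect_le continuous_intros C_k_continuous[OF d_C3]) auto
  moreover have "K \<subseteq> \<Omega>"
  proof
    fix x assume "x \<in> K"
    then have "0 < real (Suc k) * d x" by (simp add: K_def)
    then show "x \<in> \<Omega>" by (simp add: domain_eq zero_less_mult_iff)
  qed
  moreover have "cutoff k x = 0 \<and> wgt k x = 0" if "x \<notin> K" for x
  proof -
    have "real (Suc k) * d x \<le> 1"
    proof (rule ccontr)
      assume a: "\<not> real (Suc k) * d x \<le> 1"
      then have "0 < real (Suc k) * d x" by linarith
      then have "x \<in> \<Omega>" by (simp add: domain_eq zero_less_mult_iff)
      then have "x \<in> K" using a closure_subset[of \<Omega>] by (auto simp: K_def)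
      then show False using that by simp
    qed
    then show ?thesis by (simp add: cutoff_def wgt_def step_eq_0 step'_eq_0)
  qed
  ultimately show ?thesis using that by blast
qed

lemma cutoff_eventually:
  assumes "x \<in> \<Omega>" shows "\<exists>k0. \<forall>k\<ge>k0. cutoff k x = 1 \<and> wgt k x = 0"
proof -
  obtain k0 where k0: "2 < real k0 * d x" using reals_Archimedean3[OF d_pos[OF assms]] by blast
  have "2 \<le> real (Suc k) * d x" if "k \<ge> k0" for k
  proof -
    have "real k0 * d x \<le> real (Suc k) * d x" using that d_pos[OF assms] by (intro mult_right_mono) auto
    then show ?thesis using k0 by simp
  qed
  then show ?thesis by (intro exI[of _ k0]) (auto simp: cutoff_def wgt_def step_eq_1 step'_eq_0)
qed

lemma cutoff_limit:
  assumes h: "integrable M h" shows "(\<lambda>k. \<integral>x. cutoff k x * h x \<partial>M) \<longlonglongrightarrow> (\<integral>x. h x \<partial>M)"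
proof (rule integral_dominated_convergence[where w="\<lambda>x. \<bar>h x\<bar>"])
  show "h \<in> borel_measurable M" using h by auto
  then show "(\<lambda>x. cutoff k x * h x) \<in> borel_measurable M" for k
    by (intro borel_measurable_times[OF continuous_measurable[OF cutoff_cont]])
  show "integrable M (\<lambda>x. \<bar>h x\<bar>)" using h by simp
  show "AE x in M. (\<lambda>k. cutoff k x * h x) \<longlonglongrightarrow> h x"
  proof (rule AE_I2)
    fix x assume "x \<in> space M"
    then obtain k0 where "\<forall>k\<ge>k0. cutoff k x = 1 \<and> wgt k x = 0" using cutoff_eventually[of x] by auto
    then show "(\<lambda>k. cutoff k x * h x) \<longlonglongrightarrow> h x"
      by (intro tendsto_eventually eventually_sequentiallyI[of k0]) simp
  qed
  show "AE x in M. norm (cutoff k x * h x) \<le> \<bar>h x\<bar>" for k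
    by (intro AE_I2) (simp add: abs_mult mult_left_le_one_le step_bounds cutoff_def)
qed

text \<open>A factor of order \<open>d\<close> compensates the size of the weight: on the layer
  \<open>Suc k * d < 2\<close> and \<open>step' \<le> 9\<close>, whence the bound \<open>18\<close>.
  At each point the weight is eventually zero, so dominated convergence applies.\<close>

lemma wgt_limit:
  assumes h: "integrable M h" and X: "continuous_on UNIV X" "\<And>x. x \<in> \<Omega> \<Longrightarrow> \<bar>X x\<bar> \<le> A * d x"
  shows "(\<lambda>k. \<integral>x. wgt k x * X x * h x \<partial>M) \<longlonglongrightarrow> 0"
proof -
  have bd: "\<bar>wgt k x * X x\<bar> \<le> 18 * \<bar>A\<bar>" if x: "x \<in> \<Omega>" for k x
  proof (cases "real (Suc k) * d x \<ge> 2")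
    case True
    then show ?thesis by (simp add: wgt_def step'_eq_0)
  next
    case False
    have d0: "d x > 0" using x by (rule d_pos)
    have "\<bar>X x\<bar> \<le> \<bar>A\<bar> * d x" using X(2)[OF x] d0 by (smt (verit) mult_right_mono)
    then have "\<bar>wgt k x\<bar> * \<bar>X x\<bar> \<le> (real (Suc k) * 9) * (\<bar>A\<bar> * d x)"
      unfolding wgt_def abs_mult using step'_bounds[of "real (Suc k) * d x"] by (intro mult_mono) auto
    also have "\<dots> = 9 * \<bar>A\<bar> * (real (Suc k) * d x)" by simp
    also have "\<dots> \<le> 9 * \<bar>A\<bar> * 2" using False by (intro mult_left_mono) auto
    finally show ?thesis by (simp add: abs_mult)
  qed
  have "(\<lambda>k. \<integral>x. wgt k x * X x * h x \<partial>M) \<longlonglongrightarrow> (\<integral>x. 0 \<partial>M)"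
  proof (rule integral_dominated_convergence[where w="\<lambda>x. 18 * \<bar>A\<bar> * \<bar>h x\<bar>"])
    have "h \<in> borel_measurable M" using h by auto
    then show "(\<lambda>x. wgt k x * X x * h x) \<in> borel_measurable M" for k
      by (intro borel_measurable_times[OF borel_measurable_times[OF continuous_measurable[OF wgt_cont] continuous_measurable[OF X(1)]]])
    show "integrable M (\<lambda>x. 18 * \<bar>A\<bar> * \<bar>h x\<bar>)" using h by simp
    show "AE x in M. (\<lambda>k. wgt k x * X x * h x) \<longlonglongrightarrow> 0"
    proof (rule AE_I2)
      fix x assume "x \<in> space M"
      then obtain k0 where "\<forall>k\<ge>k0. cutoff k x = 1 \<and> wgt k x = 0" using cutoff_eventually[of x] by auto
      then show "(\<lambda>k. wgt k x * X x * h x) \<longlonglongrightarrow> 0"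
        by (intro tendsto_eventually eventually_sequentiallyI[of k0]) simp
    qed
    show "AE x in M. norm (wgt k x * X x * h x) \<le> 18 * \<bar>A\<bar> * \<bar>h x\<bar>" for k
      using bd by (intro AE_I2) (auto simp: abs_mult[of _ "h _"] intro!: mult_right_mono)
  qed simp
  then show ?thesis by simp
qed

lemma cutoff_parts:
  assumes f: "H1 f F" and g: "H1 g G" and a: "C_k (Suc 0) a"
  shows "(\<integral>x. g x * (a x * cutoff k x * F i x + (a x * (wgt k x * N i x) + pderiv_at i a x * cutoff k x) * f x) \<partial>M)
    = - (\<integral>x. G i x * (a x * cutoff k x * f x) \<partial>M)"
proof -
  obtain K where K: "compact K" "K \<subseteq> \<Omega>" "\<And>x. x \<notin> K \<Longrightarrow> cutoff k x = 0" "\<And>x. x \<notin> K \<Longrightarrow> wgt k x = 0"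
    by (rule cutoff_support[of k]) (rule that; assumption)
  have eq: "pderiv_at i (\<lambda>x. a x * cutoff k x) x = a x * (wgt k x * N i x) + pderiv_at i a x * cutoff k x" for x
    using a cutoff_C1[of k] by (subst pderiv_at_mult) (auto simp: pderiv_cutoff)
  show ?thesis
    using H1_compact_support_parts[OF K(1,2) f C_k_mult[OF a cutoff_C1[of k]] _ _ g, of i] K(3,4) unfolding eq by simp
qed

text \<open>Cutting off produces a layer term with the factor \<open>d * wgt\<close>, which stays
  bounded and vanishes in the limit, whatever the boundary values of \<open>h\<close> are.\<close>

lemma zero_trace_d_mult:
  assumes h: "H1 h H" shows "zero_trace (\<lambda>x. d x * h x)"
proof -
  have dC1: "C_k (Suc 0) d" by (rule d_Ck) simp
  have dc: "continuous_on UNIV d" by (rule C_k_continuous[OF dC1])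
  show ?thesis
  proof (rule zero_traceI[OF H1_mult[OF h dC1]])
    fix \<psi> \<Psi> i assume p: "H1 \<psi> \<Psi>"
    have i1: "integrable M (\<lambda>x. d x * (\<psi> x * H i x))" "integrable M (\<lambda>x. N i x * (\<psi> x * h x))" "integrable M (\<lambda>x. d x * (\<Psi> i x * h x))"
      "integrable M (\<lambda>x. \<psi> x * h x)"
      by (intro continuous_mult_integrable sq_integrable_mult dc N_cont H1_sq[OF h] H1_sq[OF p])+
    have i2: "integrable M (\<lambda>x. cutoff k x * (d x * (\<psi> x * H i x) + N i x * (\<psi> x * h x)))"
      "integrable M (\<lambda>x. (wgt k x * (d x * N i x)) * (\<psi> x * h x))" for k
      by (intro continuous_mult_integrable continuous_on_mult cutoff_cont wgt_cont dc N_cont i1 Bochner_Integration.integrable_add)+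
    have "(\<integral>x. cutoff k x * (d x * (\<psi> x * H i x) + N i x * (\<psi> x * h x)) \<partial>M) + (\<integral>x. (wgt k x * (d x * N i x)) * (\<psi> x * h x) \<partial>M)
        = - (\<integral>x. cutoff k x * (d x * (\<Psi> i x * h x)) \<partial>M)" for k
      using cutoff_parts[OF h p dC1, of k i]
      by (subst Bochner_Integration.integral_add[OF i2, symmetric]) (simp add: algebra_simps)
    moreover have "(\<lambda>k. (\<integral>x. cutoff k x * (d x * (\<psi> x * H i x) + N i x * (\<psi> x * h x)) \<partial>M) + (\<integral>x. (wgt k x * (d x * N i x)) * (\<psi> x * h x) \<partial>M))
      \<longlonglongrightarrow> (\<integral>x. d x * (\<psi> x * H i x) + N i x * (\<psi> x * h x) \<partial>M) + 0"
    proof (intro tendsto_add cutoff_limit)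
      obtain B where B: "\<And>x. x \<in> closure \<Omega> \<Longrightarrow> \<bar>N i x\<bar> \<le> B" using continuous_bounded[OF N_cont] by metis
      have "\<bar>d x * N i x\<bar> \<le> B * d x" if "x \<in> \<Omega>" for x
        using B[of x] that closure_subset[of \<Omega>] d_pos[OF that] by (auto simp: abs_mult mult.commute intro!: mult_right_mono)
      then show "(\<lambda>k. \<integral>x. (wgt k x * (d x * N i x)) * (\<psi> x * h x) \<partial>M) \<longlonglongrightarrow> 0"
        by (intro wgt_limit[where A=B] i1 continuous_on_mult dc N_cont)
    qed (use i1 in auto)
    moreover have "(\<lambda>k. - (\<integral>x. cutoff k x * (d x * (\<Psi> i x * h x)) \<partial>M)) \<longlonglongrightarrow> - (\<integral>x. d x * (\<Psi> i x * h x) \<partial>M)"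
      by (intro tendsto_minus cutoff_limit i1)
    ultimately have "(\<integral>x. d x * (\<psi> x * H i x) + N i x * (\<psi> x * h x) \<partial>M) = - (\<integral>x. d x * (\<Psi> i x * h x) \<partial>M)"
      using LIMSEQ_unique by simp
    then show "(\<integral>x. d x * h x * \<Psi> i x \<partial>M) = - (\<integral>x. (d x * H i x + N i x * h x) * \<psi> x \<partial>M)"
      by (simp add: algebra_simps)
  qed
qed

text \<open>On the boundary this is N / |N|^2, so that \<open>Y\<close> times \<open>N\<close> is
  one there; unlike that quotient it stays smooth at critical points of \<open>d\<close>.\<close>

definition Y :: "'n \<Rightarrow> real^'n \<Rightarrow> real" where "Y i x = N i x / Q x"

lemma Y_C2: "C_k 2 (Y i)"
  unfolding Y_def[abs_def] using Q_pos by (intro C_k_divide N_C2 Q_C2) (auto simp: less_imp_neq[symmetric])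

lemma Y_C1: "C_k (Suc 0) (Y i)" by (rule C_k_mono[OF Y_C2]) simp

lemma Y_cont: "continuous_on UNIV (Y i)" by (rule C_k_continuous[OF Y_C2])

lemma NY_sum: "x \<in> \<Omega> \<Longrightarrow> (\<Sum>i\<in>UNIV. N i x * Y i x) = 1 - (d x)\<^sup>2 / Q x"
proof -
  assume x: "x \<in> \<Omega>"
  have "(\<Sum>i\<in>UNIV. N i x * Y i x) = (\<Sum>i\<in>UNIV. (N i x)\<^sup>2) / Q x"
    by (simp add: Y_def sum_divide_distrib power2_eq_square)
  also have "\<dots> = (Q x - (d x)\<^sup>2) / Q x" using Q_eq[OF x] by simp
  finally show ?thesis using Q_pos[of x] by (simp add: diff_divide_distrib)
qed

lemma continuous_bounded_family:
  fixes f :: "'b::finite \<Rightarrow> real^'n \<Rightarrow> real"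
  assumes "\<And>i. continuous_on UNIV (f i)"
  obtains B where "B > 0" "\<And>i x. x \<in> \<Omega> \<Longrightarrow> \<bar>f i x\<bar> \<le> B"
proof -
  have "\<exists>B. B > 0 \<and> (\<forall>x\<in>closure \<Omega>. \<bar>f i x\<bar> \<le> B)" for i using continuous_bounded[OF assms] by metis
  then obtain b where b: "\<And>i. b i > 0" "\<And>i x. x \<in> closure \<Omega> \<Longrightarrow> \<bar>f i x\<bar> \<le> b i" by metis
  have le: "b i \<le> (\<Sum>i\<in>UNIV. b i)" for i using b(1) by (intro member_le_sum) (auto simp: less_imp_le)
  have "\<bar>f i x\<bar> \<le> (\<Sum>i\<in>UNIV. b i)" if "x \<in> \<Omega>" for i x
    using b(2)[of x i] le[of i] that closure_subset[of \<Omega>] by auto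
  moreover have "(\<Sum>i\<in>UNIV. b i) > 0" using b(1) by (intro sum_pos) auto
  ultimately show ?thesis using that by blast
qed

lemma Q_lower: obtains c where "c > 0" "\<And>x. x \<in> \<Omega> \<Longrightarrow> c \<le> Q x"
proof -
  have "continuous_on UNIV (\<lambda>x. inverse (Q x))"
    using Q_pos by (intro C_k_continuous[OF C_k_inverse[OF Q_C2]]) (auto simp: less_imp_neq[symmetric])
  then obtain B where B: "B > 0" "\<And>x. x \<in> closure \<Omega> \<Longrightarrow> \<bar>inverse (Q x)\<bar> \<le> B" using continuous_bounded by metis
  have "inverse B \<le> Q x" if "x \<in> \<Omega>" for x
  proof -
    have "\<bar>inverse (Q x)\<bar> \<le> B" using B(2)[of x] that closure_subset[of \<Omega>] by blast
    then have "inverse (Q x) \<le> B" by linarith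
    then show ?thesis using Q_pos[of x] B(1) by (simp add: inverse_eq_divide field_simps)
  qed
  then show ?thesis using that[of "inverse B"] B(1) by simp
qed

subsection \<open>Hardy inequality\<close>

text \<open>The divergence of \<open>(s - d)^2 * g^2 * Y\<close>, cut to the layer
  \<open>d < s\<close>, has integral zero. Differentiating the square gives
  \<open>- 2 * (s - d)\<close> times the product of \<open>N\<close> and \<open>Y\<close>, which is
  close to one in a thin layer; the other terms are absorbed or become gradient terms carrying
  \<open>s ^ 3\<close>.\<close>

lemma hardy_layer:
  assumes z: "zero_trace g" and G: "H1 g G"
  obtains A s0 where "A > 0" "s0 > 0" "\<And>s. 0 < s \<Longrightarrow> s \<le> s0 \<Longrightarrow>
    (\<integral>x. max 0 (s - d x) * (g x)\<^sup>2 \<partial>M) \<le> A * s ^ 3 * (\<integral>x. indicator {x. d x < s} x * (\<Sum>i\<in>UNIV. (G i x)\<^sup>2) \<partial>M)"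
proof -
  define dY where "dY x = (\<Sum>i\<in>UNIV. pderiv_at i (Y i) x)" for x
  have dYc: "continuous_on UNIV dY" unfolding dY_def using Y_C1 by (intro continuous_on_sum) simp
  obtain B1 where B1: "B1 > 0" "\<And>x. x \<in> closure \<Omega> \<Longrightarrow> \<bar>dY x\<bar> \<le> B1" using continuous_bounded[OF dYc] by metis
  obtain B where B: "B > 0" "\<And>i x. x \<in> \<Omega> \<Longrightarrow> \<bar>Y i x\<bar> \<le> B" using continuous_bounded_family[of Y, OF Y_cont] by metis
  obtain c where c: "c > 0" "\<And>x. x \<in> \<Omega> \<Longrightarrow> c \<le> Q x" using Q_lower by metis
  define n where "n = real CARD('n)"
  \<comment> \<open>\<open>4\<close> comes from Young's inequality for the gradient term, and
    \<open>n * B\<^sup>2\<close> bounds the squared length of \<open>Y\<close>.\<close>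
  define A where "A = 4 * n * B\<^sup>2"
  have A: "A > 0" using B(1) by (simp add: A_def n_def)
  \<comment> \<open>The first bound makes \<open>m\<close> times the divergence of \<open>Y\<close>
    at most \<open>1/4\<close>; the other two together make \<open>d\<^sup>2 / Q\<close> at most
    \<open>1/4\<close>.\<close>
  define s0 where "s0 = min (1 / (4 * B1)) (min 1 (c / 4))"
  have s0: "s0 > 0" using B1(1) c(1) by (simp add: s0_def)
  have dC: "C_k (Suc 0) d" by (rule d_Ck) simp
  have dc: "continuous_on UNIV d" by (rule C_k_continuous[OF dC])
  note gs = H1_sq[OF G]
  have main: "(\<integral>x. max 0 (s - d x) * (g x)\<^sup>2 \<partial>M) \<le> A * s ^ 3 * (\<integral>x. indicator {x. d x < s} x * (\<Sum>i\<in>UNIV. (G i x)\<^sup>2) \<partial>M)"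
    if s: "0 < s" "s \<le> s0" for s
  proof -
    define m where "m x = max 0 (s - d x)" for x
    have mc: "continuous_on UNIV m" unfolding m_def by (intro continuous_intros dc)
    have m0: "0 \<le> m x" for x by (simp add: m_def)
    have sd: "C_k (Suc 0) (\<lambda>x. s - d x)" by (intro C_k_diff C_k_const dC)
    have m2C: "C_k (Suc 0) (\<lambda>x. (m x)\<^sup>2)"
      unfolding m_def using C_k_pos_part_power[OF sd, of 1] by (simp add: numeral_2_eq_2 del: C_k.simps)
    have m2d: "pderiv_at i (\<lambda>x. (m x)\<^sup>2) x = - 2 * m x * N i x" for i x
    proof -
      have "pderiv_at i (\<lambda>x. (max 0 (s - d x))\<^sup>2) x = 2 * max 0 (s - d x) * pderiv_at i (\<lambda>x. s - d x) x"
        using sd by (intro pderiv_at_compose_real(1)[OF pos_part_square_deriv]) simp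
      also have "pderiv_at i (\<lambda>x. s - d x) x = - N i x"
        using d_differentiable by (subst pderiv_at_diff) auto
      finally show ?thesis by (simp add: m_def)
    qed
    define a where "a i x = (m x)\<^sup>2 * Y i x" for i x
    have aC: "C_k (Suc 0) (a i)" for i unfolding a_def[abs_def] by (intro C_k_mult m2C Y_C1)
    have ac: "continuous_on UNIV (a i)" "continuous_on UNIV (pderiv_at i (a i))" for i
      using C_k_continuous[OF aC] aC[of i] by auto
    have ad: "pderiv_at i (a i) x = (m x)\<^sup>2 * pderiv_at i (Y i) x - 2 * m x * (N i x * Y i x)" for i x
      unfolding a_def[abs_def] using m2C Y_C1[of i] by (subst pderiv_at_mult) (auto simp: m2d)
    define P where "P x = (\<Sum>i\<in>UNIV. pderiv_at i (a i) x * (g x)\<^sup>2 + 2 * (a i x * (G i x * g x)))" for x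
    have ii: "integrable M (\<lambda>x. pderiv_at i (a i) x * (g x)\<^sup>2)" "integrable M (\<lambda>x. a i x * (G i x * g x))" for i
      by (intro continuous_mult_integrable ac sq_integrable_square sq_integrable_mult gs)+
    have Pint: "integrable M P" unfolding P_def
      by (intro Bochner_Integration.integrable_sum Bochner_Integration.integrable_add integrable_mult_right ii)
    have P0: "(\<integral>x. P x \<partial>M) = 0"
    proof -
      have "(\<integral>x. pderiv_at i (a i) x * (g x)\<^sup>2 + 2 * (a i x * (G i x * g x)) \<partial>M) = 0" for i
      proof -
        have "(\<integral>x. g x * (a i x * G i x + pderiv_at i (a i) x * g x) \<partial>M) = - (\<integral>x. G i x * (a i x * g x) \<partial>M)"
          using zero_traceD[OF z G H1_mult[OF G aC], of i i] .
        moreover have "(\<integral>x. g x * (a i x * G i x + pderiv_at i (a i) x * g x) \<partial>M)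
          = (\<integral>x. pderiv_at i (a i) x * (g x)\<^sup>2 \<partial>M) + (\<integral>x. a i x * (G i x * g x) \<partial>M)"
          by (subst Bochner_Integration.integral_add[OF ii, symmetric]) (simp add: algebra_simps power2_eq_square)
        moreover have "(\<integral>x. G i x * (a i x * g x) \<partial>M) = (\<integral>x. a i x * (G i x * g x) \<partial>M)"
          by (simp add: algebra_simps)
        ultimately show ?thesis using ii by simp
      qed
      then show ?thesis unfolding P_def using ii by (subst Bochner_Integration.integral_sum) auto
    qed
    define R where "R x = A * s ^ 3 * (indicator {x. d x < s} x * (\<Sum>i\<in>UNIV. (G i x)\<^sup>2))" for x
    have im: "(indicator {x. d x < s} :: real^'n \<Rightarrow> real) \<in> borel_measurable M"
      by (rule borel_imp_measurable, rule borel_measurable_indicator)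
        (use open_Collect_less[OF dc continuous_on_const] in auto)
    have GG: "integrable M (\<lambda>x. \<Sum>i\<in>UNIV. (G i x)\<^sup>2)"
      by (intro Bochner_Integration.integrable_sum sq_integrable_square gs)
    have Rint: "integrable M R" unfolding R_def
    proof (intro integrable_mult_right)
      show "integrable M (\<lambda>x. indicator {x. d x < s} x * (\<Sum>i\<in>UNIV. (G i x)\<^sup>2))"
      proof (rule Bochner_Integration.integrable_bound[OF GG])
        show "(\<lambda>x. indicator {x. d x < s} x * (\<Sum>i\<in>UNIV. (G i x)\<^sup>2)) \<in> borel_measurable M"
          using GG by (intro borel_measurable_times im) auto
      qed (auto simp: indicator_def sum_nonneg)
    qed
    have pt: "m x * (g x)\<^sup>2 \<le> R x - P x" if x: "x \<in> \<Omega>" for x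
    proof (cases "m x = 0")
      case True
      then have "P x = 0" unfolding P_def ad a_def by simp
      moreover have "R x \<ge> 0" unfolding R_def using A s(1) by (intro mult_nonneg_nonneg) (auto simp: sum_nonneg)
      ultimately show ?thesis using True by simp
    next
      case False
      then have mp: "m x > 0" using m0[of x] by simp
      then have ds: "d x < s" by (simp add: m_def max_def split: if_splits)
      have dp: "d x > 0" using d_pos[OF x] .
      have ms: "m x \<le> s" using dp s(1) by (simp add: m_def)
      have s1: "s \<le> 1" "s \<le> c / 4" "s \<le> 1 / (4 * B1)" using s(2) by (auto simp: s0_def)
      define S where "S = (\<Sum>i\<in>UNIV. Y i x * G i x)"
      have Pe: "P x = (m x)\<^sup>2 * dY x * (g x)\<^sup>2 - 2 * m x * (1 - (d x)\<^sup>2 / Q x) * (g x)\<^sup>2 + 2 * (m x)\<^sup>2 * g x * S"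
      proof -
        have "P x = (\<Sum>i\<in>UNIV. (m x)\<^sup>2 * (g x)\<^sup>2 * pderiv_at i (Y i) x - 2 * m x * (g x)\<^sup>2 * (N i x * Y i x) + 2 * (m x)\<^sup>2 * g x * (Y i x * G i x))"
          unfolding P_def ad a_def by (intro sum.cong) (auto simp: algebra_simps)
        also have "\<dots> = (m x)\<^sup>2 * (g x)\<^sup>2 * dY x - 2 * m x * (g x)\<^sup>2 * (\<Sum>i\<in>UNIV. N i x * Y i x) + 2 * (m x)\<^sup>2 * g x * S"
          by (simp add: sum.distrib sum_subtractf sum_distrib_left[symmetric] dY_def S_def)
        finally show ?thesis unfolding NY_sum[OF x] by (simp add: algebra_simps)
      qed
      have q: "(d x)\<^sup>2 / Q x \<le> 1 / 4"
      proof -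
        have "(d x)\<^sup>2 \<le> s * 1" unfolding power2_eq_square using ds dp s1(1) by (intro mult_mono) auto
        also have "\<dots> \<le> Q x / 4" using s1(2) c(2)[OF x] by simp
        finally show ?thesis using Q_pos[of x] by (simp add: field_simps)
      qed
      \<comment> \<open>The main term contributes \<open>3/2\<close>, the two error terms cost
        \<open>1/4\<close> each, and one full copy of \<open>m * g\<^sup>2\<close> remains.\<close>
      have t1: "2 * m x * (1 - (d x)\<^sup>2 / Q x) * (g x)\<^sup>2 \<ge> 3 / 2 * (m x * (g x)\<^sup>2)"
      proof -
        have "2 * m x * (g x)\<^sup>2 * (1 - (d x)\<^sup>2 / Q x) \<ge> 2 * m x * (g x)\<^sup>2 * (3 / 4)"
          using q mp by (intro mult_left_mono) auto
        then show ?thesis by (simp add: algebra_simps)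
      qed
      have t2: "(m x)\<^sup>2 * dY x * (g x)\<^sup>2 \<le> 1 / 4 * (m x * (g x)\<^sup>2)"
      proof -
        have "\<bar>dY x\<bar> \<le> B1" using B1(2)[of x] x closure_subset[of \<Omega>] by blast
        then have "dY x \<le> B1" by linarith
        then have "m x * dY x \<le> m x * B1" using mp by (intro mult_left_mono) auto
        also have "\<dots> \<le> (1 / (4 * B1)) * B1" using ms s1(3) B1(1) by (intro mult_right_mono) auto
        also have "\<dots> = 1 / 4" using B1(1) by simp
        finally have "(m x * dY x) * (m x * (g x)\<^sup>2) \<le> 1 / 4 * (m x * (g x)\<^sup>2)"
          using mp by (intro mult_right_mono) auto
        then show ?thesis by (simp add: power2_eq_square mult_ac)
      qed
      have t3: "- (2 * (m x)\<^sup>2 * g x * S) \<ge> - (1 / 4 * (m x * (g x)\<^sup>2)) - 4 * (m x) ^ 3 * S\<^sup>2"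
      proof -
        have "0 \<le> m x * (g x / 2 - 2 * m x * S)\<^sup>2" using mp by simp
        then show ?thesis by (simp add: power2_diff algebra_simps power2_eq_square power3_eq_cube)
      qed
      have t4: "4 * (m x) ^ 3 * S\<^sup>2 \<le> R x"
      proof -
        have "S\<^sup>2 \<le> (\<Sum>i\<in>UNIV. (Y i x)\<^sup>2) * (\<Sum>i\<in>UNIV. (G i x)\<^sup>2)"
          unfolding S_def by (rule Cauchy_Schwarz_ineq_sum)
        also have "\<dots> \<le> (n * B\<^sup>2) * (\<Sum>i\<in>UNIV. (G i x)\<^sup>2)"
        proof (intro mult_right_mono sum_nonneg)
          have "(Y i x)\<^sup>2 \<le> B\<^sup>2" for i using B(2)[OF x, of i] B(1) abs_le_square_iff[of "Y i x" B] by simp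
          then have "(\<Sum>i\<in>UNIV. (Y i x)\<^sup>2) \<le> (\<Sum>i\<in>(UNIV::'n set). B\<^sup>2)" by (intro sum_mono)
          then show "(\<Sum>i\<in>UNIV. (Y i x)\<^sup>2) \<le> n * B\<^sup>2" by (simp add: n_def)
        qed simp
        finally have S: "S\<^sup>2 \<le> (n * B\<^sup>2) * (\<Sum>i\<in>UNIV. (G i x)\<^sup>2)" .
        have "4 * (m x) ^ 3 * S\<^sup>2 \<le> 4 * s ^ 3 * ((n * B\<^sup>2) * (\<Sum>i\<in>UNIV. (G i x)\<^sup>2))"
          using ms mp s(1) by (intro mult_mono power_mono S) auto
        then show ?thesis using ds by (simp add: R_def A_def mult_ac)
      qed
      show ?thesis using t1 t2 t3 t4 unfolding Pe by linarith
    qed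
    have mi: "integrable M (\<lambda>x. m x * (g x)\<^sup>2)" by (intro continuous_mult_integrable mc sq_integrable_square gs)
    have "(\<integral>x. m x * (g x)\<^sup>2 \<partial>M) \<le> (\<integral>x. R x - P x \<partial>M)"
      using pt by (intro integral_mono mi Bochner_Integration.integrable_diff Rint Pint) auto
    also have "\<dots> = (\<integral>x. R x \<partial>M)" using Rint Pint P0 by simp
    finally show ?thesis by (simp add: m_def R_def)
  qed
  show ?thesis using that[OF A s0 main] by blast
qed

text \<open>With \<open>s = 4 / Suc k\<close> the square of the weight, of order \<open>k^2\<close>,
  is at most a multiple of \<open>k^3 * (s - d)\<close>, and the factor \<open>s ^ 3\<close> of the
  Hardy estimate cancels \<open>k^3\<close>. What remains is the gradient energy in a layer that
  shrinks to nothing.\<close>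

lemma hardy_limit:
  assumes z: "zero_trace g"
  shows "(\<lambda>k. nrm2 M (\<lambda>x. wgt k x * g x)) \<longlonglongrightarrow> 0"
proof -
  obtain G where G: "H1 g G" using zero_trace_H1[OF z] by blast
  obtain A s0 where A: "A > 0" "s0 > 0" and
    h: "\<And>s. 0 < s \<Longrightarrow> s \<le> s0 \<Longrightarrow>
    (\<integral>x. max 0 (s - d x) * (g x)\<^sup>2 \<partial>M) \<le> A * s ^ 3 * (\<integral>x. indicator {x. d x < s} x * (\<Sum>i\<in>UNIV. (G i x)\<^sup>2) \<partial>M)"
    using hardy_layer[OF z G] by blast
  have dc: "continuous_on UNIV d" by (rule C_k_continuous[OF d_C3])
  note gs = H1_sq[OF G]
  have GG: "integrable M (\<lambda>x. \<Sum>i\<in>UNIV. (G i x)\<^sup>2)"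
    by (intro Bochner_Integration.integrable_sum sq_integrable_square gs)
  define J where "J k = (\<integral>x. indicator {x. d x < 4 / real (Suc k)} x * (\<Sum>i\<in>UNIV. (G i x)\<^sup>2) \<partial>M)" for k
  have im: "(indicator {x. d x < s} :: real^'n \<Rightarrow> real) \<in> borel_measurable M" for s
    by (rule borel_imp_measurable, rule borel_measurable_indicator)
      (use open_Collect_less[OF dc continuous_on_const] in auto)
  have J: "J \<longlonglongrightarrow> 0"
  proof -
    have "(\<lambda>k. J k) \<longlonglongrightarrow> (\<integral>x. 0 \<partial>M)"
      unfolding J_def
    proof (rule integral_dominated_convergence[where w="\<lambda>x. \<Sum>i\<in>UNIV. (G i x)\<^sup>2"])
      show "(\<lambda>x. indicator {x. d x < 4 / real (Suc k)} x * (\<Sum>i\<in>UNIV. (G i x)\<^sup>2)) \<in> borel_measurable M" for k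
        using GG by (intro borel_measurable_times im) auto
      show "AE x in M. (\<lambda>k. indicator {x. d x < 4 / real (Suc k)} x * (\<Sum>i\<in>UNIV. (G i x)\<^sup>2)) \<longlonglongrightarrow> 0"
      proof (rule AE_I2)
        fix x assume "x \<in> space M"
        then have "d x > 0" using d_pos by simp
        then obtain k0 where k0: "4 < real k0 * d x" using reals_Archimedean3 by blast
        have "\<not> d x < 4 / real (Suc k)" if "k \<ge> k0" for k
        proof -
          have "real k0 * d x \<le> real (Suc k) * d x" using that \<open>d x > 0\<close> by (intro mult_right_mono) auto
          then have "4 \<le> real (Suc k) * d x" using k0 by simp
          then show ?thesis by (simp add: field_simps)
        qed
        then show "(\<lambda>k. indicator {x. d x < 4 / real (Suc k)} x * (\<Sum>i\<in>UNIV. (G i x)\<^sup>2)) \<longlonglongrightarrow> 0"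
          by (intro tendsto_eventually eventually_sequentiallyI[of k0]) (simp add: indicator_def)
      qed
      show "AE x in M. norm (indicator {x. d x < 4 / real (Suc k)} x * (\<Sum>i\<in>UNIV. (G i x)\<^sup>2)) \<le> (\<Sum>i\<in>UNIV. (G i x)\<^sup>2)" for k
        by (intro AE_I2) (auto simp: indicator_def sum_nonneg)
    qed (use GG in auto)
    then show ?thesis by simp
  qed
  obtain k1 where k1: "4 / real (Suc k1) < s0"
  proof -
    obtain n where "1 / real (Suc n) < s0 / 4" using nat_approx_posE[of "s0 / 4"] A(2) by auto
    then show ?thesis using that[of n] by (simp add: field_simps)
  qed
  have bd: "(\<integral>x. (wgt k x * g x)\<^sup>2 \<partial>M) \<le> (2592 * A) * J k" if k: "k \<ge> k1" for k
  proof -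
    define K where "K = real (Suc k)"
    have K: "K > 0" by (simp add: K_def)
    have ks: "4 / K \<le> s0"
    proof -
      have "4 / K \<le> 4 / real (Suc k1)" using k unfolding K_def by (intro divide_left_mono) auto
      then show ?thesis using k1 by simp
    qed
    \<comment> \<open>Where the weight is nonzero, \<open>d < 2 / K\<close>, so
      \<open>4 / K - d\<close> exceeds \<open>2 / K\<close>. With \<open>step' \<le> 9\<close> this
      gives the factor \<open>81 * K ^ 3 / 2\<close>, and \<open>81 / 2\<close> times the cube of
      \<open>4\<close> is \<open>2592\<close>.\<close>
    have pt: "(wgt k x * g x)\<^sup>2 \<le> (81 * K ^ 3 / 2) * (max 0 (4 / K - d x) * (g x)\<^sup>2)" if x: "x \<in> \<Omega>" for x
    proof (cases "K * d x < 2")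
      case False
      then have "wgt k x = 0" by (simp add: wgt_def K_def step'_eq_0)
      then show ?thesis using K by simp
    next
      case True
      then have dx: "d x < 2 / K" using K by (simp add: field_simps)
      have "(wgt k x)\<^sup>2 \<le> (K * 9)\<^sup>2"
        unfolding wgt_def K_def[symmetric] using step'_bounds[of "K * d x"] K by (intro power_mono mult_left_mono) auto
      also have "\<dots> = (81 * K ^ 3 / 2) * (2 / K)" using K by (simp add: power2_eq_square power3_eq_cube)
      also have "\<dots> \<le> (81 * K ^ 3 / 2) * max 0 (4 / K - d x)"
      proof (intro mult_left_mono)
        have "4 / K = 2 / K + 2 / K" by simp
        then show "2 / K \<le> max 0 (4 / K - d x)" using dx by linarith
      qed (use K in auto)
      finally have "(wgt k x)\<^sup>2 * (g x)\<^sup>2 \<le> (81 * K ^ 3 / 2) * max 0 (4 / K - d x) * (g x)\<^sup>2"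
        by (intro mult_right_mono) auto
      then show ?thesis by (simp add: power_mult_distrib mult_ac)
    qed
    have mc: "continuous_on UNIV (\<lambda>x. max 0 (4 / K - d x))" by (intro continuous_intros dc)
    have "(\<integral>x. (wgt k x * g x)\<^sup>2 \<partial>M) \<le> (\<integral>x. (81 * K ^ 3 / 2) * (max 0 (4 / K - d x) * (g x)\<^sup>2) \<partial>M)"
    proof (rule integral_mono)
      show "integrable M (\<lambda>x. (wgt k x * g x)\<^sup>2)"
        by (intro sq_integrable_square continuous_mult_sq_integrable wgt_cont gs)
      show "integrable M (\<lambda>x. (81 * K ^ 3 / 2) * (max 0 (4 / K - d x) * (g x)\<^sup>2))"
        by (intro integrable_mult_right continuous_mult_integrable mc sq_integrable_square gs)
    qed (use pt in simp)
    also have "\<dots> = (81 * K ^ 3 / 2) * (\<integral>x. max 0 (4 / K - d x) * (g x)\<^sup>2 \<partial>M)" by simp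
    also have "\<dots> \<le> (81 * K ^ 3 / 2) * (A * (4 / K) ^ 3 * J k)"
      using h[of "4 / K"] K ks by (intro mult_left_mono) (auto simp: J_def K_def)
    also have "\<dots> = (2592 * A) * J k"
      using K by (simp add: power3_eq_cube field_simps)
    finally show ?thesis .
  qed
  have "(\<lambda>k. sqrt ((2592 * A) * J k)) \<longlonglongrightarrow> sqrt ((2592 * A) * 0)"
    by (intro tendsto_intros J)
  then have l: "(\<lambda>k. sqrt ((2592 * A) * J k)) \<longlonglongrightarrow> 0" by simp
  show ?thesis
  proof (rule Lim_null_comparison[OF _ l])
    show "\<forall>\<^sub>F k in sequentially. norm (nrm2 M (\<lambda>x. wgt k x * g x)) \<le> sqrt ((2592 * A) * J k)"
      using eventually_ge_at_top[of k1] by eventually_elim (use bd in \<open>simp add: nrm2_def\<close>)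
  qed
qed

text \<open>The form in which layer terms disappear later: one factor has zero trace, the other is
  merely square integrable.\<close>

lemma hardy_pair:
  assumes z: "zero_trace g" and p: "sq_integrable M p"
  shows "(\<lambda>k. \<integral>x. wgt k x * g x * p x \<partial>M) \<longlonglongrightarrow> 0"
proof -
  obtain G where G: "H1 g G" using zero_trace_H1[OF z] by blast
  have bd: "\<bar>\<integral>x. wgt k x * g x * p x \<partial>M\<bar> \<le> nrm2 M (\<lambda>x. wgt k x * g x) * nrm2 M p" for k
    by (intro Cauchy_Schwarz_integral p continuous_mult_sq_integrable wgt_cont H1_sq[OF G])
  have "(\<lambda>k. nrm2 M (\<lambda>x. wgt k x * g x) * nrm2 M p) \<longlonglongrightarrow> 0 * nrm2 M p"
    by (intro tendsto_intros hardy_limit z)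
  then show ?thesis by (intro tendsto_0_le_real[OF bd]) simp
qed

end

context bounded_open
begin

subsection \<open>Gradients of harmonic functions\<close>

text \<open>By itself this says that the field \<open>P\<close> is weakly divergence free; together
  with \<open>H1 p P\<close> it makes \<open>p\<close> harmonic.\<close>

definition weakly_harmonic :: "('n \<Rightarrow> real^'n \<Rightarrow> real) \<Rightarrow> bool" where
  "weakly_harmonic P \<longleftrightarrow> (\<forall>\<phi>\<in>test_functions \<Omega>. (\<Sum>i\<in>UNIV. \<integral>x. P i x * pderiv_at i \<phi> x \<partial>M) = 0)"

lemma mollify_gradient:
  assumes "compact K" "K \<subseteq> \<Omega>" "H1 f F" "\<And>x. x \<notin> K \<Longrightarrow> f x = 0" "\<And>i x. x \<notin> K \<Longrightarrow> F i x = 0"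
  obtains N where "\<And>n. n \<ge> N \<Longrightarrow> mollify n f \<in> test_functions \<Omega>"
    "\<And>n i. n \<ge> N \<Longrightarrow> pderiv_at i (mollify n f) = mollify n (F i)"
proof -
  obtain K' N where K': "compact K'" "K' \<subseteq> \<Omega>" "K \<subseteq> K'"
    and test: "\<forall>n f. N \<le> n \<longrightarrow> sq_integrable M f \<longrightarrow> (\<forall>y. y \<notin> K \<longrightarrow> f y = 0) \<longrightarrow> mollify n f \<in> test_functions \<Omega>"
    and pd: "\<forall>n f i f' x. N \<le> n \<longrightarrow> wd i f f' \<longrightarrow> (\<forall>y. y \<notin> K \<longrightarrow> f y = 0) \<longrightarrow> (\<forall>y. y \<notin> K \<longrightarrow> f' y = 0) \<longrightarrow>
      pderiv_at i (mollify n f) x = mollify n f' x"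
    by (rule mollify_compact[OF assms(1,2)]) (rule that; assumption)
  have "mollify n f \<in> test_functions \<Omega>" if "n \<ge> N" for n
    using test that H1_sq(1)[OF assms(3)] assms(4) by blast
  moreover have "pderiv_at i (mollify n f) = mollify n (F i)" if "n \<ge> N" for n i
  proof
    fix x show "pderiv_at i (mollify n f) x = mollify n (F i) x"
      using pd that H1_wd[OF assms(3), of i] assms(4,5) by blast
  qed
  ultimately show ?thesis using that by blast
qed

text \<open>Mollification extends the defining identity from test functions to H^1 functions of
  compact support.\<close>

lemma weakly_harmonic_compact:
  assumes K: "compact K" "K \<subseteq> \<Omega>" and f: "H1 f F" "\<And>x. x \<notin> K \<Longrightarrow> f x = 0" "\<And>i x. x \<notin> K \<Longrightarrow> F i x = 0"
    and P: "\<And>i. sq_integrable M (P i)" "weakly_harmonic P"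
  shows "(\<Sum>i\<in>UNIV. \<integral>x. F i x * P i x \<partial>M) = 0"
proof -
  obtain N where N: "\<And>n. n \<ge> N \<Longrightarrow> mollify n f \<in> test_functions \<Omega>"
    "\<And>n i. n \<ge> N \<Longrightarrow> pderiv_at i (mollify n f) = mollify n (F i)"
    using mollify_gradient[OF K f] by blast
  have "(\<lambda>n. \<Sum>i\<in>UNIV. \<integral>x. mollify n (F i) x * P i x \<partial>M) \<longlonglongrightarrow> (\<Sum>i\<in>UNIV. \<integral>x. F i x * P i x \<partial>M)"
    by (intro tendsto_sum L2_lim_product_const mollify_L2_lim H1_sq[OF f(1)] P)
  moreover have "(\<Sum>i\<in>UNIV. \<integral>x. mollify n (F i) x * P i x \<partial>M) = 0" if "n \<ge> N" for n
    using P(2) N(1)[OF that] unfolding weakly_harmonic_def N(2)[OF that, symmetric] by (simp add: mult.commute)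
  then have "(\<lambda>n. \<Sum>i\<in>UNIV. \<integral>x. mollify n (F i) x * P i x \<partial>M) \<longlonglongrightarrow> 0"
    by (intro tendsto_eventually eventually_sequentiallyI[of N]) auto
  ultimately show ?thesis using LIMSEQ_unique by blast
qed

lemma mollify_uminus: "mollify n (\<lambda>x. - f x) x = - mollify n f x"
  by (simp add: mollify_def conv_def)

text \<open>The double divergence of an antisymmetric field vanishes by symmetry of second
  derivatives. \<open>p\<close> and \<open>f\<close> have only one derivative each, so the field is
  mollified first and the derivative of \<open>p\<close> is then moved onto it.\<close>

lemma antisymmetric_compact:
  assumes K: "compact K" "K \<subseteq> \<Omega>" and f: "\<And>i j. H1 (f i j) (F i j)" "\<And>i j x. x \<notin> K \<Longrightarrow> f i j x = 0"
      "\<And>i j l x. x \<notin> K \<Longrightarrow> F i j l x = 0"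
    and anti: "\<And>i j x. f i j x = - f j i x"
    and P: "H1 p P"
  shows "(\<Sum>i\<in>UNIV. \<Sum>j\<in>UNIV. \<integral>x. F i j i x * P j x \<partial>M) = 0"
proof -
  have "\<exists>N. \<forall>n\<ge>N. mollify n (f i j) \<in> test_functions \<Omega> \<and> (\<forall>l. pderiv_at l (mollify n (f i j)) = mollify n (F i j l))" for i j
    using mollify_gradient[OF K f(1)[of i j] f(2) f(3)] by metis
  then obtain n0 where n0: "\<And>i j n. n \<ge> n0 i j \<Longrightarrow> mollify n (f i j) \<in> test_functions \<Omega> \<and> (\<forall>l. pderiv_at l (mollify n (f i j)) = mollify n (F i j l))"
    by metis
  define N where "N = (\<Sum>i\<in>UNIV. \<Sum>j\<in>UNIV. n0 i j)"
  have N: "n0 i j \<le> N" for i j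
  proof -
    have "n0 i j \<le> (\<Sum>j\<in>UNIV. n0 i j)" by (rule member_le_sum) auto
    also have "\<dots> \<le> N" unfolding N_def by (rule member_le_sum) auto
    finally show ?thesis .
  qed
  have lim: "(\<lambda>n. \<Sum>i\<in>UNIV. \<Sum>j\<in>UNIV. \<integral>x. mollify n (F i j i) x * P j x \<partial>M) \<longlonglongrightarrow> (\<Sum>i\<in>UNIV. \<Sum>j\<in>UNIV. \<integral>x. F i j i x * P j x \<partial>M)"
    by (intro tendsto_sum L2_lim_product_const mollify_L2_lim H1_sq[OF f(1)] H1_sq[OF P])
  have "(\<Sum>i\<in>UNIV. \<Sum>j\<in>UNIV. \<integral>x. mollify n (F i j i) x * P j x \<partial>M) = 0" if n: "n \<ge> N" for n
  proof -
    define \<phi> where "\<phi> i j = mollify n (f i j)" for i j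
    have t: "\<phi> i j \<in> test_functions \<Omega>" "pderiv_at l (\<phi> i j) = mollify n (F i j l)" for i j l
      using n0[of i j n] N[of i j] n by (auto simp: \<phi>_def)
    have an: "\<phi> i j = (\<lambda>x. - \<phi> j i x)" for i j
    proof -
      have "f i j = (\<lambda>x. - f j i x)" using anti by blast
      then show ?thesis unfolding \<phi>_def by (metis mollify_uminus ext)
    qed
    have c2: "C_k 2 (\<phi> i j)" "C_k (Suc 0) (\<phi> i j)" "C_k (Suc 0) (pderiv_at l (\<phi> i j))" for i j l
      using test_functionsD(1)[OF t(1)] test_functionsD(1)[OF test_functions_pderiv[OF t(1)]] by auto
    have pan: "pderiv_at l (\<phi> i j) x = - pderiv_at l (\<phi> j i) x" for i j l x
      using c2(2)[of j i] by (subst an) (simp add: pderiv_at_uminus)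
    have pan2: "pderiv_at k (pderiv_at l (\<phi> i j)) x = - pderiv_at k (pderiv_at l (\<phi> j i)) x" for i j k l x
    proof -
      have "pderiv_at l (\<phi> i j) = (\<lambda>x. - pderiv_at l (\<phi> j i) x)" using pan by blast
      then show ?thesis using c2(3)[of l j i] by (simp add: pderiv_at_uminus)
    qed
    define S where "S = (\<Sum>i\<in>UNIV. \<Sum>j\<in>UNIV. \<integral>x. pderiv_at j (pderiv_at i (\<phi> i j)) x * p x \<partial>M)"
    have "(\<integral>x. mollify n (F i j i) x * P j x \<partial>M) = - (\<integral>x. pderiv_at j (pderiv_at i (\<phi> i j)) x * p x \<partial>M)" for i j
      using wdD(3)[OF H1_wd[OF P, of j] test_functions_pderiv[OF t(1)[of i j], of i]]
      unfolding t(2)[symmetric] by (simp add: mult.commute)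
    then have 1: "(\<Sum>i\<in>UNIV. \<Sum>j\<in>UNIV. \<integral>x. mollify n (F i j i) x * P j x \<partial>M) = - S"
      by (simp add: S_def sum_negf)
    have "S = (\<Sum>i\<in>UNIV. \<Sum>j\<in>UNIV. - (\<integral>x. pderiv_at i (pderiv_at j (\<phi> j i)) x * p x \<partial>M))"
      unfolding S_def by (intro sum.cong refl) (subst pderiv_at_commute[OF c2(1)], subst pan2, simp)
    also have "\<dots> = - (\<Sum>i\<in>UNIV. \<Sum>j\<in>UNIV. \<integral>x. pderiv_at i (pderiv_at j (\<phi> j i)) x * p x \<partial>M)"
      by (simp add: sum_negf)
    also have "(\<Sum>i\<in>UNIV. \<Sum>j\<in>UNIV. \<integral>x. pderiv_at i (pderiv_at j (\<phi> j i)) x * p x \<partial>M) = S"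
      unfolding S_def by (rule sum.swap)
    finally show ?thesis using 1 by simp
  qed
  then have "(\<lambda>n. \<Sum>i\<in>UNIV. \<Sum>j\<in>UNIV. \<integral>x. mollify n (F i j i) x * P j x \<partial>M) \<longlonglongrightarrow> 0"
    by (intro tendsto_eventually eventually_sequentiallyI[of N]) auto
  with lim show ?thesis using LIMSEQ_unique by blast
qed

end

section \<open>Boundary identities obtained by cutting off\<close>

context defining_function
begin

text \<open>Tangential derivatives vanish where the function does. After cutting off, the layer term
  contains the tangential derivative of \<phi>, and the zero trace of \<phi> allows a second
  integration by parts in it. The derivative that falls on the weight is parallel to
  \<open>N\<close> and cancels by antisymmetry; what is left has the factor
  \<open>wgt k x * \<phi> x\<close> and vanishes by the Hardy inequality.\<close>

lemma zero_trace_tangential: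
  assumes z: "zero_trace \<phi>" and D: "H1 \<phi> D" and E: "\<And>a. H1 (D a) (E a)"
  shows "zero_trace (\<lambda>x. N a x * D b x - N b x * D a x)"
proof -
  define t where "t x = N a x * D b x - N b x * D a x" for x
  define T where "T i x = (N a x * E b i x + pderiv_at i (N a) x * D b x) - (N b x * E a i x + pderiv_at i (N b) x * D a x)" for i x
  have tT: "H1 t T" unfolding t_def[abs_def] T_def[abs_def] by (intro H1_diff H1_mult E N_C1)
  have NC: "continuous_on UNIV (pderiv_at i (N j))" for i j using N_C1[of j] by simp
  have "(\<integral>x. t x * \<Psi> i x \<partial>M) = - (\<integral>x. T i x * \<psi> x \<partial>M)" if p: "H1 \<psi> \<Psi>" for \<psi> \<Psi> i
  proof -
    have ti: "integrable M (\<lambda>x. t x * \<Psi> i x)" "integrable M (\<lambda>x. T i x * \<psi> x)" "integrable M (\<lambda>x. t x * \<psi> x)"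
      by (intro sq_integrable_mult H1_sq[OF tT] H1_sq[OF p])+
    have e1: "(\<integral>x. cutoff k x * (t x * \<Psi> i x) \<partial>M) + (\<integral>x. wgt k x * N i x * (t x * \<psi> x) \<partial>M) = - (\<integral>x. cutoff k x * (T i x * \<psi> x) \<partial>M)" for k
    proof -
      have "integrable M (\<lambda>x. cutoff k x * (t x * \<Psi> i x))" "integrable M (\<lambda>x. wgt k x * N i x * (t x * \<psi> x))"
        by (intro continuous_mult_integrable continuous_on_mult cutoff_cont wgt_cont N_cont ti)+
      then show ?thesis using cutoff_parts[OF p tT C_k_const[of "Suc 0" 1], of k i]
        by (simp add: algebra_simps)
    qed
    \<comment> \<open>\<open>q1\<close> collects the terms where \<psi> is differentiated,
      \<open>q2\<close> those where \<open>N i\<close> is.\<close>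
    define q1 where "q1 x = N i x * (N a x * \<Psi> b x - N b x * \<Psi> a x)" for x
    define q2 where "q2 x = (N a x * pderiv_at b (N i) x - N b x * pderiv_at a (N i) x) * \<psi> x" for x
    have q1: "sq_integrable M q1" unfolding q1_def[abs_def]
      by (intro continuous_mult_sq_integrable sq_integrable_diff N_cont H1_sq[OF p])
    have q2: "sq_integrable M q2" unfolding q2_def[abs_def]
      by (intro continuous_mult_sq_integrable continuous_on_mult continuous_on_diff N_cont NC H1_sq[OF p])
    have e2: "(\<integral>x. wgt k x * N i x * (t x * \<psi> x) \<partial>M) = - ((\<integral>x. wgt k x * \<phi> x * q1 x \<partial>M) + (\<integral>x. wgt k x * \<phi> x * q2 x \<partial>M))" for k
    proof -
      define c where "c j x = N j x * (wgt k x * N i x)" for j x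
      have cC: "C_k (Suc 0) (c j)" for j unfolding c_def[abs_def] by (intro C_k_mult N_C1 wgt_C1)
      have cc: "continuous_on UNIV (c j)" "continuous_on UNIV (pderiv_at l (c j))" for j l
        using C_k_continuous[OF cC] cC[of j] by auto
      have z1: "(\<integral>x. \<phi> x * (c j x * \<Psi> l x + pderiv_at l (c j) x * \<psi> x) \<partial>M) = - (\<integral>x. D l x * (c j x * \<psi> x) \<partial>M)" for j l
        by (rule zero_traceD[OF z D H1_mult[OF p cC]])
      have int1: "integrable M (\<lambda>x. \<phi> x * (c j x * \<Psi> l x + pderiv_at l (c j) x * \<psi> x))" "integrable M (\<lambda>x. D l x * (c j x * \<psi> x))" for j l
        by (intro sq_integrable_mult H1_sq[OF D] sq_integrable_add continuous_mult_sq_integrable cc H1_sq[OF p])+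
      \<comment> \<open>Two cancellations: the terms with \<open>e\<close> are symmetric in
        \<open>a\<close> and \<open>b\<close>, and so is the Hessian of \<open>d\<close>.\<close>
      have dc: "pderiv_at b (c a) x - pderiv_at a (c b) x = wgt k x * (N a x * pderiv_at b (N i) x - N b x * pderiv_at a (N i) x)" for x
      proof -
        obtain e where e: "\<And>l. pderiv_at l (wgt k) x = e * N l x" using pderiv_wgt by metis
        have w: "wgt k differentiable (at x)" using wgt_C1 by simp
        have "pderiv_at l (c j) x = N j x * (wgt k x * pderiv_at l (N i) x + e * N l x * N i x) + pderiv_at l (N j) x * (wgt k x * N i x)" for l j
          unfolding c_def[abs_def] using N_differentiable w
          by (subst pderiv_at_mult) (auto simp: pderiv_at_mult e)
        then show ?thesis using N_sym[of b a x] by (simp add: algebra_simps)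
      qed
      have "(\<integral>x. wgt k x * N i x * (t x * \<psi> x) \<partial>M) = (\<integral>x. D b x * (c a x * \<psi> x) - D a x * (c b x * \<psi> x) \<partial>M)"
        by (simp add: t_def c_def algebra_simps)
      also have "\<dots> = - ((\<integral>x. \<phi> x * (c a x * \<Psi> b x + pderiv_at b (c a) x * \<psi> x) \<partial>M) - (\<integral>x. \<phi> x * (c b x * \<Psi> a x + pderiv_at a (c b) x * \<psi> x) \<partial>M))"
        using int1(2) by (simp add: z1)
      also have "(\<integral>x. \<phi> x * (c a x * \<Psi> b x + pderiv_at b (c a) x * \<psi> x) \<partial>M) - (\<integral>x. \<phi> x * (c b x * \<Psi> a x + pderiv_at a (c b) x * \<psi> x) \<partial>M)
        = (\<integral>x. \<phi> x * (c a x * \<Psi> b x + pderiv_at b (c a) x * \<psi> x) - \<phi> x * (c b x * \<Psi> a x + pderiv_at a (c b) x * \<psi> x) \<partial>M)"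
        using int1(1) by simp
      also have "(\<lambda>x. \<phi> x * (c a x * \<Psi> b x + pderiv_at b (c a) x * \<psi> x) - \<phi> x * (c b x * \<Psi> a x + pderiv_at a (c b) x * \<psi> x))
        = (\<lambda>x. wgt k x * \<phi> x * q1 x + wgt k x * \<phi> x * q2 x)"
      proof
        fix x
        have "\<phi> x * (c a x * \<Psi> b x + pderiv_at b (c a) x * \<psi> x) - \<phi> x * (c b x * \<Psi> a x + pderiv_at a (c b) x * \<psi> x)
          = \<phi> x * (c a x * \<Psi> b x - c b x * \<Psi> a x) + \<phi> x * \<psi> x * (pderiv_at b (c a) x - pderiv_at a (c b) x)"
          by (simp add: algebra_simps)
        then show "\<phi> x * (c a x * \<Psi> b x + pderiv_at b (c a) x * \<psi> x) - \<phi> x * (c b x * \<Psi> a x + pderiv_at a (c b) x * \<psi> x)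
          = wgt k x * \<phi> x * q1 x + wgt k x * \<phi> x * q2 x"
          unfolding dc by (simp add: c_def q1_def q2_def algebra_simps)
      qed
      also have "(\<integral>x. wgt k x * \<phi> x * q1 x + wgt k x * \<phi> x * q2 x \<partial>M) = (\<integral>x. wgt k x * \<phi> x * q1 x \<partial>M) + (\<integral>x. wgt k x * \<phi> x * q2 x \<partial>M)"
        by (intro Bochner_Integration.integral_add sq_integrable_mult continuous_mult_sq_integrable wgt_cont H1_sq[OF D] q1 q2)
      finally show ?thesis .
    qed
    have "(\<lambda>k. (\<integral>x. cutoff k x * (t x * \<Psi> i x) \<partial>M) + (- ((\<integral>x. wgt k x * \<phi> x * q1 x \<partial>M) + (\<integral>x. wgt k x * \<phi> x * q2 x \<partial>M)))) \<longlonglongrightarrow> (\<integral>x. t x * \<Psi> i x \<partial>M) + (- (0 + 0))"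
      by (intro tendsto_add tendsto_minus cutoff_limit ti hardy_pair z q1 q2)
    moreover have "(\<lambda>k. - (\<integral>x. cutoff k x * (T i x * \<psi> x) \<partial>M)) \<longlonglongrightarrow> - (\<integral>x. T i x * \<psi> x \<partial>M)"
      by (intro tendsto_minus cutoff_limit ti)
    ultimately show ?thesis unfolding e2[symmetric] e1 using LIMSEQ_unique by fastforce
  qed
  then have "zero_trace t" by (intro zero_traceI[OF tT])
  then show ?thesis unfolding t_def[abs_def] .
qed

text \<open>The cut-off makes \<open>g\<close> compactly supported, and the resulting layer term
  contains the zero trace factor \<open>g\<close>. Used with \<open>g\<close> the divergence of the
  tangential part \<open>v\<close>.\<close>

lemma zero_trace_harmonic_orthogonal:
  assumes z: "zero_trace g" and G: "H1 g G" and P: "\<And>i. sq_integrable M (P i)" "weakly_harmonic P"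
  shows "(\<Sum>i\<in>UNIV. \<integral>x. G i x * P i x \<partial>M) = 0"
proof -
  have e: "(\<Sum>i\<in>UNIV. (\<integral>x. cutoff k x * (G i x * P i x) \<partial>M) + (\<integral>x. wgt k x * g x * (N i x * P i x) \<partial>M)) = 0" for k
  proof -
    obtain K where K: "compact K" "K \<subseteq> \<Omega>" "\<And>x. x \<notin> K \<Longrightarrow> cutoff k x = 0" "\<And>x. x \<notin> K \<Longrightarrow> wgt k x = 0"
      by (rule cutoff_support[of k]) (rule that; assumption)
    have "(\<Sum>i\<in>UNIV. \<integral>x. (cutoff k x * G i x + pderiv_at i (cutoff k) x * g x) * P i x \<partial>M) = 0"
      using K by (intro weakly_harmonic_compact[OF K(1,2) H1_mult[OF G cutoff_C1[of k]]] P) (auto simp: pderiv_cutoff)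
    moreover have "(\<integral>x. (cutoff k x * G i x + pderiv_at i (cutoff k) x * g x) * P i x \<partial>M)
      = (\<integral>x. cutoff k x * (G i x * P i x) \<partial>M) + (\<integral>x. wgt k x * g x * (N i x * P i x) \<partial>M)" for i
    proof -
      have "integrable M (\<lambda>x. cutoff k x * (G i x * P i x))" "integrable M (\<lambda>x. wgt k x * g x * (N i x * P i x))"
        by (intro continuous_mult_integrable cutoff_cont sq_integrable_mult continuous_mult_sq_integrable wgt_cont N_cont H1_sq[OF G] P)+
      then show ?thesis
        by (subst Bochner_Integration.integral_add[symmetric]) (auto simp: pderiv_cutoff algebra_simps)
    qed
    ultimately show ?thesis by simp
  qed
  have "(\<lambda>k. \<Sum>i\<in>UNIV. (\<integral>x. cutoff k x * (G i x * P i x) \<partial>M) + (\<integral>x. wgt k x * g x * (N i x * P i x) \<partial>M)) \<longlonglongrightarrow> (\<Sum>i\<in>UNIV. (\<integral>x. G i x * P i x \<partial>M) + 0)"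
    by (intro tendsto_sum tendsto_add cutoff_limit hardy_pair z sq_integrable_mult continuous_mult_sq_integrable N_cont H1_sq[OF G] P)
  then show ?thesis unfolding e by (simp add: LIMSEQ_const_iff)
qed

text \<open>Used with \<open>f\<close> the curl of \<open>w\<close>: its divergence over the first
  index is the Laplacian of \<open>w\<close> minus the gradient of its divergence. Here
  \<open>p\<close> can be any H^1 function, since only symmetry of second derivatives
  enters.\<close>

lemma zero_trace_antisymmetric_orthogonal:
  assumes z: "\<And>i j. zero_trace (f i j)" and F: "\<And>i j. H1 (f i j) (F i j)"
    and anti: "\<And>i j x. f i j x = - f j i x" and P: "H1 p P"
  shows "(\<Sum>i\<in>UNIV. \<Sum>j\<in>UNIV. \<integral>x. F i j i x * P j x \<partial>M) = 0"
proof -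
  have e: "(\<Sum>i\<in>UNIV. \<Sum>j\<in>UNIV. (\<integral>x. cutoff k x * (F i j i x * P j x) \<partial>M) + (\<integral>x. wgt k x * f i j x * (N i x * P j x) \<partial>M)) = 0" for k
  proof -
    obtain K where K: "compact K" "K \<subseteq> \<Omega>" "\<And>x. x \<notin> K \<Longrightarrow> cutoff k x = 0" "\<And>x. x \<notin> K \<Longrightarrow> wgt k x = 0"
      by (rule cutoff_support[of k]) (rule that; assumption)
    have "(\<Sum>i\<in>UNIV. \<Sum>j\<in>UNIV. \<integral>x. (cutoff k x * F i j i x + pderiv_at i (cutoff k) x * f i j x) * P j x \<partial>M) = 0"
    proof (rule antisymmetric_compact[OF K(1,2) H1_mult[OF F cutoff_C1[of k]] _ _ _ P])
      show "cutoff k x * f i j x = - (cutoff k x * f j i x)" for i j x using anti[of i j x] by simp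
    qed (use K in \<open>auto simp: pderiv_cutoff\<close>)
    moreover have "(\<integral>x. (cutoff k x * F i j i x + pderiv_at i (cutoff k) x * f i j x) * P j x \<partial>M)
      = (\<integral>x. cutoff k x * (F i j i x * P j x) \<partial>M) + (\<integral>x. wgt k x * f i j x * (N i x * P j x) \<partial>M)" for i j
    proof -
      have "integrable M (\<lambda>x. cutoff k x * (F i j i x * P j x))" "integrable M (\<lambda>x. wgt k x * f i j x * (N i x * P j x))"
        by (intro continuous_mult_integrable cutoff_cont sq_integrable_mult continuous_mult_sq_integrable wgt_cont N_cont H1_sq[OF F] H1_sq[OF P])+
      then show ?thesis
        by (subst Bochner_Integration.integral_add[symmetric]) (auto simp: pderiv_cutoff algebra_simps)
    qed
    ultimately show ?thesis by simp
  qed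
  have "(\<lambda>k. \<Sum>i\<in>UNIV. \<Sum>j\<in>UNIV. (\<integral>x. cutoff k x * (F i j i x * P j x) \<partial>M) + (\<integral>x. wgt k x * f i j x * (N i x * P j x) \<partial>M)) \<longlonglongrightarrow> (\<Sum>i\<in>UNIV. \<Sum>j\<in>UNIV. (\<integral>x. F i j i x * P j x \<partial>M) + 0)"
    by (intro tendsto_sum tendsto_add cutoff_limit hardy_pair z sq_integrable_mult continuous_mult_sq_integrable N_cont H1_sq[OF F] H1_sq[OF P])
  then show ?thesis unfolding e by (simp add: LIMSEQ_const_iff)
qed

end

section \<open>The Rellich identity\<close>

context bounded_open
begin

text \<open>Evaluation at \<open>x\<close> is testing with the reflected kernel, whose second
  derivatives are symmetric.\<close>

lemma mollify_curl_free:
  assumes P: "H1 p P" and b: "cball x (1 / real (Suc n)) \<subseteq> \<Omega>"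
  shows "pderiv_at j (mollify n (P i)) x = pderiv_at i (mollify n (P j)) x"
proof -
  define \<phi> where "\<phi> y = mollifier n (x - y)" for y
  have t: "\<phi> \<in> test_functions \<Omega>" unfolding \<phi>_def[abs_def] by (rule test_reflect_mollifier[OF b])
  have pd: "pderiv_at j \<phi> y = - pderiv_at j (mollifier n) (x - y)" for j y
    unfolding \<phi>_def[abs_def] by (rule pderiv_at_reflect[OF C_k_differentiable[OF C_k_mollifier]])
  have e: "pderiv_at j (mollify n (P i)) x = (\<integral>y. p y * pderiv_at i (pderiv_at j \<phi>) y \<partial>M)" for i j
  proof -
    have "pderiv_at j (mollify n (P i)) x = - (\<integral>y. P i y * pderiv_at j \<phi> y \<partial>M)"
      by (simp add: pderiv_at_mollify[OF H1_sq(2)[OF P]] conv_def pd)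
    also have "\<dots> = (\<integral>y. p y * pderiv_at i (pderiv_at j \<phi>) y \<partial>M)"
      using wdD(3)[OF H1_wd[OF P] test_functions_pderiv[OF t]] by simp
    finally show ?thesis .
  qed
  show ?thesis unfolding e using pderiv_at_commute[OF test_functionsD(1)[OF t]] by simp
qed

lemma mollify_divergence_free:
  assumes P: "\<And>i. sq_integrable M (P i)" "weakly_harmonic P" and b: "cball x (1 / real (Suc n)) \<subseteq> \<Omega>"
  shows "(\<Sum>i\<in>UNIV. pderiv_at i (mollify n (P i)) x) = 0"
proof -
  define \<phi> where "\<phi> y = mollifier n (x - y)" for y
  have t: "\<phi> \<in> test_functions \<Omega>" unfolding \<phi>_def[abs_def] by (rule test_reflect_mollifier[OF b])
  have pd: "pderiv_at j \<phi> y = - pderiv_at j (mollifier n) (x - y)" for j y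
    unfolding \<phi>_def[abs_def] by (rule pderiv_at_reflect[OF C_k_differentiable[OF C_k_mollifier]])
  have "pderiv_at i (mollify n (P i)) x = - (\<integral>y. P i y * pderiv_at i \<phi> y \<partial>M)" for i
    by (simp add: pderiv_at_mollify[OF P(1)] conv_def pd)
  then show ?thesis using P(2) t by (simp add: weakly_harmonic_def sum_negf)
qed

text \<open>On \<open>K\<close> the mollified gradient \<open>V\<close> is curl free and divergence
  free, as soon as the kernel fits into the domain around \<open>K\<close>. All terms with
  derivatives of \<open>V\<close> then cancel in a suitable divergence, and the remaining ones
  contain \<open>V\<close> only quadratically, so they converge although \<open>P\<close> need not
  have square integrable derivatives up to the boundary.\<close>

lemma rellich_compact:
  assumes K: "compact K" "K \<subseteq> \<Omega>" and Z: "\<And>j. C_k (Suc 0) (Z j)" "\<And>j x. x \<notin> K \<Longrightarrow> Z j x = 0"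
    and P: "H1 p P" "weakly_harmonic P"
  shows "(\<Sum>i\<in>UNIV. \<Sum>j\<in>UNIV. (\<integral>x. pderiv_at i (Z i) x * P j x * P j x \<partial>M) - 2 * (\<integral>x. pderiv_at i (Z j) x * P i x * P j x \<partial>M)) = 0"
proof -
  obtain K' N where K': "compact K'" "K' \<subseteq> \<Omega>" "K \<subseteq> K'"
    and ball: "\<forall>n x. N \<le> n \<longrightarrow> x \<in> K \<longrightarrow> cball x (1 / real (Suc n)) \<subseteq> \<Omega>"
    by (rule mollify_compact[OF K]) (rule that; assumption)
  have Zc: "continuous_on UNIV (Z j)" "continuous_on UNIV (pderiv_at i (Z j))" for i j
    using C_k_continuous[OF Z(1)] Z(1)[of j] by auto
  have Z0: "pderiv_at i (Z j) x = 0" if "x \<notin> K" for i j x by (rule pderiv_eq_0_outside[OF K(1) Z(2) that])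
  note Ps = H1_sq(2)[OF P(1)]
  define V where "V n i = mollify n (P i)" for n i
  have VC: "C_k (Suc 0) (V n i)" for n i unfolding V_def by (rule C_k_mollify[OF Ps])
  have Vd: "V n i differentiable (at x)" for n i x using VC[of n i] by simp
  have Vc: "continuous_on UNIV (V n i)" for n i by (rule C_k_continuous[OF VC])
  have Zd: "Z i differentiable (at x)" for i x using Z(1)[of i] by simp
  have lim: "(\<lambda>n. \<integral>x. a x * V n i x * V n j x \<partial>M) \<longlonglongrightarrow> (\<integral>x. a x * P i x * P j x \<partial>M)" if "continuous_on UNIV a" for a i j
    unfolding V_def by (intro L2_lim_product continuous_mult_L2_lim mollify_L2_lim Ps that)
  have z: "(\<Sum>i\<in>UNIV. \<Sum>j\<in>UNIV. (\<integral>x. pderiv_at i (Z i) x * V n j x * V n j x \<partial>M) - 2 * (\<integral>x. pderiv_at i (Z j) x * V n i x * V n j x \<partial>M)) = 0"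
    if n: "n \<ge> N" for n
  proof -
    \<comment> \<open>The field \<open>Z\<close> times |V|^2 minus twice \<open>V\<close> times the
      scalar product of \<open>Z\<close> and \<open>V\<close>, written as one sum.\<close>
    define \<Psi> where "\<Psi> i x = (\<Sum>j\<in>UNIV. Z i x * (V n j x * V n j x) - 2 * ((Z j x * V n j x) * V n i x))" for i x
    have \<Psi>C: "C_k (Suc 0) (\<Psi> i)" for i
      unfolding \<Psi>_def[abs_def] by (intro C_k_sum C_k_diff C_k_cmult C_k_mult Z VC)
    have \<Psi>0: "\<Psi> i x = 0" if "x \<notin> K" for i x unfolding \<Psi>_def using Z(2)[OF that] by simp
    have pd: "pderiv_at i (\<Psi> i) x = (\<Sum>j\<in>UNIV. (pderiv_at i (Z i) x * V n j x * V n j x - 2 * (pderiv_at i (Z j) x * V n i x * V n j x))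
        + (2 * (Z i x * V n j x * pderiv_at i (V n j) x) - 2 * (Z j x * pderiv_at i (V n j) x * V n i x) - 2 * (Z j x * V n j x * pderiv_at i (V n i) x)))" for i x
      unfolding \<Psi>_def[abs_def] using Zd Vd
      by (subst pderiv_at_sum) (auto intro!: sum.cong differentiable_diff differentiable_mult simp: pderiv_at_diff pderiv_at_mult differentiable_diff differentiable_mult algebra_simps)
    have tot: "(\<Sum>i\<in>UNIV. pderiv_at i (\<Psi> i) x) = (\<Sum>i\<in>UNIV. \<Sum>j\<in>UNIV. pderiv_at i (Z i) x * V n j x * V n j x - 2 * (pderiv_at i (Z j) x * V n i x * V n j x))" for x
    proof (cases "x \<in> K")
      case False
      then have "pderiv_at i (\<Psi> i) x = 0" for i by (intro pderiv_eq_0_outside[OF K(1) \<Psi>0])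
      then show ?thesis using Z0[OF False] by simp
    next
      case True
      then have b: "cball x (1 / real (Suc n)) \<subseteq> \<Omega>" using ball n by blast
      have cf: "pderiv_at i (V n j) x = pderiv_at j (V n i) x" for i j
        unfolding V_def by (rule mollify_curl_free[OF P(1) b])
      have df: "(\<Sum>i\<in>UNIV. pderiv_at i (V n i) x) = 0" unfolding V_def by (rule mollify_divergence_free[OF Ps P(2) b])
      have 1: "(\<Sum>i\<in>UNIV. \<Sum>j\<in>UNIV. Z i x * V n j x * pderiv_at i (V n j) x) = (\<Sum>i\<in>UNIV. \<Sum>j\<in>UNIV. Z j x * pderiv_at i (V n j) x * V n i x)"
        by (subst sum.swap) (intro sum.cong refl, subst cf, simp add: mult_ac)
      have 2: "(\<Sum>i\<in>UNIV. \<Sum>j\<in>UNIV. Z j x * V n j x * pderiv_at i (V n i) x) = 0"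
      proof -
        have "(\<Sum>i\<in>UNIV. \<Sum>j\<in>UNIV. Z j x * V n j x * pderiv_at i (V n i) x) = (\<Sum>i\<in>UNIV. (\<Sum>j\<in>UNIV. Z j x * V n j x) * pderiv_at i (V n i) x)"
          by (simp add: sum_distrib_right)
        also have "\<dots> = (\<Sum>j\<in>UNIV. Z j x * V n j x) * (\<Sum>i\<in>UNIV. pderiv_at i (V n i) x)" by (simp add: sum_distrib_left)
        finally show ?thesis by (simp add: df)
      qed
      have "(\<Sum>i\<in>UNIV. \<Sum>j\<in>UNIV. 2 * (Z i x * V n j x * pderiv_at i (V n j) x) - 2 * (Z j x * pderiv_at i (V n j) x * V n i x) - 2 * (Z j x * V n j x * pderiv_at i (V n i) x)) = 0"
        unfolding sum_subtractf sum_distrib_left[symmetric] 1 2 by simp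
      then show ?thesis unfolding pd sum.distrib by simp
    qed
    have "(\<integral>x. (\<Sum>i\<in>UNIV. pderiv_at i (\<Psi> i) x) \<partial>lborel) = 0"
    proof -
      have "integrable lborel (pderiv_at i (\<Psi> i))" for i
        using \<Psi>C[of i] pderiv_eq_0_outside[OF K(1) \<Psi>0]
        by (intro continuous_compact_support_integrable(1)[OF _ K(1)]) auto
      then show ?thesis
        using integral_pderiv_compact_support[OF \<Psi>C K(1) \<Psi>0] by (subst Bochner_Integration.integral_sum) auto
    qed
    moreover have "(\<integral>x. (\<Sum>i\<in>UNIV. pderiv_at i (\<Psi> i) x) \<partial>M) = (\<integral>x. (\<Sum>i\<in>UNIV. pderiv_at i (\<Psi> i) x) \<partial>lborel)"
    proof (rule integral_eq_lborel)
      show "continuous_on UNIV (\<lambda>x. \<Sum>i\<in>UNIV. pderiv_at i (\<Psi> i) x)" using \<Psi>C by (intro continuous_on_sum) simp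
      fix x assume "x \<notin> \<Omega>"
      then have "x \<notin> K" using K(2) by blast
      then show "(\<Sum>i\<in>UNIV. pderiv_at i (\<Psi> i) x) = 0" by (simp add: pderiv_eq_0_outside[OF K(1) \<Psi>0])
    qed
    ultimately have "(\<integral>x. (\<Sum>i\<in>UNIV. \<Sum>j\<in>UNIV. pderiv_at i (Z i) x * V n j x * V n j x - 2 * (pderiv_at i (Z j) x * V n i x * V n j x)) \<partial>M) = 0"
      unfolding tot by simp
    moreover have "integrable M (\<lambda>x. pderiv_at i (Z j) x * V n k x * V n l x)" for i j k l
      by (intro fm.sq_integrable_integrable continuous_sq_integrable continuous_on_mult Zc Vc)
    ultimately show ?thesis by (simp add: Bochner_Integration.integral_sum)
  qed
  have "(\<lambda>n. \<Sum>i\<in>UNIV. \<Sum>j\<in>UNIV. (\<integral>x. pderiv_at i (Z i) x * V n j x * V n j x \<partial>M) - 2 * (\<integral>x. pderiv_at i (Z j) x * V n i x * V n j x \<partial>M))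
    \<longlonglongrightarrow> (\<Sum>i\<in>UNIV. \<Sum>j\<in>UNIV. (\<integral>x. pderiv_at i (Z i) x * P j x * P j x \<partial>M) - 2 * (\<integral>x. pderiv_at i (Z j) x * P i x * P j x \<partial>M))"
    by (intro tendsto_sum tendsto_diff tendsto_mult tendsto_const lim Zc)
  moreover have "(\<lambda>n. \<Sum>i\<in>UNIV. \<Sum>j\<in>UNIV. (\<integral>x. pderiv_at i (Z i) x * V n j x * V n j x \<partial>M) - 2 * (\<integral>x. pderiv_at i (Z j) x * V n i x * V n j x \<partial>M)) \<longlonglongrightarrow> 0"
    using z by (intro tendsto_eventually eventually_sequentiallyI[of N]) auto
  ultimately show ?thesis using LIMSEQ_unique by blast
qed

end

context defining_function
begin

text \<open>It suffices that \<open>X\<close> vanishes to first order in \<open>d\<close>: cutting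
  off then costs a bounded layer factor times an integrable function, which disappears by
  \<open>wgt_limit\<close>.\<close>

lemma rellich:
  assumes X: "\<And>j. C_k (Suc 0) (X j)" "\<And>j x. x \<in> \<Omega> \<Longrightarrow> \<bar>X j x\<bar> \<le> A * d x"
    and P: "H1 p P" "weakly_harmonic P"
  shows "(\<Sum>i\<in>UNIV. \<Sum>j\<in>UNIV. (\<integral>x. pderiv_at i (X i) x * (P j x * P j x) \<partial>M) - 2 * (\<integral>x. pderiv_at i (X j) x * (P i x * P j x) \<partial>M)) = 0"
proof -
  have Xc: "continuous_on UNIV (X j)" "continuous_on UNIV (pderiv_at i (X j))" for i j
    using C_k_continuous[OF X(1)] X(1)[of j] by auto
  have pp: "integrable M (\<lambda>x. P a x * P b x)" for a b by (intro sq_integrable_mult H1_sq[OF P(1)])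
  have ipp: "integrable M (\<lambda>x. pderiv_at i (X j) x * (P a x * P b x))" for a b i j
    by (intro continuous_mult_integrable Xc pp)
  obtain B where B: "B > 0" "\<And>i x. x \<in> \<Omega> \<Longrightarrow> \<bar>N i x\<bar> \<le> B" using continuous_bounded_family[of N, OF N_cont] by metis
  have lim: "(\<lambda>k. \<integral>x. pderiv_at i (\<lambda>x. X j x * cutoff k x) x * P a x * P b x \<partial>M) \<longlonglongrightarrow> (\<integral>x. pderiv_at i (X j) x * (P a x * P b x) \<partial>M)" for i j a b
  proof -
    have e: "(\<integral>x. pderiv_at i (\<lambda>x. X j x * cutoff k x) x * P a x * P b x \<partial>M)
      = (\<integral>x. cutoff k x * (pderiv_at i (X j) x * (P a x * P b x)) \<partial>M) + (\<integral>x. wgt k x * (X j x * N i x) * (P a x * P b x) \<partial>M)" for k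
    proof -
      have "integrable M (\<lambda>x. cutoff k x * (pderiv_at i (X j) x * (P a x * P b x)))" "integrable M (\<lambda>x. wgt k x * (X j x * N i x) * (P a x * P b x))"
        by (intro continuous_mult_integrable continuous_on_mult wgt_cont cutoff_cont Xc N_cont pp)+
      moreover have "pderiv_at i (\<lambda>x. X j x * cutoff k x) x = X j x * (wgt k x * N i x) + pderiv_at i (X j) x * cutoff k x" for x
        using X(1)[of j] cutoff_C1[of k] by (subst pderiv_at_mult) (auto simp: pderiv_cutoff)
      ultimately show ?thesis
        by (subst Bochner_Integration.integral_add[symmetric]) (auto simp: algebra_simps)
    qed
    have "\<bar>X j x * N i x\<bar> \<le> (\<bar>A\<bar> * B) * d x" if x: "x \<in> \<Omega>" for x
    proof -
      have "\<bar>X j x\<bar> \<le> \<bar>A\<bar> * d x" using X(2)[OF x, of j] d_pos[OF x] by (smt (verit) mult_right_mono)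
      then have "\<bar>X j x\<bar> * \<bar>N i x\<bar> \<le> (\<bar>A\<bar> * d x) * B" using B(2)[OF x] d_pos[OF x] by (intro mult_mono) auto
      then show ?thesis by (simp add: abs_mult mult_ac)
    qed
    then have "(\<lambda>k. (\<integral>x. cutoff k x * (pderiv_at i (X j) x * (P a x * P b x)) \<partial>M) + (\<integral>x. wgt k x * (X j x * N i x) * (P a x * P b x) \<partial>M)) \<longlonglongrightarrow> (\<integral>x. pderiv_at i (X j) x * (P a x * P b x) \<partial>M) + 0"
      by (intro tendsto_add cutoff_limit ipp wgt_limit[where A="\<bar>A\<bar> * B"] pp continuous_on_mult Xc N_cont)
    then show ?thesis unfolding e by simp
  qed
  have "(\<Sum>i\<in>UNIV. \<Sum>j\<in>UNIV. (\<integral>x. pderiv_at i (\<lambda>x. X i x * cutoff k x) x * P j x * P j x \<partial>M) - 2 * (\<integral>x. pderiv_at i (\<lambda>x. X j x * cutoff k x) x * P i x * P j x \<partial>M)) = 0" for k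
  proof -
    obtain K where K: "compact K" "K \<subseteq> \<Omega>" "\<And>x. x \<notin> K \<Longrightarrow> cutoff k x = 0" "\<And>x. x \<notin> K \<Longrightarrow> wgt k x = 0"
      by (rule cutoff_support[of k]) (rule that; assumption)
    show ?thesis
      using K(3) by (intro rellich_compact[OF K(1,2) C_k_mult[OF X(1) cutoff_C1[of k]] _ P]) auto
  qed
  moreover have "(\<lambda>k. \<Sum>i\<in>UNIV. \<Sum>j\<in>UNIV. (\<integral>x. pderiv_at i (\<lambda>x. X i x * cutoff k x) x * P j x * P j x \<partial>M) - 2 * (\<integral>x. pderiv_at i (\<lambda>x. X j x * cutoff k x) x * P i x * P j x \<partial>M))
    \<longlonglongrightarrow> (\<Sum>i\<in>UNIV. \<Sum>j\<in>UNIV. (\<integral>x. pderiv_at i (X i) x * (P j x * P j x) \<partial>M) - 2 * (\<integral>x. pderiv_at i (X j) x * (P i x * P j x) \<partial>M))"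
    by (intro tendsto_sum tendsto_diff tendsto_mult tendsto_const lim)
  ultimately show ?thesis by (simp add: LIMSEQ_const_iff)
qed

lemma dY_deriv: "pderiv_at i (\<lambda>x. d x * Y j x) x = N i x * Y j x + d x * pderiv_at i (Y j) x"
  using d_differentiable Y_C1[of j] by (subst pderiv_at_mult) auto

lemma dY_C1: "C_k (Suc 0) (\<lambda>x. d x * Y j x)"
  by (intro C_k_mult Y_C1 d_Ck) simp

lemma dY_bound: obtains B where "B > 0" "\<And>j x. x \<in> \<Omega> \<Longrightarrow> \<bar>d x * Y j x\<bar> \<le> B * d x"
proof -
  obtain B where B: "B > 0" "\<And>i x. x \<in> \<Omega> \<Longrightarrow> \<bar>Y i x\<bar> \<le> B" using continuous_bounded_family[of Y, OF Y_cont] by metis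
  have "\<bar>d x * Y j x\<bar> \<le> B * d x" if "x \<in> \<Omega>" for j x
    using B(2)[OF that, of j] d_pos[OF that] by (simp add: abs_mult mult.commute mult_right_mono)
  then show ?thesis using that B(1) by blast
qed

section \<open>Contraction of the tangential part\<close>

text \<open>For the field \<open>d * Y\<close> the Rellich integrand is |P|^2 minus twice the normal
  part, up to terms carrying a factor \<open>d\<close>. Hence the normal part holds about half of
  the energy, and the error is controlled by the energy weighted with
  \<open>d\<^sup>2\<close>.\<close>

lemma normal_energy:
  obtains K where "K > 0" "\<And>p P. H1 p P \<Longrightarrow> weakly_harmonic P \<Longrightarrow>
    (\<integral>x. (\<Sum>j\<in>UNIV. (P j x)\<^sup>2) \<partial>M) \<le> K * (\<integral>x. (\<Sum>i\<in>UNIV. N i x * P i x)\<^sup>2 / Q x + (d x)\<^sup>2 * (\<Sum>j\<in>UNIV. (P j x)\<^sup>2) \<partial>M)"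
proof -
  obtain B0 where B0: "B0 > 0" "\<And>j x. x \<in> \<Omega> \<Longrightarrow> \<bar>d x * Y j x\<bar> \<le> B0 * d x" using dY_bound by metis
  have yc: "continuous_on UNIV (pderiv_at i (Y j))" for i j using Y_C1[of j] by simp
  obtain B where B: "B > 0" "\<And>ij x. x \<in> \<Omega> \<Longrightarrow> \<bar>pderiv_at (fst ij) (Y (snd ij)) x\<bar> \<le> B"
    using continuous_bounded_family[of "\<lambda>ij. pderiv_at (fst ij) (Y (snd ij))", OF yc] by metis
  obtain c where c: "c > 0" "\<And>x. x \<in> \<Omega> \<Longrightarrow> c \<le> Q x" using Q_lower by metis
  define n where "n = real CARD('n)"
  \<comment> \<open>\<open>n * B\<close> for the divergence of \<open>Y\<close>, and twice that for
    the quadratic form of its Jacobian.\<close>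
  define C where "C = 3 * n * B"
  have n: "n > 0" by (simp add: n_def)
  have C: "C > 0" using B n by (simp add: C_def)
  \<comment> \<open>Half of the energy is absorbed on the left. This doubles the factor 2 of the
    normal part and the coefficients \<open>1 / c\<close> and \<open>C\<^sup>2 / 2\<close> of the
    terms with \<open>d\<^sup>2\<close>.\<close>
  define K where "K = max 4 (2 * (1 / c + C\<^sup>2 / 2))"
  have K: "K > 0" by (simp add: K_def)
  have "(\<integral>x. (\<Sum>j\<in>UNIV. (P j x)\<^sup>2) \<partial>M) \<le> K * (\<integral>x. (\<Sum>i\<in>UNIV. N i x * P i x)\<^sup>2 / Q x + (d x)\<^sup>2 * (\<Sum>j\<in>UNIV. (P j x)\<^sup>2) \<partial>M)"
    if P: "H1 p P" "weakly_harmonic P" for p P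
  proof -
    have pp: "integrable M (\<lambda>x. P a x * P b x)" for a b by (intro sq_integrable_mult H1_sq[OF P(1)])
    define \<nu> where "\<nu> x = (\<Sum>i\<in>UNIV. N i x * P i x)\<^sup>2 / Q x" for x
    define T where "T x = (\<Sum>j\<in>UNIV. (P j x)\<^sup>2)" for x
    have T0: "T x \<ge> 0" for x unfolding T_def by (simp add: sum_nonneg)
    have \<nu>0: "\<nu> x \<ge> 0" for x unfolding \<nu>_def using Q_pos[of x] by simp
    have \<nu>e: "\<nu> x = (\<Sum>i\<in>UNIV. \<Sum>j\<in>UNIV. N i x * Y j x * (P i x * P j x))" for x
      unfolding \<nu>_def power2_eq_square sum_product sum_divide_distrib Y_def by (intro sum.cong) (auto simp: mult_ac)
    have NYc: "continuous_on UNIV (\<lambda>x. N i x * Y j x)" for i j by (intro continuous_on_mult N_cont Y_cont)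
    have dc: "continuous_on UNIV d" by (rule C_k_continuous[OF d_C3])
    have \<nu>i: "integrable M \<nu>" unfolding \<nu>e[abs_def]
      by (intro Bochner_Integration.integrable_sum continuous_mult_integrable NYc pp)
    have Ti: "integrable M T" unfolding T_def[abs_def]
      by (intro Bochner_Integration.integrable_sum sq_integrable_square H1_sq[OF P(1)])
    have dTi: "integrable M (\<lambda>x. (d x)\<^sup>2 * T x)"
      by (intro continuous_mult_integrable continuous_on_power dc Ti)
    define R where "R x = (\<Sum>i\<in>UNIV. \<Sum>j\<in>UNIV. pderiv_at i (\<lambda>x. d x * Y i x) x * (P j x * P j x) - 2 * (pderiv_at i (\<lambda>x. d x * Y j x) x * (P i x * P j x)))" for x
    have cY: "continuous_on UNIV (pderiv_at i (\<lambda>x. d x * Y j x))" for i j using dY_C1[of j] by simp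
    have Ri: "integrable M R" unfolding R_def[abs_def]
      by (intro Bochner_Integration.integrable_sum Bochner_Integration.integrable_diff integrable_mult_right continuous_mult_integrable cY pp)
    have R0: "(\<integral>x. R x \<partial>M) = 0"
    proof -
      have "(\<integral>x. R x \<partial>M) = (\<Sum>i\<in>UNIV. \<Sum>j\<in>UNIV. (\<integral>x. pderiv_at i (\<lambda>x. d x * Y i x) x * (P j x * P j x) \<partial>M) - 2 * (\<integral>x. pderiv_at i (\<lambda>x. d x * Y j x) x * (P i x * P j x) \<partial>M))"
        unfolding R_def using continuous_mult_integrable[OF cY pp] by (simp add: Bochner_Integration.integral_sum)
      then show ?thesis using rellich[OF dY_C1 B0(2) P] by simp
    qed
    have pt: "T x \<le> K * (\<nu> x + (d x)\<^sup>2 * T x) + 2 * R x" if x: "x \<in> \<Omega>" for x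
    proof -
      have TT: "(\<Sum>j\<in>UNIV. P j x * P j x) = T x" by (simp add: T_def power2_eq_square)
      define u where "u = (\<Sum>i\<in>UNIV. pderiv_at i (Y i) x) * T x - 2 * (\<Sum>i\<in>UNIV. \<Sum>j\<in>UNIV. pderiv_at i (Y j) x * (P i x * P j x))"
      have Re: "R x = (1 - (d x)\<^sup>2 / Q x) * T x - 2 * \<nu> x + d x * u"
      proof -
        have "R x = (\<Sum>i\<in>UNIV. pderiv_at i (\<lambda>x. d x * Y i x) x) * T x - 2 * (\<Sum>i\<in>UNIV. \<Sum>j\<in>UNIV. pderiv_at i (\<lambda>x. d x * Y j x) x * (P i x * P j x))"
          unfolding R_def sum_subtractf sum_distrib_left[symmetric] TT by (simp add: sum_distrib_right)
        also have "(\<Sum>i\<in>UNIV. pderiv_at i (\<lambda>x. d x * Y i x) x) = (1 - (d x)\<^sup>2 / Q x) + d x * (\<Sum>i\<in>UNIV. pderiv_at i (Y i) x)"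
          unfolding dY_deriv sum.distrib NY_sum[OF x] by (simp add: sum_distrib_left)
        also have "(\<Sum>i\<in>UNIV. \<Sum>j\<in>UNIV. pderiv_at i (\<lambda>x. d x * Y j x) x * (P i x * P j x)) = \<nu> x + d x * (\<Sum>i\<in>UNIV. \<Sum>j\<in>UNIV. pderiv_at i (Y j) x * (P i x * P j x))"
          unfolding dY_deriv \<nu>e distrib_right sum.distrib by (simp add: sum_distrib_left mult.assoc)
        finally show ?thesis by (simp add: u_def algebra_simps)
      qed
      have u: "\<bar>u\<bar> \<le> C * T x"
      proof -
        have bij: "\<bar>pderiv_at i (Y j) x\<bar> \<le> B" for i j using B(2)[OF x, of "(i, j)"] by simp
        have "\<bar>\<Sum>i\<in>UNIV. pderiv_at i (Y i) x\<bar> \<le> (\<Sum>i\<in>(UNIV::'n set). B)"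
          by (intro order_trans[OF sum_abs] sum_mono bij)
        then have "\<bar>\<Sum>i\<in>UNIV. pderiv_at i (Y i) x\<bar> \<le> n * B" by (simp add: n_def)
        then have u1: "\<bar>(\<Sum>i\<in>UNIV. pderiv_at i (Y i) x) * T x\<bar> \<le> n * B * T x"
          using T0[of x] by (simp add: abs_mult mult_right_mono)
        have "\<bar>pderiv_at i (Y j) x * (P i x * P j x)\<bar> \<le> B * (((P i x)\<^sup>2 + (P j x)\<^sup>2) / 2)" for i j
        proof -
          have "\<bar>P i x * P j x\<bar> \<le> ((P i x)\<^sup>2 + (P j x)\<^sup>2) / 2"
            using sum_squares_bound[of "\<bar>P i x\<bar>" "\<bar>P j x\<bar>"] by (simp add: abs_mult)
          then show ?thesis unfolding abs_mult[of "pderiv_at i (Y j) x"] using bij B(1) by (intro mult_mono) auto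
        qed
        then have "\<bar>\<Sum>i\<in>UNIV. \<Sum>j\<in>UNIV. pderiv_at i (Y j) x * (P i x * P j x)\<bar> \<le> (\<Sum>i\<in>UNIV. \<Sum>j\<in>UNIV. B * (((P i x)\<^sup>2 + (P j x)\<^sup>2) / 2))"
          by (intro order_trans[OF sum_abs] sum_mono)
        also have "\<dots> = B * (n * T x)"
        proof -
          have "(\<Sum>i\<in>UNIV. \<Sum>j\<in>(UNIV::'n set). (P i x)\<^sup>2 + (P j x)\<^sup>2) = 2 * (n * T x)"
            by (simp add: sum.distrib n_def T_def sum_distrib_left)
          moreover have "(\<Sum>i\<in>UNIV. \<Sum>j\<in>(UNIV::'n set). B * (((P i x)\<^sup>2 + (P j x)\<^sup>2) / 2)) = B * ((\<Sum>i\<in>UNIV. \<Sum>j\<in>(UNIV::'n set). (P i x)\<^sup>2 + (P j x)\<^sup>2) / 2)"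
            by (simp only: sum_distrib_left sum_divide_distrib)
          ultimately show ?thesis by simp
        qed
        finally show ?thesis using u1 unfolding u_def C_def by (simp add: algebra_simps)
      qed
      have dp: "d x > 0" by (rule d_pos[OF x])
      have "\<bar>d x * u\<bar> \<le> d x * (C * T x)" using u dp by (simp add: abs_mult mult_left_mono)
      also have "\<dots> \<le> (1 / 2 + C\<^sup>2 / 2 * (d x)\<^sup>2) * T x"
      proof -
        have "d x * C \<le> 1 / 2 + C\<^sup>2 / 2 * (d x)\<^sup>2"
          using sum_squares_bound[of 1 "d x * C"] by (simp add: power_mult_distrib algebra_simps)
        then have "d x * C * T x \<le> (1 / 2 + C\<^sup>2 / 2 * (d x)\<^sup>2) * T x" using T0 by (intro mult_right_mono)
        then show ?thesis by (simp add: mult_ac)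
      qed
      finally have du: "- (d x * u) \<le> (1 / 2 + C\<^sup>2 / 2 * (d x)\<^sup>2) * T x" by linarith
      have dq: "(d x)\<^sup>2 / Q x * T x \<le> (1 / c) * (d x)\<^sup>2 * T x"
        using c(1) c(2)[OF x] T0[of x] by (intro mult_right_mono) (auto simp: divide_left_mono)
      define W where "W = (d x)\<^sup>2 * T x"
      have "T x = R x + (d x)\<^sup>2 / Q x * T x + 2 * \<nu> x - d x * u" unfolding Re by (simp add: algebra_simps)
      moreover have "(d x)\<^sup>2 / Q x * T x \<le> (1 / c) * W" using dq by (simp add: W_def)
      moreover have "- (d x * u) \<le> T x / 2 + C\<^sup>2 * W / 2" using du by (simp add: W_def algebra_simps)
      ultimately have "T x \<le> 2 * R x + 4 * \<nu> x + (2 * ((1 / c) * W) + C\<^sup>2 * W)" by linarith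
      then have 1: "T x \<le> 2 * R x + 4 * \<nu> x + 2 * (1 / c + C\<^sup>2 / 2) * ((d x)\<^sup>2 * T x)"
        by (simp add: W_def algebra_simps)
      have 2: "4 * \<nu> x \<le> K * \<nu> x" using \<nu>0 by (intro mult_right_mono) (auto simp: K_def)
      have 3: "2 * (1 / c + C\<^sup>2 / 2) * ((d x)\<^sup>2 * T x) \<le> K * ((d x)\<^sup>2 * T x)"
        using T0 by (intro mult_right_mono) (auto simp: K_def)
      show ?thesis using 1 2 3 by (simp add: distrib_left)
    qed
    have "(\<integral>x. T x \<partial>M) \<le> (\<integral>x. K * (\<nu> x + (d x)\<^sup>2 * T x) + 2 * R x \<partial>M)"
      using pt by (intro integral_mono Ti Bochner_Integration.integrable_add integrable_mult_right \<nu>i dTi Ri) auto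
    also have "\<dots> = K * (\<integral>x. \<nu> x + (d x)\<^sup>2 * T x \<partial>M)"
      using \<nu>i dTi Ri R0 by simp
    finally show ?thesis unfolding T_def \<nu>_def .
  qed
  then show ?thesis using that K by blast
qed

text \<open>On the boundary, where \<open>d = 0\<close> and \<open>Q = \<bar>N\<bar>\<^sup>2\<close>, this is the projection onto the tangent space.\<close>
definition tang :: "'n \<Rightarrow> 'n \<Rightarrow> real^'n \<Rightarrow> real" where
  "tang j l x = ((if j = l then 1 else 0) - N j x * Y l x) / (1 + (d x)\<^sup>2)"

text \<open>Pointwise, \<open>tang\<close> loses a multiple of the normal part, because that
  direction is projected out, and a multiple of \<open>d\<^sup>2\<close> times the energy, because
  of the factor \<open>1 / (1 + d^2)\<close>. These are exactly the two quantities that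
  \<open>normal_energy\<close> compares with the whole energy.\<close>

lemma tangential_contraction:
  obtains \<theta> where "0 < \<theta>" "\<theta> < 1" "\<And>p P. H1 p P \<Longrightarrow> weakly_harmonic P \<Longrightarrow>
    (\<integral>x. (\<Sum>j\<in>UNIV. (\<Sum>l\<in>UNIV. tang j l x * P l x)\<^sup>2) \<partial>M) \<le> \<theta> * (\<integral>x. (\<Sum>j\<in>UNIV. (P j x)\<^sup>2) \<partial>M)"
proof -
  obtain K where K: "K > 0" "\<And>p P. H1 p P \<Longrightarrow> weakly_harmonic P \<Longrightarrow>
    (\<integral>x. (\<Sum>j\<in>UNIV. (P j x)\<^sup>2) \<partial>M) \<le> K * (\<integral>x. (\<Sum>i\<in>UNIV. N i x * P i x)\<^sup>2 / Q x + (d x)\<^sup>2 * (\<Sum>j\<in>UNIV. (P j x)\<^sup>2) \<partial>M)"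
    by (rule normal_energy) (rule that; assumption)
  have dc: "continuous_on UNIV d" by (rule C_k_continuous[OF d_C3])
  obtain D where D: "D > 0" "\<And>x. x \<in> closure \<Omega> \<Longrightarrow> \<bar>d x\<bar> \<le> D" using continuous_bounded[OF dc] by metis
  \<comment> \<open>A lower bound on the domain for the square of the factor
    \<open>1 / (1 + d^2)\<close>.\<close>
  define c where "c = 1 / (1 + D\<^sup>2)\<^sup>2"
  have Dp: "1 + D\<^sup>2 > 0" "1 + D\<^sup>2 \<ge> 1" by (auto simp: add_pos_nonneg)
  have c: "c > 0" unfolding c_def using Dp(1) by (intro divide_pos_pos zero_less_power) auto
  \<comment> \<open>The maximum keeps \<theta> positive whatever the size of \<open>c / K\<close>;
    its square root is divided by later.\<close>
  define \<theta> where "\<theta> = max (1 / 2) (1 - c / K)"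
  have \<theta>: "0 < \<theta>" "\<theta> < 1" using c K(1) by (auto simp: \<theta>_def)
  have "(\<integral>x. (\<Sum>j\<in>UNIV. (\<Sum>l\<in>UNIV. tang j l x * P l x)\<^sup>2) \<partial>M) \<le> \<theta> * (\<integral>x. (\<Sum>j\<in>UNIV. (P j x)\<^sup>2) \<partial>M)"
    if P: "H1 p P" "weakly_harmonic P" for p P
  proof -
    define \<nu> where "\<nu> x = (\<Sum>i\<in>UNIV. N i x * P i x)\<^sup>2 / Q x" for x
    define T where "T x = (\<Sum>j\<in>UNIV. (P j x)\<^sup>2)" for x
    define S where "S x = (\<Sum>j\<in>UNIV. (\<Sum>l\<in>UNIV. tang j l x * P l x)\<^sup>2)" for x
    have T0: "T x \<ge> 0" for x unfolding T_def by (simp add: sum_nonneg)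
    have \<nu>0: "\<nu> x \<ge> 0" for x unfolding \<nu>_def using Q_pos[of x] by simp
    have Ti: "integrable M T" unfolding T_def[abs_def]
      by (intro Bochner_Integration.integrable_sum sq_integrable_square H1_sq[OF P(1)])
    have dTi: "integrable M (\<lambda>x. (d x)\<^sup>2 * T x)"
      by (intro continuous_mult_integrable continuous_on_power dc Ti)
    have pp: "integrable M (\<lambda>x. P a x * P b x)" for a b by (intro sq_integrable_mult H1_sq[OF P(1)])
    have \<nu>e: "\<nu> x = (\<Sum>i\<in>UNIV. \<Sum>j\<in>UNIV. N i x * Y j x * (P i x * P j x))" for x
      unfolding \<nu>_def power2_eq_square sum_product sum_divide_distrib Y_def by (intro sum.cong) (auto simp: mult_ac)
    have \<nu>i: "integrable M \<nu>" unfolding \<nu>e[abs_def]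
      by (intro Bochner_Integration.integrable_sum continuous_mult_integrable continuous_on_mult N_cont Y_cont pp)
    have tc: "continuous_on UNIV (tang j l)" for j l
    proof -
      have "1 + (d x)\<^sup>2 \<noteq> 0" for x by (metis add_pos_nonneg less_irrefl zero_le_power2 zero_less_one)
      then show ?thesis unfolding tang_def[abs_def] by (intro continuous_intros N_cont Y_cont dc) auto
    qed
    have Si: "integrable M S" unfolding S_def[abs_def]
      by (intro Bochner_Integration.integrable_sum sq_integrable_square sq_integrable_sum continuous_mult_sq_integrable tc H1_sq[OF P(1)])
    have pt: "S x \<le> T x - c * (\<nu> x + (d x)\<^sup>2 * T x)" if x: "x \<in> \<Omega>" for x
    proof -
      define \<kappa> where "\<kappa> = 1 / (1 + (d x)\<^sup>2)"
      define s where "s = (\<Sum>i\<in>UNIV. N i x * P i x)"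
      have dp: "1 + (d x)\<^sup>2 \<ge> 1" by simp
      have \<kappa>: "0 < \<kappa>" "\<kappa> \<le> 1"
      proof -
        have "0 < 1 + (d x)\<^sup>2" using dp by linarith
        then show "0 < \<kappa>" "\<kappa> \<le> 1" unfolding \<kappa>_def using dp by (auto simp only: zero_less_divide_1_iff divide_le_eq_1)
      qed
      have dD: "(d x)\<^sup>2 \<le> D\<^sup>2"
        using D(2)[of x] D(1) x closure_subset[of \<Omega>] abs_le_square_iff[of "d x" D] by auto
      have \<kappa>D: "1 / (1 + D\<^sup>2) \<le> \<kappa>" unfolding \<kappa>_def using dD dp Dp(1) by (intro divide_left_mono mult_pos_pos) linarith+
      have q: "Q x > 0" by (rule Q_pos)
      have NQ: "(\<Sum>j\<in>UNIV. (N j x)\<^sup>2) \<le> Q x" using Q_eq[OF x] by simp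
      have "(\<Sum>l\<in>UNIV. tang j l x * P l x) = \<kappa> * (P j x - N j x * (s / Q x))" for j
      proof -
        have "(\<Sum>l\<in>UNIV. tang j l x * P l x) = (\<Sum>l\<in>UNIV. \<kappa> * ((if j = l then P l x else 0) - N j x * (N l x * P l x) / Q x))"
          by (intro sum.cong) (auto simp: tang_def \<kappa>_def Y_def algebra_simps diff_divide_distrib)
        also have "\<dots> = \<kappa> * (P j x - N j x * (s / Q x))"
          by (simp add: sum_distrib_left[symmetric] sum_subtractf s_def sum_divide_distrib[symmetric])
        finally show ?thesis .
      qed
      then have "S x = \<kappa>\<^sup>2 * (\<Sum>j\<in>UNIV. (P j x - N j x * (s / Q x))\<^sup>2)"
        by (simp add: S_def power_mult_distrib sum_distrib_left)
      also have "(\<Sum>j\<in>UNIV. (P j x - N j x * (s / Q x))\<^sup>2) = T x - 2 * (s / Q x) * s + (s / Q x)\<^sup>2 * (\<Sum>j\<in>UNIV. (N j x)\<^sup>2)"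
      proof -
        have "(\<Sum>j\<in>UNIV. (P j x - N j x * r)\<^sup>2) = T x - 2 * r * s + r\<^sup>2 * (\<Sum>j\<in>UNIV. (N j x)\<^sup>2)" for r
        proof -
          have "(\<Sum>j\<in>UNIV. (P j x - N j x * r)\<^sup>2) = (\<Sum>j\<in>UNIV. (P j x)\<^sup>2 - 2 * r * (N j x * P j x) + r\<^sup>2 * (N j x)\<^sup>2)"
            by (intro sum.cong) (auto simp: power2_eq_square algebra_simps)
          also have "\<dots> = T x - 2 * r * s + r\<^sup>2 * (\<Sum>j\<in>UNIV. (N j x)\<^sup>2)"
            unfolding sum.distrib sum_subtractf sum_distrib_left[symmetric] T_def s_def ..
          finally show ?thesis .
        qed
        then show ?thesis by blast
      qed
      finally have Se: "S x = \<kappa>\<^sup>2 * (T x - 2 * (s / Q x) * s + (s / Q x)\<^sup>2 * (\<Sum>j\<in>UNIV. (N j x)\<^sup>2))" .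
      have "(s / Q x)\<^sup>2 * (\<Sum>j\<in>UNIV. (N j x)\<^sup>2) \<le> (s / Q x)\<^sup>2 * Q x" using NQ by (intro mult_left_mono) auto
      also have "\<dots> = \<nu> x" using q by (simp add: \<nu>_def s_def power2_eq_square)
      finally have "S x \<le> \<kappa>\<^sup>2 * (T x - \<nu> x)"
        unfolding Se by (intro mult_left_mono) (auto simp: \<nu>_def s_def power2_eq_square)
      also have "\<dots> = T x - ((1 - \<kappa>\<^sup>2) * T x + \<kappa>\<^sup>2 * \<nu> x)" by (simp add: algebra_simps)
      also have "\<dots> \<le> T x - (c * (d x)\<^sup>2 * T x + c * \<nu> x)"
      proof -
        have c\<kappa>: "c \<le> \<kappa>\<^sup>2"
          using power_mono[OF \<kappa>D, of 2] Dp by (simp add: c_def power_divide)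
        have "\<kappa>\<^sup>2 \<le> \<kappa>" using \<kappa> by (simp add: power2_eq_square mult_left_le)
        have "c * (d x)\<^sup>2 \<le> \<kappa> * (d x)\<^sup>2" using c\<kappa> \<open>\<kappa>\<^sup>2 \<le> \<kappa>\<close> by (intro mult_right_mono) auto
        also have "\<kappa> * (d x)\<^sup>2 = 1 - \<kappa>"
        proof -
          have "1 + (d x)\<^sup>2 \<noteq> 0" using dp by linarith
          then have "\<kappa> * (1 + (d x)\<^sup>2) = 1" unfolding \<kappa>_def by (simp only: nonzero_eq_divide_eq[symmetric] not_False_eq_True)
          then show ?thesis by (simp add: algebra_simps)
        qed
        also have "\<dots> \<le> 1 - \<kappa>\<^sup>2" using \<open>\<kappa>\<^sup>2 \<le> \<kappa>\<close> by simp
        finally have "c * (d x)\<^sup>2 * T x \<le> (1 - \<kappa>\<^sup>2) * T x" using T0 by (intro mult_right_mono)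
        moreover have "c * \<nu> x \<le> \<kappa>\<^sup>2 * \<nu> x" using c\<kappa> \<nu>0 by (intro mult_right_mono)
        ultimately show ?thesis by linarith
      qed
      finally show ?thesis by (simp add: algebra_simps)
    qed
    have "(\<integral>x. S x \<partial>M) \<le> (\<integral>x. T x - c * (\<nu> x + (d x)\<^sup>2 * T x) \<partial>M)"
      using pt by (intro integral_mono Si Bochner_Integration.integrable_diff integrable_mult_right Bochner_Integration.integrable_add Ti \<nu>i dTi) auto
    also have "\<dots> = (\<integral>x. T x \<partial>M) - c * (\<integral>x. \<nu> x + (d x)\<^sup>2 * T x \<partial>M)" using Ti \<nu>i dTi by simp
    also have "\<dots> \<le> (\<integral>x. T x \<partial>M) - (c / K) * (\<integral>x. T x \<partial>M)"
    proof -
      have "(\<integral>x. T x \<partial>M) \<le> K * (\<integral>x. \<nu> x + (d x)\<^sup>2 * T x \<partial>M)" using K(2)[OF P] unfolding T_def \<nu>_def .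
      then have "(c / K) * (\<integral>x. T x \<partial>M) \<le> (c / K) * (K * (\<integral>x. \<nu> x + (d x)\<^sup>2 * T x \<partial>M))" using c K(1) by (intro mult_left_mono) auto
      then show ?thesis using K(1) by simp
    qed
    also have "\<dots> = (1 - c / K) * (\<integral>x. T x \<partial>M)" by (simp add: algebra_simps)
    also have "\<dots> \<le> \<theta> * (\<integral>x. T x \<partial>M)"
      using T0 by (intro mult_right_mono integral_nonneg_AE) (auto simp: \<theta>_def)
    finally show ?thesis unfolding S_def T_def .
  qed
  then show ?thesis using that \<theta> by blast
qed

end

context bounded_open
begin

section \<open>The pressure estimate\<close>

lemma wd_cong:
  assumes "wd i f g" "\<And>x. x \<in> \<Omega> \<Longrightarrow> f x = f' x" "\<And>x. x \<in> \<Omega> \<Longrightarrow> g x = g' x"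
  shows "wd i f' g'"
proof -
  have sq: "sq_integrable M h \<longleftrightarrow> sq_integrable M h'" if "\<And>x. x \<in> \<Omega> \<Longrightarrow> h x = h' x" for h h'
  proof -
    have "h \<in> borel_measurable M \<longleftrightarrow> h' \<in> borel_measurable M" using that by (intro measurable_cong) simp
    moreover have "integrable M (\<lambda>x. (h x)\<^sup>2) \<longleftrightarrow> integrable M (\<lambda>x. (h' x)\<^sup>2)"
      using that by (intro Bochner_Integration.integrable_cong) auto
    ultimately show ?thesis by (simp add: sq_integrable_def)
  qed
  have int: "(\<integral>x. h x * k x \<partial>M) = (\<integral>x. h' x * k x \<partial>M)" if "\<And>x. x \<in> \<Omega> \<Longrightarrow> h x = h' x" for h h' k :: "real^'n \<Rightarrow> real"
    using that by (intro Bochner_Integration.integral_cong) auto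
  show ?thesis using assms(1) sq[OF assms(2)] sq[OF assms(3)] int[OF assms(2)] int[OF assms(3)] by (simp add: wd_def)
qed

lemma H1_cong: "H1 f F \<Longrightarrow> (\<And>x. x \<in> \<Omega> \<Longrightarrow> f x = f' x) \<Longrightarrow> H1 f' F"
  unfolding H1_def by (blast intro: wd_cong)

lemma zero_trace_cong:
  assumes "zero_trace f" "\<And>x. x \<in> \<Omega> \<Longrightarrow> f x = f' x" shows "zero_trace f'"
proof -
  obtain F where F: "H1 f F" using zero_trace_H1[OF assms(1)] by blast
  show ?thesis
  proof (rule zero_traceI[OF H1_cong[OF F assms(2)]])
    fix \<psi> \<Psi> i assume p: "H1 \<psi> \<Psi>"
    have "(\<integral>x. f' x * \<Psi> i x \<partial>M) = (\<integral>x. f x * \<Psi> i x \<partial>M)"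
      using assms(2) by (intro Bochner_Integration.integral_cong) auto
    then show "(\<integral>x. f' x * \<Psi> i x \<partial>M) = - (\<integral>x. F i x * \<psi> x \<partial>M)"
      using zero_traceD[OF assms(1) F p] by simp
  qed
qed

text \<open>Both derivatives are moved onto the test function, where they commute; the fundamental
  lemma gives the rest.\<close>

lemma second_derivative_sym:
  assumes D: "H1 f D" and E: "\<And>i. H1 (D i) (E i)"
  shows "AE x in M. E i l x = E l i x"
proof -
  have s: "sq_integrable M (\<lambda>x. E i l x - E l i x)" by (intro sq_integrable_diff H1_sq[OF E])
  have "AE x in M. E i l x - E l i x = 0"
  proof (rule fundamental_lemma[OF sq_locally_integrable[OF s]])
    fix \<phi> assume t: "\<phi> \<in> test_functions \<Omega>"
    have e: "(\<integral>x. E i l x * \<phi> x \<partial>M) = (\<integral>x. f x * pderiv_at i (pderiv_at l \<phi>) x \<partial>M)" for i l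
      using wdD(3)[OF H1_wd[OF E, of l i] t] wdD(3)[OF H1_wd[OF D, of i] test_functions_pderiv[OF t, of l]] by simp
    have "(\<integral>x. E i l x * \<phi> x \<partial>M) = (\<integral>x. E l i x * \<phi> x \<partial>M)"
      unfolding e using pderiv_at_commute[OF test_functionsD(1)[OF t]] by simp
    then show "(\<integral>x. (E i l x - E l i x) * \<phi> x \<partial>M) = 0"
      using H1_sq[OF E] test_sq[OF t] by (simp add: left_diff_distrib sq_integrable_mult)
  qed
  then show ?thesis by simp
qed

text \<open>The coordinate \<open>x $ i\<close> has derivative one in direction \<open>i\<close>, so
  integrating \<open>x $ i * f\<^sup>2\<close> by parts expresses the square of \<open>f\<close>
  through \<open>f * F i\<close>; Young's inequality absorbs half of it.\<close>

lemma poincare_zero_trace: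
  obtains C where "C \<ge> 0" "\<And>f F i. zero_trace f \<Longrightarrow> H1 f F \<Longrightarrow> (\<integral>x. (f x)\<^sup>2 \<partial>M) \<le> C * (\<integral>x. (F i x)\<^sup>2 \<partial>M)"
proof -
  obtain R where R: "\<forall>x\<in>\<Omega>. norm x \<le> R" using bounded_domain by (auto simp: bounded_iff)
  have "(\<integral>x. (f x)\<^sup>2 \<partial>M) \<le> (4 * R\<^sup>2) * (\<integral>x. (F i x)\<^sup>2 \<partial>M)" if z: "zero_trace f" and F: "H1 f F" for f F i
  proof -
    have a: "C_k (Suc 0) (\<lambda>x::real^'n. x $ i)" by (rule C_k_nth)
    have ac: "continuous_on UNIV (\<lambda>x::real^'n. x $ i)" by (rule C_k_continuous[OF a])
    note s = H1_sq[OF F]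
    have i1: "integrable M (\<lambda>x. x $ i * (f x * F i x))" by (intro continuous_mult_integrable ac sq_integrable_mult s)
    have i2: "integrable M (\<lambda>x. (f x)\<^sup>2)" "integrable M (\<lambda>x. (F i x)\<^sup>2)" by (intro sq_integrable_square s)+
    have "(\<integral>x. f x * (x $ i * F i x + pderiv_at i (\<lambda>x. x $ i) x * f x) \<partial>M) = - (\<integral>x. F i x * (x $ i * f x) \<partial>M)"
      by (rule zero_traceD[OF z F H1_mult[OF F a]])
    then have "(\<integral>x. x $ i * (f x * F i x) + (f x)\<^sup>2 \<partial>M) = - (\<integral>x. x $ i * (f x * F i x) \<partial>M)"
      by (simp add: pderiv_at_nth algebra_simps power2_eq_square)
    then have "(\<integral>x. (f x)\<^sup>2 \<partial>M) = (\<integral>x. - 2 * (x $ i * (f x * F i x)) \<partial>M)" using i1 i2 by simp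
    also have "\<dots> \<le> (\<integral>x. (f x)\<^sup>2 / 2 + 2 * R\<^sup>2 * (F i x)\<^sup>2 \<partial>M)"
    proof (rule integral_mono)
      fix x assume "x \<in> space M"
      then have "\<bar>x $ i\<bar> \<le> R" using R component_le_norm_cart[of x i] by force
      then have xi: "(x $ i)\<^sup>2 \<le> R\<^sup>2" using abs_le_square_iff[of "x $ i" R] by auto
      have "0 \<le> (f x + 2 * (x $ i * F i x))\<^sup>2 / 2" by simp
      also have "\<dots> = (f x)\<^sup>2 / 2 + 2 * ((x $ i)\<^sup>2 * (F i x)\<^sup>2) + 2 * (x $ i * (f x * F i x))"
        by (simp add: power2_eq_square algebra_simps)
      also have "\<dots> \<le> (f x)\<^sup>2 / 2 + 2 * (R\<^sup>2 * (F i x)\<^sup>2) + 2 * (x $ i * (f x * F i x))"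
        using xi by (intro add_mono mult_left_mono mult_right_mono order_refl) auto
      finally show "- 2 * (x $ i * (f x * F i x)) \<le> (f x)\<^sup>2 / 2 + 2 * R\<^sup>2 * (F i x)\<^sup>2" by simp
    qed (use i1 i2 in auto)
    also have "\<dots> = (\<integral>x. (f x)\<^sup>2 \<partial>M) / 2 + 2 * R\<^sup>2 * (\<integral>x. (F i x)\<^sup>2 \<partial>M)" using i2 by simp
    finally show ?thesis by simp
  qed
  then show ?thesis using that[of "4 * R\<^sup>2"] by simp
qed

text \<open>The Laplacian of \<open>u\<close> minus the gradient of its divergence is weakly
  divergence free, by symmetry of second derivatives moved onto the test function. Orthogonality to
  gradients of test functions therefore leaves only \<open>P\<close>.\<close>

lemma stokes_pressure_harmonic:
  assumes D: "\<And>j. H1 (u j) (D j)" and E: "\<And>j i. H1 (D j i) (E j i)" and P: "H1 p P"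
    and orth: "\<And>\<phi> \<Phi>. H1 \<phi> \<Phi> \<Longrightarrow> (\<Sum>j\<in>UNIV. \<integral>x. (- (\<Sum>i\<in>UNIV. E j i i x) + (\<Sum>i\<in>UNIV. E i i j x) + P j x) * \<Phi> j x \<partial>M) = 0"
  shows "weakly_harmonic P"
  unfolding weakly_harmonic_def
proof
  fix \<phi> assume t: "\<phi> \<in> test_functions \<Omega>"
  note Es = H1_sq(2)[OF E] and Ps = H1_sq(2)[OF P]
  have ts: "sq_integrable M (pderiv_at i \<phi>)" for i by (rule test_sq[OF test_functions_pderiv[OF t]])
  have i1: "integrable M (\<lambda>x. E a b c x * pderiv_at i \<phi> x)" "integrable M (\<lambda>x. P i x * pderiv_at i \<phi> x)" for a b c i
    by (intro sq_integrable_mult Es Ps ts)+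
  have "(\<Sum>j\<in>UNIV. \<integral>x. (- (\<Sum>i\<in>UNIV. E j i i x) + (\<Sum>i\<in>UNIV. E i i j x) + P j x) * pderiv_at j \<phi> x \<partial>M) = 0"
    by (rule orth[OF H1_classical[OF test_functionsD(1)[OF t]]])
  moreover have "(\<integral>x. (- (\<Sum>i\<in>UNIV. E j i i x) + (\<Sum>i\<in>UNIV. E i i j x) + P j x) * pderiv_at j \<phi> x \<partial>M)
    = - (\<Sum>i\<in>UNIV. \<integral>x. E j i i x * pderiv_at j \<phi> x \<partial>M) + (\<Sum>i\<in>UNIV. \<integral>x. E i i j x * pderiv_at j \<phi> x \<partial>M) + (\<integral>x. P j x * pderiv_at j \<phi> x \<partial>M)" for j
  proof -
    have "(- (\<Sum>i\<in>UNIV. E j i i x) + (\<Sum>i\<in>UNIV. E i i j x) + P j x) * pderiv_at j \<phi> x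
      = - (\<Sum>i\<in>UNIV. E j i i x * pderiv_at j \<phi> x) + (\<Sum>i\<in>UNIV. E i i j x * pderiv_at j \<phi> x) + P j x * pderiv_at j \<phi> x" for x
      by (simp add: distrib_right sum_distrib_right left_diff_distrib)
    then show ?thesis using i1 by simp
  qed
  ultimately have 1: "(\<Sum>j\<in>UNIV. \<integral>x. P j x * pderiv_at j \<phi> x \<partial>M) = (\<Sum>j\<in>UNIV. \<Sum>i\<in>UNIV. \<integral>x. E j i i x * pderiv_at j \<phi> x \<partial>M) - (\<Sum>j\<in>UNIV. \<Sum>i\<in>UNIV. \<integral>x. E i i j x * pderiv_at j \<phi> x \<partial>M)"
    by (simp add: sum.distrib sum_subtractf)
  have "(\<integral>x. E j i i x * pderiv_at j \<phi> x \<partial>M) = (\<integral>x. E j j i x * pderiv_at i \<phi> x \<partial>M)" for i j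
  proof -
    have "(\<integral>x. E j i i x * pderiv_at j \<phi> x \<partial>M) = - (\<integral>x. D j i x * pderiv_at i (pderiv_at j \<phi>) x \<partial>M)"
      using wdD(3)[OF H1_wd[OF E, of i j i] test_functions_pderiv[OF t, of j]] by simp
    also have "\<dots> = - (\<integral>x. D j i x * pderiv_at j (pderiv_at i \<phi>) x \<partial>M)"
      using pderiv_at_commute[OF test_functionsD(1)[OF t]] by simp
    also have "\<dots> = (\<integral>x. E j i j x * pderiv_at i \<phi> x \<partial>M)"
      using wdD(3)[OF H1_wd[OF E, of j j i] test_functions_pderiv[OF t, of i]] by simp
    also have "\<dots> = (\<integral>x. E j j i x * pderiv_at i \<phi> x \<partial>M)"
      using second_derivative_sym[OF D E, of j i j]
      by (intro integral_cong_AE borel_measurable_times sq_integrable_measurable[OF Es] sq_integrable_measurable[OF ts]) auto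
    finally show ?thesis .
  qed
  then have "(\<Sum>j\<in>UNIV. \<Sum>i\<in>UNIV. \<integral>x. E j i i x * pderiv_at j \<phi> x \<partial>M) = (\<Sum>j\<in>UNIV. \<Sum>i\<in>UNIV. \<integral>x. E j j i x * pderiv_at i \<phi> x \<partial>M)"
    by simp
  also have "\<dots> = (\<Sum>j\<in>UNIV. \<Sum>i\<in>UNIV. \<integral>x. E i i j x * pderiv_at j \<phi> x \<partial>M)" by (rule sum.swap)
  finally show "(\<Sum>i\<in>UNIV. \<integral>x. P i x * pderiv_at i \<phi> x \<partial>M) = 0" using 1 by simp
qed

end

section \<open>Boundary behaviour of the two parts of the velocity\<close>

context defining_function
begin

lemma inv_d_C2: "C_k 2 (\<lambda>x. 1 / (1 + (d x)\<^sup>2))"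
proof -
  have "1 + (d x)\<^sup>2 \<noteq> 0" for x by (metis add_pos_nonneg less_irrefl zero_le_power2 zero_less_one)
  then show ?thesis by (intro C_k_divide C_k_add C_k_const C_k_power d_Ck) auto
qed

lemma tang_C2: "C_k 2 (tang j l)"
proof -
  have "tang j l = (\<lambda>x. ((if j = l then 1 else 0) - N j x * Y l x) * (1 / (1 + (d x)\<^sup>2)))"
    by (rule ext) (simp add: tang_def)
  then show ?thesis by (simp only:) (intro C_k_mult C_k_diff C_k_const N_C2 Y_C2 inv_d_C2)
qed

lemma tang_C1: "C_k (Suc 0) (tang j l)" by (rule C_k_mono[OF tang_C2]) simp

lemma tang_pderiv_C1: "C_k (Suc 0) (pderiv_at i (tang j l))" using tang_C2[of j l] by (simp add: numeral_2_eq_2)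

lemma tang_sym: "tang j l x = tang l j x"
  by (simp add: tang_def Y_def mult.commute)

lemma tang_mult:
  "tang j l x * t = (1 / (1 + (d x)\<^sup>2)) * ((if j = l then t else 0) - N j x * Y l x * t)"
  by (cases "j = l") (simp_all add: tang_def left_diff_distrib)

lemma C1_inv_d: "C_k (Suc 0) (\<lambda>x. 1 / (1 + (d x)\<^sup>2))" by (rule C_k_mono[OF inv_d_C2]) simp

text \<open>Derivatives of \<open>tang\<close> multiply \<open>u\<close>, which has zero trace.
  Since \<open>N\<close> times \<open>Y\<close> is \<open>1 - d\<^sup>2 / Q\<close>, the remaining
  sum is a combination of tangential derivatives \<open>N l * D l j - N j * D l l\<close> plus terms
  with a factor \<open>d\<close>; both kinds have zero trace.\<close>

lemma tangential_divergence_zero_trace: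
  assumes z: "\<And>j. zero_trace (u j)" and D: "\<And>j. H1 (u j) (D j)" and E: "\<And>j i. H1 (D j i) (E j i)"
  shows "zero_trace (\<lambda>x. \<Sum>j\<in>UNIV. \<Sum>l\<in>UNIV. tang j l x * D l j x + pderiv_at j (tang j l) x * u l x)"
proof -
  define c where "c x = 1 / (1 + (d x)\<^sup>2)" for x
  have C: "C_k (Suc 0) (\<lambda>x. 1 / (1 + (d x)\<^sup>2))" by (rule C1_inv_d)
  have 1: "zero_trace (\<lambda>x. \<Sum>j\<in>UNIV. \<Sum>l\<in>UNIV. pderiv_at j (tang j l) x * u l x)"
    by (intro zero_trace_sum zero_trace_mult z tang_pderiv_C1)
  have QC: "C_k (Suc 0) Q" by (rule C_k_mono[OF Q_C2]) simp
  have dQ: "C_k (Suc 0) (\<lambda>x. d x / Q x)"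
    using Q_pos by (intro C_k_divide d_Ck QC) (auto simp: less_imp_neq[symmetric])
  have 2: "zero_trace (\<lambda>x. c x * ((\<Sum>l\<in>UNIV. \<Sum>j\<in>UNIV. (- Y j x) * (N l x * D l j x - N j x * D l l x)) + d x * (\<Sum>l\<in>UNIV. (d x / Q x) * D l l x)))"
    unfolding c_def
    by (intro zero_trace_mult[OF _ C] zero_trace_add zero_trace_sum zero_trace_mult[OF zero_trace_tangential[OF z D E]]
        C_k_uminus Y_C1 zero_trace_d_mult[OF H1_sum[OF H1_mult[OF E dQ]]])
  have "zero_trace (\<lambda>x. \<Sum>j\<in>UNIV. \<Sum>l\<in>UNIV. tang j l x * D l j x)"
  proof (rule zero_trace_cong[OF 2])
    fix x assume x: "x \<in> \<Omega>"
    have NY: "(\<Sum>j\<in>UNIV. N j x * Y j x) = 1 - (d x)\<^sup>2 / Q x" by (rule NY_sum[OF x])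
    have "(\<Sum>l\<in>UNIV. \<Sum>j\<in>UNIV. (- Y j x) * (N l x * D l j x - N j x * D l l x))
      = (\<Sum>l\<in>UNIV. (\<Sum>j\<in>UNIV. N j x * Y j x) * D l l x - (\<Sum>j\<in>UNIV. N j x * Y l x * D l j x))"
      unfolding sum_distrib_right sum_subtractf[symmetric] by (intro sum.cong) (auto simp: Y_def algebra_simps)
    also have "\<dots> = (\<Sum>l\<in>UNIV. D l l x - d x * ((d x / Q x) * D l l x) - (\<Sum>j\<in>UNIV. N j x * Y l x * D l j x))"
      unfolding NY by (intro sum.cong) (auto simp: algebra_simps power2_eq_square)
    finally have "(\<Sum>l\<in>UNIV. \<Sum>j\<in>UNIV. (- Y j x) * (N l x * D l j x - N j x * D l l x)) + d x * (\<Sum>l\<in>UNIV. (d x / Q x) * D l l x)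
      = (\<Sum>l\<in>UNIV. D l l x - (\<Sum>j\<in>UNIV. N j x * Y l x * D l j x))"
      by (simp add: sum_subtractf sum_distrib_left)
    also have "\<dots> = (\<Sum>l\<in>UNIV. \<Sum>j\<in>UNIV. (if j = l then D l j x else 0) - N j x * Y l x * D l j x)"
      by (simp add: sum_subtractf)
    finally have "c x * ((\<Sum>l\<in>UNIV. \<Sum>j\<in>UNIV. (- Y j x) * (N l x * D l j x - N j x * D l l x)) + d x * (\<Sum>l\<in>UNIV. (d x / Q x) * D l l x))
      = (\<Sum>l\<in>UNIV. \<Sum>j\<in>UNIV. tang j l x * D l j x)"
      by (simp only: sum_distrib_left tang_mult c_def)
    also have "\<dots> = (\<Sum>j\<in>UNIV. \<Sum>l\<in>UNIV. tang j l x * D l j x)" by (rule sum.swap)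
    finally show "c x * ((\<Sum>l\<in>UNIV. \<Sum>j\<in>UNIV. (- Y j x) * (N l x * D l j x - N j x * D l l x)) + d x * (\<Sum>l\<in>UNIV. (d x / Q x) * D l l x))
      = (\<Sum>j\<in>UNIV. \<Sum>l\<in>UNIV. tang j l x * D l j x)" .
  qed
  from zero_trace_add[OF this 1] show ?thesis by (simp add: sum.distrib)
qed

text \<open>\<open>W j i\<close> is the derivative in direction \<open>i\<close> of the component
  \<open>j\<close> of \<open>w = u - v\<close>. Up to the factor \<open>1 / (1 + d^2)\<close>,
  \<open>w\<close> is \<open>N\<close> times a scalar plus \<open>d\<^sup>2 * u\<close>, so
  antisymmetrising leaves tangential derivatives of \<open>u\<close>, terms with \<open>d\<close>,
  and multiples of \<open>u\<close>.\<close>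

lemma normal_curl_zero_trace:
  assumes z: "\<And>j. zero_trace (u j)" and D: "\<And>j. H1 (u j) (D j)" and E: "\<And>j i. H1 (D j i) (E j i)"
  defines "W \<equiv> \<lambda>j i x. D j i x - (\<Sum>l\<in>UNIV. tang j l x * D l i x + pderiv_at i (tang j l) x * u l x)"
  shows "zero_trace (\<lambda>x. W j i x - W i j x)"
proof -
  have C: "C_k (Suc 0) (\<lambda>x. 1 / (1 + (d x)\<^sup>2))" by (rule C1_inv_d)
  have dC: "C_k (Suc 0) d" by (rule d_Ck) simp
  have 1: "zero_trace (\<lambda>x. (1 / (1 + (d x)\<^sup>2)) * ((\<Sum>l\<in>UNIV. Y l x * (N j x * D l i x - N i x * D l j x)) + d x * (d x * (D j i x - D i j x)))
     - (\<Sum>l\<in>UNIV. (pderiv_at i (tang j l) x - pderiv_at j (tang i l) x) * u l x))"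
    by (intro zero_trace_diff zero_trace_mult[OF _ C] zero_trace_add zero_trace_sum
        zero_trace_mult[OF zero_trace_tangential[OF z D E] Y_C1] zero_trace_d_mult[OF H1_mult[OF H1_diff[OF E E] dC]]
        zero_trace_mult[OF z] C_k_diff tang_pderiv_C1)
  show ?thesis
  proof (rule zero_trace_cong[OF 1])
    fix x
    have ne: "1 + (d x)\<^sup>2 \<noteq> 0" by (metis add_pos_nonneg less_irrefl zero_le_power2 zero_less_one)
    \<comment> \<open>Subtracting the projection restores the \<open>N\<close>-part, and the factor
      \<open>1 / (1 + d^2)\<close> leaves the extra \<open>d\<^sup>2\<close> term.\<close>
    have k: "D j i x - (\<Sum>l\<in>UNIV. tang j l x * D l i x) = (1 / (1 + (d x)\<^sup>2)) * ((\<Sum>l\<in>UNIV. Y l x * (N j x * D l i x)) + d x * (d x * D j i x))" for j i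
    proof -
      have "(\<Sum>l\<in>UNIV. tang j l x * D l i x) = (\<Sum>l\<in>UNIV. (1 / (1 + (d x)\<^sup>2)) * ((if j = l then D l i x else 0) - Y l x * (N j x * D l i x)))"
        by (intro sum.cong refl) (simp only: tang_mult mult.assoc mult.left_commute)
      also have "\<dots> = (1 / (1 + (d x)\<^sup>2)) * (D j i x - (\<Sum>l\<in>UNIV. Y l x * (N j x * D l i x)))"
        by (simp only: sum_distrib_left[symmetric] sum_subtractf) simp
      finally show ?thesis using ne by (simp add: field_simps power2_eq_square)
    qed
    have w: "W j i x = (1 / (1 + (d x)\<^sup>2)) * ((\<Sum>l\<in>UNIV. Y l x * (N j x * D l i x)) + d x * (d x * D j i x)) - (\<Sum>l\<in>UNIV. pderiv_at i (tang j l) x * u l x)" for j i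
      unfolding W_def sum.distrib using k[of j i] by simp
    show "(1 / (1 + (d x)\<^sup>2)) * ((\<Sum>l\<in>UNIV. Y l x * (N j x * D l i x - N i x * D l j x)) + d x * (d x * (D j i x - D i j x)))
     - (\<Sum>l\<in>UNIV. (pderiv_at i (tang j l) x - pderiv_at j (tang i l) x) * u l x) = W j i x - W i j x"
      unfolding w right_diff_distrib left_diff_distrib sum_subtractf by (simp add: algebra_simps)
  qed
qed

end

lemma sum_square_le_card:
  fixes f :: "'a::finite \<Rightarrow> real"
  shows "(\<Sum>a\<in>UNIV. f a)\<^sup>2 \<le> real CARD('a) * (\<Sum>a\<in>UNIV. (f a)\<^sup>2)"
  using Cauchy_Schwarz_ineq_sum[of "\<lambda>_. 1" f UNIV] by simp

section \<open>The estimate for given derivatives\<close>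

context defining_function
begin

text \<open>All derivatives are explicit arguments, so the result applies to any representatives,
  and the constants are fixed before \<open>u\<close>. Orthogonality to gradients is all that is
  used of the Helmholtz projection.\<close>

theorem stokes_pressure_estimate:
  obtains \<beta> C where "\<beta> < 1" "C \<ge> 0"
    "\<And>u D E p P. (\<And>j. zero_trace (u j)) \<Longrightarrow> (\<And>j. H1 (u j) (D j)) \<Longrightarrow> (\<And>j i. H1 (D j i) (E j i)) \<Longrightarrow> H1 p P \<Longrightarrow>
      (\<And>\<phi> \<Phi>. H1 \<phi> \<Phi> \<Longrightarrow> (\<Sum>j\<in>UNIV. \<integral>x. (- (\<Sum>i\<in>UNIV. E j i i x) + (\<Sum>i\<in>UNIV. E i i j x) + P j x) * \<Phi> j x \<partial>M) = 0) \<Longrightarrow>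
      (\<integral>x. (\<Sum>j\<in>UNIV. (P j x)\<^sup>2) \<partial>M) \<le> \<beta> * (\<integral>x. (\<Sum>j\<in>UNIV. (\<Sum>i\<in>UNIV. E j i i x)\<^sup>2) \<partial>M)
        + C * (\<integral>x. (\<Sum>j\<in>UNIV. \<Sum>i\<in>UNIV. (D j i x)\<^sup>2) \<partial>M)"
proof -
  obtain \<theta> where \<theta>: "0 < \<theta>" "\<theta> < 1" "\<And>p P. H1 p P \<Longrightarrow> weakly_harmonic P \<Longrightarrow>
    (\<integral>x. (\<Sum>j\<in>UNIV. (\<Sum>l\<in>UNIV. tang j l x * P l x)\<^sup>2) \<partial>M) \<le> \<theta> * (\<integral>x. (\<Sum>j\<in>UNIV. (P j x)\<^sup>2) \<partial>M)"
    by (rule tangential_contraction) (rule that; assumption)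
  \<comment> \<open>\<open>q\<close> becomes \<beta>. The square root is what Young's inequality
    makes of the contraction factor \<theta>.\<close>
  define q where "q = sqrt \<theta>"
  have q: "0 < q" "q < 1" "q\<^sup>2 = \<theta>" using \<theta>(1,2) by (auto simp: q_def)
  define m1 where "m1 i j l = pderiv_at i (tang j l)" for i j l
  define m2 where "m2 k i j l = pderiv_at k (pderiv_at i (tang j l))" for k i j l
  have c0: "continuous_on UNIV (tang j l)" for j l by (rule C_k_continuous[OF tang_C2])
  have c1: "continuous_on UNIV (m1 i j l)" for i j l unfolding m1_def by (rule C_k_continuous[OF tang_pderiv_C1])
  have c2: "continuous_on UNIV (m2 k i j l)" for k i j l unfolding m2_def using tang_pderiv_C1[of i j l] by simp
  obtain B1 where B1: "B1 > 0" "\<And>t x. x \<in> \<Omega> \<Longrightarrow> \<bar>(case t of (i, j, l) \<Rightarrow> m1 i j l) x\<bar> \<le> B1"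
    using continuous_bounded_family[of "\<lambda>t. case t of (i, j, l) \<Rightarrow> m1 i j l"] c1 by (metis (mono_tags, lifting) case_prod_beta')
  obtain B2 where B2: "B2 > 0" "\<And>t x. x \<in> \<Omega> \<Longrightarrow> \<bar>(case t of (i, j, l) \<Rightarrow> m2 i i j l) x\<bar> \<le> B2"
    using continuous_bounded_family[of "\<lambda>t. case t of (i, j, l) \<Rightarrow> m2 i i j l"] c2 by (metis (mono_tags, lifting) case_prod_beta')
  have b1: "(m1 i j l x)\<^sup>2 \<le> B1\<^sup>2" if "x \<in> \<Omega>" for i j l x
    using B1(2)[OF that, of "(i, j, l)"] B1(1) abs_le_square_iff[of "m1 i j l x" B1] by simp
  have b2: "(m2 i i j l x)\<^sup>2 \<le> B2\<^sup>2" if "x \<in> \<Omega>" for i j l x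
    using B2(2)[OF that, of "(i, j, l)"] B2(1) abs_le_square_iff[of "m2 i i j l x" B2] by simp
  obtain Cp where Cp: "Cp \<ge> 0" "\<And>f F i. zero_trace f \<Longrightarrow> H1 f F \<Longrightarrow> (\<integral>x. (f x)\<^sup>2 \<partial>M) \<le> Cp * (\<integral>x. (F i x)\<^sup>2 \<partial>M)"
    by (rule poincare_zero_trace) (rule that; assumption)
  define n where "n = real CARD('n)"
  have n: "n > 0" by (simp add: n_def)
  \<comment> \<open>Two Cauchy-Schwarz estimates for the double sum in \<open>r\<close> and the sum
    over components give \<open>n * (n * n)\<close>. The factors \<open>8\<close> and
    \<open>2\<close> come from bounding a squared sum by twice the squares, with
    \<open>2 * m1\<close> squared, and \<open>Cp\<close> turns \<open>u\<close> into its
    gradient.\<close>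
  define CR where "CR = n * (n * n) * (8 * B1\<^sup>2 + 2 * B2\<^sup>2 * Cp)"
  have CR: "CR \<ge> 0" unfolding CR_def using n Cp(1) by simp
  define C where "C = CR / (1 - q)"
  have C: "C \<ge> 0" using CR q by (simp add: C_def)
  have "(\<integral>x. (\<Sum>j\<in>UNIV. (P j x)\<^sup>2) \<partial>M) \<le> q * (\<integral>x. (\<Sum>j\<in>UNIV. (\<Sum>i\<in>UNIV. E j i i x)\<^sup>2) \<partial>M)
        + C * (\<integral>x. (\<Sum>j\<in>UNIV. \<Sum>i\<in>UNIV. (D j i x)\<^sup>2) \<partial>M)"
    if z: "\<And>j. zero_trace (u j)" and D: "\<And>j. H1 (u j) (D j)" and E: "\<And>j i. H1 (D j i) (E j i)" and P: "H1 p P" and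
      orth: "\<And>\<phi> \<Phi>. H1 \<phi> \<Phi> \<Longrightarrow> (\<Sum>j\<in>UNIV. \<integral>x. (- (\<Sum>i\<in>UNIV. E j i i x) + (\<Sum>i\<in>UNIV. E i i j x) + P j x) * \<Phi> j x \<partial>M) = 0"
    for u D E p P
  proof -
    have harm: "weakly_harmonic P" by (rule stokes_pressure_harmonic[OF D E P orth])
    note us = H1_sq(1)[OF D] and Ds = H1_sq(2)[OF D] and Es = H1_sq(2)[OF E] and Ps = H1_sq(2)[OF P]
    define v where "v j x = (\<Sum>l\<in>UNIV. tang j l x * u l x)" for j x
    define Dv where "Dv j i x = (\<Sum>l\<in>UNIV. tang j l x * D l i x + m1 i j l x * u l x)" for j i x
    define Ev where "Ev j i k x = (\<Sum>l\<in>UNIV. (tang j l x * E l i k x + m1 k j l x * D l i x) + (m1 i j l x * D l k x + m2 k i j l x * u l x))" for j i k x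
    have Dv: "H1 (v j) (Dv j)" for j
      unfolding v_def[abs_def] Dv_def[abs_def] m1_def by (intro H1_sum H1_mult D tang_C1)
    have Ev: "H1 (Dv j i) (Ev j i)" for j i
      unfolding Dv_def[abs_def] Ev_def[abs_def] m1_def m2_def by (intro H1_sum H1_add H1_mult D E tang_C1 tang_pderiv_C1)
    note Evs = H1_sq(2)[OF Ev]
    have divz: "zero_trace (\<lambda>x. \<Sum>j\<in>UNIV. Dv j j x)"
      unfolding Dv_def m1_def by (rule tangential_divergence_zero_trace[OF z D E])
    have 1: "(\<Sum>k\<in>UNIV. \<integral>x. (\<Sum>j\<in>UNIV. Ev j j k x) * P k x \<partial>M) = 0"
      by (rule zero_trace_harmonic_orthogonal[OF divz H1_sum[OF Ev] Ps harm])
    define Dw where "Dw j i x = D j i x - Dv j i x" for j i x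
    define Ew where "Ew j i k x = E j i k x - Ev j i k x" for j i k x
    have w: "H1 (\<lambda>x. u j x - v j x) (Dw j)" for j unfolding Dw_def[abs_def] by (intro H1_diff D Dv)
    have Ew: "H1 (Dw j i) (Ew j i)" for j i unfolding Dw_def[abs_def] Ew_def[abs_def] by (intro H1_diff E Ev)
    note Ews = H1_sq(2)[OF Ew]
    \<comment> \<open>The antisymmetric field is the curl of \<open>w\<close>.\<close>
    have 2: "(\<Sum>i\<in>UNIV. \<Sum>j\<in>UNIV. \<integral>x. (Ew j i i x - Ew i j i x) * P j x \<partial>M) = 0"
    proof (rule zero_trace_antisymmetric_orthogonal[where f="\<lambda>i j x. Dw j i x - Dw i j x"
          and F="\<lambda>i j k x. Ew j i k x - Ew i j k x", OF _ _ _ P])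
      show "zero_trace (\<lambda>x. Dw j i x - Dw i j x)" for i j
        using normal_curl_zero_trace[OF z D E, where j=j and i=i] unfolding Dw_def Dv_def m1_def .
      show "H1 (\<lambda>x. Dw j i x - Dw i j x) (\<lambda>k x. Ew j i k x - Ew i j k x)" for i j
        by (intro H1_diff Ew)
    qed simp
    \<comment> \<open>Swapping the last two indices almost everywhere turns the second term into the
      gradient of the divergence of \<open>w\<close>.\<close>
    have 3: "(\<Sum>i\<in>UNIV. \<Sum>j\<in>UNIV. \<integral>x. (Ew j i i x - Ew i i j x) * P j x \<partial>M) = 0"
    proof -
      have "(\<integral>x. (Ew j i i x - Ew i i j x) * P j x \<partial>M) = (\<integral>x. (Ew j i i x - Ew i j i x) * P j x \<partial>M)" for i j
        using second_derivative_sym[OF w[of i] Ew, of i j]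
        by (intro integral_cong_AE borel_measurable_times borel_measurable_diff sq_integrable_measurable[OF Ews] sq_integrable_measurable[OF Ps]) auto
      then have "(\<Sum>i\<in>UNIV. \<Sum>j\<in>UNIV. \<integral>x. (Ew j i i x - Ew i i j x) * P j x \<partial>M)
        = (\<Sum>i\<in>UNIV. \<Sum>j\<in>UNIV. \<integral>x. (Ew j i i x - Ew i j i x) * P j x \<partial>M)"
        by (intro sum.cong refl)
      with 2 show ?thesis by (rule trans[rotated])
    qed
    define T where "T x = (\<Sum>j\<in>UNIV. (P j x)\<^sup>2)" for x
    define L where "L j x = (\<Sum>i\<in>UNIV. E j i i x)" for j x
    define S where "S l x = (\<Sum>j\<in>UNIV. tang l j x * P j x)" for l x
    define r where "r j x = (\<Sum>l\<in>UNIV. \<Sum>i\<in>UNIV. 2 * m1 i j l x * D l i x + m2 i i j l x * u l x)" for j x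
    have Ts: "integrable M T" unfolding T_def[abs_def] by (intro Bochner_Integration.integrable_sum sq_integrable_square Ps)
    have Ls: "sq_integrable M (L j)" for j unfolding L_def[abs_def] by (intro sq_integrable_sum Es)
    have Ss: "sq_integrable M (S j)" for j unfolding S_def[abs_def] by (intro sq_integrable_sum continuous_mult_sq_integrable c0 Ps)
    have rs: "sq_integrable M (r j)" for j
    proof -
      have "sq_integrable M (\<lambda>x. \<Sum>l\<in>UNIV. \<Sum>i\<in>UNIV. 2 * (m1 i j l x * D l i x) + m2 i i j l x * u l x)"
        by (intro sq_integrable_sum sq_integrable_add sq_integrable_cmult continuous_mult_sq_integrable c1 c2 Ds us)
      then show ?thesis unfolding r_def[abs_def] by (simp only: mult.assoc)
    qed
    \<comment> \<open>The weak equation is tested with the pressure itself. After the splitting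
      \<open>E = Ev + Ew\<close>, fact \<open>1\<close> removes the gradient of the divergence of
      \<open>v\<close>, and fact \<open>3\<close> the whole contribution of
      \<open>w\<close>.\<close>
    have Tint: "(\<integral>x. T x \<partial>M) = (\<Sum>j\<in>UNIV. \<integral>x. (\<Sum>i\<in>UNIV. Ev j i i x) * P j x \<partial>M)"
    proof -
      have ii: "integrable M (\<lambda>x. E a b c x * P j x)" "integrable M (\<lambda>x. Ev a b c x * P j x)" "integrable M (\<lambda>x. Ew a b c x * P j x)" "integrable M (\<lambda>x. P j x * P j x)" for a b c j
        by (intro sq_integrable_mult Es Evs Ews Ps)+
      have e0: "(\<integral>x. (- (\<Sum>i\<in>UNIV. E j i i x) + (\<Sum>i\<in>UNIV. E i i j x) + P j x) * P j x \<partial>M)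
        = (\<integral>x. (P j x)\<^sup>2 \<partial>M) - ((\<integral>x. (\<Sum>i\<in>UNIV. Ev j i i x) * P j x \<partial>M) - (\<integral>x. (\<Sum>i\<in>UNIV. Ev i i j x) * P j x \<partial>M)
          + (\<Sum>i\<in>UNIV. \<integral>x. (Ew j i i x - Ew i i j x) * P j x \<partial>M))" for j
      proof -
        have Ee: "E a b c x = Ev a b c x + Ew a b c x" for a b c x by (simp add: Ew_def)
        have "(- (\<Sum>i\<in>UNIV. E j i i x) + (\<Sum>i\<in>UNIV. E i i j x) + P j x) * P j x
          = P j x * P j x - ((\<Sum>i\<in>UNIV. Ev j i i x * P j x) - (\<Sum>i\<in>UNIV. Ev i i j x * P j x) + ((\<Sum>i\<in>UNIV. Ew j i i x * P j x) - (\<Sum>i\<in>UNIV. Ew i i j x * P j x)))" for x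
          unfolding Ee sum.distrib sum_distrib_right[symmetric] by (simp add: algebra_simps)
        moreover have "(\<integral>x. (\<Sum>i\<in>UNIV. Ev j i i x) * P j x \<partial>M) = (\<Sum>i\<in>UNIV. \<integral>x. Ev j i i x * P j x \<partial>M)"
          "(\<integral>x. (\<Sum>i\<in>UNIV. Ev i i j x) * P j x \<partial>M) = (\<Sum>i\<in>UNIV. \<integral>x. Ev i i j x * P j x \<partial>M)"
          unfolding sum_distrib_right using ii by (simp_all add: Bochner_Integration.integral_sum)
        ultimately show ?thesis using ii by (simp add: left_diff_distrib sum_subtractf power2_eq_square)
      qed
      have "(\<Sum>j\<in>UNIV. \<integral>x. (P j x)\<^sup>2 \<partial>M) = (\<Sum>j\<in>UNIV. \<integral>x. (\<Sum>i\<in>UNIV. Ev j i i x) * P j x \<partial>M) - (\<Sum>j\<in>UNIV. \<integral>x. (\<Sum>i\<in>UNIV. Ev i i j x) * P j x \<partial>M)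
          + (\<Sum>j\<in>UNIV. \<Sum>i\<in>UNIV. \<integral>x. (Ew j i i x - Ew i i j x) * P j x \<partial>M)"
        using orth[OF P] unfolding e0 sum_subtractf sum.distrib by simp
      also have "(\<Sum>j\<in>UNIV. \<Sum>i\<in>UNIV. \<integral>x. (Ew j i i x - Ew i i j x) * P j x \<partial>M) = 0"
        using 3 by (subst sum.swap)
      finally show ?thesis unfolding T_def using 1 sq_integrable_square[OF Ps] by (simp add: Bochner_Integration.integral_sum)
    qed
    \<comment> \<open>Product rule for the Laplacian of \<open>v\<close>: the matrix applied to the
      Laplacian of \<open>u\<close>, plus \<open>r\<close>, which contains at most first derivatives
      of \<open>u\<close>.\<close>
    have Ev_tr: "(\<Sum>i\<in>UNIV. Ev j i i x) = (\<Sum>l\<in>UNIV. tang j l x * L l x) + r j x" for j x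
    proof -
      have "(\<Sum>i\<in>UNIV. Ev j i i x) = (\<Sum>i\<in>UNIV. \<Sum>l\<in>UNIV. tang j l x * E l i i x + (2 * m1 i j l x * D l i x + m2 i i j l x * u l x))"
        unfolding Ev_def by (intro sum.cong refl) simp
      also have "\<dots> = (\<Sum>l\<in>UNIV. \<Sum>i\<in>UNIV. tang j l x * E l i i x + (2 * m1 i j l x * D l i x + m2 i i j l x * u l x))"
        by (rule sum.swap)
      also have "\<dots> = (\<Sum>l\<in>UNIV. tang j l x * L l x) + r j x"
        unfolding sum.distrib r_def L_def sum_distrib_left ..
      finally show ?thesis .
    qed
    \<comment> \<open>The matrix is symmetric and moves from the Laplacian of \<open>u\<close> to
      the pressure gradient, where the contraction is available.\<close>
    have Tint2: "(\<integral>x. T x \<partial>M) = (\<integral>x. (\<Sum>l\<in>UNIV. L l x * S l x) + (\<Sum>j\<in>UNIV. r j x * P j x) \<partial>M)"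
    proof -
      have "(\<integral>x. T x \<partial>M) = (\<integral>x. (\<Sum>j\<in>UNIV. (\<Sum>i\<in>UNIV. Ev j i i x) * P j x) \<partial>M)"
        unfolding Tint by (intro Bochner_Integration.integral_sum[symmetric] sq_integrable_mult sq_integrable_sum Evs Ps)
      also have "(\<lambda>x. \<Sum>j\<in>UNIV. (\<Sum>i\<in>UNIV. Ev j i i x) * P j x) = (\<lambda>x. (\<Sum>l\<in>UNIV. L l x * S l x) + (\<Sum>j\<in>UNIV. r j x * P j x))"
      proof
        fix x
        have "(\<Sum>j\<in>UNIV. (\<Sum>l\<in>UNIV. tang j l x * L l x) * P j x) = (\<Sum>j\<in>UNIV. \<Sum>l\<in>UNIV. L l x * (tang l j x * P j x))"
          unfolding sum_distrib_right by (intro sum.cong refl) (simp add: tang_sym mult_ac)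
        also have "\<dots> = (\<Sum>l\<in>UNIV. L l x * S l x)" unfolding S_def sum_distrib_left by (rule sum.swap)
        finally show "(\<Sum>j\<in>UNIV. (\<Sum>i\<in>UNIV. Ev j i i x) * P j x) = (\<Sum>l\<in>UNIV. L l x * S l x) + (\<Sum>j\<in>UNIV. r j x * P j x)"
          unfolding Ev_tr distrib_right sum.distrib by simp
      qed
      finally show ?thesis .
    qed
    have yng: "a * b \<le> (s / 2) * a\<^sup>2 + (1 / (2 * s)) * b\<^sup>2" if "s > 0" for a b s :: real
    proof -
      have "0 \<le> (s * a - b)\<^sup>2 / (2 * s)" using that by simp
      also have "\<dots> = (s / 2) * a\<^sup>2 + (1 / (2 * s)) * b\<^sup>2 - a * b"
        using that by (simp add: power2_eq_square field_simps)
      finally show ?thesis by simp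
    qed
    have iL: "integrable M (\<lambda>x. \<Sum>l\<in>UNIV. (L l x)\<^sup>2)" "integrable M (\<lambda>x. \<Sum>l\<in>UNIV. (S l x)\<^sup>2)" "integrable M (\<lambda>x. \<Sum>l\<in>UNIV. (r l x)\<^sup>2)"
      by (intro Bochner_Integration.integrable_sum sq_integrable_square Ls Ss rs)+
    \<comment> \<open>Young's inequality with weights \<open>q\<close> and \<open>1 - q\<close>. As
      the energy of \<open>S\<close> is at most \<open>q\<^sup>2\<close> times that of the pressure
      gradient, the latter appears on the right with \<open>q / 2\<close> and
      \<open>(1 - q) / 2\<close>, exactly one half altogether; absorbing it doubles
      \<open>q / 2\<close> to \<open>q\<close>.\<close>
    have "(\<integral>x. T x \<partial>M) \<le> (\<integral>x. ((q / 2) * (\<Sum>l\<in>UNIV. (L l x)\<^sup>2) + (1 / (2 * q)) * (\<Sum>l\<in>UNIV. (S l x)\<^sup>2))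
         + ((1 / (2 * (1 - q))) * (\<Sum>l\<in>UNIV. (r l x)\<^sup>2) + ((1 - q) / 2) * T x) \<partial>M)"
      unfolding Tint2
    proof (rule integral_mono)
      show "integrable M (\<lambda>x. (\<Sum>l\<in>UNIV. L l x * S l x) + (\<Sum>j\<in>UNIV. r j x * P j x))"
        by (intro Bochner_Integration.integrable_add Bochner_Integration.integrable_sum sq_integrable_mult Ls Ss rs Ps)
      show "integrable M (\<lambda>x. ((q / 2) * (\<Sum>l\<in>UNIV. (L l x)\<^sup>2) + (1 / (2 * q)) * (\<Sum>l\<in>UNIV. (S l x)\<^sup>2))
         + ((1 / (2 * (1 - q))) * (\<Sum>l\<in>UNIV. (r l x)\<^sup>2) + ((1 - q) / 2) * T x))"
        by (intro Bochner_Integration.integrable_add integrable_mult_right iL Ts)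
      fix x
      have "(\<Sum>l\<in>UNIV. L l x * S l x) \<le> (\<Sum>l\<in>UNIV. (q / 2) * (L l x)\<^sup>2 + (1 / (2 * q)) * (S l x)\<^sup>2)"
        by (intro sum_mono yng q)
      moreover have "(\<Sum>j\<in>UNIV. r j x * P j x) \<le> (\<Sum>j\<in>UNIV. (1 / (2 * (1 - q))) * (r j x)\<^sup>2 + ((1 - q) / 2) * (P j x)\<^sup>2)"
      proof (rule sum_mono)
        fix j
        have "P j x * r j x \<le> ((1 - q) / 2) * (P j x)\<^sup>2 + (1 / (2 * (1 - q))) * (r j x)\<^sup>2" using q by (intro yng) simp
        then show "r j x * P j x \<le> (1 / (2 * (1 - q))) * (r j x)\<^sup>2 + ((1 - q) / 2) * (P j x)\<^sup>2" by (simp only: mult.commute[of "r j x"] add.commute)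
      qed
      ultimately show "(\<Sum>l\<in>UNIV. L l x * S l x) + (\<Sum>j\<in>UNIV. r j x * P j x)
        \<le> ((q / 2) * (\<Sum>l\<in>UNIV. (L l x)\<^sup>2) + (1 / (2 * q)) * (\<Sum>l\<in>UNIV. (S l x)\<^sup>2)) + ((1 / (2 * (1 - q))) * (\<Sum>l\<in>UNIV. (r l x)\<^sup>2) + ((1 - q) / 2) * T x)"
        unfolding T_def sum.distrib sum_distrib_left by linarith
    qed
    also have "\<dots> = ((q / 2) * (\<integral>x. (\<Sum>l\<in>UNIV. (L l x)\<^sup>2) \<partial>M) + (1 / (2 * q)) * (\<integral>x. (\<Sum>l\<in>UNIV. (S l x)\<^sup>2) \<partial>M))
         + ((1 / (2 * (1 - q))) * (\<integral>x. (\<Sum>l\<in>UNIV. (r l x)\<^sup>2) \<partial>M) + ((1 - q) / 2) * (\<integral>x. T x \<partial>M))"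
      using iL Ts by simp
    also have "(1 / (2 * q)) * (\<integral>x. (\<Sum>l\<in>UNIV. (S l x)\<^sup>2) \<partial>M) \<le> (q / 2) * (\<integral>x. T x \<partial>M)"
    proof -
      have "(1 / (2 * q)) * (\<integral>x. (\<Sum>l\<in>UNIV. (S l x)\<^sup>2) \<partial>M) \<le> (1 / (2 * q)) * (q\<^sup>2 * (\<integral>x. T x \<partial>M))"
        using \<theta>(3)[OF P harm] q unfolding S_def T_def by (intro mult_left_mono) auto
      also have "\<dots> = (q / 2) * (\<integral>x. T x \<partial>M)" using q(1) by (simp add: power2_eq_square)
      finally show ?thesis .
    qed
    finally have a0: "(\<integral>x. T x \<partial>M) \<le> ((q / 2) * (\<integral>x. (\<Sum>l\<in>UNIV. (L l x)\<^sup>2) \<partial>M) + (q / 2) * (\<integral>x. T x \<partial>M))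
         + ((1 / (2 * (1 - q))) * (\<integral>x. (\<Sum>l\<in>UNIV. (r l x)\<^sup>2) \<partial>M) + ((1 - q) / 2) * (\<integral>x. T x \<partial>M))"
      by linarith
    have alg: "t \<le> q * l + 2 * k * s" if "t \<le> ((q / 2) * l + (q / 2) * t) + (k * s + ((1 - q) / 2) * t)" for t l k s :: real
      using that by (simp add: field_simps)
    have "2 * (1 / (2 * (1 - q))) = 1 / (1 - q)" by (simp add: divide_simps)
    then have a: "(\<integral>x. T x \<partial>M) \<le> q * (\<integral>x. (\<Sum>l\<in>UNIV. (L l x)\<^sup>2) \<partial>M) + (1 / (1 - q)) * (\<integral>x. (\<Sum>l\<in>UNIV. (r l x)\<^sup>2) \<partial>M)"
      using alg[OF a0] by (simp only:)
    define DD where "DD = (\<integral>x. (\<Sum>j\<in>UNIV. \<Sum>i\<in>UNIV. (D j i x)\<^sup>2) \<partial>M)"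
    have DDi: "integrable M (\<lambda>x. \<Sum>j\<in>UNIV. \<Sum>i\<in>UNIV. (D j i x)\<^sup>2)" "integrable M (\<lambda>x. \<Sum>l\<in>UNIV. (u l x)\<^sup>2)"
      by (intro Bochner_Integration.integrable_sum sq_integrable_square Ds us)+
    have uD: "(\<integral>x. (\<Sum>l\<in>UNIV. n * (u l x)\<^sup>2) \<partial>M) \<le> Cp * DD"
    proof -
      have "(\<integral>x. (\<Sum>l\<in>UNIV. n * (u l x)\<^sup>2) \<partial>M) = (\<Sum>l\<in>UNIV. \<Sum>i\<in>(UNIV::'n set). (\<integral>x. (u l x)\<^sup>2 \<partial>M))"
        using sq_integrable_square[OF us] by (simp add: Bochner_Integration.integral_sum n_def)
      also have "\<dots> \<le> (\<Sum>l\<in>UNIV. \<Sum>i\<in>UNIV. Cp * (\<integral>x. (D l i x)\<^sup>2 \<partial>M))"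
        by (intro sum_mono Cp(2)[OF z D])
      also have "\<dots> = Cp * DD"
        unfolding DD_def using sq_integrable_square[OF Ds] by (simp add: Bochner_Integration.integral_sum sum_distrib_left)
      finally show ?thesis .
    qed
    have "(\<integral>x. (\<Sum>l\<in>UNIV. (r l x)\<^sup>2) \<partial>M) \<le> (\<integral>x. n * (n * n) * (8 * B1\<^sup>2 * (\<Sum>j\<in>UNIV. \<Sum>i\<in>UNIV. (D j i x)\<^sup>2) + 2 * B2\<^sup>2 * (\<Sum>l\<in>UNIV. n * (u l x)\<^sup>2)) \<partial>M)"
    proof (rule integral_mono[OF iL(3)])
      show "integrable M (\<lambda>x. n * (n * n) * (8 * B1\<^sup>2 * (\<Sum>j\<in>UNIV. \<Sum>i\<in>UNIV. (D j i x)\<^sup>2) + 2 * B2\<^sup>2 * (\<Sum>l\<in>UNIV. n * (u l x)\<^sup>2)))"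
        by (intro integrable_mult_right Bochner_Integration.integrable_add Bochner_Integration.integrable_sum sq_integrable_square Ds us)
      fix x assume "x \<in> space M"
      then have x: "x \<in> \<Omega>" by simp
      have "(r j x)\<^sup>2 \<le> n * n * (8 * B1\<^sup>2 * (\<Sum>j\<in>UNIV. \<Sum>i\<in>UNIV. (D j i x)\<^sup>2) + 2 * B2\<^sup>2 * (\<Sum>l\<in>UNIV. n * (u l x)\<^sup>2))" for j
      proof -
        have "(r j x)\<^sup>2 \<le> n * (\<Sum>l\<in>UNIV. (\<Sum>i\<in>UNIV. 2 * m1 i j l x * D l i x + m2 i i j l x * u l x)\<^sup>2)"
          unfolding r_def n_def by (rule sum_square_le_card)
        also have "\<dots> \<le> n * (\<Sum>l\<in>UNIV. n * (\<Sum>i\<in>UNIV. (2 * m1 i j l x * D l i x + m2 i i j l x * u l x)\<^sup>2))"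
          unfolding n_def by (intro mult_left_mono sum_mono sum_square_le_card) simp
        also have "\<dots> \<le> n * (\<Sum>l\<in>UNIV. n * (\<Sum>i\<in>UNIV. 8 * B1\<^sup>2 * (D l i x)\<^sup>2 + 2 * B2\<^sup>2 * (u l x)\<^sup>2))"
        proof (intro mult_left_mono sum_mono)
          fix l i
          have sq2: "(a + b)\<^sup>2 \<le> 2 * a\<^sup>2 + 2 * b\<^sup>2" for a b :: real
            using sum_squares_bound[of a b] by (simp add: power2_sum)
          have "(2 * m1 i j l x * D l i x + m2 i i j l x * u l x)\<^sup>2 \<le> 2 * (2 * m1 i j l x * D l i x)\<^sup>2 + 2 * (m2 i i j l x * u l x)\<^sup>2" by (rule sq2)
          also have "\<dots> = 8 * ((m1 i j l x)\<^sup>2 * (D l i x)\<^sup>2) + 2 * ((m2 i i j l x)\<^sup>2 * (u l x)\<^sup>2)" by (simp add: power_mult_distrib)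
          also have "\<dots> \<le> 8 * (B1\<^sup>2 * (D l i x)\<^sup>2) + 2 * (B2\<^sup>2 * (u l x)\<^sup>2)"
            by (intro add_mono mult_left_mono mult_right_mono b1 b2 x) auto
          finally show "(2 * m1 i j l x * D l i x + m2 i i j l x * u l x)\<^sup>2 \<le> 8 * B1\<^sup>2 * (D l i x)\<^sup>2 + 2 * B2\<^sup>2 * (u l x)\<^sup>2" by simp
        qed (use n in auto)
        also have "\<dots> = n * n * (8 * B1\<^sup>2 * (\<Sum>j\<in>UNIV. \<Sum>i\<in>UNIV. (D j i x)\<^sup>2) + 2 * B2\<^sup>2 * (\<Sum>l\<in>UNIV. n * (u l x)\<^sup>2))"
          unfolding sum_distrib_left[symmetric] sum.distrib by (simp add: n_def sum_distrib_left[symmetric] sum.distrib algebra_simps)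
        finally show ?thesis .
      qed
      then have "(\<Sum>l\<in>UNIV. (r l x)\<^sup>2) \<le> (\<Sum>l\<in>(UNIV::'n set). n * n * (8 * B1\<^sup>2 * (\<Sum>j\<in>UNIV. \<Sum>i\<in>UNIV. (D j i x)\<^sup>2) + 2 * B2\<^sup>2 * (\<Sum>l\<in>UNIV. n * (u l x)\<^sup>2)))"
        by (intro sum_mono)
      then show "(\<Sum>l\<in>UNIV. (r l x)\<^sup>2) \<le> n * (n * n) * (8 * B1\<^sup>2 * (\<Sum>j\<in>UNIV. \<Sum>i\<in>UNIV. (D j i x)\<^sup>2) + 2 * B2\<^sup>2 * (\<Sum>l\<in>UNIV. n * (u l x)\<^sup>2))"
        by (simp add: n_def mult.assoc)
    qed
    also have "\<dots> = n * (n * n) * (8 * B1\<^sup>2 * DD + 2 * B2\<^sup>2 * (\<integral>x. (\<Sum>l\<in>UNIV. n * (u l x)\<^sup>2) \<partial>M))"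
    proof -
      have "integrable M (\<lambda>x. \<Sum>l\<in>UNIV. n * (u l x)\<^sup>2)"
        by (intro Bochner_Integration.integrable_sum integrable_mult_right sq_integrable_square us)
      then show ?thesis unfolding DD_def using DDi by simp
    qed
    also have "\<dots> \<le> n * (n * n) * (8 * B1\<^sup>2 * DD + 2 * B2\<^sup>2 * (Cp * DD))"
      using n by (intro mult_left_mono add_mono uD order_refl) auto
    also have "\<dots> = CR * DD" by (simp add: CR_def algebra_simps)
    finally have "(1 / (1 - q)) * (\<integral>x. (\<Sum>l\<in>UNIV. (r l x)\<^sup>2) \<partial>M) \<le> (1 / (1 - q)) * (CR * DD)"
      using q by (intro mult_left_mono) auto
    then show ?thesis using a unfolding T_def L_def C_def DD_def by simp
  qed
  then show ?thesis using that[OF q(2) C] by blast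
qed

end

section \<open>Helmholtz decomposition\<close>

text \<open>For nonzero \<open>b\<close> the quadratic is negative at \<open>b / k\<close> when
  \<open>k\<close> is positive and exceeds \<open>a\<close>. This is the first-order condition at a
  minimum.\<close>

lemma real_quadratic_nonneg_imp_zero:
  fixes a b :: real
  assumes "\<And>t. 0 \<le> t\<^sup>2 * a - 2 * t * b" shows "b = 0"
proof (rule ccontr)
  assume b: "b \<noteq> 0"
  define k where "k = \<bar>a\<bar> + 1"
  have k: "k > 0" "a < k" by (auto simp: k_def)
  have "(b / k)\<^sup>2 * a \<le> (b / k)\<^sup>2 * k" using k by (intro mult_left_mono) auto
  also have "\<dots> = b\<^sup>2 / k" using k by (simp add: power2_eq_square)
  finally have "(b / k)\<^sup>2 * a - 2 * (b / k) * b \<le> b\<^sup>2 / k - 2 * (b\<^sup>2 / k)" by (simp add: power2_eq_square)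
  also have "\<dots> < 0" using k b by simp
  finally show False using assms[of "b / k"] by simp
qed

section \<open>Poincare inequality on small balls\<close>

text \<open>Fundamental theorem of calculus along the segment, then Cauchy-Schwarz in the parameter.
  The bound is stated with a nonnegative integral so that Tonelli can be applied to it.\<close>

lemma segment_difference_bound:
  fixes f :: "real^'n::finite \<Rightarrow> real"
  assumes f: "C_k (Suc 0) f"
  shows "ennreal ((f (x + h) - f x)\<^sup>2) \<le>
    (\<integral>\<^sup>+t. ennreal (indicator {0..1} t * ((norm h)\<^sup>2 * (\<Sum>i\<in>UNIV. (pderiv_at i f (x + t *\<^sub>R h))\<^sup>2))) \<partial>lborel)"
proof -
  have df: "f differentiable (at y)" for y using f by simp
  have cp: "continuous_on UNIV (pderiv_at i f)" for i using f by simp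
  define \<phi> where "\<phi> t = (\<Sum>i\<in>UNIV. h $ i * pderiv_at i f (x + t *\<^sub>R h))" for t
  have cpt: "continuous_on UNIV (\<lambda>t. pderiv_at i f (x + t *\<^sub>R h))" for i
    by (rule continuous_on_compose2[OF cp]) (auto intro!: continuous_intros)
  have c\<phi>: "continuous_on UNIV \<phi>" unfolding \<phi>_def by (intro continuous_intros cpt)
  have D: "((\<lambda>t. f (x + t *\<^sub>R h)) has_real_derivative \<phi> t) (at t)" for t
  proof -
    have g: "((\<lambda>t. x + t *\<^sub>R h) has_derivative (\<lambda>s. s *\<^sub>R h)) (at t)"
      by (auto intro!: derivative_eq_intros)
    have "((\<lambda>t. f (x + t *\<^sub>R h)) has_derivative (\<lambda>s. \<Sum>l\<in>UNIV. (s *\<^sub>R h) $ l * pderiv_at l f (x + t *\<^sub>R h))) (at t)"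
      by (rule has_derivative_compose[OF g has_derivative_pderiv_at[OF df]])
    moreover have "(\<Sum>l\<in>UNIV. (s *\<^sub>R h) $ l * pderiv_at l f (x + t *\<^sub>R h)) = \<phi> t * s" for s
      by (simp add: \<phi>_def sum_distrib_left mult_ac)
    ultimately show ?thesis by (simp add: has_field_derivative_def)
  qed
  have ftc: "(\<integral>t. \<phi> t * indicator {0..1} t \<partial>lborel) = f (x + h) - f x"
  proof -
    have "(\<integral>t. \<phi> t * indicator {0..1} t \<partial>lborel) = f (x + 1 *\<^sub>R h) - f (x + 0 *\<^sub>R h)"
      using D c\<phi>
      by (intro integral_FTC_Icc_real) (auto intro: continuous_on_interior simp: continuous_on_eq_continuous_at)
    then show ?thesis by simp
  qed
  define \<iota> where "\<iota> = (indicator {0..1} :: real \<Rightarrow> real)"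
  have sq1: "sq_integrable lborel \<iota>"
  proof -
    have "(\<lambda>t. (\<iota> t)\<^sup>2) = \<iota>" by (auto simp: \<iota>_def indicator_def)
    then show ?thesis by (simp add: sq_integrable_def \<iota>_def)
  qed
  have sq2: "sq_integrable lborel (\<lambda>t. \<iota> t * \<phi> t)"
  proof -
    have m: "\<phi> \<in> borel_measurable borel" using c\<phi> by (rule borel_measurable_continuous_onI)
    have "integrable lborel (\<lambda>t. indicator {0..1} t *\<^sub>R (\<phi> t)\<^sup>2)"
      by (intro borel_integrable_compact continuous_on_power continuous_on_subset[OF c\<phi>]) auto
    moreover have "(\<lambda>t. (\<iota> t * \<phi> t)\<^sup>2) = (\<lambda>t. indicator {0..1} t *\<^sub>R (\<phi> t)\<^sup>2)" by (auto simp: \<iota>_def indicator_def)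
    ultimately show ?thesis using m by (simp add: sq_integrable_def \<iota>_def)
  qed
  have n1: "nrm2 lborel \<iota> = 1"
  proof -
    have "(\<lambda>t. (\<iota> t)\<^sup>2) = \<iota>" by (auto simp: \<iota>_def indicator_def)
    then show ?thesis by (simp add: nrm2_def \<iota>_def)
  qed
  have "(\<integral>t. \<phi> t * indicator {0..1} t \<partial>lborel) = (\<integral>t. (\<iota> t * \<phi> t) * \<iota> t \<partial>lborel)"
    by (intro Bochner_Integration.integral_cong) (auto simp: \<iota>_def indicator_def)
  then have "\<bar>f (x + h) - f x\<bar> \<le> nrm2 lborel (\<lambda>t. \<iota> t * \<phi> t)"
    using Cauchy_Schwarz_integral[OF sq2 sq1] ftc n1 by simp
  then have "(f (x + h) - f x)\<^sup>2 \<le> (\<integral>t. (\<iota> t * \<phi> t)\<^sup>2 \<partial>lborel)"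
    unfolding nrm2_square[symmetric] by (metis abs_le_square_iff abs_of_nonneg nrm2_nonneg)
  also have "\<dots> \<le> (\<integral>t. indicator {0..1} t * ((norm h)\<^sup>2 * (\<Sum>i\<in>UNIV. (pderiv_at i f (x + t *\<^sub>R h))\<^sup>2)) \<partial>lborel)"
  proof (rule integral_mono[OF sq_integrable_square[OF sq2]])
    have "integrable lborel (\<lambda>t. indicator {0..1} t *\<^sub>R ((norm h)\<^sup>2 * (\<Sum>i\<in>UNIV. (pderiv_at i f (x + t *\<^sub>R h))\<^sup>2)))"
      by (intro borel_integrable_compact continuous_intros continuous_on_subset[OF cpt]) auto
    then show "integrable lborel (\<lambda>t. indicator {0..1} t * ((norm h)\<^sup>2 * (\<Sum>i\<in>UNIV. (pderiv_at i f (x + t *\<^sub>R h))\<^sup>2)))" by simp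
    fix t
    have "(\<phi> t)\<^sup>2 \<le> (\<Sum>i\<in>UNIV. (h $ i)\<^sup>2) * (\<Sum>i\<in>UNIV. (pderiv_at i f (x + t *\<^sub>R h))\<^sup>2)"
      unfolding \<phi>_def by (rule Cauchy_Schwarz_ineq_sum)
    then show "(\<iota> t * \<phi> t)\<^sup>2 \<le> indicator {0..1} t * ((norm h)\<^sup>2 * (\<Sum>i\<in>UNIV. (pderiv_at i f (x + t *\<^sub>R h))\<^sup>2))"
      by (auto simp: \<iota>_def indicator_def sum_square_norm)
  qed
  finally have "ennreal ((f (x + h) - f x)\<^sup>2) \<le> ennreal (\<integral>t. indicator {0..1} t * ((norm h)\<^sup>2 * (\<Sum>i\<in>UNIV. (pderiv_at i f (x + t *\<^sub>R h))\<^sup>2)) \<partial>lborel)"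
    by (rule ennreal_leI)
  also have "\<dots> = (\<integral>\<^sup>+t. ennreal (indicator {0..1} t * ((norm h)\<^sup>2 * (\<Sum>i\<in>UNIV. (pderiv_at i f (x + t *\<^sub>R h))\<^sup>2))) \<partial>lborel)"
  proof (rule nn_integral_eq_integral[symmetric])
    have "integrable lborel (\<lambda>t. indicator {0..1} t *\<^sub>R ((norm h)\<^sup>2 * (\<Sum>i\<in>UNIV. (pderiv_at i f (x + t *\<^sub>R h))\<^sup>2)))"
      by (intro borel_integrable_compact continuous_intros continuous_on_subset[OF cpt]) auto
    then show "integrable lborel (\<lambda>t. indicator {0..1} t * ((norm h)\<^sup>2 * (\<Sum>i\<in>UNIV. (pderiv_at i f (x + t *\<^sub>R h))\<^sup>2)))" by simp
  qed (intro AE_I2 mult_nonneg_nonneg sum_nonneg; simp)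
  finally show ?thesis .
qed

lemma ball_in_borel [measurable]: "ball (z :: 'a::euclidean_space) r \<in> sets borel"
  by simp

lemma nn_integral_lborel_translation:
  fixes f :: "'a::euclidean_space \<Rightarrow> ennreal"
  assumes "f \<in> borel_measurable borel"
  shows "(\<integral>\<^sup>+x. f (c + x) \<partial>lborel) = (\<integral>\<^sup>+x. f x \<partial>lborel)"
proof -
  have "(\<integral>\<^sup>+x. f x \<partial>lborel) = (\<integral>\<^sup>+x. f x \<partial>distr lborel borel ((+) c))" by (simp add: lborel_distr_plus)
  also have "\<dots> = (\<integral>\<^sup>+x. f (c + x) \<partial>lborel)" using assms by (intro nn_integral_distr) auto
  finally show ?thesis by simp
qed

text \<open>Writing \<open>y = x + h\<close> and exchanging integrals leaves, for each
  \<open>h\<close> and \<open>t\<close>, a translate of the squared gradient. Two points of the ball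
  differ by less than \<open>2 * r\<close>, so every translate lies in the ball of radius
  \<open>3 * r\<close>.\<close>

lemma ball_difference_bound:
  fixes f :: "real^'n::finite \<Rightarrow> real"
  assumes f: "C_k (Suc 0) f" and r: "r > 0"
  shows "(\<integral>\<^sup>+x. \<integral>\<^sup>+y. indicator (ball z r) x * (indicator (ball z r) y * ennreal ((f y - f x)\<^sup>2)) \<partial>lborel \<partial>lborel)
    \<le> emeasure lborel (ball (0::real^'n) (2 * r)) * (ennreal ((2 * r)\<^sup>2) *
       (\<integral>\<^sup>+x. indicator (ball z (3 * r)) x * ennreal (\<Sum>i\<in>UNIV. (pderiv_at i f x)\<^sup>2) \<partial>lborel))"
proof -
  have cp: "continuous_on UNIV (pderiv_at i f)" for i using f by simp
  have mf[measurable]: "f \<in> borel_measurable borel" using C_k_continuous[OF f] by (rule borel_measurable_continuous_onI)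
  have mp[measurable]: "pderiv_at i f \<in> borel_measurable borel" for i using cp by (rule borel_measurable_continuous_onI)
  define g where "g x = (\<Sum>i\<in>UNIV. (pderiv_at i f x)\<^sup>2)" for x
  have g[measurable]: "g \<in> borel_measurable borel" unfolding g_def by measurable
  have g0: "0 \<le> g x" for x by (simp add: g_def sum_nonneg)
  define J where "J = (\<integral>\<^sup>+x. indicator (ball z (3 * r)) x * ennreal (g x) \<partial>lborel)"
  have shift: "(\<integral>\<^sup>+x. indicator (ball z r) x * ennreal (g (x + v)) \<partial>lborel) \<le> J" if v: "norm v \<le> 2 * r" for v
  proof -
    have "(\<integral>\<^sup>+x. indicator (ball z r) x * ennreal (g (x + v)) \<partial>lborel) = (\<integral>\<^sup>+x. indicator (ball (z + v) r) (v + x) * ennreal (g (v + x)) \<partial>lborel)"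
      by (intro nn_integral_cong) (auto simp: add.commute indicator_def dist_norm)
    also have "\<dots> = (\<integral>\<^sup>+y. indicator (ball (z + v) r) y * ennreal (g y) \<partial>lborel)"
      by (rule nn_integral_lborel_translation) measurable
    also have "\<dots> \<le> J" unfolding J_def
    proof (intro nn_integral_mono mult_right_mono)
      fix y
      have "y \<in> ball z (3 * r)" if "y \<in> ball (z + v) r"
      proof -
        have "dist z y \<le> dist z (z + v) + dist (z + v) y" by (rule dist_triangle)
        then show ?thesis using that v by (simp add: dist_norm)
      qed
      then show "(indicator (ball (z + v) r) y :: ennreal) \<le> indicator (ball z (3 * r)) y" by (auto simp: indicator_def)
    qed simp
    finally show ?thesis .
  qed
  have inner: "(\<integral>\<^sup>+y. indicator (ball z r) x * (indicator (ball z r) y * ennreal ((f y - f x)\<^sup>2)) \<partial>lborel)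
    \<le> (\<integral>\<^sup>+h. indicator (ball 0 (2 * r)) h * (indicator (ball z r) x * ennreal ((f (x + h) - f x)\<^sup>2)) \<partial>lborel)" for x
  proof -
    have "(\<integral>\<^sup>+y. indicator (ball z r) x * (indicator (ball z r) y * ennreal ((f y - f x)\<^sup>2)) \<partial>lborel)
      = (\<integral>\<^sup>+h. indicator (ball z r) x * (indicator (ball z r) (x + h) * ennreal ((f (x + h) - f x)\<^sup>2)) \<partial>lborel)"
      by (rule nn_integral_lborel_translation[symmetric]) measurable
    also have "\<dots> \<le> (\<integral>\<^sup>+h. indicator (ball 0 (2 * r)) h * (indicator (ball z r) x * ennreal ((f (x + h) - f x)\<^sup>2)) \<partial>lborel)"
    proof (rule nn_integral_mono)
      fix h
      have "h \<in> ball 0 (2 * r)" if "x \<in> ball z r" "x + h \<in> ball z r"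
      proof -
        have "dist x (x + h) \<le> dist x z + dist z (x + h)" by (rule dist_triangle)
        then show ?thesis using that by (simp add: dist_norm norm_minus_commute)
      qed
      then show "indicator (ball z r) x * (indicator (ball z r) (x + h) * ennreal ((f (x + h) - f x)\<^sup>2))
        \<le> indicator (ball 0 (2 * r)) h * (indicator (ball z r) x * ennreal ((f (x + h) - f x)\<^sup>2))" by (auto simp: indicator_def)
    qed
    finally show ?thesis .
  qed
  have "(\<integral>\<^sup>+x. \<integral>\<^sup>+y. indicator (ball z r) x * (indicator (ball z r) y * ennreal ((f y - f x)\<^sup>2)) \<partial>lborel \<partial>lborel)
    \<le> (\<integral>\<^sup>+x. \<integral>\<^sup>+h. indicator (ball 0 (2 * r)) h * (indicator (ball z r) x * ennreal ((f (x + h) - f x)\<^sup>2)) \<partial>lborel \<partial>lborel)"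
    by (intro nn_integral_mono inner)
  also have "\<dots> = (\<integral>\<^sup>+h. \<integral>\<^sup>+x. indicator (ball 0 (2 * r)) h * (indicator (ball z r) x * ennreal ((f (x + h) - f x)\<^sup>2)) \<partial>lborel \<partial>lborel)"
    by (rule lborel_pair.Fubini'[symmetric]) measurable
  also have "\<dots> \<le> (\<integral>\<^sup>+h. indicator (ball 0 (2 * r)) h * (ennreal ((2 * r)\<^sup>2) * J) \<partial>(lborel :: (real^'n) measure))"
  proof (rule nn_integral_mono)
    fix h :: "real^'n"
    show "(\<integral>\<^sup>+x. indicator (ball 0 (2 * r)) h * (indicator (ball z r) x * ennreal ((f (x + h) - f x)\<^sup>2)) \<partial>lborel)
      \<le> indicator (ball 0 (2 * r)) h * (ennreal ((2 * r)\<^sup>2) * J)"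
    proof (cases "h \<in> ball 0 (2 * r)")
      case True
      then have hn: "norm h \<le> 2 * r" by simp
      have "(\<integral>\<^sup>+x. indicator (ball z r) x * ennreal ((f (x + h) - f x)\<^sup>2) \<partial>lborel)
        \<le> (\<integral>\<^sup>+x. indicator (ball z r) x * (\<integral>\<^sup>+t. ennreal (indicator {0..1} t * ((norm h)\<^sup>2 * g (x + t *\<^sub>R h))) \<partial>lborel) \<partial>lborel)"
        unfolding g_def by (intro nn_integral_mono mult_left_mono segment_difference_bound f) simp
      also have "\<dots> = (\<integral>\<^sup>+x. \<integral>\<^sup>+t. indicator (ball z r) x * ennreal (indicator {0..1} t * ((norm h)\<^sup>2 * g (x + t *\<^sub>R h))) \<partial>lborel \<partial>lborel)"
        by (intro nn_integral_cong nn_integral_cmult[symmetric]) measurable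
      also have "\<dots> = (\<integral>\<^sup>+t. \<integral>\<^sup>+x. indicator (ball z r) x * ennreal (indicator {0..1} t * ((norm h)\<^sup>2 * g (x + t *\<^sub>R h))) \<partial>lborel \<partial>lborel)"
      proof -
        have "pair_sigma_finite (lborel :: (real^'n) measure) (lborel :: real measure)" ..
        then show ?thesis by (rule pair_sigma_finite.Fubini'[symmetric]) measurable
      qed
      also have "\<dots> \<le> (\<integral>\<^sup>+t. indicator {0..1::real} t * (ennreal ((2 * r)\<^sup>2) * J) \<partial>lborel)"
      proof (rule nn_integral_mono)
        fix t :: real
        show "(\<integral>\<^sup>+x. indicator (ball z r) x * ennreal (indicator {0..1} t * ((norm h)\<^sup>2 * g (x + t *\<^sub>R h))) \<partial>lborel) \<le> indicator {0..1} t * (ennreal ((2 * r)\<^sup>2) * J)"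
        proof (cases "t \<in> {0..1}")
          case t: True
          have "(\<integral>\<^sup>+x. indicator (ball z r) x * ennreal ((norm h)\<^sup>2 * g (x + t *\<^sub>R h)) \<partial>lborel)
            = (\<integral>\<^sup>+x. ennreal ((norm h)\<^sup>2) * (indicator (ball z r) x * ennreal (g (x + t *\<^sub>R h))) \<partial>lborel)"
            by (intro nn_integral_cong) (simp add: ennreal_mult g0 mult_ac)
          also have "\<dots> = ennreal ((norm h)\<^sup>2) * (\<integral>\<^sup>+x. indicator (ball z r) x * ennreal (g (x + t *\<^sub>R h)) \<partial>lborel)"
            by (rule nn_integral_cmult) measurable
          also have "\<dots> \<le> ennreal ((2 * r)\<^sup>2) * J"
          proof (intro mult_mono ennreal_leI shift)
            show "(norm h)\<^sup>2 \<le> (2 * r)\<^sup>2" using hn by (intro power_mono) auto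
            have "\<bar>t\<bar> * norm h \<le> 1 * (2 * r)" using t hn by (intro mult_mono) auto
            then show "norm (t *\<^sub>R h) \<le> 2 * r" by simp
          qed auto
          finally show ?thesis using t by simp
        qed simp
      qed
      also have "\<dots> = ennreal ((2 * r)\<^sup>2) * J"
        by (subst nn_integral_multc) auto
      finally show ?thesis using True by simp
    qed simp
  qed
  also have "\<dots> = emeasure lborel (ball (0::real^'n) (2 * r)) * (ennreal ((2 * r)\<^sup>2) * J)"
    by (subst nn_integral_multc) auto
  finally show ?thesis unfolding J_def g_def .
qed

lemma ball_indicator_integrable:
  fixes g :: "real^'n::finite \<Rightarrow> real"
  assumes "continuous_on UNIV g"
  shows "integrable lborel (\<lambda>x. indicator (ball z r) x * g x)"
proof -
  have "integrable lborel (\<lambda>x. indicator (cball z r) x *\<^sub>R g x)"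
    by (intro borel_integrable_compact continuous_on_subset[OF assms]) auto
  from integrable_mult_indicator[OF _ this, of "ball z r"]
  have "integrable lborel (\<lambda>x. indicator (ball z r) x *\<^sub>R (indicator (cball z r) x *\<^sub>R g x))" by simp
  moreover have "(\<lambda>x. indicator (ball z r) x *\<^sub>R (indicator (cball z r) x *\<^sub>R g x)) = (\<lambda>x. indicator (ball z r) x * g x)"
    by (auto simp: indicator_def)
  ultimately show ?thesis by simp
qed

text \<open>Expanding the double integral of \<open>(f y - f x)^2\<close> gives twice the volume
  times the integral of \<open>f\<^sup>2\<close>, minus twice the squared integral of
  \<open>f\<close>.\<close>

lemma ball_variance_bound:
  fixes f :: "real^'n::finite \<Rightarrow> real"
  assumes f: "C_k (Suc 0) f" and r: "r > 0"
  shows "2 * measure lborel (ball z r) * (\<integral>x. indicator (ball z r) x * (f x)\<^sup>2 \<partial>lborel) - 2 * (\<integral>x. indicator (ball z r) x * f x \<partial>lborel)\<^sup>2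
    \<le> measure lborel (ball (0::real^'n) (2 * r)) * (2 * r)\<^sup>2 * (\<integral>x. indicator (ball z (3 * r)) x * (\<Sum>i\<in>UNIV. (pderiv_at i f x)\<^sup>2) \<partial>lborel)"
proof -
  have cf: "continuous_on UNIV f" using f by (rule C_k_continuous)
  have cp: "continuous_on UNIV (pderiv_at i f)" for i using f by simp
  define V where "V = measure lborel (ball z r)"
  define A where "A = (\<integral>x. indicator (ball z r) x * (f x)\<^sup>2 \<partial>lborel)"
  define S where "S = (\<integral>x. indicator (ball z r) x * f x \<partial>lborel)"
  have i0: "integrable lborel (\<lambda>x. indicator (ball z r) x * c)" "(\<integral>x. indicator (ball z r) x * c \<partial>lborel) = V * c" for c :: real
    using ball_indicator_integrable[of "\<lambda>_. c" z r] by (auto simp: V_def)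
  note i1 = ball_indicator_integrable[OF cf, of z r]
  have i2: "integrable lborel (\<lambda>x. indicator (ball z r) x * (f x)\<^sup>2)" by (intro ball_indicator_integrable continuous_on_power cf)
  have inner: "(\<integral>\<^sup>+y. indicator (ball z r) x * (indicator (ball z r) y * ennreal ((f y - f x)\<^sup>2)) \<partial>lborel)
    = ennreal (indicator (ball z r) x * (A - 2 * f x * S + V * (f x)\<^sup>2))" for x
  proof (cases "x \<in> ball z r")
    case True
    have e: "indicator (ball z r) y * (f y - f x)\<^sup>2 = indicator (ball z r) y * (f y)\<^sup>2 - 2 * f x * (indicator (ball z r) y * f y) + indicator (ball z r) y * (f x)\<^sup>2" for y
      by (simp add: power2_diff algebra_simps)
    have ie: "integrable lborel (\<lambda>y. indicator (ball z r) y * (f y - f x)\<^sup>2)"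
      unfolding e by (intro Bochner_Integration.integrable_add Bochner_Integration.integrable_diff i2 integrable_mult_right i1 i0)
    have "(\<integral>\<^sup>+y. indicator (ball z r) y * ennreal ((f y - f x)\<^sup>2) \<partial>lborel) = (\<integral>\<^sup>+y. ennreal (indicator (ball z r) y * (f y - f x)\<^sup>2) \<partial>lborel)"
      by (intro nn_integral_cong) (auto simp: indicator_def)
    also have "\<dots> = ennreal (\<integral>y. indicator (ball z r) y * (f y - f x)\<^sup>2 \<partial>lborel)"
      by (intro nn_integral_eq_integral ie) auto
    also have "(\<integral>y. indicator (ball z r) y * (f y - f x)\<^sup>2 \<partial>lborel) = A - 2 * f x * S + V * (f x)\<^sup>2"
      unfolding e using i0 i1 i2 by (simp add: A_def S_def)
    finally show ?thesis using True by simp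
  qed simp
  have e2: "indicator (ball z r) x * (A - 2 * f x * S + V * (f x)\<^sup>2) = indicator (ball z r) x * A - 2 * S * (indicator (ball z r) x * f x) + V * (indicator (ball z r) x * (f x)\<^sup>2)" for x
    by (simp add: algebra_simps)
  have i3: "integrable lborel (\<lambda>x. indicator (ball z r) x * (A - 2 * f x * S + V * (f x)\<^sup>2))"
    unfolding e2 by (intro Bochner_Integration.integrable_add Bochner_Integration.integrable_diff i2 integrable_mult_right i1 i0)
  have pos: "0 \<le> A - 2 * f x * S + V * (f x)\<^sup>2" for x
  proof -
    have e: "indicator (ball z r) y * (f y - f x)\<^sup>2 = indicator (ball z r) y * (f y)\<^sup>2 - 2 * f x * (indicator (ball z r) y * f y) + indicator (ball z r) y * (f x)\<^sup>2" for y
      by (simp add: power2_diff algebra_simps)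
    have "(\<integral>y. indicator (ball z r) y * (f y - f x)\<^sup>2 \<partial>lborel) = A - 2 * f x * S + V * (f x)\<^sup>2"
      unfolding e using i0 i1 i2 by (simp add: A_def S_def)
    moreover have "0 \<le> (\<integral>y. indicator (ball z r) y * (f y - f x)\<^sup>2 \<partial>lborel)" by (intro integral_nonneg_AE) auto
    ultimately show ?thesis by simp
  qed
  define G where "G = (\<integral>x. indicator (ball z (3 * r)) x * (\<Sum>i\<in>UNIV. (pderiv_at i f x)\<^sup>2) \<partial>lborel)"
  have ig: "integrable lborel (\<lambda>x. indicator (ball z (3 * r)) x * (\<Sum>i\<in>UNIV. (pderiv_at i f x)\<^sup>2))"
    by (intro ball_indicator_integrable continuous_on_sum continuous_on_power cp)
  have lhs: "(\<integral>\<^sup>+x. \<integral>\<^sup>+y. indicator (ball z r) x * (indicator (ball z r) y * ennreal ((f y - f x)\<^sup>2)) \<partial>lborel \<partial>lborel) = ennreal (2 * V * A - 2 * S\<^sup>2)"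
  proof -
    have "(\<integral>\<^sup>+x. \<integral>\<^sup>+y. indicator (ball z r) x * (indicator (ball z r) y * ennreal ((f y - f x)\<^sup>2)) \<partial>lborel \<partial>lborel)
      = ennreal (\<integral>x. indicator (ball z r) x * (A - 2 * f x * S + V * (f x)\<^sup>2) \<partial>lborel)"
      unfolding inner by (intro nn_integral_eq_integral i3) (use pos in auto)
    also have "(\<integral>x. indicator (ball z r) x * (A - 2 * f x * S + V * (f x)\<^sup>2) \<partial>lborel) = V * A - 2 * S * S + V * A"
      unfolding e2 using i0 i1 i2 by (simp add: A_def[symmetric] S_def[symmetric])
    also have "\<dots> = 2 * V * A - 2 * S\<^sup>2" by (simp add: power2_eq_square)
    finally show ?thesis .
  qed
  have rhs: "emeasure lborel (ball (0::real^'n) (2 * r)) * (ennreal ((2 * r)\<^sup>2) * (\<integral>\<^sup>+x. indicator (ball z (3 * r)) x * ennreal (\<Sum>i\<in>UNIV. (pderiv_at i f x)\<^sup>2) \<partial>lborel))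
    = ennreal (measure lborel (ball (0::real^'n) (2 * r)) * (2 * r)\<^sup>2 * G)"
  proof -
    have "(\<integral>\<^sup>+x. indicator (ball z (3 * r)) x * ennreal (\<Sum>i\<in>UNIV. (pderiv_at i f x)\<^sup>2) \<partial>lborel) = (\<integral>\<^sup>+x. ennreal (indicator (ball z (3 * r)) x * (\<Sum>i\<in>UNIV. (pderiv_at i f x)\<^sup>2)) \<partial>lborel)"
      by (intro nn_integral_cong) (auto simp: indicator_def)
    also have "\<dots> = ennreal G" unfolding G_def by (intro nn_integral_eq_integral ig AE_I2 mult_nonneg_nonneg sum_nonneg) auto
    finally have 1: "(\<integral>\<^sup>+x. indicator (ball z (3 * r)) x * ennreal (\<Sum>i\<in>UNIV. (pderiv_at i f x)\<^sup>2) \<partial>lborel) = ennreal G" .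
    have "emeasure lborel (ball (0::real^'n) (2 * r)) = ennreal (measure lborel (ball (0::real^'n) (2 * r)))"
      using emeasure_lborel_ball_finite[of "0::real^'n" "2 * r"] by (intro emeasure_eq_ennreal_measure) auto
    moreover have "0 \<le> G" unfolding G_def by (intro integral_nonneg_AE AE_I2 mult_nonneg_nonneg sum_nonneg) auto
    ultimately show ?thesis unfolding 1 by (simp add: ennreal_mult[symmetric] mult.assoc)
  qed
  have "ennreal (2 * V * A - 2 * S\<^sup>2) \<le> ennreal (measure lborel (ball (0::real^'n) (2 * r)) * (2 * r)\<^sup>2 * G)"
    using ball_difference_bound[OF f r, of z] unfolding lhs rhs .
  moreover have "0 \<le> measure lborel (ball (0::real^'n) (2 * r)) * (2 * r)\<^sup>2 * G"
    unfolding G_def by (intro mult_nonneg_nonneg integral_nonneg_AE AE_I2 sum_nonneg) auto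
  ultimately show ?thesis unfolding V_def A_def S_def G_def by (simp add: ennreal_le_iff)
qed

context bounded_open
begin

lemma indicator_measurable_M: "A \<in> sets borel \<Longrightarrow> (indicator A :: real^'n \<Rightarrow> real) \<in> borel_measurable M"
  by (rule borel_imp_measurable, rule borel_measurable_indicator)

lemma integral_indicator_lborel:
  assumes "A \<in> sets borel" "A \<subseteq> \<Omega>" "continuous_on UNIV g"
  shows "(\<integral>x. indicator A x * g x \<partial>M) = (\<integral>x. indicator A x * (g x :: real) \<partial>lborel)"
proof -
  have "(\<integral>x. indicator A x * g x \<partial>M) = (\<integral>x. indicator \<Omega> x *\<^sub>R (indicator A x * g x) \<partial>lebesgue)"
    by (rule integral_restrict_space) simp
  also have "(\<lambda>x. indicator \<Omega> x *\<^sub>R (indicator A x * g x)) = (\<lambda>x. indicator A x * g x)"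
    using assms(2) by (intro ext) (auto simp: indicator_def)
  also have "(\<integral>x. indicator A x * g x \<partial>lebesgue) = (\<integral>x. indicator A x * g x \<partial>lborel)"
    using assms(1) borel_measurable_continuous_onI[OF assms(3)] by (intro integral_completion) auto
  finally show ?thesis .
qed

lemma indicator_mult_integrable:
  assumes "A \<in> sets borel" "integrable M h" shows "integrable M (\<lambda>x. indicator A x * (h x :: real))"
proof (rule Bochner_Integration.integrable_bound[OF assms(2)])
  show "(\<lambda>x. indicator A x * h x) \<in> borel_measurable M"
    using assms(2) by (intro borel_measurable_times indicator_measurable_M assms(1)) auto
qed (auto simp: indicator_def)

lemma indicator_mult_L2_lim:
  assumes "A \<in> sets borel" "L2_lim M f F" shows "L2_lim M (\<lambda>n x. indicator A x * f n x) (\<lambda>x. indicator A x * F x)"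
  by (rule L2_lim_bdd_mult[OF assms(2) indicator_measurable_M[OF assms(1)], of 1]) (auto simp: indicator_def)

text \<open>The variance bound is applied to mollifications, whose gradients are mollified gradients
  near the large closed ball; in the limit the zero mean removes the squared integral.\<close>

lemma ball_poincare:
  assumes r: "r > 0" and b: "cball z (3 * r) \<subseteq> \<Omega>"
  obtains C where "C \<ge> 0" "\<And>q H. H1 q H \<Longrightarrow> (\<integral>x. indicator (ball z r) x * q x \<partial>M) = 0 \<Longrightarrow>
    (\<integral>x. indicator (ball z r) x * (q x)\<^sup>2 \<partial>M) \<le> C * (\<integral>x. (\<Sum>i\<in>UNIV. (H i x)\<^sup>2) \<partial>M)"
proof -
  define V where "V = measure lborel (ball z r)"
  have V: "V > 0" unfolding V_def by (rule content_ball_pos[OF r])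
  define C0 where "C0 = measure lborel (ball (0::real^'n) (2 * r)) * (2 * r)\<^sup>2"
  have C0: "C0 \<ge> 0" by (simp add: C0_def)
  have sub: "ball z r \<subseteq> \<Omega>" "ball z (3 * r) \<subseteq> cball z (3 * r)" "ball z (3 * r) \<subseteq> \<Omega>" using b r by (auto simp: subset_iff)
  have "(\<integral>x. indicator (ball z r) x * (q x)\<^sup>2 \<partial>M) \<le> (C0 / (2 * V)) * (\<integral>x. (\<Sum>i\<in>UNIV. (H i x)\<^sup>2) \<partial>M)"
    if q: "H1 q H" and q0: "(\<integral>x. indicator (ball z r) x * q x \<partial>M) = 0" for q H
  proof -
    obtain K' N where K': "compact K'" "K' \<subseteq> \<Omega>" "cball z (3 * r) \<subseteq> K'"
      and ball: "\<forall>n x. N \<le> n \<longrightarrow> x \<in> cball z (3 * r) \<longrightarrow> cball x (1 / real (Suc n)) \<subseteq> \<Omega>"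
      by (rule mollify_compact[OF compact_cball b]) (rule that; assumption)
    note qs = H1_sq(1)[OF q] and Hs = H1_sq(2)[OF q]
    define f where "f n = mollify n q" for n
    have fC: "C_k (Suc 0) (f n)" for n unfolding f_def by (rule C_k_mollify[OF qs])
    have fc: "continuous_on UNIV (f n)" for n by (rule C_k_continuous[OF fC])
    have pc: "continuous_on UNIV (pderiv_at i (f n))" for i n using fC[of n] by simp
    have mc: "continuous_on UNIV (mollify n (H i))" for n i by (rule mollify_continuous[OF Hs])
    have ineq: "2 * V * (\<integral>x. indicator (ball z r) x * (f n x)\<^sup>2 \<partial>M) - 2 * (\<integral>x. indicator (ball z r) x * f n x \<partial>M)\<^sup>2
      \<le> C0 * (\<Sum>i\<in>UNIV. \<integral>x. mollify n (H i) x * mollify n (H i) x \<partial>M)" if n: "n \<ge> N" for n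
    proof -
      have pd: "pderiv_at i (f n) x = mollify n (H i) x" if "x \<in> ball z (3 * r)" for i x
      proof -
        have "cball x (1 / real (Suc n)) \<subseteq> \<Omega>" using ball n that sub(2) by blast
        then show ?thesis unfolding f_def pderiv_at_mollify[OF qs] by (rule conv_pderiv_interior[OF H1_wd[OF q]])
      qed
      have "2 * V * (\<integral>x. indicator (ball z r) x * (f n x)\<^sup>2 \<partial>M) - 2 * (\<integral>x. indicator (ball z r) x * f n x \<partial>M)\<^sup>2
        = 2 * V * (\<integral>x. indicator (ball z r) x * (f n x)\<^sup>2 \<partial>lborel) - 2 * (\<integral>x. indicator (ball z r) x * f n x \<partial>lborel)\<^sup>2"
        using sub(1) by (simp add: integral_indicator_lborel fc continuous_on_power)
      also have "\<dots> \<le> C0 * (\<integral>x. indicator (ball z (3 * r)) x * (\<Sum>i\<in>UNIV. (pderiv_at i (f n) x)\<^sup>2) \<partial>lborel)"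
        unfolding V_def C0_def by (rule ball_variance_bound[OF fC r])
      also have "(\<integral>x. indicator (ball z (3 * r)) x * (\<Sum>i\<in>UNIV. (pderiv_at i (f n) x)\<^sup>2) \<partial>lborel)
        = (\<integral>x. indicator (ball z (3 * r)) x * (\<Sum>i\<in>UNIV. (pderiv_at i (f n) x)\<^sup>2) \<partial>M)"
        using sub(3) by (intro integral_indicator_lborel[symmetric] continuous_on_sum continuous_on_power pc) auto
      also have "\<dots> \<le> (\<integral>x. (\<Sum>i\<in>UNIV. mollify n (H i) x * mollify n (H i) x) \<partial>M)"
      proof (rule integral_mono)
        show "integrable M (\<lambda>x. indicator (ball z (3 * r)) x * (\<Sum>i\<in>UNIV. (pderiv_at i (f n) x)\<^sup>2))"
          by (intro indicator_mult_integrable fm.sq_integrable_integrable continuous_sq_integrable continuous_on_sum continuous_on_power pc) simp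
        show "integrable M (\<lambda>x. \<Sum>i\<in>UNIV. mollify n (H i) x * mollify n (H i) x)"
          by (intro fm.sq_integrable_integrable continuous_sq_integrable continuous_on_sum continuous_on_mult mc)
        fix x
        show "indicator (ball z (3 * r)) x * (\<Sum>i\<in>UNIV. (pderiv_at i (f n) x)\<^sup>2) \<le> (\<Sum>i\<in>UNIV. mollify n (H i) x * mollify n (H i) x)"
          using pd[of x] by (cases "x \<in> ball z (3 * r)") (auto simp: power2_eq_square intro!: sum_nonneg)
      qed
      also have "\<dots> = (\<Sum>i\<in>UNIV. \<integral>x. mollify n (H i) x * mollify n (H i) x \<partial>M)"
        by (intro Bochner_Integration.integral_sum fm.sq_integrable_integrable continuous_sq_integrable continuous_on_mult mc)
      finally show ?thesis using C0 by (simp add: mult_left_mono)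
    qed
    have ml: "L2_lim M f q" unfolding f_def[abs_def] by (rule mollify_L2_lim[OF qs])
    have l1: "(\<lambda>n. \<integral>x. (indicator (ball z r) x * f n x) * f n x \<partial>M) \<longlonglongrightarrow> (\<integral>x. (indicator (ball z r) x * q x) * q x \<partial>M)"
      by (intro L2_lim_product indicator_mult_L2_lim ml) simp
    have l2: "(\<lambda>n. \<integral>x. (indicator (ball z r) x * f n x) * 1 \<partial>M) \<longlonglongrightarrow> (\<integral>x. (indicator (ball z r) x * q x) * 1 \<partial>M)"
      by (intro L2_lim_product_const indicator_mult_L2_lim ml continuous_sq_integrable) auto
    have l3: "(\<lambda>n. \<Sum>i\<in>UNIV. \<integral>x. mollify n (H i) x * mollify n (H i) x \<partial>M) \<longlonglongrightarrow> (\<Sum>i\<in>UNIV. \<integral>x. H i x * H i x \<partial>M)"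
      by (intro tendsto_sum L2_lim_product mollify_L2_lim Hs)
    have "2 * V * (\<integral>x. indicator (ball z r) x * (q x)\<^sup>2 \<partial>M) - 2 * 0\<^sup>2 \<le> C0 * (\<Sum>i\<in>UNIV. \<integral>x. H i x * H i x \<partial>M)"
    proof (rule LIMSEQ_le)
      show "(\<lambda>n. 2 * V * (\<integral>x. indicator (ball z r) x * (f n x)\<^sup>2 \<partial>M) - 2 * (\<integral>x. indicator (ball z r) x * f n x \<partial>M)\<^sup>2) \<longlonglongrightarrow> 2 * V * (\<integral>x. indicator (ball z r) x * (q x)\<^sup>2 \<partial>M) - 2 * 0\<^sup>2"
        using l1 l2 unfolding q0[symmetric] power2_eq_square[of "f _ _"] power2_eq_square[of "q _"] mult.assoc mult_1_right
        by (intro tendsto_intros)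
      show "(\<lambda>n. C0 * (\<Sum>i\<in>UNIV. \<integral>x. mollify n (H i) x * mollify n (H i) x \<partial>M)) \<longlonglongrightarrow> C0 * (\<Sum>i\<in>UNIV. \<integral>x. H i x * H i x \<partial>M)"
        by (intro tendsto_intros l3)
    qed (use ineq in blast)
    moreover have "(\<Sum>i\<in>UNIV. \<integral>x. H i x * H i x \<partial>M) = (\<integral>x. (\<Sum>i\<in>UNIV. (H i x)\<^sup>2) \<partial>M)"
      using sq_integrable_square[OF Hs] by (simp add: Bochner_Integration.integral_sum power2_eq_square)
    ultimately show ?thesis using V by (simp add: field_simps)
  qed
  moreover have "C0 / (2 * V) \<ge> 0" using C0 V by simp
  ultimately show ?thesis using that by blast
qed

text \<open>The vector field \<open>X\<close> points towards \<open>z\<close>, vanishes on the boundary of the large ball and has positive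
  divergence away from \<open>z\<close>; hence \<open>2 \<integral> q X \<cdot> \<nabla>q = - \<integral> q\<^sup>2 div X\<close> controls \<open>q\<close> on the large ball by its
  values on the small one.\<close>
lemma ball_enlarge:
  assumes r: "0 < r'" "0 < R0" "R0 < R" and b: "cball z R \<subseteq> \<Omega>"
  obtains C where "C \<ge> 0" "\<And>q H. H1 q H \<Longrightarrow>
    (\<integral>x. indicator (ball z R0) x * (q x)\<^sup>2 \<partial>M) \<le> C * ((\<integral>x. indicator (ball z r') x * (q x)\<^sup>2 \<partial>M) + (\<integral>x. (\<Sum>i\<in>UNIV. (H i x)\<^sup>2) \<partial>M))"
proof -
  define n where "n = real CARD('n)"
  have n: "n > 0" by (simp add: n_def)
  have R: "R > 0" using r by simp
  \<comment> \<open>With this power the factor \<open>2 * Suc k * |x - z|^2 - n * m\<close> in the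
    divergence of \<open>X\<close> is at least one outside the small ball, since
    \<open>m \<le> R\<^sup>2\<close>.\<close>
  obtain k :: nat where k: "n * R\<^sup>2 + 1 < real k * (2 * r'\<^sup>2)"
    using reals_Archimedean3[of "2 * r'\<^sup>2"] r(1) by auto
  have k1: "k \<ge> 1"
  proof (rule ccontr)
    assume "\<not> k \<ge> 1"
    then have "k = 0" by simp
    then have "n * R\<^sup>2 + 1 < 0" using k by simp
    moreover have "0 \<le> n * R\<^sup>2" using n by simp
    ultimately show False by linarith
  qed
  define f where "f x = R\<^sup>2 - (\<Sum>i\<in>UNIV. (x $ i - z $ i)\<^sup>2)" for x
  have f_norm: "f x = R\<^sup>2 - (norm (x - z))\<^sup>2" for x unfolding f_def sum_square_norm[symmetric] by simp
  have fC: "C_k j f" for j unfolding f_def[abs_def] by (intro C_k_diff C_k_const C_k_sum C_k_power C_k_nth)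
  have fd: "f differentiable (at x)" for x using fC[of "Suc 0"] by simp
  have dz: "(\<lambda>x::real^'n. x $ j - z $ j) differentiable (at x)" for j x
    using C_k_differentiable[OF C_k_diff[OF C_k_nth[of "Suc 0"] C_k_const]] .
  have pz: "pderiv_at i (\<lambda>x::real^'n. x $ j - z $ j) x = (if i = j then 1 else 0)" for i j x
    using C_k_differentiable[OF C_k_nth[of "Suc 0"]] by (subst pderiv_at_diff) (auto simp: pderiv_at_nth)
  have fp: "pderiv_at i f x = - 2 * (x $ i - z $ i)" for i x
  proof -
    have "pderiv_at i f x = 0 - pderiv_at i (\<lambda>x. \<Sum>j\<in>UNIV. (x $ j - z $ j)\<^sup>2) x"
      unfolding f_def[abs_def]
      by (subst pderiv_at_diff) (auto intro!: differentiable_sum differentiable_power dz)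
    also have "pderiv_at i (\<lambda>x. \<Sum>j\<in>UNIV. (x $ j - z $ j)\<^sup>2) x = (\<Sum>j\<in>UNIV. if i = j then 2 * (x $ j - z $ j) else 0)"
    proof -
      have "pderiv_at i (\<lambda>x. (x $ j - z $ j)\<^sup>2) x = (if i = j then 2 * (x $ j - z $ j) else 0)" for j
        unfolding pderiv_at_power[OF dz] pz by simp
      then show ?thesis by (subst pderiv_at_sum) (auto intro!: differentiable_power dz)
    qed
    finally show ?thesis by simp
  qed
  define m where "m x = max 0 (f x)" for x
  define g where "g x = m x ^ Suc k" for x
  have m0: "0 \<le> m x" "m x \<le> R\<^sup>2" for x by (auto simp: m_def f_norm)
  obtain k' where k': "k = Suc k'" using k1 by (cases k) auto
  have gC: "C_k (Suc 0) g" unfolding g_def[abs_def] m_def by (rule C_k_pos_part_power[OF fC]) (use k1 in simp)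
  have gp: "pderiv_at i g x = real (Suc k) * m x ^ k * (- 2 * (x $ i - z $ i))" for i x
  proof -
    have "pderiv_at i (\<lambda>x. (max 0 (f x)) ^ Suc (Suc k')) x = real (Suc (Suc k')) * (max 0 (f x)) ^ Suc k' * pderiv_at i f x"
      by (rule pderiv_at_compose_real(1)[OF pos_part_power_deriv fd])
    then show ?thesis unfolding g_def[abs_def] m_def k' fp .
  qed
  define X where "X i x = - ((x $ i - z $ i) * g x)" for i x
  have XC: "C_k (Suc 0) (X i)" for i
    unfolding X_def[abs_def] by (intro C_k_uminus C_k_mult gC C_k_diff C_k_nth C_k_const)
  have Xc: "continuous_on UNIV (X i)" "continuous_on UNIV (pderiv_at i (X i))" for i
    using C_k_continuous[OF XC] XC[of i] by auto
  have Xp: "pderiv_at i (X i) x = - g x + 2 * real (Suc k) * m x ^ k * (x $ i - z $ i)\<^sup>2" for i x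
  proof -
    have "pderiv_at i (X i) x = - pderiv_at i (\<lambda>x. (x $ i - z $ i) * g x) x"
      unfolding X_def[abs_def] using gC dz by (intro pderiv_at_uminus differentiable_mult) auto
    also have "pderiv_at i (\<lambda>x. (x $ i - z $ i) * g x) x = (x $ i - z $ i) * pderiv_at i g x + g x"
      using gC dz by (subst pderiv_at_mult) (auto simp: pz)
    finally show ?thesis unfolding gp by (simp add: power2_eq_square algebra_simps)
  qed
  have X0: "X i x = 0 \<and> pderiv_at i (X i) x = 0" if "x \<notin> cball z R" for i x
  proof -
    have "R\<^sup>2 \<le> (norm (x - z))\<^sup>2" using that R by (intro power_mono) (auto simp: dist_norm norm_minus_commute)
    then have "m x = 0" by (simp add: m_def f_norm)
    then show ?thesis unfolding Xp using k1 by (simp add: X_def g_def)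
  qed
  define dX where "dX x = (\<Sum>i\<in>UNIV. pderiv_at i (X i) x)" for x
  have dXe: "dX x = m x ^ k * (2 * real (Suc k) * (norm (x - z))\<^sup>2 - n * m x)" for x
  proof -
    have "dX x = - n * g x + 2 * real (Suc k) * m x ^ k * (\<Sum>i\<in>UNIV. (x $ i - z $ i)\<^sup>2)"
      unfolding dX_def Xp sum.distrib by (simp add: n_def sum_distrib_left)
    also have "(\<Sum>i\<in>UNIV. (x $ i - z $ i)\<^sup>2) = (norm (x - z))\<^sup>2" using sum_square_norm[of "x - z"] by simp
    finally show ?thesis by (simp add: g_def algebra_simps)
  qed
  \<comment> \<open>\<open>A\<close> compensates on the small ball, where the divergence of
    \<open>X\<close> may be negative; \<open>B\<close> bounds the gradient term left by Young's
    inequality; \<open>c\<close> is half a lower bound of \<open>m ^ k\<close> on the ball of radius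
    \<open>R0\<close>.\<close>
  define A where "A = (R\<^sup>2) ^ k * (1 + n * R\<^sup>2)"
  define B where "B = 2 * R\<^sup>2 * (R\<^sup>2) ^ (k + 2)"
  have A: "A \<ge> 0" "B \<ge> 0" using n by (auto simp: A_def B_def)
  define c where "c = (R\<^sup>2 - R0\<^sup>2) ^ k / 2"
  have c: "c > 0" using r by (auto simp: c_def power_strict_mono)
  have low: "m x ^ k \<le> dX x + indicator (ball z r') x * A" for x
  proof (cases "x \<in> ball z r'")
    case True
    have "- dX x \<le> m x ^ k * (n * m x)"
      unfolding dXe using m0(1)[of x] by (simp add: right_diff_distrib)
    then have "m x ^ k - dX x \<le> m x ^ k * (1 + n * m x)" by (simp add: distrib_left)
    also have "\<dots> \<le> A" unfolding A_def
      using m0[of x] n by (intro mult_mono power_mono add_left_mono mult_left_mono) auto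
    finally show ?thesis using True by simp
  next
    case False
    then have "r' \<le> norm (x - z)" by (simp add: dist_norm norm_minus_commute)
    then have t: "r'\<^sup>2 \<le> (norm (x - z))\<^sup>2" using r by (intro power_mono) auto
    have "n * m x + 1 \<le> n * R\<^sup>2 + 1" using m0(2)[of x] n by simp
    also have "\<dots> \<le> real (Suc k) * (2 * r'\<^sup>2)"
    proof -
      have "real k * (2 * r'\<^sup>2) \<le> real (Suc k) * (2 * r'\<^sup>2)" by (intro mult_right_mono) auto
      then show ?thesis using k by linarith
    qed
    also have "\<dots> \<le> real (Suc k) * (2 * (norm (x - z))\<^sup>2)" using t by (intro mult_left_mono) auto
    finally have "1 \<le> 2 * real (Suc k) * (norm (x - z))\<^sup>2 - n * m x" by (simp add: algebra_simps)
    then have "m x ^ k * 1 \<le> dX x" unfolding dXe using m0(1)[of x] by (intro mult_left_mono) auto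
    then show ?thesis using False by simp
  qed
  have "(\<integral>x. indicator (ball z R0) x * (q x)\<^sup>2 \<partial>M) \<le> (max A B / c) * ((\<integral>x. indicator (ball z r') x * (q x)\<^sup>2 \<partial>M) + (\<integral>x. (\<Sum>i\<in>UNIV. (H i x)\<^sup>2) \<partial>M))"
    if q: "H1 q H" for q H
  proof -
    note qs = H1_sq(1)[OF q] and Hs = H1_sq(2)[OF q]
    define T where "T x = (\<Sum>i\<in>UNIV. (H i x)\<^sup>2)" for x
    have T0: "T x \<ge> 0" for x by (simp add: T_def sum_nonneg)
    have Ti: "integrable M T" unfolding T_def[abs_def] by (intro Bochner_Integration.integrable_sum sq_integrable_square Hs)
    have i1: "integrable M (\<lambda>x. pderiv_at i (X i) x * (q x)\<^sup>2)" "integrable M (\<lambda>x. X i x * (H i x * q x))" for i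
      by (intro continuous_mult_integrable Xc sq_integrable_square sq_integrable_mult qs Hs)+
    define P where "P x = (\<Sum>i\<in>UNIV. pderiv_at i (X i) x * (q x)\<^sup>2 + 2 * (X i x * (H i x * q x)))" for x
    have Pi: "integrable M P" unfolding P_def
      by (intro Bochner_Integration.integrable_sum Bochner_Integration.integrable_add integrable_mult_right i1)
    have P0: "(\<integral>x. P x \<partial>M) = 0"
    proof -
      have "(\<integral>x. pderiv_at i (X i) x * (q x)\<^sup>2 + 2 * (X i x * (H i x * q x)) \<partial>M) = 0" for i
      proof -
        have "(\<integral>x. q x * (X i x * H i x + pderiv_at i (X i) x * q x) \<partial>M) = - (\<integral>x. H i x * (X i x * q x) \<partial>M)"
          using X0 by (intro H1_compact_support_parts[OF compact_cball b q XC _ _ q]) auto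
        moreover have "(\<integral>x. q x * (X i x * H i x + pderiv_at i (X i) x * q x) \<partial>M)
          = (\<integral>x. pderiv_at i (X i) x * (q x)\<^sup>2 \<partial>M) + (\<integral>x. X i x * (H i x * q x) \<partial>M)"
          by (subst Bochner_Integration.integral_add[OF i1, symmetric]) (simp add: algebra_simps power2_eq_square)
        moreover have "(\<integral>x. H i x * (X i x * q x) \<partial>M) = (\<integral>x. X i x * (H i x * q x) \<partial>M)" by (simp add: algebra_simps)
        ultimately show ?thesis using i1 by simp
      qed
      then show ?thesis unfolding P_def using i1 by (subst Bochner_Integration.integral_sum) auto
    qed
    have pt: "c * (indicator (ball z R0) x * (q x)\<^sup>2) \<le> P x + A * (indicator (ball z r') x * (q x)\<^sup>2) + B * T x" for x
    proof -
      define S where "S = (\<Sum>i\<in>UNIV. (x $ i - z $ i) * H i x)"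
      have "P x = dX x * (q x)\<^sup>2 + 2 * (\<Sum>i\<in>UNIV. X i x * (H i x * q x))"
        unfolding P_def dX_def sum.distrib sum_distrib_right sum_distrib_left ..
      also have "(\<Sum>i\<in>UNIV. X i x * (H i x * q x)) = - (g x * q x * S)"
        unfolding S_def X_def sum_distrib_left sum_negf[symmetric] by (intro sum.cong) (auto simp: algebra_simps)
      finally have Pe: "P x = dX x * (q x)\<^sup>2 - 2 * (g x * q x * S)" by simp
      have "2 * (g x * q x * S) \<le> m x ^ k * (q x)\<^sup>2 / 2 + 2 * (m x ^ k * (m x * S)\<^sup>2)"
      proof -
        have "0 \<le> m x ^ k * (q x - 2 * (m x * S))\<^sup>2 / 2" using m0 by simp
        then show ?thesis by (simp add: g_def power2_eq_square algebra_simps)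
      qed
      moreover have "2 * (m x ^ k * (m x * S)\<^sup>2) \<le> B * T x"
      proof (cases "x \<in> cball z R")
        case False
        then have "R\<^sup>2 \<le> (norm (x - z))\<^sup>2" using R by (intro power_mono) (auto simp: dist_norm norm_minus_commute)
        then have "m x = 0" by (simp add: m_def f_norm)
        then show ?thesis using A T0[of x] by simp
      next
        case True
        have "S\<^sup>2 \<le> (\<Sum>i\<in>UNIV. (x $ i - z $ i)\<^sup>2) * T x" unfolding S_def T_def by (rule Cauchy_Schwarz_ineq_sum)
        also have "(\<Sum>i\<in>UNIV. (x $ i - z $ i)\<^sup>2) = (norm (x - z))\<^sup>2" using sum_square_norm[of "x - z"] by simp
        also have "(norm (x - z))\<^sup>2 * T x \<le> R\<^sup>2 * T x"
          using True T0[of x] by (intro mult_right_mono power_mono) (auto simp: dist_norm norm_minus_commute)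
        finally have S: "S\<^sup>2 \<le> R\<^sup>2 * T x" .
        have "2 * (m x ^ k * (m x * S)\<^sup>2) = 2 * (m x ^ (k + 2) * S\<^sup>2)" by (simp only: power_mult_distrib power_add mult.assoc)
        also have "\<dots> \<le> 2 * ((R\<^sup>2) ^ (k + 2) * (R\<^sup>2 * T x))"
          using m0[of x] S by (intro mult_left_mono mult_mono power_mono) auto
        finally show ?thesis by (simp add: B_def mult_ac)
      qed
      moreover have "m x ^ k * (q x)\<^sup>2 \<le> dX x * (q x)\<^sup>2 + A * (indicator (ball z r') x * (q x)\<^sup>2)"
      proof -
        have "m x ^ k * (q x)\<^sup>2 \<le> (dX x + indicator (ball z r') x * A) * (q x)\<^sup>2" by (intro mult_right_mono low) simp
        then show ?thesis by (simp add: algebra_simps)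
      qed
      ultimately have 1: "m x ^ k * (q x)\<^sup>2 / 2 \<le> P x + A * (indicator (ball z r') x * (q x)\<^sup>2) + B * T x" unfolding Pe by linarith
      have "c * (indicator (ball z R0) x * (q x)\<^sup>2) \<le> m x ^ k * (q x)\<^sup>2 / 2"
      proof (cases "x \<in> ball z R0")
        case True
        then have "(norm (x - z))\<^sup>2 \<le> R0\<^sup>2" by (intro power_mono) (auto simp: dist_norm norm_minus_commute)
        then have "R\<^sup>2 - R0\<^sup>2 \<le> m x" by (simp add: m_def f_norm)
        then have "(R\<^sup>2 - R0\<^sup>2) ^ k \<le> m x ^ k" using r by (intro power_mono) (auto simp: power_mono)
        then have "(R\<^sup>2 - R0\<^sup>2) ^ k * (q x)\<^sup>2 \<le> m x ^ k * (q x)\<^sup>2" by (intro mult_right_mono) auto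
        then show ?thesis using True by (simp add: c_def)
      qed (use m0 in simp)
      then show ?thesis using 1 by linarith
    qed
    have ib: "integrable M (\<lambda>x. indicator (ball z s) x * (q x)\<^sup>2)" for s
      by (intro indicator_mult_integrable sq_integrable_square qs) simp
    have "c * (\<integral>x. indicator (ball z R0) x * (q x)\<^sup>2 \<partial>M) = (\<integral>x. c * (indicator (ball z R0) x * (q x)\<^sup>2) \<partial>M)" by simp
    also have "\<dots> \<le> (\<integral>x. P x + A * (indicator (ball z r') x * (q x)\<^sup>2) + B * T x \<partial>M)"
      by (intro integral_mono pt Bochner_Integration.integrable_add integrable_mult_right ib Pi Ti)
    also have "\<dots> = A * (\<integral>x. indicator (ball z r') x * (q x)\<^sup>2 \<partial>M) + B * (\<integral>x. T x \<partial>M)"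
      using ib Pi Ti P0 by simp
    also have "\<dots> \<le> max A B * (\<integral>x. indicator (ball z r') x * (q x)\<^sup>2 \<partial>M) + max A B * (\<integral>x. T x \<partial>M)"
      using T0 by (intro add_mono mult_right_mono integral_nonneg_AE) auto
    finally show ?thesis unfolding T_def using c by (simp add: field_simps)
  qed
  moreover have "max A B / c \<ge> 0" using A c by simp
  ultimately show ?thesis using that by blast
qed

end

context defining_function
begin

text \<open>The field \<open>d * Y\<close> vanishes on the boundary and has divergence one up to
  terms with \<open>d\<close>. Integrating \<open>q\<^sup>2\<close> times this divergence by parts
  bounds \<open>q\<close> by its gradient and by \<open>d * q\<close>, which is small near the
  boundary.\<close>

lemma interior_control:
  obtains C where "C \<ge> 0" "\<And>q H. H1 q H \<Longrightarrow>
    (\<integral>x. (q x)\<^sup>2 \<partial>M) \<le> C * ((\<integral>x. (d x)\<^sup>2 * (q x)\<^sup>2 \<partial>M) + (\<integral>x. (\<Sum>i\<in>UNIV. (H i x)\<^sup>2) \<partial>M))"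
proof -
  obtain B where B: "B > 0" "\<And>j x. x \<in> \<Omega> \<Longrightarrow> \<bar>d x * Y j x\<bar> \<le> B * d x" by (rule dY_bound) (rule that; assumption)
  obtain c where c: "c > 0" "\<And>x. x \<in> \<Omega> \<Longrightarrow> c \<le> Q x" by (rule Q_lower) (rule that; assumption)
  have dc: "continuous_on UNIV d" by (rule C_k_continuous[OF d_C3])
  define dY where "dY x = (\<Sum>i\<in>UNIV. pderiv_at i (Y i) x)" for x
  have dYc: "continuous_on UNIV dY" unfolding dY_def using Y_C1 by (intro continuous_on_sum) simp
  obtain B1 where B1: "B1 > 0" "\<And>x. x \<in> closure \<Omega> \<Longrightarrow> \<bar>dY x\<bar> \<le> B1" by (rule continuous_bounded[OF dYc]) (rule that; assumption)
  obtain D where D: "D > 0" "\<And>x. x \<in> closure \<Omega> \<Longrightarrow> \<bar>d x\<bar> \<le> D" by (rule continuous_bounded[OF dc]) (rule that; assumption)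
  define n where "n = real CARD('n)"
  define A where "A = 2 * (1 / c + B1\<^sup>2)"
  define G where "G = 8 * n * (B * D)\<^sup>2"
  have n: "n > 0" by (simp add: n_def)
  have AG: "A \<ge> 0" "G \<ge> 0" using c n by (auto simp: A_def G_def)
  have "(\<integral>x. (q x)\<^sup>2 \<partial>M) \<le> max A G * ((\<integral>x. (d x)\<^sup>2 * (q x)\<^sup>2 \<partial>M) + (\<integral>x. (\<Sum>i\<in>UNIV. (H i x)\<^sup>2) \<partial>M))"
    if q: "H1 q H" for q H
  proof -
    note qs = H1_sq(1)[OF q] and Hs = H1_sq(2)[OF q]
    define T where "T x = (\<Sum>i\<in>UNIV. (H i x)\<^sup>2)" for x
    have T0: "T x \<ge> 0" for x by (simp add: T_def sum_nonneg)
    have Ti: "integrable M T" unfolding T_def[abs_def] by (intro Bochner_Integration.integrable_sum sq_integrable_square Hs)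
    define a where "a i x = N i x * Y i x + d x * pderiv_at i (Y i) x" for i x
    define b where "b i x = d x * Y i x" for i x
    have bC: "C_k (Suc 0) (b i)" for i unfolding b_def[abs_def] by (rule dY_C1)
    have bp: "pderiv_at i (b i) x = a i x" for i x unfolding b_def[abs_def] a_def by (rule dY_deriv)
    have ac: "continuous_on UNIV (a i)" for i
    proof -
      have "continuous_on UNIV (pderiv_at i (b i))" using bC[of i] by simp
      moreover have "pderiv_at i (b i) = a i" using bp by blast
      ultimately show ?thesis by simp
    qed
    have bc: "continuous_on UNIV (b i)" for i by (rule C_k_continuous[OF bC])
    have i1: "integrable M (\<lambda>x. a i x * (q x)\<^sup>2)" "integrable M (\<lambda>x. b i x * (H i x * q x))" for i
      by (intro continuous_mult_integrable ac bc sq_integrable_square sq_integrable_mult qs Hs)+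
    define P where "P x = (\<Sum>i\<in>UNIV. a i x * (q x)\<^sup>2 + 2 * (b i x * (H i x * q x)))" for x
    have Pi: "integrable M P" unfolding P_def
      by (intro Bochner_Integration.integrable_sum Bochner_Integration.integrable_add integrable_mult_right i1)
    have P0: "(\<integral>x. P x \<partial>M) = 0"
    proof -
      have "(\<integral>x. a i x * (q x)\<^sup>2 + 2 * (b i x * (H i x * q x)) \<partial>M) = 0" for i
      proof -
        have z: "zero_trace (\<lambda>x. b i x * q x)"
          using zero_trace_d_mult[OF H1_mult[OF q Y_C1[of i]]] unfolding b_def by (simp only: mult.assoc)
        have "(\<integral>x. b i x * q x * H i x \<partial>M) = - (\<integral>x. (b i x * H i x + pderiv_at i (b i) x * q x) * q x \<partial>M)"
          by (rule zero_traceD[OF z H1_mult[OF q bC] q])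
        moreover have "(\<integral>x. (b i x * H i x + pderiv_at i (b i) x * q x) * q x \<partial>M)
          = (\<integral>x. a i x * (q x)\<^sup>2 \<partial>M) + (\<integral>x. b i x * (H i x * q x) \<partial>M)"
          unfolding bp by (subst Bochner_Integration.integral_add[OF i1, symmetric]) (simp add: algebra_simps power2_eq_square)
        moreover have "(\<integral>x. b i x * q x * H i x \<partial>M) = (\<integral>x. b i x * (H i x * q x) \<partial>M)" by (simp add: algebra_simps)
        ultimately show ?thesis using i1 by simp
      qed
      then show ?thesis unfolding P_def using i1 by (subst Bochner_Integration.integral_sum) auto
    qed
    have di: "integrable M (\<lambda>x. (d x)\<^sup>2 * (q x)\<^sup>2)"
      by (intro continuous_mult_integrable continuous_on_power dc sq_integrable_square qs)
    have pt: "(q x)\<^sup>2 \<le> 2 * P x + A * ((d x)\<^sup>2 * (q x)\<^sup>2) + G * T x" if x: "x \<in> \<Omega>" for x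
    proof -
      define S where "S = (\<Sum>i\<in>UNIV. b i x * H i x)"
      have cl: "x \<in> closure \<Omega>" using x closure_subset by blast
      have "P x = (\<Sum>i\<in>UNIV. a i x) * (q x)\<^sup>2 + 2 * (S * q x)"
        unfolding P_def S_def sum.distrib sum_distrib_right sum_distrib_left by (simp add: mult.assoc)
      also have "(\<Sum>i\<in>UNIV. a i x) = (\<Sum>i\<in>UNIV. N i x * Y i x) + d x * dY x"
        by (simp add: a_def dY_def sum.distrib sum_distrib_left)
      finally have "P x = ((\<Sum>i\<in>UNIV. N i x * Y i x) + d x * dY x) * (q x)\<^sup>2 + 2 * (S * q x)" .
      then have Pe: "P x = (q x)\<^sup>2 - (d x)\<^sup>2 / Q x * (q x)\<^sup>2 + d x * dY x * (q x)\<^sup>2 + 2 * (S * q x)"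
        unfolding NY_sum[OF x] by (simp add: algebra_simps)
      have 1: "(d x)\<^sup>2 / Q x * (q x)\<^sup>2 \<le> (1 / c) * ((d x)\<^sup>2 * (q x)\<^sup>2)"
      proof -
        have "(d x)\<^sup>2 / Q x \<le> (d x)\<^sup>2 / c" using c(1) c(2)[OF x] by (intro divide_left_mono) auto
        then have "(d x)\<^sup>2 / Q x * (q x)\<^sup>2 \<le> (d x)\<^sup>2 / c * (q x)\<^sup>2" by (intro mult_right_mono) auto
        then show ?thesis by simp
      qed
      have 2: "- (d x * dY x * (q x)\<^sup>2) \<le> (1 / 4) * (q x)\<^sup>2 + B1\<^sup>2 * ((d x)\<^sup>2 * (q x)\<^sup>2)"
      proof -
        have "\<bar>d x * dY x\<bar> \<le> d x * B1" using B1(2)[OF cl] d_pos[OF x] by (simp add: abs_mult)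
        then have "- (d x * dY x) \<le> d x * B1" by linarith
        also have "\<dots> \<le> 1 / 4 + B1\<^sup>2 * (d x)\<^sup>2"
        proof -
          have "0 \<le> (1 / 2 - d x * B1)\<^sup>2" by simp
          then show ?thesis by (simp add: power2_diff power_mult_distrib algebra_simps power2_eq_square[of "1/2 :: real"])
        qed
        finally have "- (d x * dY x) * (q x)\<^sup>2 \<le> (1 / 4 + B1\<^sup>2 * (d x)\<^sup>2) * (q x)\<^sup>2" by (intro mult_right_mono) auto
        then show ?thesis by (simp add: algebra_simps)
      qed
      have 3: "- (2 * (S * q x)) \<le> (1 / 4) * (q x)\<^sup>2 + 4 * S\<^sup>2"
      proof -
        have "0 \<le> (q x / 2 + 2 * S)\<^sup>2" by simp
        then show ?thesis by (simp add: power2_sum power2_eq_square algebra_simps)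
      qed
      have 4: "4 * S\<^sup>2 \<le> (G / 2) * T x"
      proof -
        have "S\<^sup>2 \<le> (\<Sum>i\<in>UNIV. (b i x)\<^sup>2) * T x" unfolding S_def T_def by (rule Cauchy_Schwarz_ineq_sum)
        also have "\<dots> \<le> (n * (B * D)\<^sup>2) * T x"
        proof (intro mult_right_mono T0)
          have "(b i x)\<^sup>2 \<le> (B * D)\<^sup>2" for i
          proof -
            have "B * d x \<le> B * D" using D(2)[OF cl] B(1) by (intro mult_left_mono) auto
            then have "\<bar>b i x\<bar> \<le> \<bar>B * D\<bar>" using B(2)[OF x, of i] unfolding b_def by linarith
            then show ?thesis by (simp add: abs_le_square_iff)
          qed
          then have "(\<Sum>i\<in>UNIV. (b i x)\<^sup>2) \<le> (\<Sum>i\<in>(UNIV::'n set). (B * D)\<^sup>2)" by (intro sum_mono)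
          then show "(\<Sum>i\<in>UNIV. (b i x)\<^sup>2) \<le> n * (B * D)\<^sup>2" by (simp add: n_def)
        qed
        finally show ?thesis by (simp add: G_def)
      qed
      have "(q x)\<^sup>2 / 2 \<le> P x + (1 / c + B1\<^sup>2) * ((d x)\<^sup>2 * (q x)\<^sup>2) + (G / 2) * T x"
        using 1 2 3 4 unfolding Pe distrib_right[of "1 / c"] by linarith
      then show ?thesis unfolding A_def mult.assoc by linarith
    qed
    have "(\<integral>x. (q x)\<^sup>2 \<partial>M) \<le> (\<integral>x. 2 * P x + A * ((d x)\<^sup>2 * (q x)\<^sup>2) + G * T x \<partial>M)"
      using pt by (intro integral_mono sq_integrable_square qs Bochner_Integration.integrable_add integrable_mult_right Pi di Ti) auto
    also have "\<dots> = A * (\<integral>x. (d x)\<^sup>2 * (q x)\<^sup>2 \<partial>M) + G * (\<integral>x. T x \<partial>M)"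
      using Pi di Ti P0 by simp
    also have "\<dots> \<le> max A G * (\<integral>x. (d x)\<^sup>2 * (q x)\<^sup>2 \<partial>M) + max A G * (\<integral>x. T x \<partial>M)"
      using T0 by (intro add_mono mult_right_mono integral_nonneg_AE) auto
    finally show ?thesis unfolding T_def by (simp add: distrib_left)
  qed
  moreover have "max A G \<ge> 0" using AG by simp
  ultimately show ?thesis using that by blast
qed

end

section \<open>Convergence from convergence of gradients\<close>

text \<open>An arbitrary quantity with two indices instead of a metric: squared local seminorms can
  then be compared, added and summed over a cover.\<close>

definition Cauchy_kernel :: "(nat \<Rightarrow> nat \<Rightarrow> real) \<Rightarrow> bool" where
  "Cauchy_kernel X \<longleftrightarrow> (\<forall>e>0. \<exists>N. \<forall>m\<ge>N. \<forall>n\<ge>N. X m n < e)"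

lemma Cauchy_kernel_le:
  assumes "Cauchy_kernel X" "\<And>m n. Y m n \<le> C * X m n" "\<And>m n. 0 \<le> X m n" "0 \<le> C"
  shows "Cauchy_kernel Y"
  unfolding Cauchy_kernel_def
proof (intro allI impI)
  fix e :: real assume e: "e > 0"
  have "e / (C + 1) > 0" using e assms(4) by simp
  then obtain N where N: "\<And>m n. m \<ge> N \<Longrightarrow> n \<ge> N \<Longrightarrow> X m n < e / (C + 1)"
    using assms(1) unfolding Cauchy_kernel_def by meson
  have "Y m n < e" if "m \<ge> N" "n \<ge> N" for m n
  proof -
    have "Y m n \<le> (C + 1) * X m n" using assms(2)[of m n] assms(3)[of m n] by (simp add: distrib_right)
    also have "\<dots> < (C + 1) * (e / (C + 1))" using N[OF that] assms(4) by (intro mult_strict_left_mono) auto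
    also have "\<dots> = e" using assms(4) by simp
    finally show ?thesis .
  qed
  then show "\<exists>N. \<forall>m\<ge>N. \<forall>n\<ge>N. Y m n < e" by blast
qed

lemma Cauchy_kernel_add:
  assumes "Cauchy_kernel X" "Cauchy_kernel Y" shows "Cauchy_kernel (\<lambda>m n. X m n + Y m n)"
  unfolding Cauchy_kernel_def
proof (intro allI impI)
  fix e :: real assume e: "e > 0"
  obtain N1 where N1: "\<And>m n. m \<ge> N1 \<Longrightarrow> n \<ge> N1 \<Longrightarrow> X m n < e / 2"
    using assms(1) e unfolding Cauchy_kernel_def by (meson half_gt_zero)
  obtain N2 where N2: "\<And>m n. m \<ge> N2 \<Longrightarrow> n \<ge> N2 \<Longrightarrow> Y m n < e / 2"
    using assms(2) e unfolding Cauchy_kernel_def by (meson half_gt_zero)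
  show "\<exists>N. \<forall>m\<ge>N. \<forall>n\<ge>N. X m n + Y m n < e"
    using N1 N2 by (intro exI[of _ "max N1 N2"]) (smt (verit) field_sum_of_halves max.bounded_iff)
qed

lemma Cauchy_kernel_sum:
  assumes "finite S" "\<And>a. a \<in> S \<Longrightarrow> Cauchy_kernel (X a)" shows "Cauchy_kernel (\<lambda>m n. \<Sum>a\<in>S. X a m n)"
  using assms
proof (induction S rule: finite_induct)
  case empty
  then show ?case by (simp add: Cauchy_kernel_def)
next
  case (insert a S)
  then show ?case by (simp add: Cauchy_kernel_add)
qed

context defining_function
begin

text \<open>The set \<open>W\<close> of points with a ball on which the sequence is Cauchy is open
  and, by \<open>ball_enlarge\<close>, relatively closed. Connectedness makes it the whole domain, a
  finite cover handles the compact set where \<open>d \<ge> s\<close>, and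
  \<open>interior_control\<close> absorbs the remaining boundary layer.\<close>

lemma gradient_limit:
  assumes conn: "connected \<Omega>" and q: "\<And>n. H1 (q n) (G n)"
    and G: "Cauchy_kernel (\<lambda>m n. \<integral>x. (\<Sum>i\<in>UNIV. (G m i x - G n i x)\<^sup>2) \<partial>M)"
    and r0: "r0 > 0" "cball z0 (3 * r0) \<subseteq> \<Omega>" and mean: "\<And>n. (\<integral>x. indicator (ball z0 r0) x * q n x \<partial>M) = 0"
  shows "\<exists>g. L2_lim M q g"
proof -
  define T where "T m n = (\<integral>x. (\<Sum>i\<in>UNIV. (G m i x - G n i x)\<^sup>2) \<partial>M)" for m n
  have T0: "T m n \<ge> 0" for m n unfolding T_def by (intro integral_nonneg_AE AE_I2 sum_nonneg) auto
  have TC: "Cauchy_kernel T" using G unfolding T_def[abs_def] .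
  have qd: "H1 (\<lambda>x. q m x - q n x) (\<lambda>i x. G m i x - G n i x)" for m n by (rule H1_diff[OF q q])
  note qs = H1_sq(1)[OF qd] and qs1 = H1_sq(1)[OF q]
  define X where "X A m n = (\<integral>x. indicator A x * (q m x - q n x)\<^sup>2 \<partial>M)" for A m n
  have X0: "X A m n \<ge> 0" for A m n unfolding X_def by (intro integral_nonneg_AE AE_I2) (auto simp: indicator_def)
  have Xi: "integrable M (\<lambda>x. indicator A x * (q m x - q n x)\<^sup>2)" if "A \<in> sets borel" for A m n
    by (intro indicator_mult_integrable that sq_integrable_square qs)
  have mono: "Cauchy_kernel (X A)" if "Cauchy_kernel (X B)" "A \<subseteq> B" "A \<in> sets borel" "B \<in> sets borel" for A B
  proof (rule Cauchy_kernel_le[OF that(1), of _ 1])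
    show "X A m n \<le> 1 * X B m n" for m n
      unfolding X_def mult_1 using that(2) by (intro integral_mono Xi that) (auto simp: indicator_def)
  qed (use X0 in auto)
  define W where "W = {x \<in> \<Omega>. \<exists>s>0. ball x s \<subseteq> \<Omega> \<and> Cauchy_kernel (X (ball x s))}"
  have start: "Cauchy_kernel (X (ball z0 r0))"
  proof -
    obtain C where C: "C \<ge> 0" "\<And>q H. H1 q H \<Longrightarrow> (\<integral>x. indicator (ball z0 r0) x * q x \<partial>M) = 0 \<Longrightarrow>
      (\<integral>x. indicator (ball z0 r0) x * (q x)\<^sup>2 \<partial>M) \<le> C * (\<integral>x. (\<Sum>i\<in>UNIV. (H i x)\<^sup>2) \<partial>M)"
      by (rule ball_poincare[OF r0]) (rule that; assumption)
    show ?thesis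
    proof (rule Cauchy_kernel_le[OF TC])
      fix m n
      have "integrable M (\<lambda>x. indicator (ball z0 r0) x * q n x)" for n
        by (intro indicator_mult_integrable fm.sq_integrable_integrable qs1) simp
      then have "(\<integral>x. indicator (ball z0 r0) x * (q m x - q n x) \<partial>M) = 0"
        using mean by (simp add: right_diff_distrib)
      from C(2)[OF qd this] show "X (ball z0 r0) m n \<le> C * T m n" unfolding X_def T_def .
    qed (use T0 C in auto)
  qed
  have "openin (top_of_set \<Omega>) W"
  proof -
    have "open W" unfolding open_contains_ball
    proof
      fix x assume "x \<in> W"
      then obtain s where s: "s > 0" "ball x s \<subseteq> \<Omega>" "Cauchy_kernel (X (ball x s))" by (auto simp: W_def)
      have "ball x s \<subseteq> W"
      proof
        fix y assume y: "y \<in> ball x s"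
        define t where "t = s - dist x y"
        have t: "t > 0" using y by (simp add: t_def)
        have sub: "ball y t \<subseteq> ball x s"
        proof
          fix w assume "w \<in> ball y t"
          then show "w \<in> ball x s" using dist_triangle[of x w y] by (simp add: t_def)
        qed
        have "Cauchy_kernel (X (ball y t))" by (rule mono[OF s(3) sub]) auto
        then show "y \<in> W" unfolding W_def using t sub s(2) y by blast
      qed
      then show "\<exists>e>0. ball x e \<subseteq> W" using s(1) by blast
    qed
    moreover have "W \<subseteq> \<Omega>" by (auto simp: W_def)
    ultimately show ?thesis using open_domain by (simp add: openin_open_eq)
  qed
  \<comment> \<open>The radius \<open>R\<close> depends on the limit point \<open>x\<close> only. A
    possibly tiny good ball at a nearby \<open>y\<close> is enlarged to radius \<open>2 * R\<close>,
    which covers \<open>ball x R\<close>.\<close>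
  moreover have "closedin (top_of_set \<Omega>) W"
    unfolding closedin_limpt
  proof (intro conjI allI impI)
    show "W \<subseteq> \<Omega>" by (auto simp: W_def)
    fix x assume x: "x islimpt W \<and> x \<in> \<Omega>"
    obtain R where R: "R > 0" "ball x (4 * R) \<subseteq> \<Omega>"
    proof -
      obtain e where "e > 0" "ball x e \<subseteq> \<Omega>" using x open_domain open_contains_ball by blast
      then show ?thesis using that[of "e / 4"] by simp
    qed
    obtain y where y: "y \<in> W" "y \<noteq> x" "dist y x < R" using x R(1) unfolding islimpt_approachable by blast
    obtain s where s: "s > 0" "ball y s \<subseteq> \<Omega>" "Cauchy_kernel (X (ball y s))" using y(1) by (auto simp: W_def)
    have b: "cball y (3 * R) \<subseteq> \<Omega>"
    proof
      fix w assume "w \<in> cball y (3 * R)"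
      then have "dist x w < 4 * R" using dist_triangle[of x w y] y(3) by (simp add: dist_commute)
      then show "w \<in> \<Omega>" using R(2) by auto
    qed
    have R2: "0 < 2 * R" "2 * R < 3 * R" using R(1) by auto
    obtain C where C: "C \<ge> 0" "\<And>q H. H1 q H \<Longrightarrow>
      (\<integral>x. indicator (ball y (2 * R)) x * (q x)\<^sup>2 \<partial>M) \<le> C * ((\<integral>x. indicator (ball y s) x * (q x)\<^sup>2 \<partial>M) + (\<integral>x. (\<Sum>i\<in>UNIV. (H i x)\<^sup>2) \<partial>M))"
      by (rule ball_enlarge[OF s(1) R2 b]) (rule that; assumption)
    have "Cauchy_kernel (X (ball y (2 * R)))"
    proof (rule Cauchy_kernel_le[OF Cauchy_kernel_add[OF s(3) TC]])
      show "X (ball y (2 * R)) m n \<le> C * (X (ball y s) m n + T m n)" for m n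
        using C(2)[OF qd[of m n]] unfolding X_def T_def .
    qed (use X0 T0 C in auto)
    moreover have "ball x R \<subseteq> ball y (2 * R)"
    proof
      fix w assume "w \<in> ball x R"
      then show "w \<in> ball y (2 * R)" using dist_triangle[of y w x] y(3) by simp
    qed
    ultimately have "Cauchy_kernel (X (ball x R))" by (intro mono[of "ball y (2 * R)" "ball x R"]) auto
    moreover have "ball x R \<subseteq> \<Omega>" using R by auto
    ultimately show "x \<in> W" using x R(1) by (auto simp: W_def)
  qed
  moreover have "W \<noteq> {}"
  proof -
    have "z0 \<in> \<Omega>" "ball z0 r0 \<subseteq> \<Omega>" using r0 by (auto simp: subset_iff)
    then show ?thesis using start r0(1) by (auto simp: W_def)
  qed
  ultimately have W: "W = \<Omega>" using conn by (auto simp: connected_clopen)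
  then have "\<forall>x\<in>\<Omega>. \<exists>s>0. ball x s \<subseteq> \<Omega> \<and> Cauchy_kernel (X (ball x s))" by (auto simp: W_def)
  then obtain \<rho> where \<rho>: "\<And>x. x \<in> \<Omega> \<Longrightarrow> \<rho> x > 0" "\<And>x. x \<in> \<Omega> \<Longrightarrow> Cauchy_kernel (X (ball x (\<rho> x)))" by metis
  obtain C where C: "C \<ge> 0" "\<And>q H. H1 q H \<Longrightarrow>
    (\<integral>x. (q x)\<^sup>2 \<partial>M) \<le> C * ((\<integral>x. (d x)\<^sup>2 * (q x)\<^sup>2 \<partial>M) + (\<integral>x. (\<Sum>i\<in>UNIV. (H i x)\<^sup>2) \<partial>M))"
    by (rule interior_control) (rule that; assumption)
  have dc: "continuous_on UNIV d" by (rule C_k_continuous[OF d_C3])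
  obtain D where D: "D > 0" "\<And>x. x \<in> closure \<Omega> \<Longrightarrow> \<bar>d x\<bar> \<le> D" by (rule continuous_bounded[OF dc]) (rule that; assumption)
  \<comment> \<open>Chosen so that \<open>C * s\<^sup>2 \<le> 1 / 2\<close>, which allows absorption
    where \<open>d < s\<close>; \<open>C + 1\<close> avoids dividing by zero.\<close>
  define s where "s = sqrt (1 / (2 * (C + 1)))"
  have s: "s > 0" "C * s\<^sup>2 \<le> 1 / 2" using C(1) by (auto simp: s_def field_simps)
  define K where "K = closure \<Omega> \<inter> {x. s \<le> d x}"
  have Kc: "compact K" unfolding K_def using bounded_domain
    by (intro compact_Int_closed closed_Collect_le continuous_intros dc) auto
  have KO: "K \<subseteq> \<Omega>" using s(1) by (auto simp: K_def domain_eq)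
  have Kb: "K \<in> sets borel" using Kc by (intro borel_closed compact_imp_closed)
  have KX: "Cauchy_kernel (X K)"
  proof -
    obtain S where S: "S \<subseteq> K" "finite S" "K \<subseteq> (\<Union>x\<in>S. ball x (\<rho> x))"
    proof (rule compactE_image[OF Kc, of K "\<lambda>x. ball x (\<rho> x)"])
      show "K \<subseteq> (\<Union>x\<in>K. ball x (\<rho> x))" using \<rho>(1) KO by force
    qed auto
    have "Cauchy_kernel (\<lambda>m n. \<Sum>x\<in>S. X (ball x (\<rho> x)) m n)"
      using S KO \<rho>(2) by (intro Cauchy_kernel_sum) auto
    then show ?thesis
    proof (rule Cauchy_kernel_le[where C=1])
      fix m n
      have "X K m n \<le> (\<integral>x. (\<Sum>y\<in>S. indicator (ball y (\<rho> y)) x * (q m x - q n x)\<^sup>2) \<partial>M)"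
        unfolding X_def
      proof (intro integral_mono Xi Kb Bochner_Integration.integrable_sum)
        fix x
        have "indicator K x \<le> (\<Sum>y\<in>S. indicator (ball y (\<rho> y)) x :: real)"
        proof (cases "x \<in> K")
          case True
          then obtain y where y: "y \<in> S" "x \<in> ball y (\<rho> y)" using S(3) by blast
          have "indicator (ball y (\<rho> y)) x \<le> (\<Sum>y\<in>S. indicator (ball y (\<rho> y)) x :: real)"
            by (rule member_le_sum[OF y(1)]) (use S(2) in auto)
          then show ?thesis using True y(2) by simp
        qed (simp add: sum_nonneg)
        then have "indicator K x * (q m x - q n x)\<^sup>2 \<le> (\<Sum>y\<in>S. indicator (ball y (\<rho> y)) x) * (q m x - q n x)\<^sup>2"
          by (intro mult_right_mono) auto
        then show "indicator K x * (q m x - q n x)\<^sup>2 \<le> (\<Sum>y\<in>S. indicator (ball y (\<rho> y)) x * (q m x - q n x)\<^sup>2)"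
          by (simp add: sum_distrib_right)
      qed simp
      also have "\<dots> = 1 * (\<Sum>x\<in>S. X (ball x (\<rho> x)) m n)"
        unfolding X_def mult_1 by (intro Bochner_Integration.integral_sum Xi) simp
      finally show "X K m n \<le> 1 * (\<Sum>x\<in>S. X (ball x (\<rho> x)) m n)" .
    qed (use X0 in \<open>auto intro: sum_nonneg\<close>)
  qed
  have fin: "(\<integral>x. (q m x - q n x)\<^sup>2 \<partial>M) \<le> (2 * C * max 1 (D\<^sup>2)) * (X K m n + T m n)" for m n
  proof -
    define f where "f x = q m x - q n x" for x
    have fi: "integrable M (\<lambda>x. (f x)\<^sup>2)" unfolding f_def by (intro sq_integrable_square qs)
    have "(\<integral>x. (d x)\<^sup>2 * (f x)\<^sup>2 \<partial>M) \<le> (\<integral>x. s\<^sup>2 * (f x)\<^sup>2 + D\<^sup>2 * (indicator K x * (f x)\<^sup>2) \<partial>M)"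
    proof (rule integral_mono)
      show "integrable M (\<lambda>x. (d x)\<^sup>2 * (f x)\<^sup>2)" by (intro continuous_mult_integrable continuous_on_power dc fi)
      show "integrable M (\<lambda>x. s\<^sup>2 * (f x)\<^sup>2 + D\<^sup>2 * (indicator K x * (f x)\<^sup>2))"
        by (intro Bochner_Integration.integrable_add integrable_mult_right fi indicator_mult_integrable Kb)
      fix x assume "x \<in> space M"
      then have x: "x \<in> \<Omega>" "x \<in> closure \<Omega>" using closure_subset[of \<Omega>] by auto
      have "(d x)\<^sup>2 \<le> s\<^sup>2 + D\<^sup>2 * indicator K x"
      proof (cases "x \<in> K")
        case True
        have "(d x)\<^sup>2 \<le> D\<^sup>2" using D(2)[OF x(2)] D(1) abs_le_square_iff[of "d x" D] by simp
        then show ?thesis using True by (simp add: add_increasing)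
      next
        case False
        then have "d x \<le> s" using x(2) by (simp add: K_def)
        then show ?thesis using False d_pos[OF x(1)] by (simp add: power_mono)
      qed
      then have "(d x)\<^sup>2 * (f x)\<^sup>2 \<le> (s\<^sup>2 + D\<^sup>2 * indicator K x) * (f x)\<^sup>2" by (intro mult_right_mono) auto
      then show "(d x)\<^sup>2 * (f x)\<^sup>2 \<le> s\<^sup>2 * (f x)\<^sup>2 + D\<^sup>2 * (indicator K x * (f x)\<^sup>2)" by (simp add: algebra_simps)
    qed
    also have "\<dots> = s\<^sup>2 * (\<integral>x. (f x)\<^sup>2 \<partial>M) + D\<^sup>2 * X K m n"
      using fi Xi[OF Kb, of m n] by (simp add: X_def f_def)
    finally have 1: "(\<integral>x. (d x)\<^sup>2 * (f x)\<^sup>2 \<partial>M) \<le> s\<^sup>2 * (\<integral>x. (f x)\<^sup>2 \<partial>M) + D\<^sup>2 * X K m n" .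
    have F0: "0 \<le> (\<integral>x. (f x)\<^sup>2 \<partial>M)" by (intro integral_nonneg_AE) auto
    have "(\<integral>x. (f x)\<^sup>2 \<partial>M) \<le> C * ((\<integral>x. (d x)\<^sup>2 * (f x)\<^sup>2 \<partial>M) + T m n)"
      using C(2)[OF qd[of m n]] unfolding f_def T_def .
    also have "\<dots> \<le> C * ((s\<^sup>2 * (\<integral>x. (f x)\<^sup>2 \<partial>M) + D\<^sup>2 * X K m n) + T m n)"
      using C(1) 1 by (intro mult_left_mono add_right_mono) auto
    also have "\<dots> = (C * s\<^sup>2) * (\<integral>x. (f x)\<^sup>2 \<partial>M) + C * (D\<^sup>2 * X K m n + 1 * T m n)" by (simp add: algebra_simps)
    also have "\<dots> \<le> (1 / 2) * (\<integral>x. (f x)\<^sup>2 \<partial>M) + C * (max 1 (D\<^sup>2) * X K m n + max 1 (D\<^sup>2) * T m n)"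
      using C(1) s(2) F0 X0 T0 by (intro add_mono mult_right_mono mult_left_mono) auto
    finally show ?thesis unfolding f_def by (simp add: algebra_simps)
  qed
  have "Cauchy_kernel (\<lambda>m n. \<integral>x. (q m x - q n x)\<^sup>2 \<partial>M)"
    by (rule Cauchy_kernel_le[OF Cauchy_kernel_add[OF KX TC] fin]) (use X0 T0 C in auto)
  then have cau: "\<exists>N. \<forall>m\<ge>N. \<forall>n\<ge>N. nrm2 M (\<lambda>x. q m x - q n x) < e" if "e > 0" for e
  proof -
    have e2: "e\<^sup>2 > 0" using that by simp
    obtain N where N: "\<forall>m\<ge>N. \<forall>n\<ge>N. (\<integral>x. (q m x - q n x)\<^sup>2 \<partial>M) < e\<^sup>2"
      using \<open>Cauchy_kernel (\<lambda>m n. \<integral>x. (q m x - q n x)\<^sup>2 \<partial>M)\<close> e2 unfolding Cauchy_kernel_def by meson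
    have "nrm2 M (\<lambda>x. q m x - q n x) < e" if "m \<ge> N" "n \<ge> N" for m n
      using N that \<open>e > 0\<close> unfolding nrm2_def by (intro real_less_lsqrt) auto
    then show ?thesis by blast
  qed
  show ?thesis by (rule fm.L2_complete[OF qs1 cau])
qed

end

context bounded_open
begin

lemma H1_limit:
  assumes q: "\<And>n. H1 (q n) (G n)" and l: "L2_lim M q g" "\<And>i. L2_lim M (\<lambda>n. G n i) (F i)"
  shows "H1 g F"
  unfolding H1_def wd_def
proof (intro allI conjI ballI)
  show "sq_integrable M g" "sq_integrable M (F i)" for i using l by (auto simp: L2_lim_def)
  fix i \<phi> assume t: "\<phi> \<in> test_functions \<Omega>"
  have "(\<lambda>n. \<integral>x. q n x * pderiv_at i \<phi> x \<partial>M) \<longlonglongrightarrow> (\<integral>x. g x * pderiv_at i \<phi> x \<partial>M)"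
    by (intro L2_lim_product_const l test_sq[OF test_functions_pderiv[OF t]])
  moreover have "(\<lambda>n. - (\<integral>x. G n i x * \<phi> x \<partial>M)) \<longlonglongrightarrow> - (\<integral>x. F i x * \<phi> x \<partial>M)"
    by (intro tendsto_minus L2_lim_product_const l test_sq[OF t])
  moreover have "(\<integral>x. q n x * pderiv_at i \<phi> x \<partial>M) = - (\<integral>x. G n i x * \<phi> x \<partial>M)" for n
    by (rule wdD(3)[OF H1_wd[OF q] t])
  ultimately show "(\<integral>x. g x * pderiv_at i \<phi> x \<partial>M) = - (\<integral>x. F i x * \<phi> x \<partial>M)"
    using LIMSEQ_unique by simp
qed

end

context defining_function
begin

section \<open>Projection onto gradients\<close>

text \<open>The space of gradients is not known to be closed beforehand;
  \<open>gradient_limit\<close> is what shows that the limit of the minimising gradients is again a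
  gradient. Orthogonality is the Euler-Lagrange equation of \<open>J\<close>.\<close>

theorem helmholtz_decomposition:
  assumes conn: "connected \<Omega>" and ne: "\<Omega> \<noteq> {}" and F: "\<And>j. sq_integrable M (F j)"
  obtains g G where "H1 g G" "\<And>\<phi> \<Phi>. H1 \<phi> \<Phi> \<Longrightarrow> (\<Sum>j\<in>UNIV. \<integral>x. (F j x - G j x) * \<Phi> j x \<partial>M) = 0"
proof -
  define J where "J H = (\<integral>x. (\<Sum>j\<in>UNIV. (F j x - H j x)\<^sup>2) \<partial>M)" for H :: "'n \<Rightarrow> real^'n \<Rightarrow> real"
  have J0: "J H \<ge> 0" for H unfolding J_def by (intro integral_nonneg_AE AE_I2 sum_nonneg) auto
  define S where "S = {J H | H q. H1 q H}"
  have S: "S \<noteq> {}" "bdd_below S" unfolding S_def using H1_0 J0 by (auto intro!: bdd_belowI[of _ 0])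
  define m where "m = Inf S"
  have mle: "m \<le> J H" if "H1 q H" for q H unfolding m_def using that S(2) by (intro cInf_lower) (auto simp: S_def)
  have "\<exists>q H. H1 q H \<and> J H < m + inverse (real (Suc n))" for n
  proof -
    have "\<exists>x\<in>S. x < m + inverse (real (Suc n))"
      using S unfolding m_def by (subst cInf_less_iff[symmetric]) auto
    then show ?thesis unfolding S_def by blast
  qed
  then obtain q0 H where q0: "\<And>n. H1 (q0 n) (H n)" "\<And>n. J (H n) < m + inverse (real (Suc n))" by metis
  note Hs = H1_sq(2)[OF q0(1)]
  obtain z0 where z0: "z0 \<in> \<Omega>" using ne by blast
  obtain e0 where e0: "e0 > 0" "ball z0 e0 \<subseteq> \<Omega>" using z0 open_domain open_contains_ball by blast
  define r0 where "r0 = e0 / 6"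
  have r0: "r0 > 0" "cball z0 (3 * r0) \<subseteq> \<Omega>" using e0 by (auto simp: r0_def subset_iff)
  have V: "measure M (ball z0 r0) > 0"
  proof -
    have sub: "ball z0 r0 \<subseteq> \<Omega>" using r0 by (auto simp: subset_iff)
    have "measure M (ball z0 r0) = measure lebesgue (ball z0 r0)" using sub by (intro measure_restrict_space) auto
    then show ?thesis using content_ball_pos[OF r0(1), of z0] by simp
  qed
  \<comment> \<open>\<open>J\<close> does not see additive constants, so the potentials could drift;
    subtracting the mean over a fixed ball prevents this and leaves the gradients unchanged.\<close>
  define a where "a n = (\<integral>x. indicator (ball z0 r0) x * q0 n x \<partial>M) / measure M (ball z0 r0)" for n
  define q where "q n x = q0 n x - a n" for n x
  have q: "H1 (q n) (H n)" for n
  proof -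
    have "H1 (\<lambda>x. q0 n x - a n) (\<lambda>i x. H n i x - pderiv_at i (\<lambda>_. a n) x)"
      by (rule H1_diff[OF q0(1) H1_classical[OF C_k_const]])
    then show ?thesis unfolding q_def[abs_def] by simp
  qed
  have mean: "(\<integral>x. indicator (ball z0 r0) x * q n x \<partial>M) = 0" for n
  proof -
    have bm: "ball z0 r0 \<inter> \<Omega> = ball z0 r0" using r0 by (auto simp: subset_iff)
    have i1: "integrable M (\<lambda>x. indicator (ball z0 r0) x * q0 n x)"
      by (intro indicator_mult_integrable fm.sq_integrable_integrable H1_sq[OF q0(1)]) simp
    have i2: "integrable M (\<lambda>x. indicator (ball z0 r0) x * a n)"
      by (intro indicator_mult_integrable fm.integrable_const) simp
    have "(\<integral>x. indicator (ball z0 r0) x * a n \<partial>M) = measure M (ball z0 r0) * a n"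
      by (simp add: bm)
    then have "(\<integral>x. indicator (ball z0 r0) x * q n x \<partial>M) = (\<integral>x. indicator (ball z0 r0) x * q0 n x \<partial>M) - measure M (ball z0 r0) * a n"
      using i1 i2 by (simp add: q_def right_diff_distrib)
    then show ?thesis using V by (simp add: a_def)
  qed
  \<comment> \<open>Parallelogram identity: the midpoint of two gradients is again a gradient, so
    \<open>J\<close> is at least \<open>m\<close> there.\<close>
  have par: "(\<integral>x. (\<Sum>i\<in>UNIV. (H k i x - H n i x)\<^sup>2) \<partial>M) \<le> 2 * inverse (real (Suc k)) + 2 * inverse (real (Suc n))" for k n
  proof -
    define A where "A i x = (1 / 2) * (H k i x + H n i x)" for i x
    have "H1 (\<lambda>x. (1 / 2) * (q0 k x + q0 n x)) A" unfolding A_def[abs_def] by (intro H1_cmult H1_add q0(1))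
    then have mA: "m \<le> J A" by (rule mle)
    have As: "sq_integrable M (A i)" for i unfolding A_def[abs_def] by (intro sq_integrable_cmult sq_integrable_add Hs)
    have ii: "integrable M (\<lambda>x. \<Sum>i\<in>UNIV. (F i x - K i x)\<^sup>2)" if "\<And>i. sq_integrable M (K i)" for K
      by (intro Bochner_Integration.integrable_sum sq_integrable_square sq_integrable_diff F that)
    have "(\<Sum>i\<in>UNIV. (H k i x - H n i x)\<^sup>2) = 2 * (\<Sum>i\<in>UNIV. (F i x - H k i x)\<^sup>2) + 2 * (\<Sum>i\<in>UNIV. (F i x - H n i x)\<^sup>2) - 4 * (\<Sum>i\<in>UNIV. (F i x - A i x)\<^sup>2)" for x
      unfolding sum_distrib_left sum.distrib[symmetric] sum_subtractf[symmetric]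
      by (intro sum.cong) (auto simp: A_def power2_eq_square field_simps)
    then have "(\<integral>x. (\<Sum>i\<in>UNIV. (H k i x - H n i x)\<^sup>2) \<partial>M) = 2 * J (H k) + 2 * J (H n) - 4 * J A"
      unfolding J_def using ii[OF Hs] ii[OF As] by simp
    then show ?thesis using mA q0(2)[of k] q0(2)[of n] by linarith
  qed
  have HC: "Cauchy_kernel (\<lambda>k n. \<integral>x. (\<Sum>i\<in>UNIV. (H k i x - H n i x)\<^sup>2) \<partial>M)"
    unfolding Cauchy_kernel_def
  proof (intro allI impI)
    fix e :: real assume e: "e > 0"
    obtain N where N: "inverse (real (Suc N)) < e / 4" using reals_Archimedean[of "e / 4"] e by auto
    have "(\<integral>x. (\<Sum>i\<in>UNIV. (H k i x - H n i x)\<^sup>2) \<partial>M) < e" if "k \<ge> N" "n \<ge> N" for k n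
    proof -
      have "inverse (real (Suc k)) \<le> inverse (real (Suc N))" "inverse (real (Suc n)) \<le> inverse (real (Suc N))"
        using that by (auto intro!: le_imp_inverse_le)
      then show ?thesis using par[of k n] N by linarith
    qed
    then show "\<exists>N. \<forall>k\<ge>N. \<forall>n\<ge>N. (\<integral>x. (\<Sum>i\<in>UNIV. (H k i x - H n i x)\<^sup>2) \<partial>M) < e" by blast
  qed
  obtain g where g: "L2_lim M q g" using gradient_limit[OF conn q HC r0 mean] by blast
  have "\<exists>Gi. L2_lim M (\<lambda>n. H n i) Gi" for i
  proof (rule fm.L2_complete[OF Hs])
    fix e :: real assume e: "e > 0"
    obtain N where N: "\<forall>k\<ge>N. \<forall>n\<ge>N. (\<integral>x. (\<Sum>i\<in>UNIV. (H k i x - H n i x)\<^sup>2) \<partial>M) < e\<^sup>2"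
      using HC e unfolding Cauchy_kernel_def by (meson zero_less_power)
    have "nrm2 M (\<lambda>x. H k i x - H n i x) < e" if "k \<ge> N" "n \<ge> N" for k n
    proof -
      have "(\<integral>x. (H k i x - H n i x)\<^sup>2 \<partial>M) \<le> (\<integral>x. (\<Sum>i\<in>UNIV. (H k i x - H n i x)\<^sup>2) \<partial>M)"
      proof (rule integral_mono)
        show "integrable M (\<lambda>x. (H k i x - H n i x)\<^sup>2)" by (intro sq_integrable_square sq_integrable_diff Hs)
        show "integrable M (\<lambda>x. \<Sum>i\<in>UNIV. (H k i x - H n i x)\<^sup>2)"
          by (intro Bochner_Integration.integrable_sum sq_integrable_square sq_integrable_diff Hs)
        show "(H k i x - H n i x)\<^sup>2 \<le> (\<Sum>i\<in>UNIV. (H k i x - H n i x)\<^sup>2)" for x by (rule member_le_sum) auto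
      qed
      then show ?thesis using N that e unfolding nrm2_def by (intro real_less_lsqrt) (auto intro: le_less_trans)
    qed
    then show "\<exists>N. \<forall>m\<ge>N. \<forall>n\<ge>N. nrm2 M (\<lambda>x. H m i x - H n i x) < e" by blast
  qed
  then obtain G where G: "\<And>i. L2_lim M (\<lambda>n. H n i) (G i)" by metis
  have gG: "H1 g G" by (rule H1_limit[OF q g G])
  note Gs = H1_sq(2)[OF gG]
  have Jsum: "J K = (\<Sum>j\<in>UNIV. \<integral>x. (F j x - K j x) * (F j x - K j x) \<partial>M)" if "\<And>i. sq_integrable M (K i)" for K
    unfolding J_def power2_eq_square
    by (intro Bochner_Integration.integral_sum sq_integrable_mult sq_integrable_diff F that)
  have "(\<lambda>n. J (H n)) \<longlonglongrightarrow> J G"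
    unfolding Jsum[OF Hs] Jsum[OF Gs]
    by (intro tendsto_sum L2_lim_product L2_lim_diff L2_lim_const F G)
  moreover have "(\<lambda>n. J (H n)) \<longlonglongrightarrow> m"
  proof (rule tendsto_sandwich[of "\<lambda>n. m" "\<lambda>n. J (H n)" sequentially "\<lambda>n. m + inverse (real (Suc n))"])
    show "(\<lambda>n. m + inverse (real (Suc n))) \<longlonglongrightarrow> m"
      using tendsto_add[OF tendsto_const[of m] LIMSEQ_inverse_real_of_nat] by simp
    show "(\<lambda>n. m) \<longlonglongrightarrow> m" by simp
    show "\<forall>\<^sub>F n in sequentially. m \<le> J (H n)" using mle[OF q0(1)] by simp
    show "\<forall>\<^sub>F n in sequentially. J (H n) \<le> m + inverse (real (Suc n))" by (rule always_eventually) (use q0(2) in \<open>auto intro: less_imp_le\<close>)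
  qed
  ultimately have JG: "J G = m" by (rule LIMSEQ_unique)
  have "(\<Sum>j\<in>UNIV. \<integral>x. (F j x - G j x) * \<Phi> j x \<partial>M) = 0" if p: "H1 \<phi> \<Phi>" for \<phi> \<Phi>
  proof (rule real_quadratic_nonneg_imp_zero[of "\<Sum>j\<in>UNIV. \<integral>x. \<Phi> j x * \<Phi> j x \<partial>M"])
    fix t :: real
    note ps = H1_sq(2)[OF p]
    have h: "H1 (\<lambda>x. g x + t * \<phi> x) (\<lambda>i x. G i x + t * \<Phi> i x)" by (intro H1_add H1_cmult gG p)
    have i: "integrable M (\<lambda>x. (F j x - G j x) * (F j x - G j x))" "integrable M (\<lambda>x. (F j x - G j x) * \<Phi> j x)" "integrable M (\<lambda>x. \<Phi> j x * \<Phi> j x)" for j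
      by (intro sq_integrable_mult sq_integrable_diff F Gs ps)+
    have "m \<le> J (\<lambda>i x. G i x + t * \<Phi> i x)" by (rule mle[OF h])
    also have "\<dots> = (\<Sum>j\<in>UNIV. (\<integral>x. (F j x - G j x) * (F j x - G j x) \<partial>M) - 2 * t * (\<integral>x. (F j x - G j x) * \<Phi> j x \<partial>M) + t\<^sup>2 * (\<integral>x. \<Phi> j x * \<Phi> j x \<partial>M))"
    proof -
      have "(F j x - (G j x + t * \<Phi> j x)) * (F j x - (G j x + t * \<Phi> j x)) = (F j x - G j x) * (F j x - G j x) - 2 * t * ((F j x - G j x) * \<Phi> j x) + t\<^sup>2 * (\<Phi> j x * \<Phi> j x)" for j x
        by (simp add: power2_eq_square algebra_simps)
      then show ?thesis unfolding Jsum[OF H1_sq(2)[OF h]] using i by simp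
    qed
    also have "\<dots> = J G - 2 * t * (\<Sum>j\<in>UNIV. \<integral>x. (F j x - G j x) * \<Phi> j x \<partial>M) + t\<^sup>2 * (\<Sum>j\<in>UNIV. \<integral>x. \<Phi> j x * \<Phi> j x \<partial>M)"
      unfolding Jsum[OF Gs] by (simp add: sum.distrib sum_subtractf sum_distrib_left)
    finally show "0 \<le> t\<^sup>2 * (\<Sum>j\<in>UNIV. \<integral>x. \<Phi> j x * \<Phi> j x \<partial>M) - 2 * t * (\<Sum>j\<in>UNIV. \<integral>x. (F j x - G j x) * \<Phi> j x \<partial>M)"
      using JG by simp
  qed
  then show ?thesis using that gG by blast
qed

end

section \<open>Defining functions of domains with \<open>C\<^sup>3\<close> boundary\<close>

text \<open>A weight that is positive exactly on the ball. Only the sign of \<open>d\<close> and a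
  nonzero gradient on the boundary matter, so the weights are left unnormalised.\<close>

definition ball_bump :: "real^'n::finite \<Rightarrow> real \<Rightarrow> real^'n \<Rightarrow> real" where
  "ball_bump z r x = flat_exp 0 (r\<^sup>2 - (\<Sum>i\<in>UNIV. (x $ i - z $ i)\<^sup>2))"

lemma C_k_ball_bump: "C_k k (ball_bump z r)"
  unfolding ball_bump_def[abs_def] by (intro C_k_flat_exp C_k_diff C_k_sum C_k_power C_k_const C_k_nth)

lemma ball_bump_nonneg: "0 \<le> ball_bump z r x"
  by (simp add: ball_bump_def flat_exp_def)

lemma ball_bump_pos_iff: "r > 0 \<Longrightarrow> ball_bump z r x > 0 \<longleftrightarrow> x \<in> ball z r"
  using sum_square_norm[of "x - z"] abs_le_square_iff[of r "norm (x - z)"]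
  by (auto simp: ball_bump_def flat_exp_def dist_norm norm_minus_commute not_less[symmetric])

text \<open>A local defining function: either a constant, at interior points, or the height above the
  boundary graph, which has slope one in the direction of the graph's last axis.\<close>
definition local_defining :: "(real^'n::finite) set \<Rightarrow> real^'n \<Rightarrow> real \<Rightarrow> (real^'n \<Rightarrow> real) \<Rightarrow> bool" where
  "local_defining \<Omega> z r g \<longleftrightarrow> r > 0 \<and> C_k 3 g \<and> (\<forall>y\<in>ball z r. y \<in> \<Omega> \<longleftrightarrow> g y > 0) \<and>
    ((\<forall>y. g y > 0) \<or> (\<exists>e. \<forall>y t. g (y + t *\<^sub>R e) = g y + t))"

lemma local_defining_exists:
  fixes \<Omega> :: "(real^'n::finite) set"
  assumes "open \<Omega>" "C_k_boundary 3 \<Omega>" "z \<in> closure \<Omega>"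
  shows "\<exists>r g. local_defining \<Omega> z r g"
proof (cases "z \<in> \<Omega>")
  case True
  then obtain r where "r > 0" "ball z r \<subseteq> \<Omega>" using assms(1) open_contains_ball by blast
  then have "local_defining \<Omega> z r (\<lambda>_. 1)" by (auto simp: local_defining_def)
  then show ?thesis by blast
next
  case False
  then have "z \<in> frontier \<Omega>" using assms(1,3) by (simp add: frontier_def interior_open)
  then obtain r e \<gamma> where r: "r > 0" "norm e = 1" "C_k 3 \<gamma>"
    "\<Omega> \<inter> ball z r = {x \<in> ball z r. x \<bullet> e > \<gamma> (x - (x \<bullet> e) *\<^sub>R e)}"
    using assms(2) unfolding C_k_boundary_def by blast
  have ee: "e \<bullet> e = 1" using r(2) by (simp add: dot_square_norm)
  define g where "g x = x \<bullet> e - \<gamma> (x - (x \<bullet> e) *\<^sub>R e)" for x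
  have "linear (\<lambda>x. x - (x \<bullet> e) *\<^sub>R e)" by (rule linearI) (simp_all add: inner_add_left algebra_simps)
  moreover have "C_k 3 (\<lambda>x. x \<bullet> e)"
    unfolding inner_vec_def inner_real_def by (intro C_k_sum C_k_mult C_k_nth C_k_const)
  ultimately have "C_k 3 g" unfolding g_def[abs_def] by (intro C_k_diff C_k_compose_linear[OF _ r(3)])
  moreover have "g (y + t *\<^sub>R e) = g y + t" for y t
    by (simp add: g_def inner_add_left ee algebra_simps)
  moreover have "y \<in> \<Omega> \<longleftrightarrow> g y > 0" if "y \<in> ball z r" for y
    using arg_cong[OF r(4), of "\<lambda>A. y \<in> A"] that by (simp add: g_def)
  ultimately have "local_defining \<Omega> z r g" using r(1) unfolding local_defining_def by blast
  then show ?thesis by blast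
qed

text \<open>Near each centre the local function has the correct sign, so a sum with nonnegative
  weights has it too. The gradient cannot vanish at a boundary point because \<open>d\<close> grows
  at least at a positive rate in the direction \<open>e\<close> of one local graph, in whatever
  directions the other graphs point.\<close>

lemma defining_function_exists:
  fixes \<Omega> :: "(real^'n::finite) set"
  assumes op: "open \<Omega>" and bd: "bounded \<Omega>" and C3: "C_k_boundary 3 \<Omega>"
  shows "\<exists>d Q. defining_function \<Omega> d Q"
proof -
  obtain r g where rg: "\<And>z. z \<in> closure \<Omega> \<Longrightarrow> local_defining \<Omega> z (r z) (g z)"
    using local_defining_exists[OF op C3] by metis
  have rpos: "r z > 0" and gC: "C_k 3 (g z)" if "z \<in> closure \<Omega>" for z
    using rg[OF that] unfolding local_defining_def by blast+
  have gO: "y \<in> \<Omega> \<longleftrightarrow> g z y > 0" if "z \<in> closure \<Omega>" "y \<in> ball z (r z)" for z y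
    using rg[OF that(1)] that(2) unfolding local_defining_def by simp
  have cc: "compact (closure \<Omega>)" using bd by (simp add: compact_closure)
  obtain S where S: "S \<subseteq> closure \<Omega>" "finite S" "closure \<Omega> \<subseteq> (\<Union>z\<in>S. ball z (r z))"
  proof (rule compactE_image[OF cc, of "closure \<Omega>" "\<lambda>z. ball z (r z)"])
    show "closure \<Omega> \<subseteq> (\<Union>z\<in>closure \<Omega>. ball z (r z))" using rpos by force
  qed auto
  define \<zeta> where "\<zeta> z = ball_bump z (r z)" for z
  have \<zeta>0: "\<zeta> z x \<ge> 0" for z x by (simp add: \<zeta>_def ball_bump_nonneg)
  have \<zeta>pos: "\<zeta> z x > 0 \<longleftrightarrow> x \<in> ball z (r z)" if "z \<in> S" for z x
    unfolding \<zeta>_def using that S(1) by (intro ball_bump_pos_iff rpos) auto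
  have \<zeta>eq: "\<zeta> z x = 0" if "z \<in> S" "x \<notin> ball z (r z)" for z x
    using \<zeta>0[of z x] \<zeta>pos[OF that(1), of x] that(2) by linarith
  define d where "d x = (\<Sum>z\<in>S. \<zeta> z x * g z x)" for x
  have dC: "C_k 3 d" unfolding d_def[abs_def] \<zeta>_def
    using S(1) by (intro C_k_sum C_k_mult C_k_ball_bump gC) auto
  have term_nonneg: "\<zeta> z x * g z x \<ge> 0" if "z \<in> S" "x \<in> \<Omega>" for z x
    using \<zeta>0[of z x] \<zeta>eq[OF that(1)] gO[of z x] that S(1) by (cases "x \<in> ball z (r z)") auto
  have term_nonpos: "\<zeta> z x * g z x \<le> 0" if "z \<in> S" "x \<notin> \<Omega>" for z x
  proof (cases "x \<in> ball z (r z)")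
    case True
    then have "g z x \<le> 0" using gO[of z x] that S(1) by (auto simp: not_less)
    then show ?thesis using \<zeta>0[of z x] by (simp add: mult_nonneg_nonpos)
  qed (simp add: \<zeta>eq that)
  have d_nonpos: "d x \<le> 0" if "x \<notin> \<Omega>" for x
    unfolding d_def by (intro sum_nonpos term_nonpos that)
  have d_pos: "d x > 0" if "x \<in> \<Omega>" for x
  proof -
    obtain z where z: "z \<in> S" "x \<in> ball z (r z)" using S(3) \<open>x \<in> \<Omega>\<close> closure_subset[of \<Omega>] by blast
    then have "\<zeta> z x * g z x > 0" using \<zeta>pos[OF z(1), of x] gO[of z x] that S(1) by (simp add: subset_iff)
    then show ?thesis unfolding d_def using z(1) S(2) term_nonneg that by (intro sum_pos2) auto
  qed
  have dO: "\<Omega> = {x. d x > 0}" using d_pos d_nonpos by (force simp: not_less[symmetric])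
  define Q0 where "Q0 x = (\<Sum>i\<in>UNIV. (pderiv_at i d x)\<^sup>2) + (d x)\<^sup>2" for x
  have Q0C: "C_k 2 Q0"
    unfolding Q0_def[abs_def] using dC C_k_mono[OF dC, of 2]
    by (intro C_k_add C_k_sum C_k_power) (simp_all add: numeral_3_eq_3 numeral_2_eq_2)
  have Q0pos: "Q0 x > 0" if x: "x \<in> closure \<Omega>" for x
  proof (cases "x \<in> \<Omega>")
    case True
    then show ?thesis using d_pos[of x] by (simp add: Q0_def sum_nonneg add_nonneg_pos)
  next
    case False
    obtain z where z: "z \<in> S" "x \<in> ball z (r z)" using S(3) x by blast
    have zc: "z \<in> closure \<Omega>" using z(1) S(1) by blast
    have gx: "g z x \<le> 0" using gO[OF zc z(2)] False by simp
    obtain e where e: "\<And>y t. g z (y + t *\<^sub>R e) = g z y + t"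
      using rg[OF zc] gx unfolding local_defining_def by (meson not_less)
    \<comment> \<open>A negative value would persist in a neighbourhood, which meets the domain
      because \<open>x\<close> lies in its closure.\<close>
    have gx0: "g z x = 0"
    proof (rule ccontr)
      assume "g z x \<noteq> 0"
      then have "x \<in> {y. g z y < 0} \<inter> ball z (r z)" using gx z(2) by simp
      moreover have "open ({y. g z y < 0} \<inter> ball z (r z))"
        by (intro open_Int open_Collect_less continuous_intros C_k_continuous[OF gC[OF zc]] open_ball)
      ultimately obtain y where "y \<in> \<Omega>" "g z y < 0" "y \<in> ball z (r z)"
        using x unfolding closure_iff_nhds_not_empty by blast
      then show False using gO[OF zc] by force
    qed
    have dx: "d x \<le> 0" by (rule d_nonpos[OF False])
    have lim: "((\<lambda>t. x + t *\<^sub>R e) \<longlongrightarrow> x) (at_right 0)"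
      by (rule tendsto_eq_intros refl | simp)+
    have "\<forall>\<^sub>F t in at_right 0. x + t *\<^sub>R e \<in> ball z (r z)"
      by (rule topological_tendstoD[OF lim open_ball z(2)])
    \<comment> \<open>At \<open>x + t *\<^sub>R e\<close> the local function equals
      \<open>t\<close>, all terms of \<open>d\<close> are nonnegative, and
      \<open>d x \<le> 0\<close>. So the difference quotient is at least the weight, whose limit at
      \<open>x\<close> is positive.\<close>
    then have ev: "\<forall>\<^sub>F t in at_right 0. \<zeta> z (x + t *\<^sub>R e) \<le> (d (x + t *\<^sub>R e) - d x) / t"
      using eventually_at_right_less[of 0]
    proof eventually_elim
      case (elim t)
      then have O: "x + t *\<^sub>R e \<in> \<Omega>" using gO[OF zc elim(1)] e[of x t] gx0 by simp
      have "\<zeta> z (x + t *\<^sub>R e) * g z (x + t *\<^sub>R e) \<le> d (x + t *\<^sub>R e)"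
        unfolding d_def by (rule member_le_sum[OF z(1) _ S(2)]) (use term_nonneg O in auto)
      then show ?case using e[of x t] gx0 dx elim(2) by (simp add: field_simps)
    qed
    have df: "(d has_derivative (\<lambda>h. \<Sum>i\<in>UNIV. h $ i * pderiv_at i d x)) (at x)"
      by (rule has_derivative_pderiv_at, rule C_k_differentiable[of 2]) (use dC in \<open>simp add: numeral_3_eq_3 numeral_2_eq_2\<close>)
    have "((\<lambda>t. d (x + t *\<^sub>R e)) has_derivative (\<lambda>t. \<Sum>i\<in>UNIV. (t *\<^sub>R e) $ i * pderiv_at i d x)) (at 0)"
      by (rule has_derivative_compose[of "\<lambda>t. x + t *\<^sub>R e" "\<lambda>t. t *\<^sub>R e" 0 UNIV d])
        (auto intro!: derivative_eq_intros df)
    then have "((\<lambda>t. d (x + t *\<^sub>R e)) has_real_derivative (\<Sum>i\<in>UNIV. e $ i * pderiv_at i d x)) (at 0)"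
      by (rule has_derivative_imp_has_field_derivative) (simp add: sum_distrib_left mult_ac)
    then have "((\<lambda>t. (d (x + t *\<^sub>R e) - d x) / t) \<longlongrightarrow> (\<Sum>i\<in>UNIV. e $ i * pderiv_at i d x)) (at 0)"
      by (simp add: has_field_derivative_iff)
    then have dl: "((\<lambda>t. (d (x + t *\<^sub>R e) - d x) / t) \<longlongrightarrow> (\<Sum>i\<in>UNIV. e $ i * pderiv_at i d x)) (at_right 0)"
      by (rule filterlim_mono[OF _ order_refl at_le]) simp
    have "isCont (\<zeta> z) x"
      using C_k_continuous[OF C_k_ball_bump[where k = 0 and z = z and r = "r z"], where A = UNIV] unfolding \<zeta>_def by (simp add: continuous_on_eq_continuous_at)
    then have "((\<lambda>t. \<zeta> z (x + t *\<^sub>R e)) \<longlongrightarrow> \<zeta> z x) (at_right 0)" by (rule isCont_tendsto_compose[OF _ lim])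
    then have "\<zeta> z x \<le> (\<Sum>i\<in>UNIV. e $ i * pderiv_at i d x)"
      by (rule tendsto_le[OF _ dl _ ev, rotated]) simp
    then have "(\<Sum>i\<in>UNIV. e $ i * pderiv_at i d x) > 0" using \<zeta>pos[OF z(1), of x] z(2) by simp
    then obtain i where "pderiv_at i d x \<noteq> 0" by (metis (mono_tags, lifting) less_irrefl mult_zero_right sum.neutral)
    then have "(\<Sum>i\<in>UNIV. (pderiv_at i d x)\<^sup>2) > 0" by (intro sum_pos2[of _ i]) auto
    then show ?thesis by (simp add: Q0_def add_pos_nonneg)
  qed
  obtain c where c: "c > 0" "\<And>x. x \<in> closure \<Omega> \<Longrightarrow> c \<le> Q0 x"
  proof (cases "closure \<Omega> = {}")
    case True
    then show ?thesis using that[of 1] by auto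
  next
    case False
    obtain w where "w \<in> closure \<Omega>" "\<And>x. x \<in> closure \<Omega> \<Longrightarrow> Q0 w \<le> Q0 x"
      using continuous_attains_inf[OF cc False C_k_continuous[OF Q0C]] by blast
    then show ?thesis using that[of "Q0 w"] Q0pos by blast
  qed
  \<comment> \<open>Away from \<open>\<Omega>\<close> the gradient may vanish; the added term only changes \<open>Q0\<close> where it is below \<open>c\<close>.\<close>
  define Q where "Q x = Q0 x + (max 0 (c - Q0 x)) ^ Suc 2" for x
  have "defining_function \<Omega> d Q"
  proof
    show "C_k 2 Q" unfolding Q_def[abs_def] by (intro C_k_add Q0C C_k_pos_part_power C_k_diff C_k_const order_refl)
    show "Q x > 0" for x
    proof (cases "Q0 x = 0")
      case True
      then show ?thesis using c(1) by (simp add: Q_def)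
    next
      case False
      moreover have "Q0 x \<ge> 0" by (simp add: Q0_def sum_nonneg)
      ultimately show ?thesis by (simp add: Q_def add_pos_nonneg)
    qed
    show "Q x = (\<Sum>i\<in>UNIV. (pderiv_at i d x)\<^sup>2) + (d x)\<^sup>2" if "x \<in> \<Omega>" for x
      using c(2)[of x] closure_subset[of \<Omega>] that by (auto simp: Q_def Q0_def max_def)
  qed (fact op bd dC dO)+
  then show ?thesis by blast
qed

context bounded_open
begin

section \<open>The Stokes pressure\<close>

lemma H1_cong_AE:
  assumes "H1 f F" "AE x in M. f x = g x" "\<And>i. AE x in M. F i x = G i x"
  shows "H1 g G"
  unfolding H1_def
proof
  fix i
  have w: "wd i f (G i)" by (rule wd_cong_AE[OF H1_wd[OF assms(1)] assms(3)])
  have g: "sq_integrable M g" by (rule sq_integrable_cong_AE[OF H1_sq(1)[OF assms(1)] assms(2)])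
  have "(\<integral>x. g x * pderiv_at i \<phi> x \<partial>M) = (\<integral>x. f x * pderiv_at i \<phi> x \<partial>M)" if "\<phi> \<in> test_functions \<Omega>" for \<phi>
    using assms(2) that g wdD(1)[OF w] test_sq[OF test_functions_pderiv[OF that]]
    by (intro integral_cong_AE) (auto intro!: borel_measurable_times intro: sq_integrable_measurable)
  then show "wd i g (G i)" using w g by (simp add: wd_def)
qed

text \<open>Membership only gives some derivative with derivatives of its own; uniqueness almost
  everywhere transfers this to the representatives from which the weak Laplacian is built.\<close>

lemma sobolev_2_H1:
  assumes "f \<in> sobolev 2 \<Omega>"
  shows "H1 f (\<lambda>i. weak_pderiv \<Omega> i f)"
    and "H1 (weak_pderiv \<Omega> i f) (\<lambda>l. weak_pderiv \<Omega> l (weak_pderiv \<Omega> i f))"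
proof -
  have "sq_integrable M f" "\<And>i. \<exists>g\<in>sobolev 1 \<Omega>. has_weak_pderiv \<Omega> i f g"
    using assms by (auto simp: numeral_2_eq_2 L2_iff)
  then obtain g where g: "\<And>i. g i \<in> sobolev 1 \<Omega>" "\<And>i. has_weak_pderiv \<Omega> i f (g i)" by metis
  obtain G where G: "\<And>i. H1 (g i) (G i)" using g(1) unfolding sobolev_1_iff by metis
  have h: "H1 f g" unfolding H1_def
    using weak_imp_wd[OF g(2) \<open>sq_integrable M f\<close> H1_sq(1)[OF G]] by blast
  show "H1 f (\<lambda>i. weak_pderiv \<Omega> i f)" by (rule H1_weak_pderiv(1)[OF h])
  have "AE x in M. g i x = weak_pderiv \<Omega> i f x" using H1_weak_pderiv(2)[OF h, of i] by eventually_elim simp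
  then have "H1 (weak_pderiv \<Omega> i f) (G i)" by (rule H1_cong_AE[OF G]) simp
  then show "H1 (weak_pderiv \<Omega> i f) (\<lambda>l. weak_pderiv \<Omega> l (weak_pderiv \<Omega> i f))" by (rule H1_weak_pderiv(1))
qed

lemma L2_vec_iff: "v \<in> L2 \<Omega> \<longleftrightarrow> (\<forall>j. sq_integrable M (\<lambda>x. v x $ j))" for v :: "real^'n \<Rightarrow> real^'n"
proof
  assume v: "v \<in> L2 \<Omega>"
  show "\<forall>j. sq_integrable M (\<lambda>x. v x $ j)"
  proof
    fix j
    have vm: "v \<in> borel_measurable M" using v by (simp add: L2_def)
    have m: "(\<lambda>x. v x $ j) \<in> borel_measurable M"
      by (rule measurable_compose[OF vm]) (intro borel_measurable_continuous_onI continuous_intros)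
    have "integrable M (\<lambda>x. (v x $ j)\<^sup>2)"
    proof (rule Bochner_Integration.integrable_bound)
      show "integrable M (\<lambda>x. (norm (v x))\<^sup>2)" using v by (simp add: L2_def)
      show "AE x in M. norm ((v x $ j)\<^sup>2) \<le> norm ((norm (v x))\<^sup>2)"
        by (simp add: abs_le_square_iff[symmetric] component_le_norm_cart)
    qed (use m in measurable)
    then show "sq_integrable M (\<lambda>x. v x $ j)" using m by (simp add: sq_integrable_def)
  qed
next
  assume v: "\<forall>j. sq_integrable M (\<lambda>x. v x $ j)"
  have "v \<in> borel_measurable M"
    unfolding borel_measurable_euclidean_space[of v]
    using v by (auto simp: Basis_vec_def inner_axis sq_integrable_def)
  moreover have "integrable M (\<lambda>x. (norm (v x))\<^sup>2)"
    unfolding sum_square_norm[symmetric] using v by (intro Bochner_Integration.integrable_sum sq_integrable_square) simp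
  ultimately show "v \<in> L2 \<Omega>" by (simp add: L2_def)
qed

lemma L2_inner_vec:
  fixes v w :: "real^'n \<Rightarrow> real^'n"
  assumes "v \<in> L2 \<Omega>" "w \<in> L2 \<Omega>"
  shows "L2_inner \<Omega> v w = (\<Sum>j\<in>UNIV. \<integral>x. v x $ j * w x $ j \<partial>M)"
  unfolding L2_inner_def inner_vec_def inner_real_def using assms
  by (intro Bochner_Integration.integral_sum sq_integrable_mult) (auto simp: L2_vec_iff)

lemma H1_imp_weak_grad:
  assumes "H1 f F"
  shows "H1 f (\<lambda>j x. weak_grad \<Omega> f x $ j)" "weak_grad \<Omega> f \<in> L2 \<Omega>" "AE x in M. weak_grad \<Omega> f x $ j = F j x"
  using H1_weak_pderiv[OF assms] H1_sq(2)[OF H1_weak_pderiv(1)[OF assms]]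
  by (simp_all add: weak_grad_def L2_vec_iff)

text \<open>Replaces the chosen representative \<open>weak_grad\<close> by an arbitrary gradient in
  the orthogonality condition.\<close>

lemma helmholtz_space_iff:
  "v \<in> helmholtz_space \<Omega> \<longleftrightarrow> v \<in> L2 \<Omega> \<and> (\<forall>\<phi> \<Phi>. H1 \<phi> \<Phi> \<longrightarrow> (\<Sum>j\<in>UNIV. \<integral>x. v x $ j * \<Phi> j x \<partial>M) = 0)"
  (is "_ \<longleftrightarrow> _ \<and> ?orth")
proof (cases "v \<in> L2 \<Omega>")
  case True
  have eq: "L2_inner \<Omega> v (weak_grad \<Omega> \<phi>) = (\<Sum>j\<in>UNIV. \<integral>x. v x $ j * \<Phi> j x \<partial>M)" if h: "H1 \<phi> \<Phi>" for \<phi> \<Phi>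
  proof -
    have m: "(\<lambda>x. v x $ j) \<in> borel_measurable M" "(\<lambda>x. weak_grad \<Omega> \<phi> x $ j) \<in> borel_measurable M" "\<Phi> j \<in> borel_measurable M" for j
      using True H1_imp_weak_grad(2)[OF h] H1_sq(2)[OF h, of j] by (simp_all add: L2_vec_iff sq_integrable_def)
    have "(\<integral>x. v x $ j * weak_grad \<Omega> \<phi> x $ j \<partial>M) = (\<integral>x. v x $ j * \<Phi> j x \<partial>M)" for j
      by (intro integral_cong_AE borel_measurable_times m) (use H1_imp_weak_grad(3)[OF h, of j] in eventually_elim, simp)
    then show ?thesis by (simp add: L2_inner_vec[OF True H1_imp_weak_grad(2)[OF h]])
  qed
  show ?thesis
    unfolding helmholtz_space_def L2_orth_compl_def
  proof (safe)
    fix \<phi> \<Phi> assume z: "\<forall>w\<in>weak_grad \<Omega> ` sobolev 1 \<Omega>. L2_inner \<Omega> v w = 0" and h: "H1 \<phi> \<Phi>"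
    have "\<phi> \<in> sobolev 1 \<Omega>" using h unfolding sobolev_1_iff by blast
    then show "(\<Sum>j\<in>UNIV. \<integral>x. v x $ j * \<Phi> j x \<partial>M) = 0" using z eq[OF h] by auto
  next
    fix \<phi> assume o: ?orth and "\<phi> \<in> sobolev 1 \<Omega>"
    then obtain \<Phi> where h: "H1 \<phi> \<Phi>" unfolding sobolev_1_iff by blast
    show "L2_inner \<Omega> v (weak_grad \<Omega> \<phi>) = 0" using o h eq[OF h] by simp
  qed
qed (simp add: helmholtz_space_def L2_orth_compl_def)

lemma gradient_orth_helmholtz:
  assumes "H1 g (\<lambda>j x. v x $ j)"
  shows "v \<in> L2_orth_compl \<Omega> (helmholtz_space \<Omega>)"
  unfolding L2_orth_compl_def
proof (safe)
  show v: "v \<in> L2 \<Omega>" using H1_sq(2)[OF assms] by (simp add: L2_vec_iff)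
  fix w assume w: "w \<in> helmholtz_space \<Omega>"
  then have "L2_inner \<Omega> v w = (\<Sum>j\<in>UNIV. \<integral>x. w x $ j * v x $ j \<partial>M)"
    using L2_inner_vec[OF v, of w] by (simp add: helmholtz_space_iff mult.commute)
  also have "\<dots> = 0" using w assms unfolding helmholtz_space_iff by blast
  finally show "L2_inner \<Omega> v w = 0" .
qed

text \<open>The difference between the field and its projection is by construction a gradient, minus
  that of \<open>weak_div \<Omega> u\<close> plus \<open>p\<close>, and gradients are orthogonal to
  the Helmholtz space. Only the orthogonality of the projection to gradients is left to
  verify.\<close>

lemma is_stokes_pressureI:
  assumes \<Delta>: "weak_laplacian \<Omega> u \<in> L2 \<Omega>" and d: "H1 (weak_div \<Omega> u) D" and p: "H1 p P"
    and orth: "\<And>\<phi> \<Phi>. H1 \<phi> \<Phi> \<Longrightarrow>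
      (\<Sum>j\<in>UNIV. \<integral>x. (- weak_laplacian \<Omega> u x $ j + weak_grad \<Omega> (weak_div \<Omega> u) x $ j + weak_grad \<Omega> p x $ j) * \<Phi> j x \<partial>M) = 0"
  shows "is_stokes_pressure \<Omega> u p"
  unfolding is_stokes_pressure_def is_helmholtz_projection_def
proof (intro conjI)
  show "p \<in> sobolev 1 \<Omega>" using p unfolding sobolev_1_iff by blast
  show "(\<lambda>x. - weak_laplacian \<Omega> u x) \<in> L2 \<Omega>" using \<Delta> by (simp add: L2_def)
  show "(\<lambda>x. - weak_laplacian \<Omega> u x + weak_grad \<Omega> (weak_div \<Omega> u) x + weak_grad \<Omega> p x) \<in> helmholtz_space \<Omega>"
    unfolding helmholtz_space_iff
  proof (intro conjI allI impI)
    have "sq_integrable M (\<lambda>x. - 1 * weak_laplacian \<Omega> u x $ j + weak_grad \<Omega> (weak_div \<Omega> u) x $ j + weak_grad \<Omega> p x $ j)" for j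
      using \<Delta> H1_imp_weak_grad(2)[OF d] H1_imp_weak_grad(2)[OF p]
      by (intro sq_integrable_add sq_integrable_cmult) (simp_all add: L2_vec_iff)
    then show "(\<lambda>x. - weak_laplacian \<Omega> u x + weak_grad \<Omega> (weak_div \<Omega> u) x + weak_grad \<Omega> p x) \<in> L2 \<Omega>"
      by (simp add: L2_vec_iff)
  qed (use orth in simp)
  have "H1 (\<lambda>x. - 1 * (weak_div \<Omega> u x + p x)) (\<lambda>j x. - 1 * (weak_grad \<Omega> (weak_div \<Omega> u) x $ j + weak_grad \<Omega> p x $ j))"
    by (intro H1_cmult H1_add H1_imp_weak_grad(1)[OF d] H1_imp_weak_grad(1)[OF p])
  then show "(\<lambda>x. - weak_laplacian \<Omega> u x - (- weak_laplacian \<Omega> u x + weak_grad \<Omega> (weak_div \<Omega> u) x + weak_grad \<Omega> p x))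
      \<in> L2_orth_compl \<Omega> (helmholtz_space \<Omega>)"
    by (intro gradient_orth_helmholtz) simp
qed

end

text \<open>The constants depend on the domain alone and are fixed before \<open>u\<close>.
  Existence of a pressure stands next to the bound, which is thereby not vacuous, and the bound is
  claimed for every choice of the additive constant.\<close>

theorem mainTheorem1:
  fixes \<Omega> :: "(real^'n::finite) set"
  assumes "CARD('n) \<ge> 2"
    and "open \<Omega>" and "connected \<Omega>" and "bounded \<Omega>" and "\<Omega> \<noteq> {}"
    and "C_k_boundary 3 \<Omega>"
  shows "\<exists>\<beta> C :: real. \<beta> < 1 \<and> C \<ge> 0 \<and>
    (\<forall>u \<in> vector_fields_in (sobolev 2 \<Omega>) \<inter> vector_fields_in (sobolev_H10 \<Omega>).
      (\<exists>p. is_stokes_pressure \<Omega> u p) \<and>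
      (\<forall>p. is_stokes_pressure \<Omega> u p \<longrightarrow>
        (\<integral>x. (norm (weak_grad \<Omega> p x))\<^sup>2 \<partial>(lebesgue_on \<Omega>))
          \<le> \<beta> * (\<integral>x. (norm (weak_laplacian \<Omega> u x))\<^sup>2 \<partial>(lebesgue_on \<Omega>))
            + C * (\<integral>x. (norm (weak_jacobian \<Omega> u x))\<^sup>2 \<partial>(lebesgue_on \<Omega>))))"
proof -
  obtain d Q where "defining_function \<Omega> d Q"
    using defining_function_exists[OF assms(2,4,6)] by blast
  then interpret defining_function \<Omega> d Q .
  obtain \<beta> C where bC: "\<beta> < 1" "C \<ge> 0"
    and est: "\<And>u D E p P. (\<And>j. zero_trace (u j)) \<Longrightarrow> (\<And>j. H1 (u j) (D j)) \<Longrightarrow> (\<And>j i. H1 (D j i) (E j i)) \<Longrightarrow> H1 p P \<Longrightarrow>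
      (\<And>\<phi> \<Phi>. H1 \<phi> \<Phi> \<Longrightarrow> (\<Sum>j\<in>UNIV. \<integral>x. (- (\<Sum>i\<in>UNIV. E j i i x) + (\<Sum>i\<in>UNIV. E i i j x) + P j x) * \<Phi> j x \<partial>M) = 0) \<Longrightarrow>
      (\<integral>x. (\<Sum>j\<in>UNIV. (P j x)\<^sup>2) \<partial>M)
        \<le> \<beta> * (\<integral>x. (\<Sum>j\<in>UNIV. (\<Sum>i\<in>UNIV. E j i i x)\<^sup>2) \<partial>M) + C * (\<integral>x. (\<Sum>j\<in>UNIV. \<Sum>i\<in>UNIV. (D j i x)\<^sup>2) \<partial>M)"
    by (fact stokes_pressure_estimate)
  show ?thesis
  proof (rule exI[of _ \<beta>], rule exI[of _ C], intro conjI ballI allI impI)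
    show "\<beta> < 1" "C \<ge> 0" by fact+
    fix u assume u: "u \<in> vector_fields_in (sobolev 2 \<Omega>) \<inter> vector_fields_in (sobolev_H10 \<Omega>)"
    define D where "D j i = weak_pderiv \<Omega> i (\<lambda>y. u y $ j)" for j i
    define E where "E j i l = weak_pderiv \<Omega> l (D j i)" for j i l
    have uD: "H1 (\<lambda>y. u y $ j) (D j)" and DE: "H1 (D j i) (E j i)" for j i
      using u sobolev_2_H1[of "\<lambda>y. u y $ j"] unfolding D_def E_def vector_fields_in_def by auto
    have zt: "zero_trace (\<lambda>y. u y $ j)" for j
      using u by (intro sobolev_H10_zero_trace) (simp add: vector_fields_in_def)
    have lap: "weak_laplacian \<Omega> u x $ j = (\<Sum>i\<in>UNIV. E j i i x)" for x j
      by (simp add: weak_laplacian_def E_def D_def)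
    have lapL: "weak_laplacian \<Omega> u \<in> L2 \<Omega>"
      unfolding L2_vec_iff lap by (intro allI sq_integrable_sum H1_sq(2)[OF DE])
    have "weak_div \<Omega> u = (\<lambda>x. \<Sum>i\<in>UNIV. D i i x)"
      by (rule ext) (simp add: weak_div_def D_def)
    then have dv: "H1 (weak_div \<Omega> u) (\<lambda>j x. \<Sum>i\<in>UNIV. E i i j x)" using DE by (simp add: H1_sum)
    \<comment> \<open>\<open>weak_grad\<close> picks its own representatives, which agree with the
      given gradients only almost everywhere; the two residuals therefore agree under the
      integral.\<close>
    have residual: "(\<integral>x. (- weak_laplacian \<Omega> u x $ j + weak_grad \<Omega> (weak_div \<Omega> u) x $ j + weak_grad \<Omega> p x $ j) * \<Phi> j x \<partial>M)
        = (\<integral>x. (- (\<Sum>i\<in>UNIV. E j i i x) + (\<Sum>i\<in>UNIV. E i i j x) + P j x) * \<Phi> j x \<partial>M)"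
      if p: "H1 p P" and h: "H1 \<phi> \<Phi>" for p P \<phi> \<Phi> j
    proof (rule integral_cong_AE)
      have [measurable]: "(\<lambda>x. weak_grad \<Omega> (weak_div \<Omega> u) x $ j) \<in> borel_measurable M" "(\<lambda>x. weak_grad \<Omega> p x $ j) \<in> borel_measurable M"
        "\<Phi> j \<in> borel_measurable M" "P j \<in> borel_measurable M" "(\<lambda>x. weak_laplacian \<Omega> u x $ j) \<in> borel_measurable M"
        "E k i l \<in> borel_measurable M" for k i l
        using H1_imp_weak_grad(2)[OF dv] H1_imp_weak_grad(2)[OF p] lapL H1_sq(2)[OF h] H1_sq(2)[OF p] H1_sq(2)[OF DE]
        by (simp_all add: L2_vec_iff sq_integrable_def)
      show "(\<lambda>x. (- weak_laplacian \<Omega> u x $ j + weak_grad \<Omega> (weak_div \<Omega> u) x $ j + weak_grad \<Omega> p x $ j) * \<Phi> j x) \<in> borel_measurable M"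
        by measurable
      show "(\<lambda>x. (- (\<Sum>i\<in>UNIV. E j i i x) + (\<Sum>i\<in>UNIV. E i i j x) + P j x) * \<Phi> j x) \<in> borel_measurable M"
        by measurable
      show "AE x in M. (- weak_laplacian \<Omega> u x $ j + weak_grad \<Omega> (weak_div \<Omega> u) x $ j + weak_grad \<Omega> p x $ j) * \<Phi> j x
          = (- (\<Sum>i\<in>UNIV. E j i i x) + (\<Sum>i\<in>UNIV. E i i j x) + P j x) * \<Phi> j x"
        using H1_imp_weak_grad(3)[OF dv, of j] H1_imp_weak_grad(3)[OF p, of j] by eventually_elim (simp add: lap)
    qed
    show "\<exists>p. is_stokes_pressure \<Omega> u p"
    proof -
      have "sq_integrable M (\<lambda>x. \<Sum>i\<in>UNIV. E j i i x)" for j by (intro sq_integrable_sum H1_sq(2)[OF DE])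
      then obtain g G where g: "H1 g G"
        "\<And>\<phi> \<Phi>. H1 \<phi> \<Phi> \<Longrightarrow> (\<Sum>j\<in>UNIV. \<integral>x. ((\<Sum>i\<in>UNIV. E j i i x) - G j x) * \<Phi> j x \<partial>M) = 0"
        by (rule helmholtz_decomposition[OF assms(3,5)]) (rule that; assumption)
      \<comment> \<open>If \<nabla>g is the gradient part of the Laplacian of \<open>u\<close>, then
        \<nabla>p is \<nabla>g minus the gradient of the divergence, which fixes this choice of
        \<open>p\<close>.\<close>
      have p: "H1 (\<lambda>x. g x - weak_div \<Omega> u x) (\<lambda>j x. G j x - (\<Sum>i\<in>UNIV. E i i j x))" by (rule H1_diff[OF g(1) dv])
      have "is_stokes_pressure \<Omega> u (\<lambda>x. g x - weak_div \<Omega> u x)"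
      proof (rule is_stokes_pressureI[OF lapL dv p])
        fix \<phi> \<Phi> assume h: "H1 \<phi> \<Phi>"
        have "(\<integral>x. (- (\<Sum>i\<in>UNIV. E j i i x) + (\<Sum>i\<in>UNIV. E i i j x) + (G j x - (\<Sum>i\<in>UNIV. E i i j x))) * \<Phi> j x \<partial>M)
            = - (\<integral>x. ((\<Sum>i\<in>UNIV. E j i i x) - G j x) * \<Phi> j x \<partial>M)" for j
          by (simp add: algebra_simps flip: Bochner_Integration.integral_minus)
        then show "(\<Sum>j\<in>UNIV. \<integral>x. (- weak_laplacian \<Omega> u x $ j + weak_grad \<Omega> (weak_div \<Omega> u) x $ j
            + weak_grad \<Omega> (\<lambda>x. g x - weak_div \<Omega> u x) x $ j) * \<Phi> j x \<partial>M) = 0"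
          unfolding residual[OF p h] using g(2)[OF h] by (simp add: sum_negf)
      qed
      then show ?thesis by blast
    qed
    fix p assume p: "is_stokes_pressure \<Omega> u p"
    obtain P where pP: "H1 p P" using p unfolding is_stokes_pressure_def sobolev_1_iff by blast
    \<comment> \<open>The estimate is applied with \<open>weak_grad\<close> itself as the gradient
      of \<open>p\<close>, because its norm is the one to be bounded.\<close>
    note pg = H1_imp_weak_grad(1)[OF pP]
    have "(\<integral>x. (\<Sum>j\<in>UNIV. (weak_grad \<Omega> p x $ j)\<^sup>2) \<partial>M)
        \<le> \<beta> * (\<integral>x. (\<Sum>j\<in>UNIV. (\<Sum>i\<in>UNIV. E j i i x)\<^sup>2) \<partial>M) + C * (\<integral>x. (\<Sum>j\<in>UNIV. \<Sum>i\<in>UNIV. (D j i x)\<^sup>2) \<partial>M)"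
    proof (rule est[OF zt uD DE pg])
      fix \<phi> \<Phi> assume h: "H1 \<phi> \<Phi>"
      have "(\<Sum>j\<in>UNIV. \<integral>x. (- weak_laplacian \<Omega> u x $ j + weak_grad \<Omega> (weak_div \<Omega> u) x $ j + weak_grad \<Omega> p x $ j) * \<Phi> j x \<partial>M) = 0"
        using p h unfolding is_stokes_pressure_def is_helmholtz_projection_def helmholtz_space_iff by simp
      then show "(\<Sum>j\<in>UNIV. \<integral>x. (- (\<Sum>i\<in>UNIV. E j i i x) + (\<Sum>i\<in>UNIV. E i i j x) + weak_grad \<Omega> p x $ j) * \<Phi> j x \<partial>M) = 0"
        unfolding residual[OF pg h] .
    qed
    moreover have "(norm (weak_jacobian \<Omega> u x))\<^sup>2 = (\<Sum>j\<in>UNIV. \<Sum>i\<in>UNIV. (D j i x)\<^sup>2)" for x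
      unfolding power2_norm_eq_inner inner_vec_def inner_real_def by (simp add: power2_eq_square weak_jacobian_def weak_grad_def D_def)
    ultimately show "(\<integral>x. (norm (weak_grad \<Omega> p x))\<^sup>2 \<partial>M)
          \<le> \<beta> * (\<integral>x. (norm (weak_laplacian \<Omega> u x))\<^sup>2 \<partial>M) + C * (\<integral>x. (norm (weak_jacobian \<Omega> u x))\<^sup>2 \<partial>M)"
      by (simp add: sum_square_norm[symmetric] lap)
  qed
qed

end
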